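(* Let $G$ be a finite group and let $G^- = \{ g \in G : \langle g \rangle \text{ is not a maximal cyclic subgroup of } G\}$. If $\langle G^- \rangle < G$ (i.e. the subgroup generated by $G^-$ is proper), then $G/\langle G^- \rangle$ is one of the following: (1) a $p$-group of exponent $p$ for some prime $p$; (2) a Frobenius group whose Frobenius kernel is a $p$-group of exponent $p$ and whose Frobenius complements have order $q$, for some primes $q \neq p$; or (3) isomorphic to $A_5$.
   Context: All groups are finite. A cyclic subgroup $C$ of $G$ is maximal cyclic if there is no cyclic subgroup $D$ of $G$ with $C < D$. *)

theory Defs
  imports "HOL-Algebra.Algebra"
begin

definition cyclic_subgroups :: "('a, 'b) monoid_scheme \<Rightarrow> 'a set set" where
  "cyclic_subgroups G = {generate G {g} | g. g \<in> carrier G}"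

definition maximal_cyclic :: "('a, 'b) monoid_scheme \<Rightarrow> 'a set \<Rightarrow> bool" where
  "maximal_cyclic G C \<longleftrightarrow> C \<in> cyclic_subgroups G \<and>
     \<not> (\<exists>D \<in> cyclic_subgroups G. C \<subset> D)"

definition non_max_cyclic_elems :: "('a, 'b) monoid_scheme \<Rightarrow> 'a set" where
  "non_max_cyclic_elems G = {g \<in> carrier G. \<not> maximal_cyclic G (generate G {g})}"

definition p_group_exp_p :: "('a, 'b) monoid_scheme \<Rightarrow> 'a set \<Rightarrow> nat \<Rightarrow> bool" where
  "p_group_exp_p Q S p \<longleftrightarrow> Factorial_Ring.prime p \<and> subgroup S Q \<and> S \<noteq> {\<one>\<^bsub>Q\<^esub>} \<and>
     (\<exists>n. card S = p ^ n) \<and> (\<forall>x \<in> S. x [^]\<^bsub>Q\<^esub> p = \<one>\<^bsub>Q\<^esub>)"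

definition conj_subgroup :: "('a, 'b) monoid_scheme \<Rightarrow> 'a \<Rightarrow> 'a set \<Rightarrow> 'a set" where
  "conj_subgroup Q g H = (g <#\<^bsub>Q\<^esub> H) #>\<^bsub>Q\<^esub> (inv\<^bsub>Q\<^esub> g)"

definition frobenius_complement :: "('a, 'b) monoid_scheme \<Rightarrow> 'a set \<Rightarrow> bool" where
  "frobenius_complement Q H \<longleftrightarrow> subgroup H Q \<and> H \<noteq> {\<one>\<^bsub>Q\<^esub>} \<and> H \<noteq> carrier Q \<and>
     (\<forall>g \<in> carrier Q - H. H \<inter> conj_subgroup Q g H = {\<one>\<^bsub>Q\<^esub>})"

definition frobenius_kernel :: "('a, 'b) monoid_scheme \<Rightarrow> 'a set \<Rightarrow> 'a set" where
  "frobenius_kernel Q H =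
     (carrier Q - (\<Union>g \<in> carrier Q. conj_subgroup Q g H)) \<union> {\<one>\<^bsub>Q\<^esub>}"

definition frobenius_group :: "('a, 'b) monoid_scheme \<Rightarrow> bool" where
  "frobenius_group Q \<longleftrightarrow> group Q \<and> finite (carrier Q) \<and> (\<exists>H. frobenius_complement Q H)"

end

theory Submission
  imports Defs "HOL-Number_Theory.Cong" "HOL-Computational_Algebra.Fundamental_Theorem_Algebra"
begin

text \<open>If a prime \<open>p\<close> divides the order of \<open>g\<close>, then \<open>g\<^sup>p\<close> generates a proper subgroup of the group generated by
  \<open>g\<close>, so \<open>g\<^sup>p\<close> lies in the subgroup \<open>N\<close> generated by the non-maximal elements.  Hence every nontrivial element of \<open>G / N\<close>
  has prime order, and such groups \<open>Q\<close> have to be classified.  A norm argument shows that if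
  \<open>Q\<close> has a nontrivial normal \<open>p\<close>-subgroup, then its Sylow \<open>p\<close>-subgroup \<open>P\<close> is normal of exponent \<open>p\<close> and index
  1 or a prime; so in general Sylow subgroups intersect trivially, have index \<open>n\<^sub>p\<close> (1 or
  a prime) in their normalizers, and \<open>\<Sum>\<^sub>p (1 - 1 / \<bar>P\<bar>) / n\<^sub>p = 1 - 1 / \<bar>Q\<bar>\<close>.

  If \<open>\<bar>Q\<bar>\<close> is even and no Sylow subgroup is normal, counting pairs of involutions by their product forces
  \<open>\<bar>Q\<bar> = q (q + 1) (q + 2)\<close>, where \<open>Q\<close> acts on its \<open>q + 2\<close> Sylow 2-subgroups and only the identity fixes three of them;
  the elements of order 3 then give \<open>q = 3\<close> and \<open>Q\<close> is the alternating group on five points.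

  If \<open>\<bar>Q\<bar>\<close> is odd, use characters.  Inducing \<open>1 - \<lambda>\<close> for nontrivial linear characters \<open>\<lambda>\<close> of \<open>P\<close> yields class functions
  supported on the \<open>p\<close>-elements, with Gram matrix \<open>n\<^sub>p J + I\<close> (\<open>J\<close> all ones); any two differ by two irreducible
  characters, which produces an exceptional character for each \<open>p\<close>.  If all \<open>n\<^sub>p\<close> were greater than 1, Bessel's
  inequality on the \<open>p\<close>-elements for an exceptional character would contradict the sum above.  If \<open>n\<^sub>p = 1\<close>, some induced
  function is \<open>1 - \<mu>\<close> with \<open>\<mu>\<close> linear, and induction applied to the kernel of \<open>\<mu>\<close> yields a normal \<open>p\<close>-subgroup.\<close>

text \<open>The odd case cannot fall back on solvability. What stands in for it is the rigid shape
  of the Sylow normalizers: Sylow subgroups intersect trivially and their normalizer quotients act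
  freely on nontrivial linear characters, so the Gram matrices are explicit. Inducing
  \<open>1 - \<lambda>\<close> and not \<open>\<lambda>\<close> matters because it vanishes at the
  identity; trivial intersection then kills all terms outside the normalizer. The obstacle is that
  the exceptional character of \<open>p\<close> may have coefficient 0 in the functions of another
  prime \<open>r\<close>, where Bessel's inequality yields nothing. Parity repairs this: in odd
  order only the trivial character is real, so the vanishing inner product of a
  \<open>p\<close>-function and an \<open>r\<close>-function, read modulo 2, makes exactly one of
  the two mutual coefficients odd, and the norm bounds how many primes can be lost. The estimate
  that remains is tight for small values. Representations never appear: an irreducible character is
  a primitive Hermitian idempotent of the group algebra summed over conjugation, and inner products
  are integers because the trace of a Hermitian idempotent matrix is one.\<close>

hide_const (open) Divisibility.prime Polynomial.order
hide_fact (open) Polynomial.order_def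

lemma card_fibers: "finite A \<Longrightarrow> card A = (\<Sum>c\<in>f ` A. card {x \<in> A. f x = c})"
  using sum.image_gen[of A "\<lambda>_. 1 :: nat" f] by simp

lemma card_const_fibers:
  assumes "finite A" "f ` A = B" "\<And>c. c \<in> B \<Longrightarrow> card {x \<in> A. f x = c} = k"
  shows "card A = k * card B"
  using card_fibers[OF assms(1), of f] assms(2,3) by simp

section \<open>Conjugation and Sylow subgroups\<close>

lemma (in group) inv_cancel [simp]:
  assumes "x \<in> carrier G" "y \<in> carrier G"
  shows "inv x \<otimes> (x \<otimes> y) = y" "x \<otimes> (inv x \<otimes> y) = y"
  using assms by (simp_all flip: m_assoc)

definition cj :: "('a, 'b) monoid_scheme \<Rightarrow> 'a \<Rightarrow> 'a \<Rightarrow> 'a" (\<open>cj\<index>\<close>) where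
  "cj\<^bsub>G\<^esub> y x = y \<otimes>\<^bsub>G\<^esub> x \<otimes>\<^bsub>G\<^esub> inv\<^bsub>G\<^esub> y"

definition normalizer :: "('a, 'b) monoid_scheme \<Rightarrow> 'a set \<Rightarrow> 'a set" where
  "normalizer G H = {y \<in> carrier G. cj\<^bsub>G\<^esub> y ` H = H}"

definition psub :: "('a, 'b) monoid_scheme \<Rightarrow> nat \<Rightarrow> 'a set \<Rightarrow> bool" where
  "psub G p H \<longleftrightarrow> subgroup H G \<and> (\<exists>n. card H = p ^ n)"

definition syl :: "('a, 'b) monoid_scheme \<Rightarrow> nat \<Rightarrow> 'a set \<Rightarrow> bool" where
  "syl G p P \<longleftrightarrow> subgroup P G \<and> card P = p ^ multiplicity p (order G)"

lemma syl_psub: "syl G p P \<Longrightarrow> psub G p P"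
  by (auto simp: syl_def psub_def)

context group
begin

lemma cj_closed [simp]: "y \<in> carrier G \<Longrightarrow> x \<in> carrier G \<Longrightarrow> cj y x \<in> carrier G"
  by (simp add: cj_def)

lemma cj_mult: "y \<in> carrier G \<Longrightarrow> a \<in> carrier G \<Longrightarrow> b \<in> carrier G \<Longrightarrow> cj y (a \<otimes> b) = cj y a \<otimes> cj y b"
  by (simp add: cj_def m_assoc)

lemma cj_cj: "y \<in> carrier G \<Longrightarrow> x \<in> carrier G \<Longrightarrow> a \<in> carrier G \<Longrightarrow> cj x (cj y a) = cj (x \<otimes> y) a"
  by (simp add: cj_def m_assoc inv_mult_group)

lemma cj_one [simp]: "y \<in> carrier G \<Longrightarrow> cj y \<one> = \<one>" "a \<in> carrier G \<Longrightarrow> cj \<one> a = a"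
  by (simp_all add: cj_def)

lemma cj_inv: "y \<in> carrier G \<Longrightarrow> a \<in> carrier G \<Longrightarrow> cj y (inv a) = inv (cj y a)"
  by (simp add: cj_def m_assoc inv_mult_group)

lemma cj_pow: "y \<in> carrier G \<Longrightarrow> a \<in> carrier G \<Longrightarrow> cj y (a [^] (n::nat)) = cj y a [^] n"
  by (induction n) (simp_all add: cj_mult)

lemma cj_invl [simp]: "y \<in> carrier G \<Longrightarrow> a \<in> carrier G \<Longrightarrow> cj (inv y) (cj y a) = a"
  "y \<in> carrier G \<Longrightarrow> a \<in> carrier G \<Longrightarrow> cj y (cj (inv y) a) = a"
  by (simp_all add: cj_cj)

lemma cj_eq [simp]:
  "y \<in> carrier G \<Longrightarrow> a \<in> carrier G \<Longrightarrow> b \<in> carrier G \<Longrightarrow> cj y a = cj y b \<longleftrightarrow> a = b"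
  by (metis cj_invl(1))

lemma cj_eq_one [simp]: "y \<in> carrier G \<Longrightarrow> a \<in> carrier G \<Longrightarrow> cj y a = \<one> \<longleftrightarrow> a = \<one>"
  using cj_eq[of y a \<one>] by simp

lemma cj_id_iff: "y \<in> carrier G \<Longrightarrow> a \<in> carrier G \<Longrightarrow> cj y a = a \<longleftrightarrow> y \<otimes> a = a \<otimes> y"
  by (metis cj_def inv_solve_right' m_closed)

lemma cj_inj: "y \<in> carrier G \<Longrightarrow> H \<subseteq> carrier G \<Longrightarrow> inj_on (cj y) H"
  by (auto simp: inj_on_def subset_iff)

lemma cj_bij: "y \<in> carrier G \<Longrightarrow> bij_betw (cj y) (carrier G) (carrier G)"
  by (rule bij_betw_byWitness[where f' = "cj (inv y)"]) auto

lemma cj_image_card: "y \<in> carrier G \<Longrightarrow> H \<subseteq> carrier G \<Longrightarrow> card (cj y ` H) = card H"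
  by (simp add: card_image cj_inj)

lemma cj_image_cj: "y \<in> carrier G \<Longrightarrow> x \<in> carrier G \<Longrightarrow> H \<subseteq> carrier G \<Longrightarrow>
    cj x ` cj y ` H = cj (x \<otimes> y) ` H"
  by (force simp: cj_cj image_iff)

lemma cj_image_one: "H \<subseteq> carrier G \<Longrightarrow> cj \<one> ` H = H"
  by (force simp: image_iff)

lemma cj_image_swap:
  assumes "y \<in> carrier G" "H \<subseteq> carrier G" "K \<subseteq> carrier G"
  shows "cj y ` H = K \<longleftrightarrow> H = cj (inv y) ` K"
  using assms by (auto simp: cj_image_cj cj_image_one)

lemma cj_subgroup:
  assumes "y \<in> carrier G" "subgroup H G"
  shows "subgroup (cj y ` H) G"
proof (rule subgroupI)
  interpret H: subgroup H G by fact
  show "cj y ` H \<subseteq> carrier G" using assms by auto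
  show "cj y ` H \<noteq> {}" using H.one_closed by blast
  show "inv a \<in> cj y ` H" if "a \<in> cj y ` H" for a
    using that assms(1) by (auto simp flip: cj_inv)
  show "a \<otimes> b \<in> cj y ` H" if "a \<in> cj y ` H" "b \<in> cj y ` H" for a b
    using that assms(1) by (auto simp flip: cj_mult)
qed

lemma normalizer_subset: "normalizer G H \<subseteq> carrier G"
  by (auto simp: normalizer_def)

lemma normalizer_subgroup:
  assumes "H \<subseteq> carrier G"
  shows "subgroup (normalizer G H) G"
proof (rule subgroupI)
  show "normalizer G H \<noteq> {}" using assms by (auto simp: normalizer_def cj_image_one intro!: exI[of _ \<one>])
  show "inv a \<in> normalizer G H" if "a \<in> normalizer G H" for a
    using that assms cj_image_swap[of a H H] by (auto simp: normalizer_def)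
  show "a \<otimes> b \<in> normalizer G H" if "a \<in> normalizer G H" "b \<in> normalizer G H" for a b
    using that assms by (simp add: normalizer_def flip: cj_image_cj)
qed (rule normalizer_subset)

lemma subgroup_in_normalizer:
  assumes "subgroup H G"
  shows "H \<subseteq> normalizer G H"
proof
  interpret H: subgroup H G by fact
  fix y assume y: "y \<in> H"
  have "a \<in> cj y ` H" if "a \<in> H" for a
    using that y by (intro image_eqI[of _ _ "cj (inv y) a"]) (auto simp: cj_def m_assoc)
  then show "y \<in> normalizer G H" using y by (auto simp: normalizer_def cj_def)
qed

lemma normalizer_cj: "y \<in> normalizer G H \<Longrightarrow> a \<in> H \<Longrightarrow> cj y a \<in> H"
  by (auto simp: normalizer_def)

lemma nat_pow_carrier [simp]: "x [^]\<^bsub>G\<lparr>carrier := H\<rparr>\<^esub> (n::nat) = x [^] n"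
  by (simp add: nat_pow_consistent[symmetric])

lemma subgroup_pow: "subgroup H G \<Longrightarrow> x \<in> H \<Longrightarrow> x [^] (n::nat) \<in> H"
  by (metis int_pow_int subgroup_int_pow_closed)

lemma pow_coprime_one:
  fixes m n :: nat
  assumes "x \<in> carrier G" "x [^] m = \<one>" "x [^] n = \<one>" "coprime m n"
  shows "x = \<one>"
  using assms by (metis coprime_common_divisor_nat ord_eq_1 pow_eq_id)

lemma pow_cong:
  fixes m n k :: nat
  assumes "x \<in> carrier G" "x [^] k = \<one>" "m mod k = n mod k"
  shows "x [^] m = x [^] n"
proof -
  have "x [^] j = x [^] (j mod k)" for j
    using assms(1,2) by (metis div_mult_mod_eq mult.commute nat_pow_closed nat_pow_mult nat_pow_one
        nat_pow_pow l_one)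
  then show ?thesis using assms(3) by metis
qed

end

section \<open>Fixed points of \<open>p\<close>-groups and the Sylow theorems\<close>

locale fin_group = group G for G (structure) +
  assumes fin [simp]: "finite (carrier G)"
begin

lemma fin_subset: "H \<subseteq> carrier G \<Longrightarrow> finite H"
  by (rule finite_subset) auto

lemma fin_subgroup: "subgroup H G \<Longrightarrow> finite H"
  by (metis fin_subset subgroup.subset)

lemma subgroup_card_pos: "subgroup H G \<Longrightarrow> 0 < card H"
  by (metis fin subgroup.finite_imp_card_positive)

lemma normalizerI:
  assumes "y \<in> carrier G" "H \<subseteq> carrier G" "\<And>a. a \<in> H \<Longrightarrow> cj y a \<in> H"
  shows "y \<in> normalizer G H"
proof -
  have "cj y ` H = H" using assms by (intro card_subset_eq) (auto simp: cj_image_card fin_subset)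
  then show ?thesis using assms by (simp add: normalizer_def)
qed

text \<open>Every orbit on the non-fixed points has length \<open>card H\<close> divided by the
  order of a stabilizer, a power of \<open>p\<close> other than 1. The action is any function
  \<open>f\<close> that obeys the laws on \<open>H\<close> and \<open>E\<close>, so that both
  conjugation and translation of cosets can be plugged in.\<close>

lemma p_group_fixed_points:
  assumes H: "subgroup H G" "card H = p ^ n" and p: "prime p" and E: "finite E"
    and cl: "\<And>h x. h \<in> H \<Longrightarrow> x \<in> E \<Longrightarrow> f h x \<in> E"
    and one: "\<And>x. x \<in> E \<Longrightarrow> f \<one> x = x"
    and mult: "\<And>h k x. h \<in> H \<Longrightarrow> k \<in> H \<Longrightarrow> x \<in> E \<Longrightarrow> f (h \<otimes> k) x = f h (f k x)"
  shows "[card E = card {x \<in> E. \<forall>h\<in>H. f h x = x}] (mod p)"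
proof -
  interpret H: subgroup H G by fact
  define F where "F = {x \<in> E. \<forall>h\<in>H. f h x = x}"
  define r where "r = {(x, y). x \<in> E - F \<and> y \<in> E - F \<and> (\<exists>h\<in>H. y = f h x)}"
  have finv: "f (inv h) (f h x) = x" "f h (f (inv h) x) = x" if "h \<in> H" "x \<in> E" for h x
    using that mult[of "inv h" h x] mult[of h "inv h" x] one[of x] by simp_all
  have nonfix: "f h x \<in> E - F" if "h \<in> H" "x \<in> E - F" for h x
  proof -
    have "f h x = x" if "f h x \<in> F"
      using that \<open>h \<in> H\<close> \<open>x \<in> E - F\<close> finv(1)[of h x] H.m_inv_closed unfolding F_def by auto
    then show ?thesis using that cl by auto
  qed
  have eq: "equiv (E - F) r"
  proof (rule equivI)
    show "r \<subseteq> (E - F) \<times> (E - F)" by (auto simp: r_def)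
    show "refl_on (E - F) r" by (auto simp: refl_on_def r_def one intro!: bexI[of _ \<one>])
    show "sym r"
    proof (rule symI)
      fix x y assume "(x, y) \<in> r"
      then obtain h where "x \<in> E - F" "y \<in> E - F" "h \<in> H" "y = f h x" by (auto simp: r_def)
      moreover from this have "x = f (inv h) y" by (simp add: finv)
      ultimately show "(y, x) \<in> r" using H.m_inv_closed[of h] unfolding r_def by blast
    qed
    show "trans r"
    proof (rule transI)
      fix x y z assume "(x, y) \<in> r" "(y, z) \<in> r"
      then obtain h k where "x \<in> E - F" "z \<in> E - F" "h \<in> H" "k \<in> H" "y = f h x" "z = f k y"
        by (auto simp: r_def)
      moreover from this have "z = f (k \<otimes> h) x" by (simp add: mult)
      ultimately show "(x, z) \<in> r" using H.m_closed[of k h] unfolding r_def by blast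
    qed
  qed
  have "p dvd card C" if C: "C \<in> (E - F) // r" for C
  proof -
    obtain x where x: "x \<in> E - F" "C = r `` {x}" using C by (auto elim: quotientE)
    have C2: "C = (\<lambda>h. f h x) ` H" using x nonfix by (auto simp: r_def)
    define S where "S = {h \<in> H. f h x = x}"
    have fS: "finite S" "finite H" using H fin_subgroup by (auto simp: S_def)
    have fib: "card {h \<in> H. f h x = c} = card S" if "c \<in> C" for c
    proof -
      obtain k where k: "k \<in> H" "c = f k x" using \<open>c \<in> C\<close> unfolding C2 by blast
      have "bij_betw (\<lambda>h. k \<otimes> h) S {h \<in> H. f h x = c}"
      proof (rule bij_betw_byWitness[where f' = "\<lambda>h. inv k \<otimes> h"])
        show "\<forall>a\<in>S. inv k \<otimes> (k \<otimes> a) = a" "\<forall>a\<in>{h \<in> H. f h x = c}. k \<otimes> (inv k \<otimes> a) = a"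
          using k by (auto simp: S_def)
        show "(\<lambda>h. k \<otimes> h) ` S \<subseteq> {h \<in> H. f h x = c}"
          using k mult x by (auto simp: S_def)
        show "(\<lambda>h. inv k \<otimes> h) ` {h \<in> H. f h x = c} \<subseteq> S"
          using k mult x finv by (auto simp: S_def)
      qed
      then show ?thesis by (metis bij_betw_same_card)
    qed
    have "card H = (\<Sum>c\<in>C. card {h \<in> H. f h x = c})"
      unfolding C2 by (rule card_fibers[OF fS(2)])
    also have "\<dots> = card C * card S" using fib by simp
    finally have "card C dvd p ^ n" using H(2) by (metis dvd_triv_left)
    then obtain i where i: "card C = p ^ i" using p divides_primepow_nat by blast
    show ?thesis
    proof (cases i)
      case 0
      then have "card C = 1" using i by simp
      then obtain c where "C = {c}" by (meson card_1_singletonE)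
      have "f h x = c" if "h \<in> H" for h
        using imageI[OF that, of "\<lambda>h. f h x"] unfolding C2[symmetric] \<open>C = {c}\<close> by simp
      then have "x \<in> F" using x one[of x] H.one_closed by (simp add: F_def)
      with x show ?thesis by auto
    qed (simp add: i)
  qed
  then have "p dvd card (E - F)" using E by (intro equiv_imp_dvd_card[OF _ eq]) auto
  moreover have "card (E - F) = card E - card F" "card F \<le> card E"
    using E by (auto simp: F_def card_Diff_subset intro: card_mono)
  ultimately show ?thesis unfolding F_def[symmetric]
    by (simp add: cong_altdef_nat)
qed

end

lemma prime_power_if_only_prime:
  fixes m p :: nat
  assumes "m > 0" "prime p" "\<And>r. prime r \<Longrightarrow> r dvd m \<Longrightarrow> r = p"
  shows "\<exists>n. m = p ^ n"
proof -
  have m0: "m \<noteq> 0" "\<not> is_unit p" using assms by auto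
  obtain k where k: "m = p ^ multiplicity p m * k" "\<not> p dvd k"
    using multiplicity_decompose'[OF m0] by blast
  have "k = 1"
  proof (rule ccontr)
    assume "k \<noteq> 1"
    then obtain r where "prime r" "r dvd k" using prime_factor_nat by blast
    then show False using assms(3)[of r] k by (metis dvd_mult)
  qed
  with k show ?thesis by auto
qed

context fin_group
begin

lemma cj_in_subgroup: "subgroup H G \<Longrightarrow> y \<in> H \<Longrightarrow> x \<in> H \<Longrightarrow> cj y x \<in> H"
  using subgroup_in_normalizer normalizer_cj by blast

lemma fin_group_subgroup: "subgroup H G \<Longrightarrow> fin_group (G\<lparr>carrier := H\<rparr>)"
  by (simp add: fin_group_def fin_group_axioms_def subgroup_imp_group fin_subgroup)

lemma subgroup_order_dvd: "subgroup H G \<Longrightarrow> card H dvd order G"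
  by (metis dvd_triv_right lagrange)

lemma subgroup_card_dvd: "subgroup H G \<Longrightarrow> subgroup K G \<Longrightarrow> H \<subseteq> K \<Longrightarrow> card H dvd card K"
  using fin_group.subgroup_order_dvd[OF fin_group_subgroup, of K H] subgroup_incl[of H K]
  by (simp add: order_def)

lemma order_pos: "0 < order G"
  by (simp add: order_gt_0_iff_finite)

lemma pow_subgroup_card: "subgroup H G \<Longrightarrow> x \<in> H \<Longrightarrow> x [^] card H = \<one>"
  using group.pow_order_eq_1[OF subgroup_imp_group, of H x] by (simp add: order_def)

lemma syl_ex: "prime p \<Longrightarrow> \<exists>P. syl G p P"
  using sylow_thm[of p G "multiplicity p (order G)" "order G div p ^ multiplicity p (order G)"]
  by (auto simp: syl_def multiplicity_dvd)

lemma cauchy: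
  assumes "prime p" "p dvd order G"
  shows "\<exists>x\<in>carrier G. x \<noteq> \<one> \<and> x [^] p = \<one>"
proof -
  obtain m where "order G = p ^ 1 * m" using assms(2) by (auto elim: dvdE)
  then obtain H where H: "subgroup H G" "card H = p"
    using sylow_thm[of p G 1 m] assms by auto
  have "H \<noteq> {\<one>}" using H(2) assms(1) by auto
  then obtain x where "x \<in> H" "x \<noteq> \<one>" using subgroup.one_closed[OF H(1)] by blast
  then show ?thesis using H pow_subgroup_card[OF H(1)] subgroup.mem_carrier by force
qed

lemma cauchy_subgroup:
  assumes "prime p" "subgroup H G" "p dvd card H"
  shows "\<exists>x\<in>H. x \<noteq> \<one> \<and> x [^] p = \<one>"
  using fin_group.cauchy[OF fin_group_subgroup, of H p] assms by (simp add: order_def)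

lemma exp_psub:
  assumes "subgroup H G" "prime p" "\<And>x. x \<in> H \<Longrightarrow> x [^] p = \<one>"
  shows "psub G p H"
  unfolding psub_def
proof (intro conjI prime_power_if_only_prime)
  show "r = p" if r: "prime r" "r dvd card H" for r
  proof (rule ccontr)
    assume "r \<noteq> p"
    obtain x where "x \<in> H" "x \<noteq> \<one>" "x [^] r = \<one>" using cauchy_subgroup[OF r(1) assms(1) r(2)] by blast
    then show False
      using pow_coprime_one[of x r p] assms r(1) \<open>r \<noteq> p\<close> primes_coprime subgroup.mem_carrier by metis
  qed
qed (use assms subgroup_card_pos in auto)

lemma psub_card_dvd_syl:
  assumes "prime p" "psub G p H" "syl G p P"
  shows "card H dvd card P"
proof -
  obtain n where n: "card H = p ^ n" using assms by (auto simp: psub_def)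
  then have "p ^ n dvd order G" using subgroup_order_dvd[of H] assms(2) by (simp add: psub_def)
  then have "n \<le> multiplicity p (order G)" using assms(1) order_pos by (intro multiplicity_geI) auto
  then show ?thesis using n assms(3) by (simp add: syl_def le_imp_power_dvd)
qed

text \<open>\<open>H\<close> permutes the right cosets of \<open>P\<close>, whose number is prime to
  \<open>p\<close>, so it fixes some \<open>P #> g\<close>; this says that \<open>g\<close>
  conjugates \<open>H\<close> into \<open>P\<close>. Multiplying by \<open>inv h\<close> turns right
  translation into a left action.\<close>

lemma psub_conj_syl:
  assumes p: "prime p" and H: "psub G p H" and P: "syl G p P"
  shows "\<exists>g\<in>carrier G. H \<subseteq> cj g ` P"
proof -
  interpret P: subgroup P G using P by (simp add: syl_def)
  from H obtain n where sH: "subgroup H G" and n: "card H = p ^ n" by (auto simp: psub_def)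
  interpret H: subgroup H G by fact
  let ?E = "rcosets P"
  have "[card ?E = card {C \<in> ?E. \<forall>h\<in>H. C #> inv h = C}] (mod p)"
  proof (rule p_group_fixed_points[OF sH n p])
    show "finite ?E" using fin rcosets_subset_PowG[OF P.subgroup_axioms] by (meson finite_Pow_iff finite_subset)
    show "C #> inv h \<in> ?E" if "h \<in> H" "C \<in> ?E" for h C
      using that by (auto simp: RCOSETS_def coset_mult_assoc P.subset)
    show "C #> inv \<one> = C" if "C \<in> ?E" for C
      using that P.rcosets_carrier by auto
    show "C #> inv (h \<otimes> k) = (C #> inv k) #> inv h" if "h \<in> H" "k \<in> H" "C \<in> ?E" for h k C
      using that P.rcosets_carrier by (simp add: coset_mult_assoc inv_mult_group)
  qed
  moreover have "\<not> p dvd card ?E"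
  proof -
    obtain k where k: "order G = p ^ multiplicity p (order G) * k" "\<not> p dvd k"
      using multiplicity_decompose'[of "order G" p] order_pos p not_prime_unit by (metis less_numeral_extra(3))
    have "card ?E * card P = order G" using lagrange P.subgroup_axioms by simp
    then have "card ?E * p ^ multiplicity p (order G) = k * p ^ multiplicity p (order G)"
      using k(1) P by (simp add: syl_def mult.commute)
    then have "card ?E = k" using p by (simp add: prime_gt_0_nat)
    with k show ?thesis by simp
  qed
  ultimately have "{C \<in> ?E. \<forall>h\<in>H. C #> inv h = C} \<noteq> {}"
    by (metis card.empty cong_0_iff)
  then obtain g where g: "g \<in> carrier G" "\<forall>h\<in>H. (P #> g) #> inv h = P #> g"
    by (auto simp: RCOSETS_def)
  have "h \<in> cj (inv g) ` P" if h: "h \<in> H" for h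
  proof -
    have "P #> (g \<otimes> inv h) = P #> g" using g h by (simp add: coset_mult_assoc P.subset)
    then have "g \<in> P #> (g \<otimes> inv h)" using rcos_self[OF g(1) P.subgroup_axioms] by simp
    then have "g \<otimes> inv (g \<otimes> inv h) \<in> P" using P.rcos_module[of "g \<otimes> inv h" g] g h by simp
    then have "cj g h \<in> P" using g h by (simp add: cj_def inv_mult_group m_assoc)
    then show ?thesis using g h by (intro image_eqI[of _ _ "cj g h"]) auto
  qed
  then show ?thesis using g(1) by (intro bexI[of _ "inv g"]) auto
qed

lemma syl_cj: "y \<in> carrier G \<Longrightarrow> syl G p P \<Longrightarrow> syl G p (cj y ` P)"
  by (auto simp: syl_def cj_subgroup cj_image_card subgroup.subset)

lemma psub_in_syl:
  assumes "prime p" "psub G p H"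
  shows "\<exists>P. syl G p P \<and> H \<subseteq> P"
  using syl_ex[of p] psub_conj_syl[OF assms] assms syl_cj by metis

lemma syl_conj:
  assumes "prime p" "syl G p P" "syl G p R"
  shows "\<exists>g\<in>carrier G. R = cj g ` P"
proof -
  obtain g where g: "g \<in> carrier G" "R \<subseteq> cj g ` P"
    using psub_conj_syl[OF assms(1) syl_psub[OF assms(3)] assms(2)] by blast
  then have "R = cj g ` P"
    using assms(2,3) by (intro card_subset_eq) (auto simp: syl_def cj_image_card subgroup.subset fin_subgroup)
  with g show ?thesis by blast
qed

lemma syl_maximal:
  assumes "prime p" "syl G p P" "psub G p H" "P \<subseteq> H"
  shows "H = P"
proof -
  have "card H \<le> card P"
    using psub_card_dvd_syl[OF assms(1,3,2)] subgroup_card_pos[of P] assms(2)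
    by (auto simp: syl_def dest: dvd_imp_le)
  then show ?thesis
    using assms by (metis card_seteq fin_subgroup psub_def)
qed

text \<open>The number of cosets of \<open>D\<close> in \<open>P\<close> is divisible by
  \<open>p\<close>, hence so is the number of those fixed by \<open>D\<close>. As \<open>D\<close>
  itself is fixed, there is a second fixed coset \<open>D #> g\<close>, and its being fixed says
  that \<open>g\<close> normalizes \<open>D\<close>.\<close>

lemma psub_normalizer_grows:
  assumes p: "prime p" and P: "psub G p P" and D: "subgroup D G" "D \<subset> P"
  shows "\<exists>y\<in>P - D. y \<in> normalizer G D"
proof -
  have sP: "subgroup P G" using P by (simp add: psub_def)
  then interpret P: subgroup P G .
  interpret D: subgroup D G by fact
  obtain n where n: "card P = p ^ n" using P by (auto simp: psub_def)
  have "card D dvd card P" using subgroup_card_dvd D sP by blast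
  then obtain m where m: "card D = p ^ m" using n p divides_primepow_nat by metis
  define E where "E = (\<lambda>g. D #> g) ` P"
  have "rcosets\<^bsub>G\<lparr>carrier := P\<rparr>\<^esub> D = E" by (auto simp: RCOSETS_def E_def)
  then have lag: "card E * card D = card P"
    using group.lagrange[OF subgroup_imp_group[OF sP] subgroup_incl[OF D(1) sP]] D
    by (simp add: order_def)
  have "[card E = card {C \<in> E. \<forall>h\<in>D. C #> inv h = C}] (mod p)"
  proof (rule p_group_fixed_points[OF D(1) m p])
    show "finite E" using fin_subgroup[OF sP] by (simp add: E_def)
    show "C #> inv h \<in> E" if "h \<in> D" "C \<in> E" for h C
      using that D by (auto simp: E_def coset_mult_assoc D.subset subset_iff intro!: imageI)
    show "C #> inv \<one> = C" if "C \<in> E" for C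
      using that by (auto simp: E_def coset_mult_assoc D.subset)
    show "C #> inv (h \<otimes> k) = (C #> inv k) #> inv h" if "h \<in> D" "k \<in> D" "C \<in> E" for h k C
      using that by (auto simp: E_def coset_mult_assoc D.subset inv_mult_group m_assoc)
  qed
  moreover have "p dvd card E"
  proof -
    have "card E \<noteq> 1" using lag D by (metis P.subset card_subset_eq fin_subset mult_1 psubsetE)
    moreover have "card E dvd p ^ n" using lag n by (metis dvd_triv_left)
    ultimately show ?thesis using p by (metis divides_primepow_nat dvd_power_iff_le dvd_refl neq0_conv power_0 prime_dvd_power_nat_iff dvd_power)
  qed
  ultimately have fx: "p dvd card {C \<in> E. \<forall>h\<in>D. C #> inv h = C}" by (simp add: cong_dvd_iff)
  have D_E: "D \<in> {C \<in> E. \<forall>h\<in>D. C #> inv h = C}"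
    using D.rcos_const[OF is_group] by (auto simp: E_def image_iff D.subset intro!: bexI[of _ \<one>])
  have "{C \<in> E. \<forall>h\<in>D. C #> inv h = C} \<noteq> {D}"
    using fx p by auto
  then obtain C where C: "C \<in> E" "\<forall>h\<in>D. C #> inv h = C" "C \<noteq> D" using D_E by blast
  then obtain g where g: "g \<in> P" "C = D #> g" by (auto simp: E_def)
  have "cj g h \<in> D" if h: "h \<in> D" for h
  proof -
    have "D #> (g \<otimes> inv h) = D #> g" using C(2) g h by (simp add: coset_mult_assoc D.subset)
    then have "g \<in> D #> (g \<otimes> inv h)" using rcos_self[OF _ D(1), of g] g by simp
    then have "g \<otimes> inv (g \<otimes> inv h) \<in> D" using D.rcos_module[of "g \<otimes> inv h" g] g h by simp
    then show ?thesis using g h by (simp add: cj_def inv_mult_group m_assoc)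
  qed
  then have "g \<in> normalizer G D" using g by (intro normalizerI) (auto simp: D.subset)
  moreover have "g \<notin> D" using C(3) g D.rcos_const[OF is_group] by auto
  ultimately show ?thesis using g by blast
qed

text \<open>Let \<open>V\<close> act on itself by conjugation: the number of fixed points, which is
  the order of the center, is divisible by \<open>p\<close>.\<close>

lemma psub_center:
  assumes p: "prime p" and V: "psub G p V" "V \<noteq> {\<one>}"
  shows "\<exists>z\<in>V. z \<noteq> \<one> \<and> (\<forall>v\<in>V. cj v z = z)"
proof -
  obtain n where n: "subgroup V G" "card V = p ^ n" using V by (auto simp: psub_def)
  interpret V: subgroup V G using n(1) .
  have "[card V = card {z \<in> V. \<forall>v\<in>V. cj v z = z}] (mod p)"
  proof (rule p_group_fixed_points[OF n p])
    show "cj h x \<in> V" if "h \<in> V" "x \<in> V" for h x using that n(1) cj_in_subgroup by blast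
  qed (use fin_subgroup[OF n(1)] in \<open>simp_all add: cj_cj\<close>)
  moreover have "n \<noteq> 0"
  proof
    assume "n = 0"
    then obtain c where "V = {c}" using n(2) by (auto simp: card_1_singleton_iff)
    then show False using V(2) V.one_closed by auto
  qed
  ultimately have "p dvd card {z \<in> V. \<forall>v\<in>V. cj v z = z}"
    using n(2) by (simp add: cong_dvd_iff[of _ _ p, symmetric])
  then have "{z \<in> V. \<forall>v\<in>V. cj v z = z} \<noteq> {\<one>}" using p by auto
  moreover have "\<one> \<in> {z \<in> V. \<forall>v\<in>V. cj v z = z}" by auto
  ultimately show ?thesis by blast
qed

end

section \<open>Groups all of whose elements have prime order\<close>

text \<open>Groups with elements of prime order. The identity satisfies the condition for every
  prime, so a prime obtained from it is the order of \<open>x\<close> only if \<open>x\<close> is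
  nontrivial.\<close>

locale epo = fin_group +
  assumes prime_exp: "x \<in> carrier G \<Longrightarrow> \<exists>p::nat. prime p \<and> x [^] p = \<one>"

lemma (in comm_monoid) finprod_swap:
  assumes "finite A" "finite B" "\<And>x y. x \<in> A \<Longrightarrow> y \<in> B \<Longrightarrow> f x y \<in> carrier G"
  shows "finprod G (\<lambda>x. finprod G (f x) B) A = finprod G (\<lambda>y. finprod G (\<lambda>x. f x y) A) B"
  using assms(1,3)
proof (induction A)
  case empty
  then show ?case using assms(2) by (simp add: finprod_one_eqI)
next
  case (insert a A)
  have "finprod G (\<lambda>y. finprod G (\<lambda>x. f x y) (insert a A)) B
      = finprod G (\<lambda>y. f a y \<otimes> finprod G (\<lambda>x. f x y) A) B"
    using insert by (intro finprod_cong') (auto intro!: finprod_insert)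
  also have "\<dots> = finprod G (f a) B \<otimes> finprod G (\<lambda>y. finprod G (\<lambda>x. f x y) A) B"
    using insert by (intro finprod_multf) auto
  finally show ?case using insert by (simp add: Pi_def)
qed

context fin_group
begin

text \<open>Count the pairs \<open>(g, x)\<close> with \<open>x\<close> in
  \<open>P - {\<one>}\<close>. By \<open>ti\<close>, the pairs that give the same conjugate as
  \<open>(g, x)\<close> are the pairs \<open>(g \<otimes> n, cj (inv n) x)\<close> with
  \<open>n\<close> in the normalizer.\<close>

lemma ti_count:
  assumes P: "subgroup P G"
    and ti: "\<And>g x. g \<in> carrier G \<Longrightarrow> x \<in> P \<Longrightarrow> x \<noteq> \<one> \<Longrightarrow> cj g x \<in> P \<Longrightarrow> g \<in> normalizer G P"
  shows "card {cj g x | g x. g \<in> carrier G \<and> x \<in> P - {\<one>}} * card (normalizer G P)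
    = order G * (card P - 1)"
proof -
  interpret P: subgroup P G by fact
  let ?N = "normalizer G P"
  interpret N: subgroup ?N G by (rule normalizer_subgroup) (rule P.subset)
  let ?A = "{cj g x | g x. g \<in> carrier G \<and> x \<in> P - {\<one>}}"
  let ?D = "carrier G \<times> (P - {\<one>})"
  let ?f = "\<lambda>(g, x). cj g x"
  have "card ?D = card ?N * card ?A"
  proof (rule card_const_fibers)
    show "finite ?D" using fin_subgroup[OF P] by simp
    show "?f ` ?D = ?A" by auto
    fix c assume "c \<in> ?A"
    then obtain g x where c: "c = cj g x" "g \<in> carrier G" "x \<in> P" "x \<noteq> \<one>" by auto
    have "bij_betw (\<lambda>n. (g \<otimes> n, cj (inv n) x)) ?N {z \<in> ?D. ?f z = c}"
    proof (rule bij_betw_byWitness[where f' = "\<lambda>z. inv g \<otimes> fst z"])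
      show "\<forall>a\<in>?N. inv g \<otimes> fst (g \<otimes> a, cj (inv a) x) = a" using c by auto
      show "\<forall>z\<in>{z \<in> ?D. ?f z = c}. (g \<otimes> (inv g \<otimes> fst z), cj (inv (inv g \<otimes> fst z)) x) = z"
        using c by (auto simp: inv_mult_group simp flip: cj_cj) (metis P.mem_carrier cj_invl(1))
      show "(\<lambda>n. (g \<otimes> n, cj (inv n) x)) ` ?N \<subseteq> {z \<in> ?D. ?f z = c}"
        using c by (auto simp: cj_cj m_assoc intro: normalizer_cj)
      show "(\<lambda>z. inv g \<otimes> fst z) ` {z \<in> ?D. ?f z = c} \<subseteq> ?N"
      proof (rule subsetI)
        fix a assume "a \<in> (\<lambda>z. inv g \<otimes> fst z) ` {z \<in> ?D. ?f z = c}"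
        then obtain z where z: "z \<in> ?D" "?f z = c" "a = inv g \<otimes> fst z" by blast
        obtain h y where hy: "z = (h, y)" by (cases z)
        have h: "a = inv g \<otimes> h" "h \<in> carrier G" "y \<in> P" "y \<noteq> \<one>" "cj h y = cj g x"
          using z c(1) unfolding hy by simp_all
        have "cj (inv g) (cj h y) = x" unfolding h(5) using c by simp
        then have "cj (inv g \<otimes> h) y \<in> P" using c(2,3) h(2,3) by (simp add: cj_cj)
        moreover have "inv g \<otimes> h \<in> carrier G" using c(2) h(2) by simp
        ultimately show "a \<in> ?N" unfolding h(1) using ti[OF _ h(3,4)] by blast
      qed
    qed
    then show "card {z \<in> ?D. ?f z = c} = card ?N" by (rule bij_betw_same_card[symmetric])
  qed
  then show ?thesis using fin_subgroup[OF P] by (simp add: card_cartesian_product order_def)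
qed

lemma pow_pow_comm: "x \<in> carrier G \<Longrightarrow> (x [^] (m::nat)) [^] (n::nat) = (x [^] n) [^] m"
  by (simp add: nat_pow_pow mult.commute)

text \<open>The cyclic subgroup is spelled out as the powers with exponent below \<open>q\<close>,
  so that its order and products over it can be read off the exponents.\<close>

lemma cyclic_prime:
  assumes "prime q" "x \<in> carrier G" "x [^] q = \<one>" "x \<noteq> \<one>"
  shows "subgroup ((\<lambda>i::nat. x [^] i) ` {..<q}) G" "inj_on (\<lambda>i::nat. x [^] i) {..<q}"
    "card ((\<lambda>i::nat. x [^] i) ` {..<q}) = q"
proof -
  let ?C = "(\<lambda>i::nat. x [^] i) ` {..<q}"
  have q: "0 < q" using assms(1) prime_gt_0_nat by blast
  have mem: "x [^] (i::nat) \<in> ?C" for i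
    using q pow_cong[OF assms(2,3), of i "i mod q"] by (intro image_eqI[of _ _ "i mod q"]) auto
  show "subgroup ?C G"
  proof (rule subgroupI)
    show "?C \<noteq> {}" using q by blast
    show "a \<otimes> b \<in> ?C" if "a \<in> ?C" "b \<in> ?C" for a b
      using that mem assms(2) by (auto simp: nat_pow_mult)
    show "inv a \<in> ?C" if a: "a \<in> ?C" for a
    proof -
      obtain i where "i < q" "a = x [^] i" using a by auto
      moreover from this have "x [^] (q - i) \<otimes> x [^] i = \<one>" using assms by (simp add: nat_pow_mult)
      ultimately have "inv a = x [^] (q - i)" using assms by (simp add: inv_equality)
      then show ?thesis using mem by simp
    qed
  qed (use assms in auto)
  show inj: "inj_on (\<lambda>i::nat. x [^] i) {..<q}"
  proof (rule linorder_inj_onI)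
    fix i j :: nat assume ij: "i < j" "i \<in> {..<q}" "j \<in> {..<q}"
    have "x [^] i \<noteq> x [^] j"
    proof
      assume "x [^] i = x [^] j"
      moreover have "x [^] (j - i) \<otimes> x [^] i = x [^] j" using ij assms by (simp add: nat_pow_mult)
      ultimately have "x [^] (j - i) \<otimes> x [^] i = \<one> \<otimes> x [^] i" using assms(2) by simp
      then have "x [^] (j - i) = \<one>" using assms(2) by (subst (asm) right_cancel) auto
      moreover have "coprime (j - i) q"
        using ij assms(1) by (metis coprime_commute dvd_imp_le lessThan_iff less_imp_diff_less not_le prime_imp_coprime zero_less_diff)
      ultimately show False using pow_coprime_one[OF assms(2) _ assms(3)] assms(4) by blast
    qed
    then show "x [^] i \<noteq> x [^] j" .
  qed auto
  show "card ?C = q" using card_image[OF inj] by simp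
qed

lemma prime_card_pow:
  assumes "prime q" "subgroup Q G" "card Q = q" "x \<in> Q" "x \<noteq> \<one>"
  shows "Q = (\<lambda>i::nat. x [^] i) ` {..<q}" "x [^] q = \<one>"
proof -
  show x: "x [^] q = \<one>" using assms pow_subgroup_card by metis
  have "x \<in> carrier G" using assms subgroup.mem_carrier by metis
  moreover have "(\<lambda>i::nat. x [^] i) ` {..<q} \<subseteq> Q" using subgroup_pow assms by blast
  ultimately show "Q = (\<lambda>i::nat. x [^] i) ` {..<q}"
    using cyclic_prime[of q x] assms x card_subset_eq[OF fin_subgroup[OF assms(2)]] by metis
qed

end

context epo
begin

lemma epo_subgroup: "subgroup H G \<Longrightarrow> epo (G\<lparr>carrier := H\<rparr>)"
  using fin_group_subgroup prime_exp subgroup.mem_carrier[of H G]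
  by (auto simp: epo_def epo_axioms_def)

lemma psub_exp:
  assumes "prime p" "psub G p H" "x \<in> H"
  shows "x [^] p = \<one>"
proof -
  have x: "x \<in> carrier G" using assms by (auto simp: psub_def dest: subgroup.mem_carrier)
  obtain r :: nat where r: "prime r" "x [^] r = \<one>" using prime_exp[OF x] by blast
  obtain n where "x [^] (p ^ n) = \<one>" using assms pow_subgroup_card by (metis psub_def)
  then have "x = \<one>" if "r \<noteq> p"
    using pow_coprime_one[OF x r(2)] primes_coprime[OF r(1) assms(1) that] by simp
  then show ?thesis using r by (cases "r = p") auto
qed

text \<open>Nontrivial commuting elements of distinct prime orders \<open>p\<close> and
  \<open>q\<close> would have a product of order \<open>p * q\<close>, which is not a prime.\<close>

lemma commute_coprime_one:
  fixes p q :: nat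
  assumes "prime p" "prime q" "p \<noteq> q" "x \<in> carrier G" "y \<in> carrier G"
    "x [^] p = \<one>" "y [^] q = \<one>" "x \<otimes> y = y \<otimes> x"
  shows "x = \<one> \<or> y = \<one>"
proof -
  obtain r :: nat where r: "prime r" "(x \<otimes> y) [^] r = \<one>" using prime_exp[of "x \<otimes> y"] assms by auto
  have xy: "x [^] r \<otimes> y [^] r = \<one>" using r(2) pow_mult_distrib[OF assms(8,4,5), of r] by simp
  have pw: "(x [^] r) [^] p = \<one>" "(y [^] r) [^] q = \<one>"
    using pow_pow_comm[of x r p] pow_pow_comm[of y r q] assms by simp_all
  have "y [^] r = inv (x [^] r)" using xy assms inv_equality[of "y [^] r" "x [^] r"] inv_comm by simp
  then have "(y [^] r) [^] p = \<one>" using pw(1) assms by (simp add: nat_pow_inv)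
  then have y: "y [^] r = \<one>" using pow_coprime_one[of "y [^] r" p q] pw(2) assms(5) primes_coprime[OF assms(1-3)] by simp
  then have x: "x [^] r = \<one>" using xy assms by simp
  show ?thesis
  proof (cases "r = p")
    case True
    then show ?thesis using y pow_coprime_one[of y p q] assms primes_coprime by blast
  next
    case False
    then show ?thesis using x pow_coprime_one[of x r p] assms r primes_coprime by blast
  qed
qed

end

text \<open>An abelian normal subgroup \<open>V\<close> of exponent \<open>p\<close>, seen as a module.  If \<open>y\<close> has prime
  order \<open>r\<close> then so has \<open>v \<otimes> y\<close>, and \<open>(v \<otimes> y)\<^sup>r\<close> is the norm of \<open>v\<close> with respect to \<open>y\<close>.\<close>

locale epo_module = epo +
  fixes V p
  assumes V: "subgroup V G" and p: "prime (p::nat)"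
    and V_comm: "\<And>u v. u \<in> V \<Longrightarrow> v \<in> V \<Longrightarrow> u \<otimes> v = v \<otimes> u"
    and V_exp: "\<And>v. v \<in> V \<Longrightarrow> v [^] p = \<one>"
    and V_normal: "\<And>y v. y \<in> carrier G \<Longrightarrow> v \<in> V \<Longrightarrow> cj y v \<in> V"
    and V_nontriv: "V \<noteq> {\<one>}"
begin

sublocale V: subgroup V G by (rule V)

abbreviation GV where "GV \<equiv> G\<lparr>carrier := V\<rparr>"

sublocale GV: comm_group GV
  using V_comm subgroup_imp_group[OF V] by (intro group.group_comm_groupI) auto

lemma pow_mult_norm:
  fixes n :: nat
  assumes "y \<in> carrier G" "v \<in> V"
  shows "(v \<otimes> y) [^] n = finprod GV (\<lambda>i. cj (y [^] i) v) {..<n} \<otimes> y [^] n"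
proof (induction n)
  case 0
  show ?case by simp
next
  case (Suc n)
  let ?N = "finprod GV (\<lambda>i. cj (y [^] i) v) {..<n}"
  have N: "?N \<in> V" using GV.finprod_closed[of "\<lambda>i. cj (y [^] i) v" "{..<n}"] assms V_normal by auto
  have "(v \<otimes> y) [^] Suc n = ?N \<otimes> cj (y [^] n) v \<otimes> y [^] Suc n"
    using N assms Suc by (simp add: cj_def m_assoc)
  also have "?N \<otimes> cj (y [^] n) v = finprod GV (\<lambda>i. cj (y [^] i) v) {..<Suc n}"
    using GV.finprod_insert[of "{..<n}" n "\<lambda>i. cj (y [^] i) v"] assms V_normal N
    by (simp add: lessThan_Suc Pi_def V_comm)
  finally show ?case .
qed

lemma norm_closed:
  fixes n :: nat
  assumes "y \<in> carrier G" "v \<in> V"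
  shows "finprod GV (\<lambda>i. cj (y [^] i) v) {..<n} \<in> V"
  using GV.finprod_closed[of "\<lambda>i. cj (y [^] i) v" "{..<n}"] assms V_normal by auto

text \<open>The \<open>r\<close>-th power of \<open>v \<otimes> y\<close> is the norm, so only a
  prime \<open>s \<noteq> r\<close> that kills \<open>v \<otimes> y\<close> needs an argument. If
  \<open>s = p\<close>, then \<open>y [^] p\<close> lies in \<open>V\<close> and
  \<open>y [^] (p * p)\<close> is the identity, against the order of \<open>y\<close>; any other
  \<open>s\<close> is coprime to \<open>r * p\<close>, an exponent that kills
  \<open>v \<otimes> y\<close> as well.\<close>

lemma norm_one:
  fixes r :: nat
  assumes y: "y \<in> carrier G" "y \<noteq> \<one>" "prime r" "y [^] r = \<one>" and v: "v \<in> V"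
  shows "finprod GV (\<lambda>i. cj (y [^] i) v) {..<r} = \<one>"
proof -
  let ?N = "\<lambda>n::nat. finprod GV (\<lambda>i. cj (y [^] i) v) {..<n}"
  have N: "?N n \<in> V" for n using norm_closed y(1) v .
  have vy: "v \<otimes> y \<in> carrier G" "(v \<otimes> y) [^] r = ?N r"
    using pow_mult_norm[OF y(1) v, of r] y v N[of r] by auto
  obtain s :: nat where s: "prime s" "(v \<otimes> y) [^] s = \<one>" using prime_exp[OF vy(1)] by blast
  show ?thesis
  proof (cases "s = r")
    case True
    then show ?thesis using s vy by simp
  next
    case sr: False
    show ?thesis
    proof (cases "s = p")
      case True
      have "?N p \<otimes> y [^] p = \<one>" using pow_mult_norm[OF y(1) v, of p] s True by simp
      then have "y [^] p = inv (?N p)"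
        using N[of p] y inv_equality[of "y [^] p" "?N p"] inv_comm[of "?N p" "y [^] p"] by simp
      then have "(y [^] p) [^] p = \<one>" using N[of p] V_exp by simp
      then have "y [^] (p * p) = \<one>" using y by (simp add: nat_pow_pow)
      moreover have "coprime (p * p) r" using sr True p y(3) primes_coprime by auto
      ultimately show ?thesis using pow_coprime_one[OF y(1) _ y(4)] y(2) by blast
    next
      case False
      have "(v \<otimes> y) [^] (r * p) = \<one>" using vy N[of r] V_exp by (simp flip: nat_pow_pow)
      moreover have "coprime (r * p) s" using sr False p y(3) s primes_coprime by auto
      ultimately have "v \<otimes> y = \<one>" using pow_coprime_one[OF vy(1) _ s(2)] by blast
      then show ?thesis using vy by simp
    qed
  qed
qed

text \<open>Multiply the norms of \<open>v\<close> with respect to all \<open>x \<otimes> y\<close>, \<open>x \<in> Q\<close>, in two ways: all of them are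
  trivial, but regrouping gives \<open>v\<^sup>q\<close> times norms with respect to \<open>Q\<close>, hence \<open>v\<^sup>q\<close>.\<close>

lemma prime_subgroup_self_normalizing:
  assumes q: "prime q" "q \<noteq> p" and Q: "subgroup Q G" "card Q = q"
  shows "normalizer G Q = Q"
proof (rule ccontr)
  interpret Q: subgroup Q G by fact
  have finQ: "finite Q" using fin_subgroup[OF Q(1)] .
  assume "normalizer G Q \<noteq> Q"
  then obtain y where y: "y \<in> normalizer G Q" "y \<notin> Q" using subgroup_in_normalizer[OF Q(1)] by blast
  have yG: "y \<in> carrier G" using y(1) normalizer_subset by blast
  obtain r :: nat where r: "prime r" "y [^] r = \<one>" using prime_exp[OF yG] by blast
  have ypow: "cj (y [^] n) x \<in> Q" if "x \<in> Q" for n :: nat and x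
    using that y normalizer_subgroup[OF Q.subset] subgroup_pow normalizer_cj by blast
  have inQ: "(x \<otimes> y) [^] n \<otimes> inv (y [^] n) \<in> Q" if x: "x \<in> Q" for n :: nat and x
  proof (induction n)
    case (Suc n)
    have "(x \<otimes> y) [^] Suc n \<otimes> inv (y [^] Suc n) = ((x \<otimes> y) [^] n \<otimes> inv (y [^] n)) \<otimes> cj (y [^] n) x"
      using x yG by (simp add: cj_def m_assoc inv_mult_group)
    then show ?case using Suc ypow[OF x] by simp
  qed simp
  have Qq: "x [^] q = \<one>" if "x \<in> Q" for x using pow_subgroup_card[OF Q(1) that] Q(2) by simp
  \<comment> \<open>By \<open>inQ\<close> the \<open>r\<close>-th power of
    \<open>x \<otimes> y\<close> lies in \<open>Q\<close>, so the exponent \<open>r * q\<close>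
    kills \<open>x \<otimes> y\<close>. Unless \<open>q = r\<close>, its order is not
    \<open>q\<close>, because then \<open>y [^] q\<close> would lie in \<open>Q\<close> and
    \<open>y\<close> would be trivial; so it is \<open>r\<close>.\<close>
  have xy: "x \<otimes> y \<in> carrier G" "x \<otimes> y \<noteq> \<one>" "(x \<otimes> y) [^] r = \<one>" if x: "x \<in> Q" for x
  proof -
    show xyG: "x \<otimes> y \<in> carrier G" using x yG by simp
    have ne: "x \<otimes> y \<notin> Q" using x y(2) yG Q.m_closed[of "inv x" "x \<otimes> y"] by auto
    then show "x \<otimes> y \<noteq> \<one>" using Q.one_closed by metis
    have "((x \<otimes> y) [^] r) [^] q = \<one>" using inQ[OF x, of r] r Qq xyG by simp
    then have rq: "(x \<otimes> y) [^] (r * q) = \<one>" using xyG by (simp add: nat_pow_pow)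
    obtain s :: nat where s: "prime s" "(x \<otimes> y) [^] s = \<one>" using prime_exp[OF xyG] by blast
    have "s = r"
    proof (rule ccontr)
      assume sr: "s \<noteq> r"
      show False
      proof (cases "s = q")
        case True
        have "inv (y [^] q) \<in> Q" using inQ[OF x, of q] s True yG by simp
        then have "(inv (y [^] q)) [^] q = \<one>" using Qq by blast
        then have "y [^] (q * q) = \<one>" using yG by (simp add: nat_pow_inv nat_pow_pow)
        moreover have "coprime (q * q) r" using sr True q r primes_coprime by auto
        ultimately have "y = \<one>" using pow_coprime_one[OF yG _ r(2)] by blast
        then show False using y(2) by auto
      next
        case False
        then have "coprime (r * q) s" using sr q r s primes_coprime by auto
        then have "x \<otimes> y = \<one>" using pow_coprime_one[OF xyG rq s(2)] by blast
        then show False using ne by auto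
      qed
    qed
    then show "(x \<otimes> y) [^] r = \<one>" using s by simp
  qed
  have normQ: "finprod GV (\<lambda>z. cj z v) Q = \<one>" if v: "v \<in> V" for v
  proof -
    have "Q \<noteq> {\<one>}" using Q(2) q(1) by auto
    then obtain x where x: "x \<in> Q" "x \<noteq> \<one>" using Q.one_closed by blast
    note C = prime_card_pow[OF q(1) Q x]
    have "finprod GV (\<lambda>z. cj z v) ((\<lambda>i. x [^] i) ` {..<q}) = finprod GV (\<lambda>i. cj (x [^] i) v) {..<q}"
      using cyclic_prime(2)[OF q(1) _ C(2) x(2)] x v V_normal
      by (intro GV.finprod_reindex) auto
    then show ?thesis using norm_one[OF _ x(2) q(1) C(2) v] x C(1) by simp
  qed
  have "v = \<one>" if v: "v \<in> V" for v
  proof -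
    let ?f = "\<lambda>x (j::nat). cj ((x \<otimes> y) [^] j) v"
    have fV: "?f x j \<in> V" if "x \<in> Q" for x and j :: nat
      using that v xy V_normal by simp
    have "finprod GV (\<lambda>x. finprod GV (?f x) {..<r}) Q = finprod GV (\<lambda>x. \<one>) Q"
      using norm_one[OF xy(1,2) r(1) xy(3) v] by (intro GV.finprod_cong') auto
    then have "\<one> = finprod GV (\<lambda>j. finprod GV (\<lambda>x. ?f x j) Q) {..<r}"
      using GV.finprod_swap[OF finQ finite_lessThan[of r], where f = ?f] fV by (simp add: GV.finprod_one_eqI)
    also have "\<dots> = finprod GV (\<lambda>j. if j = 0 then v [^] q else \<one>\<^bsub>GV\<^esub>) {..<r}"
    proof (rule GV.finprod_cong')
      fix j assume "j \<in> {..<r}"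
      show "finprod GV (\<lambda>x. ?f x j) Q = (if j = 0 then v [^] q else \<one>\<^bsub>GV\<^esub>)"
      proof (cases "j = 0")
        case True
        then show ?thesis using GV.finprod_const[of v Q] v Q(2) by simp
      next
        case False
        let ?h = "\<lambda>x. (x \<otimes> y) [^] j \<otimes> inv (y [^] j)"
        \<comment> \<open>For a fixed exponent \<open>j\<close> prime to \<open>r\<close>, the
          \<open>j\<close>-th power determines \<open>x \<otimes> y\<close>, so \<open>?h\<close> is
          injective and permutes \<open>Q\<close>. Hence the product over \<open>x\<close> is the
          norm over all of \<open>Q\<close> of a conjugate of \<open>v\<close>, which is trivial by
          \<open>normQ\<close>.\<close>
        have "coprime j r" using False \<open>j \<in> {..<r}\<close> r
          by (metis coprime_commute dvd_imp_le lessThan_iff not_le neq0_conv prime_imp_coprime)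
        then obtain k where k: "[j * k = Suc 0] (mod r)" using cong_solve_coprime_nat by blast
        have pk: "((x \<otimes> y) [^] j) [^] k = x \<otimes> y" if "x \<in> Q" for x
          using pow_cong[OF xy(1)[OF that] xy(3)[OF that], of "j * k" "Suc 0"] k xy(1)[OF that]
          by (simp add: nat_pow_pow cong_def)
        have inj: "inj_on ?h Q"
        proof (rule inj_onI)
          fix x x' assume x: "x \<in> Q" "x' \<in> Q" and "?h x = ?h x'"
          then have "(x \<otimes> y) [^] j = (x' \<otimes> y) [^] j" using yG xy(1) by simp
          then have "x \<otimes> y = x' \<otimes> y" using pk x by metis
          then show "x = x'" using x yG by simp
        qed
        have bij: "?h ` Q = Q" using inj inQ finQ by (intro endo_inj_surj) auto
        have "finprod GV (\<lambda>x. ?f x j) Q = finprod GV (\<lambda>x. cj (?h x) (cj (y [^] j) v)) Q"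
          using v yG xy V_normal by (intro GV.finprod_cong') (auto simp: cj_cj m_assoc)
        also have "\<dots> = finprod GV (\<lambda>z. cj z (cj (y [^] j) v)) (?h ` Q)"
          using inj v yG V_normal inQ by (intro GV.finprod_reindex[symmetric]) auto
        also have "\<dots> = \<one>" unfolding bij using normQ v yG V_normal by simp
        finally show ?thesis using False by simp
      qed
    qed (use v subgroup_pow[OF V] in auto)
    also have "\<dots> = v [^] q"
      using GV.finprod_singleton[of 0 "{..<r}" "\<lambda>_. v [^] q"] r(1) v subgroup_pow[OF V]
      by (simp only: eq_commute[of 0]) (simp add: prime_gt_0_nat)
    finally have "v [^] q = \<one>" by simp
    then show ?thesis using pow_coprime_one[of v q p] V_exp[OF v] q p primes_coprime v by auto
  qed
  then show False using V_nontriv V.one_closed by blast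
qed

end

section \<open>Normal abelian \<open>p\<close>-subgroups force a normal Sylow subgroup\<close>

context fin_group
begin

lemma prime_card_ti:
  assumes "prime q" "subgroup Q G" "card Q = q" "g \<in> carrier G" "x \<in> Q" "x \<noteq> \<one>" "cj g x \<in> Q"
  shows "g \<in> normalizer G Q"
proof -
  have x: "x \<in> carrier G" using assms subgroup.mem_carrier by metis
  have "cj g ` Q = (\<lambda>i::nat. cj g x [^] i) ` {..<q}"
    by (subst prime_card_pow(1)[OF assms(1-3,5,6)]) (simp add: image_image cj_pow x assms(4))
  also have "\<dots> = Q" using prime_card_pow(1)[OF assms(1-3,7)] x assms by simp
  finally show ?thesis using assms by (simp add: normalizer_def)
qed

definition conjs :: "'a set \<Rightarrow> 'a set" where
  "conjs P = {cj g x | g x. g \<in> carrier G \<and> x \<in> P - {\<one>}}"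

lemma conjs_subset: "P \<subseteq> carrier G \<Longrightarrow> conjs P \<subseteq> carrier G - {\<one>}"
  by (auto simp: conjs_def subset_iff)

lemma conjs_cj: "P \<subseteq> carrier G \<Longrightarrow> g \<in> carrier G \<Longrightarrow> x \<in> conjs P \<Longrightarrow> cj g x \<in> conjs P"
  unfolding conjs_def by (auto simp: cj_cj subset_iff) (metis m_closed)

lemma conjs_pow:
  assumes "subgroup P G" "x \<in> conjs P" "x [^] (i::nat) \<noteq> \<one>"
  shows "x [^] i \<in> conjs P"
proof -
  obtain g y where "x = cj g y" "g \<in> carrier G" "y \<in> P" using assms by (auto simp: conjs_def)
  moreover from this have "x [^] i = cj g (y [^] i)" "y [^] i \<in> P" "y \<in> carrier G"
    using subgroup.mem_carrier[OF assms(1)] subgroup_pow[OF assms(1)] by (simp_all add: cj_pow)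
  ultimately show ?thesis using assms(3) by (auto simp: conjs_def)
qed

lemma conjs_cj_iff:
  "P \<subseteq> carrier G \<Longrightarrow> g \<in> carrier G \<Longrightarrow> x \<in> carrier G \<Longrightarrow> cj g x \<in> conjs P \<longleftrightarrow> x \<in> conjs P"
  using conjs_cj[of P g x] conjs_cj[of P "inv g" "cj g x"] by auto

end

text \<open>A subgroup of prime order \<open>r \<noteq> p\<close> is self-normalizing, so its
  conjugates cover the proportion \<open>1 - 1/r\<close>, at least half, of the group. The identity
  being left over, there is no room for a second such family: the elements outside the first one
  satisfy \<open>x [^] p = \<one>\<close>, and there are \<open>order G / q\<close> of them, just as
  many as a Sylow \<open>p\<close>-subgroup has.\<close>

lemma (in epo_module) normal_sylow:
  "\<exists>P. syl G p P \<and> normalizer G P = carrier G \<and> (\<forall>x\<in>carrier G. x [^] p = \<one> \<longrightarrow> x \<in> P) \<and>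
    (order G = card P \<or> (\<exists>q. prime q \<and> q \<noteq> p \<and> order G = card P * q))"
proof (cases "\<exists>q. prime q \<and> q \<noteq> p \<and> q dvd order G")
  case False
  then obtain n where n: "order G = p ^ n"
    using prime_power_if_only_prime[of "order G" p] order_pos p by auto
  then have "syl G p (carrier G)" using subgroup_self p by (auto simp: syl_def order_def prime_elem_multiplicity_power_distrib)
  moreover have "normalizer G (carrier G) = carrier G"
    using subgroup_in_normalizer[OF subgroup_self] normalizer_subset by blast
  ultimately show ?thesis by (auto simp: order_def)
next
  case True
  then obtain q where q: "prime q" "q \<noteq> p" "q dvd order G" by blast
  have count: "card (conjs Q) * r = order G * (r - 1)"
    if "prime r" "r \<noteq> p" "subgroup Q G" "card Q = r" for r Q
    using ti_count[OF that(3) prime_card_ti[OF that(1,3,4)]]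
      prime_subgroup_self_normalizing[OF that] that by (simp add: conjs_def)
  obtain x where x: "x \<in> carrier G" "x \<noteq> \<one>" "x [^] q = \<one>" using cauchy[OF q(1,3)] by blast
  define Q where "Q = (\<lambda>i::nat. x [^] i) ` {..<q}"
  have Q: "subgroup Q G" "card Q = q" using cyclic_prime[OF q(1) x(1,3,2)] by (simp_all add: Q_def)
  define A where "A = conjs Q"
  have A: "card A * q = order G * (q - 1)" using count[OF q(1,2) Q] by (simp add: A_def)
  have AG: "A \<subseteq> carrier G - {\<one>}" using conjs_subset[OF subgroup.subset[OF Q(1)]] by (simp add: A_def)
  have finA: "finite A" using AG fin_subset by blast
  have Aq: "z [^] q = \<one>" if z: "z \<in> A" for z
  proof -
    obtain g w where "z = cj g w" "g \<in> carrier G" "w \<in> Q" using z by (auto simp: A_def conjs_def)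
    then show ?thesis using pow_subgroup_card[OF Q(1), of w] Q subgroup.mem_carrier[OF Q(1)]
      by (simp flip: cj_pow)
  qed
  have rest: "z [^] p = \<one>" if z: "z \<in> carrier G" "z \<notin> A" for z
  proof (rule ccontr)
    assume zp: "z [^] p \<noteq> \<one>"
    obtain r :: nat where r: "prime r" "z [^] r = \<one>" using prime_exp z by blast
    have rp: "r \<noteq> p" and z1: "z \<noteq> \<one>" using zp r by auto
    define R where "R = (\<lambda>i::nat. z [^] i) ` {..<r}"
    have R: "subgroup R G" "card R = r" using cyclic_prime[OF r(1) z(1) r(2) z1] by (simp_all add: R_def)
    have zR: "z \<in> R" using r z prime_gt_1_nat[of r] by (auto simp: R_def intro!: image_eqI[of _ _ 1])
    have B: "card (conjs R) * r = order G * (r - 1)" using count[OF r(1) rp R] .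
    have BG: "conjs R \<subseteq> carrier G - {\<one>}" using conjs_subset[OF subgroup.subset[OF R(1)]] .
    have disj: "A \<inter> conjs R = {}"
    proof (rule ccontr)
      assume "A \<inter> conjs R \<noteq> {}"
      then obtain g u where u: "g \<in> carrier G" "u \<in> R" "u \<noteq> \<one>" "cj g u \<in> A" by (auto simp: conjs_def)
      have "u \<in> carrier G" using u subgroup.mem_carrier[OF R(1)] by blast
      then have uA: "u \<in> A" using conjs_cj_iff[OF subgroup.subset[OF Q(1)] u(1)] u(4) by (simp add: A_def)
      obtain i :: nat where i: "z = u [^] i" using prime_card_pow(1)[OF r(1) R u(2,3)] zR by blast
      then have "z \<in> A" using conjs_pow[OF Q(1), of u i] uA z1 by (simp add: A_def)
      then show False using z by blast
    qed
    have "card A + card (conjs R) = card (A \<union> conjs R)"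
      using disj finA BG fin_subset by (intro card_Un_disjoint[symmetric]) blast+
    also have "\<dots> \<le> card (carrier G - {\<one>})" using AG BG by (intro card_mono) auto
    finally have le: "card A + card (conjs R) < order G" using order_pos by (simp add: order_def)
    have half: "order G \<le> 2 * c" if "c * r = order G * (r - 1)" "r \<ge> 2" for c r :: nat
    proof -
      have "order G * r \<le> order G * (2 * (r - 1))" using that(2) by (intro mult_left_mono) auto
      also have "\<dots> = 2 * c * r" using that(1) by simp
      finally show ?thesis using that(2) by simp
    qed
    show False using half[OF A prime_ge_2_nat[OF q(1)]] half[OF B prime_ge_2_nat[OF r(1)]] le by simp
  qed
  obtain P where P: "syl G p P" using syl_ex[OF p] by blast
  have sP: "subgroup P G" using P by (simp add: syl_def)
  have PA: "P \<subseteq> carrier G - A"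
  proof
    fix z assume z: "z \<in> P"
    have "z [^] p = \<one>" "z \<in> carrier G" using psub_exp[OF p syl_psub[OF P] z] subgroup.mem_carrier[OF sP z] by auto
    moreover have "z \<noteq> \<one>" if "z \<in> A" using that AG by blast
    ultimately show "z \<in> carrier G - A" using Aq[of z] pow_coprime_one[of z p q] primes_coprime[OF p q(1)] q by blast
  qed
  have cardA: "card (carrier G - A) * q = order G"
  proof -
    have "card (carrier G - A) + card A = order G"
      using AG finA card_mono[OF fin, of A] subset_trans[OF AG, of "carrier G"] by (subst card_Diff_subset) (auto simp: order_def)
    then have "card (carrier G - A) * q + card A * q = order G * q" by (metis distrib_right)
    moreover have "order G * (q - 1) + order G = order G * q" using q(1) prime_gt_0_nat[of q]
      by (metis add.commute add_mult_distrib2 less_iff_Suc_add mult.right_neutral add_diff_cancel_left' plus_1_eq_Suc add_0)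
    ultimately show ?thesis using A by simp
  qed
  obtain k where k: "order G = p ^ multiplicity p (order G) * k" "\<not> p dvd k"
    using multiplicity_decompose'[of "order G" p] order_pos p not_prime_unit by (metis less_numeral_extra(3))
  have "\<exists>c. k = q ^ c"
  proof (rule prime_power_if_only_prime)
    show "k > 0" using k order_pos by (cases k) auto
    show "r = q" if r: "prime r" "r dvd k" for r
    proof (rule ccontr)
      assume rq: "r \<noteq> q"
      obtain z where z: "z \<in> carrier G" "z \<noteq> \<one>" "z [^] r = \<one>"
        using cauchy[of r] r k(1) by (metis dvd_mult)
      have "r \<noteq> p" using r k by auto
      then show False using rest[OF z(1)] Aq[of z] pow_coprime_one[of z r] z r rq q p primes_coprime by metis
    qed
  qed (use q in auto)
  then obtain c where c: "k = q ^ c" by blast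
  have "c \<noteq> 0"
  proof
    assume "c = 0"
    then have "q dvd p ^ multiplicity p (order G)" using k c q by simp
    then show False using q p by (metis prime_dvd_power primes_dvd_imp_eq)
  qed
  \<comment> \<open>A subgroup of order \<open>q\<close> in a larger \<open>q\<close>-group is
    normalized by an element outside it, so a subgroup of order \<open>q ^ c\<close> with
    \<open>c\<close> above 1 contradicts self-normalization.\<close>
  have "c = 1"
  proof (rule ccontr)
    assume "c \<noteq> 1"
    then have c2: "c \<ge> 2" using \<open>c \<noteq> 0\<close> by simp
    obtain R where R: "subgroup R G" "card R = q ^ c"
      using sylow_thm[OF q(1) is_group, of c "p ^ multiplicity p (order G)"] k c by (auto simp: mult.commute)
    have "q dvd card R" using R \<open>c \<noteq> 0\<close> by simp
    then obtain y where y: "y \<in> R" "y \<noteq> \<one>" "y [^] q = \<one>" using cauchy_subgroup[OF q(1) R(1)] by blast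
    define Q' where "Q' = (\<lambda>i::nat. y [^] i) ` {..<q}"
    have yG: "y \<in> carrier G" using subgroup.mem_carrier[OF R(1)] y by blast
    have Q': "subgroup Q' G" "card Q' = q" using cyclic_prime[OF q(1) yG y(3,2)] by (simp_all add: Q'_def)
    have "Q' \<subseteq> R" using subgroup_pow[OF R(1)] y by (auto simp: Q'_def)
    moreover have "Q' \<noteq> R"
      using R Q' c2 prime_gt_1_nat[OF q(1)] power_inject_exp[of q c 1] by auto
    ultimately obtain w where "w \<in> R - Q'" "w \<in> normalizer G Q'"
      using psub_normalizer_grows[OF q(1) _ Q'(1), of R] R by (auto simp: psub_def)
    then show False using prime_subgroup_self_normalizing[OF q(1,2) Q'] by blast
  qed
  then have og: "order G = card P * q" using k c P by (simp add: syl_def)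
  have "card (carrier G - A) = card P" using og cardA q(1) by (simp add: prime_gt_0_nat)
  then have PAeq: "P = carrier G - A" using PA by (intro card_subset_eq) auto
  have "g \<in> normalizer G P" if "g \<in> carrier G" for g
    using that sP subgroup.subset[OF sP] PAeq conjs_cj_iff[OF subgroup.subset[OF Q(1)] that]
    by (intro normalizerI) (auto simp: A_def)
  then have "normalizer G P = carrier G" using normalizer_subset by blast
  moreover have "x \<in> P" if "x \<in> carrier G" "x [^] p = \<one>" for x
    using that PAeq Aq[of x] AG pow_coprime_one[of x p q] primes_coprime[OF p q(1)] q by blast
  ultimately show ?thesis using P og q by blast
qed

section \<open>Normalizers of \<open>p\<close>-subgroups and trivial intersection\<close>

lemma (in group) normalizer_carrier:
  assumes "subgroup U G" "H \<subseteq> U"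
  shows "normalizer (G\<lparr>carrier := U\<rparr>) H = U \<inter> normalizer G H"
proof -
  have "cj\<^bsub>G\<lparr>carrier := U\<rparr>\<^esub> y = cj y" if "y \<in> U" for y
    using that assms by (auto simp: cj_def)
  then show ?thesis using subgroup.subset[OF assms(1)] by (auto simp: normalizer_def)
qed

context epo
begin

text \<open>The center \<open>Z\<close> of \<open>V\<close> is nontrivial, abelian and again normal
  in the group, so the module argument applies to \<open>Z\<close> in place of
  \<open>V\<close>.\<close>

lemma normal_psub_structure:
  assumes p: "prime p" and V: "psub G p V" "V \<noteq> {\<one>}" "normalizer G V = carrier G"
  shows "\<exists>P. syl G p P \<and> normalizer G P = carrier G \<and> P = {x \<in> carrier G. x [^] p = \<one>} \<and>
    (order G = card P \<or> (\<exists>q. prime q \<and> q \<noteq> p \<and> order G = card P * q))"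
proof -
  interpret V: subgroup V G using V(1) by (simp add: psub_def)
  define Z where "Z = {z \<in> V. \<forall>v\<in>V. cj v z = z}"
  have cjV: "cj y v \<in> V" if "y \<in> carrier G" "v \<in> V" for y v
    using that V(3) normalizer_cj by blast
  have sub: "subgroup Z G"
    by (rule subgroupI) (auto simp: Z_def cj_inv cj_mult intro: exI[of _ \<one>])
  have comm: "u \<otimes> v = v \<otimes> u" if "u \<in> Z" "v \<in> Z" for u v
    using that cj_id_iff[of u v] by (auto simp: Z_def)
  have nrm: "cj y v \<in> Z" if y: "y \<in> carrier G" and v: "v \<in> Z" for y v
  proof -
    have "cj u (cj y v) = cj y v" if u: "u \<in> V" for u
    proof -
      have "u \<otimes> y = y \<otimes> cj (inv y) u" using u y by (simp add: cj_def m_assoc)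
      then have "cj u (cj y v) = cj y (cj (cj (inv y) u) v)"
        using u y v by (simp add: cj_cj Z_def)
      then show ?thesis using cjV[of "inv y" u] u y v by (simp add: Z_def)
    qed
    then show ?thesis using cjV y v by (simp add: Z_def)
  qed
  have ntriv: "Z \<noteq> {\<one>}" using psub_center[OF p V(1,2)] by (auto simp: Z_def)
  have Zexp: "v [^] p = \<one>" if "v \<in> Z" for v using psub_exp[OF p V(1), of v] that by (simp add: Z_def)
  interpret epo_module G Z p
    by (intro epo_module.intro epo_axioms epo_module_axioms.intro sub p comm Zexp nrm ntriv)
  obtain P where P: "syl G p P" "normalizer G P = carrier G" "\<forall>x\<in>carrier G. x [^] p = \<one> \<longrightarrow> x \<in> P"
    "order G = card P \<or> (\<exists>q. prime q \<and> q \<noteq> p \<and> order G = card P * q)"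
    using normal_sylow by blast
  then have "P = {x \<in> carrier G. x [^] p = \<one>}"
    using psub_exp[OF p syl_psub[OF P(1)]] subgroup.subset[of P G] unfolding syl_def by blast
  with P show ?thesis by blast
qed

lemma local_structure:
  assumes p: "prime p" and V: "psub G p V" "V \<noteq> {\<one>}"
  shows "\<exists>P. psub G p P \<and> P = {x \<in> normalizer G V. x [^] p = \<one>} \<and>
    (card (normalizer G V) = card P \<or> (\<exists>q. prime q \<and> q \<noteq> p \<and> card (normalizer G V) = card P * q))"
proof -
  let ?U = "normalizer G V"
  have sV: "subgroup V G" using V by (simp add: psub_def)
  have U: "subgroup ?U G" using normalizer_subgroup[OF subgroup.subset[OF sV]] .
  interpret U: epo "G\<lparr>carrier := ?U\<rparr>" using epo_subgroup[OF U] .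
  have "psub (G\<lparr>carrier := ?U\<rparr>) p V"
    using V(1) subgroup_incl[OF sV U subgroup_in_normalizer[OF sV]] by (simp add: psub_def)
  moreover have "normalizer (G\<lparr>carrier := ?U\<rparr>) V = ?U"
    using normalizer_carrier[OF U subgroup_in_normalizer[OF sV]] by simp
  ultimately obtain P where "syl (G\<lparr>carrier := ?U\<rparr>) p P" "P = {x \<in> ?U. x [^] p = \<one>}"
    "card ?U = card P \<or> (\<exists>q. prime q \<and> q \<noteq> p \<and> card ?U = card P * q)"
    using U.normal_psub_structure[OF p, of V] V(2) by (auto simp: order_def)
  moreover from this have "psub G p P"
    using incl_subgroup[OF U, of P] by (auto simp: syl_def psub_def)
  ultimately show ?thesis by blast
qed

text \<open>Take a nontrivial intersection \<open>D\<close> of two Sylow subgroups that is as large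
  as possible. The solutions of \<open>x [^] p = \<one>\<close> in the normalizer of
  \<open>D\<close> form a \<open>p\<close>-group, contained in a Sylow subgroup \<open>S\<close>. A
  Sylow subgroup \<open>T\<close> above \<open>D\<close> contributes to it an element outside
  \<open>D\<close>, so \<open>S \<inter> T\<close> is larger than \<open>D\<close> and maximality
  gives \<open>S = T\<close>; this holds for both members of the pair.\<close>

lemma syl_ti:
  assumes p: "prime p" and "syl G p P" "syl G p R" "P \<inter> R \<noteq> {\<one>}"
  shows "P = R"
proof (rule ccontr)
  assume "P \<noteq> R"
  define B where "B n \<longleftrightarrow> (\<exists>P R. syl G p P \<and> syl G p R \<and> P \<noteq> R \<and> P \<inter> R \<noteq> {\<one>} \<and> card (P \<inter> R) = n)" for n
  have "B (card (P \<inter> R))" using assms \<open>P \<noteq> R\<close> by (auto simp: B_def)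
  moreover have "n \<le> order G" if "B n" for n
    using that by (auto simp: B_def syl_def order_def dest!: subgroup.subset intro!: card_mono)
  ultimately obtain n where n: "B n" "\<And>m. B m \<Longrightarrow> m \<le> n"
    using Nat.ex_has_greatest_nat[of B "card (P \<inter> R)" "order G"] by blast
  then obtain P R where PR: "syl G p P" "syl G p R" "P \<noteq> R" "P \<inter> R \<noteq> {\<one>}" "card (P \<inter> R) = n"
    by (auto simp: B_def)
  define D where "D = P \<inter> R"
  have sPR: "subgroup P G" "subgroup R G" using PR by (simp_all add: syl_def)
  then have sD: "subgroup D G" unfolding D_def by (rule subgroups_Inter_pair)
  have DPR: "D \<subset> P" "D \<subset> R"
    using PR syl_maximal[OF p PR(1) syl_psub[OF PR(2)]] syl_maximal[OF p PR(2) syl_psub[OF PR(1)]]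
    by (auto simp: D_def)
  have D: "psub G p D"
    by (rule exp_psub[OF sD p]) (use psub_exp[OF p syl_psub[OF PR(1)]] in \<open>simp add: D_def\<close>)
  obtain M where M: "psub G p M" "M = {x \<in> normalizer G D. x [^] p = \<one>}"
    using local_structure[OF p D] PR(4) D_def by blast
  obtain S where S: "syl G p S" "M \<subseteq> S" using psub_in_syl[OF p M(1)] by blast
  have "S = T" if T: "syl G p T" "D \<subset> T" for T
  proof (rule ccontr)
    assume ST: "S \<noteq> T"
    have sT: "subgroup T G" using T by (simp add: syl_def)
    obtain y where y: "y \<in> T" "y \<notin> D" "y \<in> normalizer G D"
      using psub_normalizer_grows[OF p syl_psub[OF T(1)] sD T(2)] by blast
    have "y \<in> S" using y S(2) M(2) psub_exp[OF p syl_psub[OF T(1)] y(1)] by blast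
    moreover have "D \<subseteq> S"
      using S(2) M(2) subgroup_in_normalizer[OF sD] psub_exp[OF p D] by blast
    ultimately have sub: "insert y D \<subseteq> S \<inter> T" using y T by auto
    have "y \<noteq> \<one>" using y(2) subgroup.one_closed[OF sD] by metis
    then have "S \<inter> T \<noteq> {\<one>}" using sub by blast
    then have "B (card (S \<inter> T))" unfolding B_def using S(1) T(1) ST by blast
    then have "card (S \<inter> T) \<le> card D" using n PR by (simp add: D_def)
    moreover have "card (insert y D) \<le> card (S \<inter> T)"
      using sub fin_subgroup[OF sT] by (intro card_mono) auto
    ultimately show False using y(2) fin_subgroup[OF sD] by simp
  qed
  then show False using PR(1,2,3) DPR by blast
qed

lemma syl_normalizer:
  assumes p: "prime p" and P: "syl G p P" "P \<noteq> {\<one>}"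
  obtains n where "card (normalizer G P) = card P * n" "n = 1 \<or> prime n \<and> n \<noteq> p"
    "\<And>x. x \<in> normalizer G P \<Longrightarrow> x [^] p = \<one> \<Longrightarrow> x \<in> P"
proof -
  obtain M where M: "psub G p M" "M = {x \<in> normalizer G P. x [^] p = \<one>}"
    "card (normalizer G P) = card M \<or> (\<exists>q. prime q \<and> q \<noteq> p \<and> card (normalizer G P) = card M * q)"
    using local_structure[OF p syl_psub[OF P(1)] P(2)] by blast
  have "P \<subseteq> M"
    using P psub_exp[OF p syl_psub[OF P(1)]] subgroup_in_normalizer[of P] M(2) unfolding syl_def by blast
  then have "M = P" using syl_maximal[OF p P(1) M(1)] by blast
  then have mem: "x \<in> P" if "x \<in> normalizer G P" "x [^] p = \<one>" for x using that M(2) by blast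
  show thesis
  proof (cases "card (normalizer G P) = card P")
    case True
    then show thesis using that[of 1] mem by simp
  next
    case False
    then obtain q where "prime q" "q \<noteq> p" "card (normalizer G P) = card P * q"
      using M(3) \<open>M = P\<close> by auto
    then show thesis using that[of q] mem by simp
  qed
qed

lemma syl_ti_normalizer:
  assumes p: "prime p" and P: "syl G p P"
    and g: "g \<in> carrier G" "x \<in> P" "x \<noteq> \<one>" "cj g x \<in> P"
  shows "g \<in> normalizer G P"
proof -
  have "x \<in> carrier G" using subgroup.mem_carrier[of P G x] P g(2) by (simp add: syl_def)
  then have "cj g x \<noteq> \<one>" using g by simp
  then have "cj g ` P \<inter> P \<noteq> {\<one>}" using g by blast
  then have "cj g ` P = P" by (rule syl_ti[OF p syl_cj[OF g(1) P] P])
  then show ?thesis using g by (simp add: normalizer_def)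
qed

end

section \<open>Sylow orders, normalizer indices and class sizes\<close>

context fin_group
begin

lemma normalizer_conj:
  assumes P: "P \<subseteq> carrier G" and g: "g \<in> carrier G"
  shows "normalizer G (cj g ` P) = cj g ` normalizer G P"
proof -
  have sub: "cj h ` normalizer G P \<subseteq> normalizer G (cj h ` P)"
    if P: "P \<subseteq> carrier G" and h: "h \<in> carrier G" for h P
  proof clarify
    fix y assume y: "y \<in> normalizer G P"
    then have yG: "y \<in> carrier G" "cj y ` P = P" by (auto simp: normalizer_def)
    have "cj (cj h y) ` cj h ` P = cj (cj h y \<otimes> h) ` P" using yG h P by (simp add: cj_image_cj)
    also have "cj h y \<otimes> h = h \<otimes> y" using yG h by (simp add: cj_def m_assoc)
    also have "cj (h \<otimes> y) ` P = cj h ` cj y ` P" using yG(1) h P by (simp add: cj_image_cj)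
    finally show "cj h y \<in> normalizer G (cj h ` P)" using yG h by (simp add: normalizer_def)
  qed
  show ?thesis
  proof
    have P': "cj g ` P \<subseteq> carrier G" using P g by auto
    have "cj (inv g) ` normalizer G (cj g ` P) \<subseteq> normalizer G P"
      using sub[OF P', of "inv g"] g P by (simp add: cj_image_cj cj_image_one)
    then have "cj g ` cj (inv g) ` normalizer G (cj g ` P) \<subseteq> cj g ` normalizer G P" by blast
    then show "normalizer G (cj g ` P) \<subseteq> cj g ` normalizer G P"
      using g normalizer_subset by (simp add: cj_image_cj cj_image_one)
  qed (rule sub[OF P g])
qed

lemma card_normalizer_conj:
  "P \<subseteq> carrier G \<Longrightarrow> g \<in> carrier G \<Longrightarrow> card (normalizer G (cj g ` P)) = card (normalizer G P)"
  by (simp add: normalizer_conj cj_image_card normalizer_subset)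

definition sylp :: "nat \<Rightarrow> 'a set" where "sylp p = (SOME P. syl G p P)"

definition sp :: "nat \<Rightarrow> nat" where "sp p = card (sylp p)"

text \<open>The index of a Sylow \<open>p\<close>-subgroup in its normalizer, the
  \<open>n\<^sub>p\<close> of the overview; the division is exact by Lagrange's theorem.\<close>

definition np :: "nat \<Rightarrow> nat" where "np p = card (normalizer G (sylp p)) div sp p"

text \<open>For a prime \<open>p\<close> and a group whose elements have prime order, these are all
  nontrivial \<open>p\<close>-elements, in general several conjugacy classes.\<close>

definition cls :: "nat \<Rightarrow> 'a set" where "cls p = {x \<in> carrier G. x \<noteq> \<one> \<and> x [^] p = \<one>}"

definition primes :: "nat set" where "primes = prime_factors (order G)"

lemma primes_iff: "p \<in> primes \<longleftrightarrow> prime p \<and> p dvd order G"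
  using order_pos by (auto simp: primes_def in_prime_factors_iff)

lemma finite_primes [simp]: "finite primes"
  by (simp add: primes_def)

lemma sylp: "prime p \<Longrightarrow> syl G p (sylp p)"
  unfolding sylp_def by (rule someI_ex) (rule syl_ex)

lemma sp_eq: "prime p \<Longrightarrow> sp p = p ^ multiplicity p (order G)"
  using sylp[of p] by (simp add: sp_def syl_def)

lemma syl_card: "prime p \<Longrightarrow> syl G p P \<Longrightarrow> card P = sp p"
  by (simp add: sp_eq syl_def)

lemma sp_power: "p \<in> primes \<Longrightarrow> \<exists>n>0. sp p = p ^ n"
  using order_pos by (auto simp: primes_iff sp_eq prime_multiplicity_gt_zero_iff
      intro!: exI[of _ "multiplicity p (order G)"])

lemma sp_ge: "p \<in> primes \<Longrightarrow> p \<le> sp p"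
  using sp_power[of p] by (auto simp: primes_iff intro!: self_le_power prime_ge_1_nat)

lemma sp_dvd: "prime p \<Longrightarrow> sp p dvd order G"
  by (simp add: sp_eq multiplicity_dvd)

lemma coprime_sp: "p \<in> primes \<Longrightarrow> q \<in> primes \<Longrightarrow> p \<noteq> q \<Longrightarrow> coprime (sp p) (sp q)"
  by (auto simp: primes_iff sp_eq primes_coprime)

lemma sylp_nontrivial: "p \<in> primes \<Longrightarrow> syl G p P \<Longrightarrow> P \<noteq> {\<one>}"
  using syl_card[of p P] sp_ge[of p] prime_ge_2_nat[of p] by (auto simp: primes_iff)

end

context epo
begin

lemma card_normalizer_syl:
  assumes p: "p \<in> primes" and P: "syl G p P"
  shows "card (normalizer G P) = sp p * np p"
proof -
  have pp: "prime p" using p by (simp add: primes_iff)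
  have Q: "syl G p (sylp p)" using sylp[OF pp] .
  obtain n where n: "card (normalizer G (sylp p)) = card (sylp p) * n"
    using syl_normalizer[OF pp Q sylp_nontrivial[OF p Q]] by metis
  then have "card (normalizer G (sylp p)) = sp p * np p"
    using sp_ge[OF p] prime_gt_0_nat[OF pp] by (simp add: np_def sp_def)
  moreover obtain g where "g \<in> carrier G" "P = cj g ` sylp p" using syl_conj[OF pp Q P] by blast
  ultimately show ?thesis using Q by (simp add: card_normalizer_conj syl_def subgroup.subset)
qed

lemma np_cases: "p \<in> primes \<Longrightarrow> np p = 1 \<or> prime (np p) \<and> np p \<noteq> p"
proof -
  assume p: "p \<in> primes"
  then have pp: "prime p" by (simp add: primes_iff)
  obtain n where "card (normalizer G (sylp p)) = card (sylp p) * n" "n = 1 \<or> prime n \<and> n \<noteq> p"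
    using syl_normalizer[OF pp sylp[OF pp] sylp_nontrivial[OF p sylp[OF pp]]] by metis
  moreover from this have "np p = n"
    using card_normalizer_syl[OF p sylp[OF pp]] sp_ge[OF p] prime_gt_0_nat[OF pp] by (simp add: sp_def)
  ultimately show ?thesis by simp
qed

lemma np_pos: "p \<in> primes \<Longrightarrow> 0 < np p"
  using np_cases[of p] prime_gt_0_nat by fastforce

lemma normalizer_p_element:
  assumes "p \<in> primes" "syl G p P" "x \<in> normalizer G P" "x [^] p = \<one>"
  shows "x \<in> P"
  using assms syl_normalizer[of p P] sylp_nontrivial[of p P] by (metis primes_iff)

lemma syl_exp: "p \<in> primes \<Longrightarrow> syl G p P \<Longrightarrow> x \<in> P \<Longrightarrow> x [^] p = \<one>"
  using psub_exp syl_psub by (simp add: primes_iff) blast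

lemma cls_in_syl:
  assumes "p \<in> primes" "x \<in> cls p"
  obtains P where "syl G p P" "x \<in> P"
proof -
  have p: "prime p" and x: "x \<in> carrier G" "x \<noteq> \<one>" "x [^] p = \<one>"
    using assms by (simp_all add: primes_iff cls_def)
  have "psub G p ((\<lambda>i::nat. x [^] i) ` {..<p})"
    using cyclic_prime[OF p x(1,3,2)] by (auto simp: psub_def intro: exI[of _ 1])
  moreover have "x \<in> (\<lambda>i::nat. x [^] i) ` {..<p}"
    using x prime_gt_1_nat[OF p] by (auto intro!: image_eqI[of _ _ 1])
  ultimately show ?thesis using psub_in_syl[OF p] that by blast
qed

lemma cls_eq_conjs: "p \<in> primes \<Longrightarrow> syl G p P \<Longrightarrow> cls p = conjs P"
proof
  assume p: "p \<in> primes" and P: "syl G p P"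
  have sP: "subgroup P G" using P by (simp add: syl_def)
  show "cls p \<subseteq> conjs P"
  proof
    fix x assume x: "x \<in> cls p"
    then obtain R where R: "syl G p R" "x \<in> R" using cls_in_syl[OF p] by blast
    then obtain g where g: "g \<in> carrier G" "R = cj g ` P" using syl_conj[of p P R] p P by (auto simp: primes_iff)
    then obtain y where "y \<in> P" "x = cj g y" using R by blast
    then show "x \<in> conjs P" using x g subgroup.mem_carrier[OF sP] by (auto simp: conjs_def cls_def)
  qed
  show "conjs P \<subseteq> cls p"
    using syl_exp[OF p P] subgroup.mem_carrier[OF sP] by (auto simp: conjs_def cls_def simp flip: cj_pow)
qed

lemma card_cls: "p \<in> primes \<Longrightarrow> card (cls p) * (sp p * np p) = order G * (sp p - 1)"
proof -
  assume p: "p \<in> primes"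
  then have pp: "prime p" by (simp add: primes_iff)
  note P = sylp[OF pp]
  show ?thesis
    using ti_count[of "sylp p"] syl_ti_normalizer[OF pp P] P cls_eq_conjs[OF p P]
      card_normalizer_syl[OF p P] syl_card[OF pp P]
    by (simp add: syl_def conjs_def)
qed

lemma cls_disjoint: "p \<in> primes \<Longrightarrow> q \<in> primes \<Longrightarrow> p \<noteq> q \<Longrightarrow> cls p \<inter> cls q = {}"
  using pow_coprime_one[of _ p q] by (auto simp: cls_def primes_iff primes_coprime)

lemma cls_cover: "carrier G - {\<one>} = (\<Union>p\<in>primes. cls p)"
proof
  show "carrier G - {\<one>} \<subseteq> (\<Union>p\<in>primes. cls p)"
  proof
    fix x assume x: "x \<in> carrier G - {\<one>}"
    then obtain p :: nat where p: "prime p" "x [^] p = \<one>" using prime_exp by blast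
    have "p dvd order G"
      using cyclic_prime(1,3)[OF p(1) _ p(2)] subgroup_order_dvd x by fastforce
    then show "x \<in> (\<Union>p\<in>primes. cls p)" using p x by (auto simp: cls_def primes_iff)
  qed
qed (auto simp: cls_def)

lemma finite_cls [simp]: "finite (cls p)"
  by (rule fin_subset) (auto simp: cls_def)

lemma card_cls_real:
  assumes "p \<in> primes"
  shows "real (card (cls p)) / order G = (1 - 1 / sp p) / np p"
proof -
  have "1 \<le> sp p" using sp_ge[OF assms] assms prime_ge_1_nat[of p] by (auto simp: primes_iff intro: order_trans)
  moreover have "real (card (cls p) * (sp p * np p)) = real (order G * (sp p - 1))"
    using card_cls[OF assms] by simp
  ultimately show ?thesis using order_pos np_pos[OF assms] by (simp add: field_simps of_nat_diff)
qed

text \<open>The sets \<open>cls p\<close> partition the nontrivial elements, and by trivial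
  intersection \<open>cls p\<close> takes up the proportion \<open>(1 - 1 / sp p) / np p\<close> of
  the group.\<close>

lemma mass: "(\<Sum>p\<in>primes. (1 - 1 / real (sp p)) / np p) = 1 - 1 / order G"
proof -
  have "real (card (carrier G - {\<one>})) = (\<Sum>p\<in>primes. real (card (cls p)))"
    unfolding cls_cover by (subst card_UN_disjoint) (use cls_disjoint in auto)
  also have "card (carrier G - {\<one>}) = order G - 1" by (simp add: order_def)
  finally have "real (order G) - 1 = (\<Sum>p\<in>primes. real (card (cls p)))" using order_pos by (simp add: of_nat_diff)
  then have "(real (order G) - 1) / order G = (\<Sum>p\<in>primes. real (card (cls p)) / order G)"
    by (simp add: sum_divide_distrib)
  then show ?thesis using order_pos card_cls_real by (simp add: diff_divide_distrib)
qed

lemma mass_le: "A \<subseteq> primes \<Longrightarrow> (\<Sum>p\<in>A. (1 - 1 / real (sp p)) / np p) \<le> 1 - 1 / order G"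
  unfolding mass[symmetric]
proof (rule sum_mono2)
  show "0 \<le> (1 - 1 / real (sp b)) / real (np b)" for b by (cases "sp b = 0") auto
qed auto

lemma no_fixed_points:
  assumes p: "p \<in> primes" "syl G p P" and y: "y \<in> normalizer G P" "y \<notin> P" and x: "x \<in> P" "cj y x = x"
  shows "x = \<one>"
proof -
  have sP: "subgroup P G" using p by (simp add: syl_def)
  have yG: "y \<in> carrier G" using y normalizer_subset by blast
  then obtain q :: nat where q: "prime q" "y [^] q = \<one>" using prime_exp by blast
  have qp: "q \<noteq> p" using q y normalizer_p_element[OF p y(1)] by blast
  have "y \<noteq> \<one>" using y(2) subgroup.one_closed[OF sP] by metis
  moreover have xG: "x \<in> carrier G" using subgroup.mem_carrier[OF sP x(1)] .
  moreover have "prime p" using p(1) by (simp add: primes_iff)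
  then have "y = \<one> \<or> x = \<one>"
    by (rule commute_coprime_one[OF q(1) _ qp yG xG q(2) syl_exp[OF p x(1)]])
      (use cj_id_iff[OF yG xG] x(2) in simp)
  ultimately show ?thesis by simp
qed

text \<open>An element of order \<open>np p\<close> in the normalizer fixes only the identity of
  \<open>P\<close>, since nontrivial elements of different prime orders do not commute; counting
  fixed points gives \<open>sp p\<close> congruent to 1.\<close>

lemma np_dvd:
  assumes p: "p \<in> primes" and "np p \<noteq> 1"
  shows "np p dvd sp p - 1"
proof -
  have pp: "prime p" using p by (simp add: primes_iff)
  have q: "prime (np p)" "np p \<noteq> p" using assms np_cases by auto
  define P where "P = sylp p"
  have P: "syl G p P" using sylp[OF pp] by (simp add: P_def)
  have sP: "subgroup P G" using P by (simp add: syl_def)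
  have N: "subgroup (normalizer G P) G" using normalizer_subgroup[OF subgroup.subset[OF sP]] .
  have "np p dvd card (normalizer G P)" using card_normalizer_syl[OF p P] by simp
  then obtain y where y: "y \<in> normalizer G P" "y \<noteq> \<one>" "y [^] np p = \<one>"
    using cauchy_subgroup[OF q(1) N] by blast
  have yG: "y \<in> carrier G" using y normalizer_subset by blast
  have yP: "y \<notin> P"
    using pow_coprime_one[OF yG y(3), of p] y(2) syl_exp[OF p P, of y] primes_coprime[OF q(1) pp q(2)] by blast
  define Y where "Y = (\<lambda>i::nat. y [^] i) ` {..<np p}"
  have Y: "subgroup Y G" "card Y = np p ^ 1"
    using cyclic_prime[OF q(1) yG y(3,2)] by (simp_all add: Y_def)
  have YN: "h \<in> normalizer G P" if "h \<in> Y" for h using that subgroup_pow[OF N y(1)] by (auto simp: Y_def)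
  have YG: "h \<in> carrier G" if "h \<in> Y" for h using YN[OF that] normalizer_subset by blast
  have yY: "y \<in> Y" using yG prime_gt_1_nat[OF q(1)] by (auto simp: Y_def intro!: image_eqI[of _ _ 1])
  have "[card P = card {x \<in> P. \<forall>h\<in>Y. cj h x = x}] (mod np p)"
  proof (rule p_group_fixed_points[OF Y q(1)])
    show "cj h x \<in> P" if "h \<in> Y" "x \<in> P" for h x using YN that normalizer_cj by blast
  qed (use fin_subgroup[OF sP] YG subgroup.mem_carrier[OF sP] in \<open>simp_all add: cj_cj\<close>)
  also have "{x \<in> P. \<forall>h\<in>Y. cj h x = x} = {\<one>}"
  proof (rule equalityI; rule subsetI)
    fix x assume "x \<in> {x \<in> P. \<forall>h\<in>Y. cj h x = x}"
    then have "x \<in> P" "cj y x = x" using yY by blast+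
    then show "x \<in> {\<one>}" using no_fixed_points[OF p P y(1) yP] by blast
  next
    fix x assume "x \<in> {\<one>}"
    then show "x \<in> {x \<in> P. \<forall>h\<in>Y. cj h x = x}" using YG subgroup.one_closed[OF sP] cj_one(1) by blast
  qed
  finally have "[sp p = 1] (mod np p)" using syl_card[OF pp P] by simp
  then show ?thesis
    using sp_ge[OF p] prime_ge_1_nat[OF pp] by (simp add: cong_altdef_nat)
qed

end

section \<open>Even order\<close>

context epo
begin

lemma involution_iff: "t \<in> carrier G \<Longrightarrow> t [^] (2::nat) = \<one> \<longleftrightarrow> inv t = t"
  by (metis inv_equality l_inv numeral_2_eq_2 nat_pow_Suc nat_pow_0 l_one)

lemma invert_iff:
  assumes "t \<in> cls 2" "z \<in> carrier G"
  shows "t \<otimes> z \<in> cls 2 \<longleftrightarrow> cj t z = inv z \<and> t \<noteq> inv z"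
proof -
  have t: "t \<in> carrier G" "inv t = t" using assms by (auto simp: cls_def involution_iff)
  have "inv (t \<otimes> z) = t \<otimes> z \<longleftrightarrow> cj t z = inv z"
  proof -
    have "inv (t \<otimes> z) = t \<otimes> z \<longleftrightarrow> inv z \<otimes> t = t \<otimes> z" using t assms by (simp add: inv_mult_group)
    also have "\<dots> \<longleftrightarrow> inv z = t \<otimes> z \<otimes> inv t" using t assms by (metis inv_closed inv_solve_right m_closed)
    finally show ?thesis by (auto simp: cj_def)
  qed
  moreover have "t \<otimes> z = \<one> \<longleftrightarrow> t = inv z" using t assms by (metis inv_equality inv_closed l_inv inv_inv)
  ultimately show ?thesis using t assms by (auto simp: cls_def involution_iff)
qed

text \<open>If \<open>t\<close> and \<open>t \<otimes> z\<close> are involutions, then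
  \<open>t\<close> inverts \<open>z\<close> and so normalizes the unique Sylow subgroup
  \<open>R\<close> above \<open>z\<close>. For \<open>p = 2\<close> it lies in the elementary
  abelian \<open>R\<close> and differs from \<open>\<one>\<close> and \<open>z\<close>. For odd
  \<open>p\<close> with \<open>np p = 2\<close> all elements of the normalizer outside
  \<open>R\<close> are involutions; otherwise the normalizer has odd order.\<close>

lemma card_inverting:
  assumes p: "p \<in> primes" "z \<in> cls p"
  shows "card {t \<in> cls 2. t \<otimes> z \<in> cls 2} = (if p = 2 then sp 2 - 2 else if np p = 2 then sp p else 0)"
proof -
  have pp: "prime p" using p by (simp add: primes_iff)
  have z: "z \<in> carrier G" "z \<noteq> \<one>" using p by (simp_all add: cls_def)
  obtain R where R: "syl G p R" "z \<in> R" using cls_in_syl[OF p] by blast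
  have sR: "subgroup R G" using R by (simp add: syl_def)
  interpret R: subgroup R G by fact
  let ?F = "{t \<in> cls 2. t \<otimes> z \<in> cls 2}"
  have tN: "t \<in> normalizer G R" if t: "t \<in> ?F" for t
  proof -
    have "t \<in> carrier G" "cj t z = inv z" using t invert_iff[of t z] z by (auto simp: cls_def)
    then show ?thesis using syl_ti_normalizer[OF pp R(1) _ R(2) z(2)] R by simp
  qed
  have cN: "card (normalizer G R) = sp p * np p" using card_normalizer_syl[OF p(1) R(1)] .
  have RN: "R \<subseteq> normalizer G R" using subgroup_in_normalizer[OF sR] .
  show ?thesis
  proof (cases "p = 2")
    case True
    have sq: "x [^] (2::nat) = \<one>" if "x \<in> R" for x using syl_exp[OF p(1) R(1) that] True by simp
    have "?F = R - {\<one>, z}"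
    proof
      show "?F \<subseteq> R - {\<one>, z}"
      proof
        fix t assume t: "t \<in> ?F"
        have "t \<in> R" using normalizer_p_element[OF p(1) R(1) tN[OF t]] t True by (simp add: cls_def)
        moreover have "t \<noteq> inv z" using t invert_iff[of t z] z by auto
        moreover have "inv z = z" using sq[OF R(2)] z by (simp add: involution_iff)
        ultimately show "t \<in> R - {\<one>, z}" using t by (auto simp: cls_def)
      qed
      show "R - {\<one>, z} \<subseteq> ?F"
      proof
        fix t assume t: "t \<in> R - {\<one>, z}"
        have zi: "inv z = z" using sq[OF R(2)] z by (simp add: involution_iff)
        have ti: "inv t = t" using sq[of t] t by (simp add: involution_iff)
        have "t \<otimes> z \<in> R" using t R by simp
        moreover have "t \<otimes> z \<noteq> \<one>"
          using t z zi inv_equality[of t z] by auto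
        ultimately show "t \<in> ?F" using t sq by (auto simp: cls_def)
      qed
    qed
    moreover have "card (R - {\<one>, z}) = card R - card {\<one>, z}"
      using R by (intro card_Diff_subset) auto
    ultimately show ?thesis using True z syl_card[OF pp R(1)] by simp
  next
    case p2: False
    have notR: "t \<notin> R" if "t \<in> cls 2" for t
      using that pow_coprime_one[of t 2 p] primes_coprime[of 2 p] p2 pp syl_exp[OF p(1) R(1), of t]
      by (auto simp: cls_def)
    have oddp: "odd (sp p)" using sp_eq[OF pp] p2 pp by (simp add: prime_odd_nat prime_ge_2_nat order.not_eq_order_implies_strict)
    show ?thesis
    proof (cases "np p = 2")
      case True
      have inv2: "t \<in> cls 2" if t: "t \<in> normalizer G R" "t \<notin> R" for t
      proof -
        have tG: "t \<in> carrier G" "t \<noteq> \<one>" using t normalizer_subset by auto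
        obtain o' :: nat where o: "prime o'" "t [^] o' = \<one>" using prime_exp tG by blast
        have "t [^] (sp p * 2) = \<one>"
          using pow_subgroup_card[OF normalizer_subgroup[OF R.subset] t(1)] cN True by simp
        then have "\<not> coprime (sp p * 2) o'" using pow_coprime_one[OF tG(1) _ o(2)] tG by blast
        moreover have "o' \<noteq> p" using o t normalizer_p_element[OF p(1) R(1) t(1)] by blast
        ultimately have "o' = 2"
          using o(1) pp sp_eq[OF pp] primes_dvd_imp_eq[of 2 o'] by (auto simp: primes_coprime)
        then show ?thesis using o tG by (simp add: cls_def)
      qed
      have "?F = normalizer G R - R"
      proof
        show "?F \<subseteq> normalizer G R - R" using tN notR by auto
        show "normalizer G R - R \<subseteq> ?F"
        proof
          fix t assume t: "t \<in> normalizer G R - R"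
          have "t \<otimes> z \<in> normalizer G R"
            using t R RN subgroup.m_closed[OF normalizer_subgroup[OF R.subset]] by blast
          moreover have "t \<otimes> z \<notin> R"
          proof
            assume "t \<otimes> z \<in> R"
            then have "t \<otimes> z \<otimes> inv z \<in> R" using R by blast
            then show False using t z normalizer_subset[of R] by (auto simp: m_assoc)
          qed
          ultimately show "t \<in> ?F" using inv2 t by blast
        qed
      qed
      moreover have "card (normalizer G R - R) = card (normalizer G R) - card R"
        using RN fin_subgroup[OF sR] by (intro card_Diff_subset)
      ultimately show ?thesis using cN True syl_card[OF pp R(1)] p2 by simp
    next
      case False
      have "?F = {}"
      proof (rule ccontr)
        assume "?F \<noteq> {}"
        then obtain t where t: "t \<in> ?F" by blast
        have t2: "t \<in> carrier G" "t \<noteq> \<one>" "t [^] (2::nat) = \<one>" using t by (auto simp: cls_def)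
        have "t [^] (sp p * np p) = \<one>"
          using pow_subgroup_card[OF normalizer_subgroup[OF R.subset] tN[OF t]] cN by simp
        then have "\<not> coprime (sp p * np p) 2" using pow_coprime_one[OF t2(1) _ t2(3)] t2 by blast
        then have "even (np p)" using oddp by (metis coprime_commute coprime_right_2_iff_odd even_mult_iff)
        then show False using np_cases[OF p(1)] False by (metis even_numeral odd_one prime_odd_nat primes_dvd_imp_eq two_is_prime_nat)
      qed
      then show ?thesis using p2 False by simp
    qed
  qed
qed

text \<open>Pairs of involutions are sorted by their product \<open>z\<close>: the diagonal belongs
  to \<open>z = \<one>\<close>, the rest to the sets \<open>cls p\<close>.\<close>

lemma card_involution_pairs:
  "card (cls 2) * card (cls 2) = card (cls 2) + (\<Sum>p\<in>primes. card (cls p) *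
    (if p = 2 then sp 2 - 2 else if np p = 2 then sp p else 0))"
proof -
  let ?I = "cls 2" and ?f = "\<lambda>z. card {t \<in> cls 2. t \<otimes> z \<in> cls 2}"
  have I: "t \<in> carrier G" "t \<otimes> t = \<one>" if "t \<in> ?I" for t
    using that by (auto simp: cls_def numeral_2_eq_2)
  have "card (?I \<times> ?I) = (\<Sum>z\<in>carrier G. card {a \<in> ?I \<times> ?I. fst a \<otimes> snd a = z})"
    using sum.group[of "?I \<times> ?I" "carrier G" "\<lambda>a. fst a \<otimes> snd a" "\<lambda>_. 1 :: nat"] I
    by (simp add: image_subset_iff)
  also have "\<dots> = (\<Sum>z\<in>carrier G. ?f z)"
  proof (rule sum.cong[OF refl])
    fix z assume z: "z \<in> carrier G"
    have "bij_betw fst {a \<in> ?I \<times> ?I. fst a \<otimes> snd a = z} {t \<in> ?I. t \<otimes> z \<in> ?I}"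
    proof (rule bij_betw_byWitness[where f' = "\<lambda>t. (t, t \<otimes> z)"])
      show "\<forall>a\<in>{a \<in> ?I \<times> ?I. fst a \<otimes> snd a = z}. (fst a, fst a \<otimes> z) = a"
        using I by (auto simp flip: m_assoc)
      show "fst ` {a \<in> ?I \<times> ?I. fst a \<otimes> snd a = z} \<subseteq> {t \<in> ?I. t \<otimes> z \<in> ?I}"
        using I by (auto simp flip: m_assoc)
      show "(\<lambda>t. (t, t \<otimes> z)) ` {t \<in> ?I. t \<otimes> z \<in> ?I} \<subseteq> {a \<in> ?I \<times> ?I. fst a \<otimes> snd a = z}"
        using I z by (auto simp flip: m_assoc)
    qed auto
    then show "card {a \<in> ?I \<times> ?I. fst a \<otimes> snd a = z} = ?f z" by (rule bij_betw_same_card)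
  qed
  also have "\<dots> = ?f \<one> + (\<Sum>z\<in>carrier G - {\<one>}. ?f z)" by (simp add: sum.remove[of _ \<one>])
  also have "?f \<one> = card ?I" using I by (intro arg_cong[where f = card]) auto
  also have "(\<Sum>z\<in>carrier G - {\<one>}. ?f z) = (\<Sum>p\<in>primes. \<Sum>z\<in>cls p. ?f z)"
    unfolding cls_cover by (rule sum.UNION_disjoint) (use cls_disjoint in auto)
  also have "\<dots> = (\<Sum>p\<in>primes. card (cls p) * (if p = 2 then sp 2 - 2 else if np p = 2 then sp p else 0))"
    by (rule sum.cong) (simp_all add: card_inverting)
  finally show ?thesis by (simp add: card_cartesian_product)
qed

end

section \<open>Arithmetic of the even case\<close>

lemma even_arith1:
  fixes q u k :: nat
  assumes "3 \<le> q" "1 \<le> u" "1 \<le> k"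
  shows "1 + k * (1 + q * u) < 1 + 2 * k * q * u ^ 2"
proof -
  have "1 + q * u < 2 * q * u"
    using mult_le_mono[OF assms(1,2)] by simp
  also have "\<dots> \<le> 2 * q * u ^ 2" using assms(2) by (simp add: power2_eq_square)
  finally have "k * (1 + q * u) < k * (2 * q * u ^ 2)" using assms(3) by (intro mult_less_mono2) auto
  then show ?thesis by (simp add: mult_ac)
qed

text \<open>In \<open>even_structure\<close>, \<open>sp 2 = 1 + q * u\<close>, the number of Sylow
  2-subgroups is \<open>1 + k * (1 + q * u)\<close>, and \<open>a\<close>, \<open>b\<close> are the
  orders of two further Sylow subgroups. The proof passes to the excesses \<open>A\<close>,
  \<open>B\<close> of \<open>a\<close>, \<open>b\<close> over their lower bounds; in these the
  difference of the two sides is a polynomial that is visibly positive.\<close>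

lemma even_arith2:
  fixes q u k a b :: nat
  assumes "3 \<le> q" "1 \<le> u" "1 \<le> k" "q ^ 2 \<le> a" "q + 2 \<le> b"
    and S: "a + b = 2 + 2 * k * q * u ^ 2"
  shows "q * (1 + k * (1 + q * u)) < a * b"
proof -
  define z where "z = int k * q * u ^ 2"
  have "u \<le> u ^ 2" using assms(2) by (simp add: power2_eq_square)
  then have le: "int k * q * u \<le> z" by (simp add: z_def mult_left_mono)
  have "1 \<le> int u ^ 2" using assms(2) by (intro one_le_power) auto
  then have "int q * k * 1 \<le> int q * k * (int u ^ 2)" by (intro mult_left_mono) auto
  then have le2: "int q * k \<le> z" by (simp add: z_def mult_ac)
  have "int (q * (1 + k * (1 + q * u))) = int q + int q * k + int q * (int k * q * u)"
    by (simp add: algebra_simps)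
  also have "\<dots> \<le> int q + z + int q * z" using le le2 by (intro add_mono mult_left_mono) auto
  finally have 1: "int (q * (1 + k * (1 + q * u))) \<le> int q + z + int q * z" .
  define A B where "A = int a - int q ^ 2" and "B = int b - (int q + 2)"
  have AB: "0 \<le> A" "0 \<le> B" using assms(4,5) by (simp_all add: A_def B_def flip: of_nat_power)
  have a: "int a = A + int q ^ 2" "int b = B + int q + 2" by (simp_all add: A_def B_def)
  have "int (a + b) = 2 + 2 * z" unfolding S by (simp add: z_def)
  then have 2: "2 * z = A + B + int q ^ 2 + int q" using a by simp
  have "2 * (int a * int b) - 2 * (int q + z + int q * z) = 2 * (int a * int b) - (2 * int q + (1 + int q) * (2 * z))"
    by (simp add: algebra_simps)
  also have "\<dots> = 2 * A * B + A * (int q + 3) + B * (2 * int q ^ 2 - int q - 1) + int q * ((int q + 3) * (int q - 1))"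
    unfolding 2 a by (simp add: algebra_simps power2_eq_square power3_eq_cube)
  also have "\<dots> > 0"
  proof -
    have "int q * 3 \<le> int q * int q" using assms(1) by (intro mult_left_mono) auto
    then have "0 \<le> 2 * int q ^ 2 - int q - 1" using assms(1) by (simp add: power2_eq_square)
    moreover have "0 < int q * ((int q + 3) * (int q - 1))" using assms(1) by simp
    ultimately show ?thesis using AB by (simp add: add_nonneg_pos)
  qed
  finally have "int q + z + int q * z < int (a * b)" by simp
  with 1 show ?thesis by linarith
qed

lemma even_arith3:
  fixes q u k b :: nat
  assumes "3 \<le> q" "1 \<le> u" "1 \<le> k" "q + b = 2 + 2 * k * q * u ^ 2" "b \<le> 1 + k * (1 + q * u)"
  shows "k = 1 \<and> u = 1"
proof -
  have le: "1 + 2 * k * q * u ^ 2 \<le> k + k * q * u + q" using assms(4,5) by (simp add: algebra_simps)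
  have kq: "k + q \<le> k * q + 1"
    using assms(1,3) by (cases k; cases q) auto
  have "u = 1"
  proof (rule ccontr)
    assume "u \<noteq> 1"
    then have "2 * u \<le> u ^ 2" using assms(2) by (simp add: power2_eq_square)
    then have "2 * k * q * (2 * u) \<le> 2 * k * q * u ^ 2" by (rule mult_le_mono2)
    then have "4 * (k * q * u) \<le> 2 * k * q * u ^ 2" by (simp only: mult_ac)
    moreover have "k * q * 1 \<le> k * q * u" using assms(2) by (intro mult_le_mono2)
    moreover have "0 < k * q" using assms by simp
    ultimately show False using le kq by linarith
  qed
  moreover have "k = 1"
  proof (rule ccontr)
    assume "k \<noteq> 1"
    then obtain m where "k = m + 2" using assms(3) by (metis add.commute add_2_eq_Suc le_SucE less_eqE not_less_eq_eq numeral_2_eq_2 One_nat_def)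
    then have "q + m * q \<le> m + 1" using le \<open>u = 1\<close> by (simp add: algebra_simps)
    then show False using mult_le_mono2[OF assms(1), of m] assms(1) by linarith
  qed
  ultimately show ?thesis by simp
qed

context epo
begin

lemma sp2_ge: "p \<in> primes \<Longrightarrow> p \<noteq> 2 \<Longrightarrow> 3 \<le> sp p"
  using sp_ge[of p] prime_ge_2_nat[of p] by (fastforce simp: primes_iff)

lemma odd_sp: "p \<in> primes \<Longrightarrow> p \<noteq> 2 \<Longrightarrow> odd (sp p)"
  using sp_eq[of p] prime_odd_nat[of p] prime_ge_2_nat[of p] by (fastforce simp: primes_iff)

text \<open>The count of pairs of involutions after inserting the class sizes: \<open>cls 2\<close>
  has \<open>M * (sp 2 - 1)\<close> elements, where \<open>M\<close> is the number of Sylow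
  2-subgroups, and a factor \<open>M\<close> cancels.\<close>

lemma even_count:
  assumes two: "2 \<in> primes"
  obtains M where "order G = sp 2 * np 2 * M" "1 \<le> M"
    "2 * (M - 1) * (sp 2 - 1) ^ 2 = sp 2 * np 2 * (\<Sum>p\<in>{p \<in> primes. np p = 2}. sp p - 1)"
proof -
  let ?s = "sp 2" and ?n = "np 2" and ?E = "{p \<in> primes. np p = 2}"
  have s2: "2 \<le> ?s" using sp_ge[OF two] .
  have "card (normalizer G (sylp 2)) dvd order G"
    using sylp[of 2] subgroup_order_dvd normalizer_subgroup by (auto simp: syl_def subgroup.subset)
  then have "?s * ?n dvd order G" using card_normalizer_syl[OF two sylp] by simp
  then obtain M where M: "order G = ?s * ?n * M" by (auto elim: dvdE)
  have M1: "1 \<le> M" using M order_pos by (cases M) auto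
  have n0: "0 < ?n" using np_pos[OF two] .
  have "card (cls 2) * (?s * ?n) = (M * (?s - 1)) * (?s * ?n)" using card_cls[OF two] M by (simp add: mult_ac)
  then have c: "card (cls 2) = M * (?s - 1)" using s2 n0 by simp
  have E: "2 * (card (cls p) * sp p) = order G * (sp p - 1)" if "p \<in> ?E" for p
    using card_cls[of p] that by (simp add: mult_ac)
  have E2: "2 \<notin> ?E" using np_cases[OF two] by auto
  have "(\<Sum>p\<in>primes. card (cls p) * (if p = 2 then ?s - 2 else if np p = 2 then sp p else 0))
      = card (cls 2) * (?s - 2) + (\<Sum>p\<in>primes - {2}. card (cls p) * (if np p = 2 then sp p else 0))"
    using two by (simp add: sum.remove[of _ 2])
  also have "(\<Sum>p\<in>primes - {2}. card (cls p) * (if np p = 2 then sp p else 0)) = (\<Sum>p\<in>?E. card (cls p) * sp p)"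
    using E2 by (intro sum.mono_neutral_cong_right) auto
  finally have "card (cls 2) * card (cls 2) = card (cls 2) + card (cls 2) * (?s - 2) + (\<Sum>p\<in>?E. card (cls p) * sp p)"
    using card_involution_pairs by simp
  moreover have "card (cls 2) + card (cls 2) * (?s - 2) = card (cls 2) * (?s - 1)"
    using s2 by (metis Suc_diff_Suc mult_Suc_right numeral_2_eq_2 One_nat_def less_eq_Suc_le)
  ultimately have "2 * (card (cls 2) * card (cls 2)) = 2 * (card (cls 2) * (?s - 1)) + (\<Sum>p\<in>?E. 2 * (card (cls p) * sp p))"
    by (simp add: sum_distrib_left)
  also have "(\<Sum>p\<in>?E. 2 * (card (cls p) * sp p)) = order G * (\<Sum>p\<in>?E. sp p - 1)"
    using E by (simp add: sum_distrib_left)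
  finally have "M * (2 * M * (?s - 1) ^ 2) = M * (2 * (?s - 1) ^ 2 + ?s * ?n * (\<Sum>p\<in>?E. sp p - 1))"
    unfolding c M by (simp add: algebra_simps power2_eq_square)
  then have "2 * M * (?s - 1) ^ 2 = 2 * (?s - 1) ^ 2 + ?s * ?n * (\<Sum>p\<in>?E. sp p - 1)"
    using M1 by simp
  then have "2 * (M - 1) * (?s - 1) ^ 2 = ?s * ?n * (\<Sum>p\<in>?E. sp p - 1)"
    by (simp add: diff_mult_distrib diff_mult_distrib2)
  with that M M1 show ?thesis by blast
qed

text \<open>Three odd primes with \<open>np p = 2\<close> would have mass at least
  \<open>(2/3 + 4/5 + 4/5) / 2\<close>, which exceeds 1: at most one of them is 3, and the others
  have Sylow order at least 5.\<close>

lemma card_E_le: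
  assumes "A \<subseteq> {p \<in> primes. np p = 2}" "A \<noteq> {}" "2 \<notin> A"
  obtains p where "A = {p}" | p r where "A = {p, r}" "p \<noteq> r"
proof (cases "card A \<le> 2")
  case True
  have "finite A" using assms(1) finite_subset[OF _ finite_primes] by blast
  then have "card A = 1 \<or> card A = 2" using True assms(2) card_gt_0_iff[of A] by linarith
  then show ?thesis using that by (auto simp: card_1_singleton_iff card_2_iff)
next
  case False
  obtain C where C: "C \<subseteq> A" "card C = 3" "finite C" using False obtain_subset_with_card_n[of 3 A] by auto
  have ge: "(if p = 3 then 2 / 3 else 4 / 5) / 2 \<le> (1 - 1 / real (sp p)) / np p" if p: "p \<in> C" for p
  proof -
    have pp: "p \<in> primes" "np p = 2" "p \<noteq> 2" "prime p" using p C assms by (auto simp: primes_iff)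
    show ?thesis
    proof (cases "p = 3")
      case True
      then show ?thesis using sp2_ge[OF pp(1,3)] pp by (simp add: field_simps)
    next
      case False
      have "p \<noteq> 4" using pp(4) by auto
      then have "5 \<le> sp p" using sp_ge[OF pp(1)] prime_ge_2_nat[OF pp(4)] pp(3) False by linarith
      then show ?thesis using pp False by (simp add: field_simps)
    qed
  qed
  have "1 < (\<Sum>p\<in>C. (if p = 3 then 2 / 3 else 4 / 5) / 2 :: real)"
  proof -
    obtain a b c where "C = {a, b, c}" "a \<noteq> b" "b \<noteq> c" "a \<noteq> c" using C(2) by (metis card_3_iff)
    then show ?thesis by auto
  qed
  also have "\<dots> \<le> (\<Sum>p\<in>C. (1 - 1 / real (sp p)) / np p)" using ge by (rule sum_mono)
  also have "\<dots> \<le> 1 - 1 / order G" using C assms by (intro mass_le) auto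
  finally show ?thesis using order_pos by simp
qed

lemma even_structure:
  assumes two: "2 \<in> primes" and nn: "\<And>p. p \<in> primes \<Longrightarrow> order G \<noteq> sp p * np p"
  obtains q r where "q \<in> primes" "r \<in> primes" "odd q" "odd r" "q \<noteq> r" "sp 2 = q + 1" "np 2 = q" "sp q = q" "np q = 2"
    "sp r = q + 2" "np r = 2" "order G = (q + 1) * q * (q + 2)"
proof -
  note result = that
  let ?s = "sp 2" and ?n = "np 2" and ?E = "{p \<in> primes. np p = 2}"
  define T where "T = (\<Sum>p\<in>?E. sp p - 1)"
  obtain M where M: "order G = ?s * ?n * M" "1 \<le> M" "2 * (M - 1) * (?s - 1) ^ 2 = ?s * ?n * T"
    using even_count[OF two] unfolding T_def by blast
  have s2: "2 \<le> ?s" using sp_ge[OF two] .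
  have E2: "2 \<notin> ?E" using np_cases[OF two] by auto
  have Eodd: "odd (sp p)" "3 \<le> sp p" "p \<in> primes" "prime p" "np p = 2" "p \<noteq> 2" if "p \<in> ?E" for p
  proof -
    show "p \<in> primes" "prime p" "np p = 2" "p \<noteq> 2" using that E2 by (auto simp: primes_iff)
    then show "odd (sp p)" "3 \<le> sp p" using odd_sp sp2_ge by blast+
  qed
  have M1: "M \<noteq> 1" using nn[OF two] M(1) by auto
  have "T \<noteq> 0"
  proof
    assume "T = 0"
    then have "2 * (M - 1) * (?s - 1) ^ 2 = 0" using M(3) by simp
    then show False using M1 M(2) s2 by simp
  qed
  then have Ene: "?E \<noteq> {}" unfolding T_def by (metis sum.empty)
  have "even T" unfolding T_def using Eodd(1,2) by (intro dvd_sum) auto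
  then obtain T' where T': "T = 2 * T'" by (elim evenE)
  have eq: "(M - 1) * (?s - 1) ^ 2 = ?s * ?n * T'" using M(3) T' by simp
  \<comment> \<open>If the Sylow 2-subgroup were self-normalizing, its mass and that of the primes
    in \<open>?E\<close>, at least 1/3 each, would leave only \<open>sp 2 = 2\<close> and a single
    prime \<open>p\<close> in \<open>?E\<close>. Then the order is \<open>2 * sp p\<close>, so the
    Sylow \<open>p\<close>-subgroup is normal, against \<open>nn\<close>.\<close>
  have n1: "?n \<noteq> 1"
  proof
    assume n1: "?n = 1"
    obtain p where p: "p \<in> ?E" using Ene by blast
    have mle: "(\<Sum>x\<in>insert 2 A. (1 - 1 / real (sp x)) / np x) < 1" if "A \<subseteq> ?E" for A
    proof -
      have "insert 2 A \<subseteq> primes" using that two by auto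
      moreover have "0 < 1 / real (order G)" using order_pos by simp
      ultimately show ?thesis using mass_le[of "insert 2 A"] by linarith
    qed
    have third: "1 / 3 \<le> (1 - 1 / real (sp x)) / np x" if "x \<in> ?E" for x
      using Eodd[OF that] by (simp add: field_simps)
    have "?s = 2"
    proof -
      have "(1 - 1 / real ?s) + (1 - 1 / real (sp p)) / np p < 1"
        using mle[of "{p}"] p Eodd(6)[OF p] n1 by simp
      then have "1 - 1 / real ?s < 2 / 3" using third[OF p] by linarith
      then have "?s < 3" using s2 by (simp add: field_simps)
      then show ?thesis using s2 by simp
    qed
    have "?E = {p}"
    proof (rule ccontr)
      assume "?E \<noteq> {p}"
      then obtain r where r: "r \<in> ?E" "r \<noteq> p" using p by blast
      then have "1 / 2 + ((1 - 1 / real (sp p)) / np p + (1 - 1 / real (sp r)) / np r) < 1"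
        using mle[of "{p, r}"] Eodd(6)[OF p] Eodd(6)[OF r(1)] p n1 \<open>?s = 2\<close> by simp
      then show False using third[OF p] third[OF r(1)] by linarith
    qed
    then have "T = sp p - 1" by (simp add: T_def)
    then have "M - 1 = sp p - 1" using M(3) \<open>?s = 2\<close> n1 by simp
    then have "M = sp p" using M(2) Eodd(2)[OF p] by simp
    then show False using nn[OF Eodd(3)[OF p]] M(1) \<open>?s = 2\<close> n1 Eodd(5)[OF p] by simp
  qed
  define q where "q = ?n"
  have q: "prime q" "q \<noteq> 2" "q dvd ?s - 1" using np_cases[OF two] n1 np_dvd[OF two] by (auto simp: q_def)
  then have q3: "3 \<le> q" "odd q" using prime_ge_2_nat[of q] prime_odd_nat[of q] by auto
  have qP: "q \<in> primes" using q M(1) by (simp add: primes_iff q_def)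
  obtain u where u: "?s - 1 = q * u" using q(3) by (elim dvdE)
  have s: "?s = 1 + q * u" and u1: "1 \<le> u" using u s2 by (cases u, auto)+
  have "(M - 1) * (q * u ^ 2) * q = ?s * T' * q" using eq u by (simp add: q_def power2_eq_square mult_ac)
  then have eq2: "(M - 1) * (q * u ^ 2) = ?s * T'" using q3 by simp
  \<comment> \<open>As \<open>?s\<close> is 1 more than a multiple of \<open>q * u\<close>, it
    divides \<open>M - 1\<close>; the quotient \<open>k\<close> and \<open>u\<close> then
    parametrize the order of the group.\<close>
  have "coprime ?s (q * u ^ 2)"
    using s by (metis coprime_1_left coprime_add_one_left coprime_mult_right_iff coprime_power_right_iff add.commute coprime_commute)
  then have "?s dvd M - 1" using eq2 by (metis coprime_dvd_mult_left_iff dvd_triv_left)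
  then obtain k where k: "M - 1 = ?s * k" by (elim dvdE)
  have Mk: "M = 1 + k * (1 + q * u)" using k M(2) s by (simp add: mult.commute)
  have k1: "1 \<le> k" using M1 Mk by (cases k) auto
  have "?s * (k * (q * u ^ 2)) = ?s * T'" using eq2 k by (simp add: mult_ac)
  then have "T' = k * (q * u ^ 2)" using s2 by simp
  then have T: "T = 2 * k * q * u ^ 2" using T' by (simp add: mult_ac)
  have ar1: "M < 1 + 2 * k * q * u ^ 2" using even_arith1[OF q3(1) u1 k1] Mk by simp
  have M0: "0 < M" using M(2) by simp
  have og: "order G = ?s * (q * M)" using M(1) by (simp add: q_def)
  have dvdM: "sp p dvd M" if p: "p \<in> ?E" "p \<noteq> q" for p
  proof -
    have "coprime (sp p) ?s" using coprime_sp[OF Eodd(3)[OF p(1)] two] Eodd(6)[OF p(1)] by simp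
    moreover have "coprime (sp p) q"
      using sp_eq[OF Eodd(4)[OF p(1)]] primes_coprime[OF Eodd(4)[OF p(1)] q(1) p(2)] by simp
    ultimately show ?thesis using sp_dvd[OF Eodd(4)[OF p(1)]] og by (metis coprime_dvd_mult_right_iff)
  qed
  have pair: "thesis" if E: "?E = {q, r}" "q \<noteq> r" for r
  proof -
    have rE: "r \<in> ?E" and qE: "q \<in> ?E" using E by auto
    note r = Eodd[OF rE]
    have "T = (sp q - 1) + (sp r - 1)" unfolding T_def E(1) using E(2) by simp
    then have S: "sp q + sp r = 2 + 2 * k * q * u ^ 2" using T Eodd(2)[OF qE] r(2) by simp
    obtain b where b: "sp q = q ^ b" "0 < b" using sp_power[OF qP] by blast
    have rM: "sp r dvd M" using dvdM[OF rE] E(2) by simp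
    have "b = 1"
    proof (rule ccontr)
      assume "b \<noteq> 1"
      then have b2: "2 \<le> b" using b by simp
      then obtain c where c: "b = Suc c" "1 \<le> c" by (cases b) auto
      \<comment> \<open>One factor \<open>q\<close> of the order is \<open>np 2\<close> itself; the
        other \<open>c\<close> factors must divide \<open>M\<close>, since \<open>?s\<close> is
        prime to \<open>q\<close>. With \<open>sp r\<close> also dividing \<open>M\<close> this
        gives \<open>sp q * sp r \<le> q * M\<close>, which \<open>even_arith2\<close>
        refutes.\<close>
      have "q ^ c * q dvd ?s * M * q" using sp_dvd[OF q(1)] og b c by (simp add: mult_ac)
      then have "q ^ c dvd ?s * M" using q3 by simp
      moreover have "coprime (q ^ c) ?s" using coprime_sp[OF qP two] q(2) b c by simp
      ultimately have qM: "q ^ c dvd M" by (metis coprime_dvd_mult_right_iff)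
      have "coprime (q ^ c) (sp r)" using coprime_sp[OF qP r(3) E(2)] b c by simp
      then have "q ^ c * sp r dvd M" using qM rM divides_mult by blast
      then have "q ^ c * sp r \<le> M" using M0 by (rule dvd_imp_le)
      then have "sp q * sp r \<le> q * M" using b c by (simp add: mult.assoc)
      moreover have "q ^ 2 \<le> sp q" using b b2 q3 by (simp add: power_increasing)
      moreover have "q + 2 \<le> sp r"
      proof -
        have "q dvd sp q" "q dvd 2 * k * q * u ^ 2" using b by auto
        moreover have "(sp r - 2) + sp q = 2 * k * q * u ^ 2" using S r(2) by simp
        ultimately have "q dvd sp r - 2" by (metis dvd_add_left_iff)
        then have "q \<le> sp r - 2" using r(2) by (intro dvd_imp_le) auto
        then show ?thesis using r(2) by simp
      qed
      ultimately show False using even_arith2[OF q3(1) u1 k1 _ _ S] Mk by simp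
    qed
    then have spq: "sp q = q" using b by simp
    have "sp r \<le> 1 + k * (1 + q * u)" using rM M0 Mk by (simp add: dvd_imp_le)
    then have ku: "k = 1" "u = 1" using even_arith3[OF q3(1) u1 k1, of "sp r"] S spq by simp_all
    have "odd r" using r(4,6) prime_odd_nat prime_ge_2_nat[OF r(4)] by auto
    moreover have f: "?s = q + 1" "sp r = q + 2" "order G = (q + 1) * q * (q + 2)"
      using s ku S spq og Mk by (simp_all add: algebra_simps)
    ultimately show thesis
      by (intro result[OF qP r(3) q3(2) _ E(2) f(1) q_def[symmetric] spq Eodd(5)[OF qE] f(2) r(5) f(3)])
  qed
  show thesis
  proof (rule card_E_le[OF subset_refl Ene E2])
    fix p assume E: "?E = {p}"
    then have p: "p \<in> ?E" by blast
    have "sp p = 1 + 2 * k * q * u ^ 2" using T Eodd(2)[OF p] by (simp add: T_def E)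
    moreover have "p = q"
    proof (rule ccontr)
      assume "p \<noteq> q"
      then have "sp p \<le> M" using dvdM[OF p] M0 by (simp add: dvd_imp_le)
      then show False using calculation ar1 by simp
    qed
    moreover have "q dvd sp q" using sp_power[OF qP] by auto
    ultimately have "q dvd 1" by (metis dvd_add_left_iff dvd_mult dvd_mult2 dvd_refl)
    then show thesis using q3 by simp
  next
    fix p r assume E: "?E = {p, r}" "p \<noteq> r"
    show thesis
    proof (cases "p = q \<or> r = q")
      case True
      then show thesis using pair[of r] pair[of p] E by (auto simp: insert_commute)
    next
      case False
      have p: "p \<in> ?E" "r \<in> ?E" using E by blast+
      have "sp p * sp r dvd M"
        using dvdM[OF p(1)] dvdM[OF p(2)] False coprime_sp[OF Eodd(3)[OF p(1)] Eodd(3)[OF p(2)] E(2)]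
        by (simp add: divides_mult)
      then have "sp p * sp r \<le> M" using M0 by (rule dvd_imp_le)
      moreover have "sp p + sp r = 2 + 2 * k * q * u ^ 2"
        using T Eodd(2)[OF p(1)] Eodd(2)[OF p(2)] E(2) by (simp add: T_def E(1))
      moreover have "sp p + sp r \<le> sp p * sp r + 1" using Eodd(2)[OF p(1)] Eodd(2)[OF p(2)]
        by (cases "sp p"; cases "sp r") auto
      ultimately show thesis using ar1 by linarith
    qed
  qed
qed

end

section \<open>The action on the Sylow 2-subgroups\<close>

lemma double_count:
  "finite A \<Longrightarrow> finite B \<Longrightarrow> (\<Sum>x\<in>A. card {y \<in> B. R x y}) = (\<Sum>y\<in>B. card {x \<in> A. R x y})"
  using sum.swap_restrict[of A B "\<lambda>_ _. 1 :: nat" R] by simp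

lemma card_distinct_triples:
  assumes "finite A" "card A = n + 2"
  shows "card {(a, b, c). a \<in> A \<and> b \<in> A \<and> c \<in> A \<and> a \<noteq> b \<and> b \<noteq> c \<and> a \<noteq> c} = (n + 2) * ((n + 1) * n)"
proof -
  have "{(a, b, c). a \<in> A \<and> b \<in> A \<and> c \<in> A \<and> a \<noteq> b \<and> b \<noteq> c \<and> a \<noteq> c}
      = Sigma A (\<lambda>a. Sigma (A - {a}) (\<lambda>b. A - {a, b}))" by auto
  also have "card \<dots> = (\<Sum>a\<in>A. \<Sum>b\<in>A - {a}. card (A - {a, b}))"
    using assms(1) by (simp add: card_SigmaI)
  also have "\<dots> = (\<Sum>a\<in>A. \<Sum>b\<in>A - {a}. n)"
    using assms by (intro sum.cong refl) (auto simp: card_Diff_subset)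
  finally show ?thesis using assms by simp
qed

locale epo_even = epo +
  fixes q
  assumes two: "2 \<in> primes" and q: "q \<in> primes" "odd q" and sp2: "sp 2 = q + 1" "np 2 = q"
    and spq: "sp q = q" "np q = 2" and order_eq: "order G = (q + 1) * q * (q + 2)"
begin

lemma q3: "prime q" "3 \<le> q"
  using q prime_ge_2_nat[of q] by (auto simp: primes_iff) (metis even_numeral le_antisym not_less_eq_eq numeral_2_eq_2 numeral_3_eq_3)

definition \<Omega> where "\<Omega> = {P. syl G 2 P}"

lemma finite_\<Omega>: "finite \<Omega>"
  by (rule finite_subset[of _ "Pow (carrier G)"]) (auto simp: \<Omega>_def syl_def dest: subgroup.subset)

lemma \<Omega>_subset: "P \<in> \<Omega> \<Longrightarrow> P \<subseteq> carrier G"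
  by (auto simp: \<Omega>_def syl_def dest: subgroup.subset)

lemma \<Omega>_cj: "g \<in> carrier G \<Longrightarrow> P \<in> \<Omega> \<Longrightarrow> cj g ` P \<in> \<Omega>"
  by (simp add: \<Omega>_def syl_cj)

lemma card_\<Omega>_normalizer: "P \<in> \<Omega> \<Longrightarrow> card (normalizer G P) = (q + 1) * q"
  using card_normalizer_syl[OF two] sp2 by (simp add: \<Omega>_def)

lemma card_\<Omega>: "card \<Omega> = q + 2"
proof -
  define S where "S = sylp 2"
  have S: "S \<in> \<Omega>" using sylp[of 2] by (simp add: \<Omega>_def S_def)
  note SG = \<Omega>_subset[OF S]
  have "card (carrier G) = ((q + 1) * q) * card \<Omega>"
  proof (rule card_const_fibers)
    show "(\<lambda>g. cj g ` S) ` carrier G = \<Omega>"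
      using \<Omega>_cj S syl_conj[of 2 S] by (auto simp: \<Omega>_def image_iff)
    fix P assume "P \<in> \<Omega>"
    then obtain h where h: "h \<in> carrier G" "P = cj h ` S" using syl_conj[of 2 S P] S by (auto simp: \<Omega>_def)
    have "bij_betw (\<lambda>n. h \<otimes> n) (normalizer G S) {g \<in> carrier G. cj g ` S = P}"
    proof (rule bij_betw_byWitness[where f' = "\<lambda>g. inv h \<otimes> g"])
      show "(\<lambda>n. h \<otimes> n) ` normalizer G S \<subseteq> {g \<in> carrier G. cj g ` S = P}"
      proof clarify
        fix n assume "n \<in> normalizer G S"
        then show "h \<otimes> n \<in> carrier G \<and> cj (h \<otimes> n) ` S = P"
          using h SG cj_image_cj[of n h S] by (simp add: normalizer_def)
      qed
      show "(\<lambda>g. inv h \<otimes> g) ` {g \<in> carrier G. cj g ` S = P} \<subseteq> normalizer G S"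
      proof clarify
        fix g assume g: "g \<in> carrier G" "P = cj g ` S"
        then have gS: "cj g ` S \<subseteq> carrier G" "cj h ` S = cj g ` S" using SG h(2) by auto
        have "S = cj (inv h) ` cj g ` S" by (rule iffD1[OF cj_image_swap[OF h(1) SG gS(1)] gS(2)])
        then have "cj (inv h \<otimes> g) ` S = S"
          using h(1) SG g(1) by (simp add: cj_image_cj)
        then show "inv h \<otimes> g \<in> normalizer G S" using h(1) g(1) by (simp add: normalizer_def)
      qed
    qed (use h normalizer_subset[of S] in \<open>auto simp: subset_iff\<close>)
    then show "card {g \<in> carrier G. cj g ` S = P} = (q + 1) * q"
      using card_\<Omega>_normalizer[OF S] by (simp add: bij_betw_same_card[symmetric])
  qed auto
  then have "((q + 1) * q) * (q + 2) = ((q + 1) * q) * card \<Omega>" using order_eq by (simp add: order_def)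
  then show ?thesis using q3 by (subst (asm) mult_cancel1) auto
qed

definition fixed where "fixed w = {P \<in> \<Omega>. w \<in> normalizer G P}"

text \<open>The normalizer has order \<open>(q + 1) * q\<close> with \<open>q + 1\<close> a power of
  2, and the elements of order 2 in it lie in \<open>P\<close>; only the order \<open>q\<close>
  remains for \<open>w\<close>.\<close>

lemma normalizer_\<Omega>_cases:
  assumes P: "P \<in> \<Omega>" and w: "w \<in> normalizer G P" "w \<notin> P"
  shows "w \<in> cls q"
proof -
  have PG: "syl G 2 P" "P \<subseteq> carrier G" using P \<Omega>_subset by (auto simp: \<Omega>_def)
  have wG: "w \<in> carrier G" using w normalizer_subset by blast
  have w1: "w \<noteq> \<one>" using w(2) PG subgroup.one_closed[of P G] by (auto simp: syl_def)
  obtain r :: nat where r: "prime r" "w [^] r = \<one>" using prime_exp[OF wG] by blast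
  have "w [^] ((q + 1) * q) = \<one>"
    using pow_subgroup_card[OF normalizer_subgroup[OF PG(2)] w(1)] card_\<Omega>_normalizer[OF P] by simp
  then have "\<not> coprime ((q + 1) * q) r" using pow_coprime_one[OF wG _ r(2)] w1 by blast
  moreover have "r \<noteq> 2" using normalizer_p_element[OF two PG(1) w(1)] w(2) r(2) by auto
  then have "coprime (q + 1) r" using r(1) primes_coprime[of 2 r]
    unfolding sp2(1)[symmetric] sp_eq[OF two_is_prime_nat] by simp
  ultimately have "\<not> coprime q r" by (metis coprime_mult_left_iff)
  then have "r = q" using primes_coprime[OF q3(1) r(1)] by blast
  then show ?thesis using wG w1 r by (simp add: cls_def)
qed

lemma cls_q_normalizer: "P \<in> \<Omega> \<Longrightarrow> card {z \<in> cls q. z \<in> normalizer G P} = (q + 1) * (q - 1)"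
proof -
  assume P: "P \<in> \<Omega>"
  then have PG: "syl G 2 P" "P \<subseteq> carrier G" "subgroup P G" using \<Omega>_subset by (auto simp: \<Omega>_def syl_def)
  have "z \<notin> P" if "z \<in> cls q" for z
    using that pow_coprime_one[of z q 2] syl_exp[OF two PG(1), of z] q(2) by (auto simp: cls_def)
  then have "{z \<in> cls q. z \<in> normalizer G P} = normalizer G P - P"
    using normalizer_\<Omega>_cases[OF P] by auto
  also have "card \<dots> = (q + 1) * q - (q + 1)"
    using card_\<Omega>_normalizer[OF P] syl_card[of 2 P] PG sp2(1) subgroup_in_normalizer[OF PG(3)]
    by (subst card_Diff_subset) (auto simp: fin_subset)
  finally show ?thesis by (simp add: diff_mult_distrib2)
qed

lemma card_fixed_cj:
  assumes "g \<in> carrier G" "w \<in> carrier G"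
  shows "card (fixed (cj g w)) = card (fixed w)"
proof -
  have "bij_betw (\<lambda>P. cj g ` P) (fixed w) (fixed (cj g w))"
  proof (rule bij_betw_byWitness[where f' = "\<lambda>P. cj (inv g) ` P"])
    have sub: "(\<lambda>P. cj h ` P) ` fixed v \<subseteq> fixed (cj h v)" if "h \<in> carrier G" for h v
      using that \<Omega>_cj \<Omega>_subset by (auto simp: fixed_def normalizer_conj)
    show "(\<lambda>P. cj g ` P) ` fixed w \<subseteq> fixed (cj g w)" using sub assms by blast
    show "(\<lambda>P. cj (inv g) ` P) ` fixed (cj g w) \<subseteq> fixed w" using sub[of "inv g" "cj g w"] assms by simp
  qed (use assms \<Omega>_subset in \<open>auto simp: fixed_def cj_image_cj cj_image_one\<close>)
  then show ?thesis by (metis bij_betw_same_card)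
qed

text \<open>The Sylow \<open>q\<close>-subgroups have order \<open>q\<close> and are conjugate, and
  the nontrivial elements of one are powers of each other, so all elements of order \<open>q\<close>
  fix equally many points. Counting incidences in two ways shows that the common number is
  2.\<close>

lemma card_fixed_cls_q: "z \<in> cls q \<Longrightarrow> card (fixed z) = 2"
proof -
  define Y where "Y = sylp q"
  have Y: "syl G q Y" "subgroup Y G" "card Y = q"
    using sylp[OF q3(1)] syl_card[OF q3(1)] spq by (auto simp: Y_def syl_def)
  obtain y where y: "y \<in> Y" "y \<noteq> \<one>"
    using sylp_nontrivial[OF q(1) Y(1)] subgroup.one_closed[OF Y(2)] by blast
  have const: "card (fixed z) = card (fixed y)" if z: "z \<in> cls q" for z
  proof -
    obtain g x where g: "z = cj g x" "g \<in> carrier G" "x \<in> Y" "x \<noteq> \<one>"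
      using z cls_eq_conjs[OF q(1) Y(1)] by (auto simp: conjs_def)
    have pow: "\<exists>i::nat. v = u [^] i" if "u \<in> Y" "u \<noteq> \<one>" "v \<in> Y" for u v
      using prime_card_pow(1)[OF q3(1) Y(2,3) that(1,2)] that(3) by blast
    have sub: "fixed u \<subseteq> fixed v" if uv: "u \<in> Y" "u \<noteq> \<one>" "v \<in> Y" for u v
    proof -
      obtain i :: nat where "v = u [^] i" using pow[OF uv] by blast
      then show ?thesis
        using subgroup_pow[OF normalizer_subgroup[OF \<Omega>_subset], of _ u i] by (auto simp: fixed_def)
    qed
    have "fixed x = fixed y" using sub[OF g(3,4) y(1)] sub[OF y g(3)] by blast
    then show ?thesis using g card_fixed_cj subgroup.mem_carrier[OF Y(2)] by simp
  qed
  have "(\<Sum>z\<in>cls q. card (fixed z)) = (\<Sum>P\<in>\<Omega>. card {z \<in> cls q. z \<in> normalizer G P})"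
    unfolding fixed_def by (rule double_count) (simp_all add: finite_\<Omega>)
  then have "card (cls q) * card (fixed y) = (q + 2) * ((q + 1) * (q - 1))"
    using const cls_q_normalizer card_\<Omega> by simp
  moreover have "(q * 2) * card (cls q) = (q * 2) * (card (cls q))" by simp
  have "card (cls q) * 2 * q = (q + 2) * ((q + 1) * (q - 1)) * q"
    using card_cls[OF q(1)] unfolding spq order_eq by (simp only: mult_ac)
  then have c: "card (cls q) * 2 = (q + 2) * ((q + 1) * (q - 1))" using q3 by (subst (asm) mult_cancel2) auto
  ultimately have "card (cls q) * card (fixed y) = card (cls q) * 2" by simp
  moreover have "card (cls q) \<noteq> 0" using c q3 by auto
  ultimately have "card (fixed y) = 2" by simp
  then show "z \<in> cls q \<Longrightarrow> card (fixed z) = 2" using const by simp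
qed

text \<open>An element not of order \<open>q\<close> lies in every Sylow 2-subgroup that it
  normalizes, and these intersect trivially. So only the identity fixes three points.\<close>

lemma card_fixed_le: "w \<in> carrier G \<Longrightarrow> w \<noteq> \<one> \<Longrightarrow> card (fixed w) \<le> 2"
proof (cases "w \<in> cls q")
  case False
  assume w: "w \<in> carrier G" "w \<noteq> \<one>"
  have "P = R" if "P \<in> fixed w" "R \<in> fixed w" for P R
    using that normalizer_\<Omega>_cases[of _ w] False w syl_ti[of 2 P R] by (auto simp: fixed_def \<Omega>_def)
  then have "card (fixed w) \<le> 1"
    by (metis card_le_Suc0_iff_eq One_nat_def card.infinite zero_le)
  then show ?thesis by simp
qed (simp add: card_fixed_cls_q)

lemma three_not_dvd:
  assumes three: "3 \<in> primes" "sp 3 = q + 2" "np 3 = 2" "q \<noteq> 3"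
  shows False
proof -
  have nofix: "x \<notin> normalizer G P" if x: "x \<in> cls 3" and P: "P \<in> \<Omega>" for x P
  proof
    assume xN: "x \<in> normalizer G P"
    have PG: "syl G 2 P" using P by (simp add: \<Omega>_def)
    have "x \<notin> P" using x pow_coprime_one[of x 3 2] syl_exp[OF two PG, of x] by (auto simp: cls_def)
    then have "x \<in> cls q" using normalizer_\<Omega>_cases[OF P xN] by blast
    then show False using x cls_disjoint[OF three(1) q(1)] three(4) by blast
  qed
  let ?T = "{(a, b, c). a \<in> \<Omega> \<and> b \<in> \<Omega> \<and> c \<in> \<Omega> \<and> a \<noteq> b \<and> b \<noteq> c \<and> a \<noteq> c}"
  let ?f = "\<lambda>(x, P). (P, cj x ` P, cj x ` cj x ` P)"
  have move: "cj x ` P \<noteq> P" if "x \<in> cls 3" "P \<in> \<Omega>" for x P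
    using nofix[OF that] that by (auto simp: normalizer_def cls_def)
  have cube: "cj x ` cj x ` cj x ` P = P" if "x \<in> cls 3" "P \<in> \<Omega>" for x P
  proof -
    have "x \<in> carrier G" "x \<otimes> x \<otimes> x = \<one>" using that by (auto simp: cls_def numeral_3_eq_3)
    then show ?thesis using \<Omega>_subset[OF that(2)] by (simp add: cj_image_cj cj_image_one m_assoc)
  qed
  have xG: "x \<in> carrier G" if "x \<in> cls 3" for x using that by (simp add: cls_def)
  have cl: "cj x ` P \<in> \<Omega>" if "x \<in> cls 3" "P \<in> \<Omega>" for x P using that \<Omega>_cj xG by blast
  have "inj_on ?f (cls 3 \<times> \<Omega>)"
  proof (rule inj_onI)
    fix z z' assume zz: "z \<in> cls 3 \<times> \<Omega>" "z' \<in> cls 3 \<times> \<Omega>" "?f z = ?f z'"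
    then obtain x P y where z: "z = (x, P)" "z' = (y, P)" and x: "x \<in> cls 3" "P \<in> \<Omega>" and y: "y \<in> cls 3"
      and e1: "cj x ` P = cj y ` P" "cj x ` cj x ` P = cj y ` cj y ` P" by auto
    define w where "w = inv y \<otimes> x"
    have wG: "w \<in> carrier G" using x y xG by (simp add: w_def)
    have wfix: "S \<in> fixed w" if S: "S \<in> \<Omega>" and eq: "cj x ` S = cj y ` S" for S
    proof -
      have "cj w ` S = cj (inv y) ` cj y ` S"
        unfolding w_def using x y xG \<Omega>_subset[OF S] eq by (simp flip: cj_image_cj)
      then have "cj w ` S = S" using y xG \<Omega>_subset[OF S] by (simp add: cj_image_cj cj_image_one)
      then show ?thesis using S wG by (simp add: fixed_def normalizer_def)
    qed
    have "P \<in> fixed w" by (rule wfix[OF x(2) e1(1)])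
    moreover have "cj x ` P \<in> fixed w" using wfix[OF cl[OF x]] e1 by simp
    moreover have "cj x ` cj x ` P \<in> fixed w"
      using wfix[OF cl[OF x(1) cl[OF x]]] e1 cube[OF x] cube[OF y x(2)] by simp
    ultimately have sub: "{P, cj x ` P, cj x ` cj x ` P} \<subseteq> fixed w" by blast
    have "cj x ` cj x ` P \<noteq> P"
      using cube[OF x] move[OF x] by metis
    moreover have "cj x ` P \<noteq> P" "cj x ` cj x ` P \<noteq> cj x ` P" using move[OF x] move[OF x(1) cl[OF x]] .
    ultimately have "distinct [P, cj x ` P, cj x ` cj x ` P]"
      by (metis distinct_length_2_or_more distinct_singleton)
    then have "card {P, cj x ` P, cj x ` cj x ` P} = 3" using distinct_card by fastforce
    then have "3 \<le> card (fixed w)"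
      using card_mono[OF _ sub] finite_\<Omega> by (auto simp: fixed_def)
    then have "w = \<one>" using card_fixed_le[OF wG] by fastforce
    then have "x = y" using xG x y by (metis inv_equality inv_inv inv_closed w_def)
    then show "z = z'" using z by simp
  qed
  moreover have "?f ` (cls 3 \<times> \<Omega>) \<subseteq> ?T"
  proof (rule image_subsetI)
    fix z assume "z \<in> cls 3 \<times> \<Omega>"
    then obtain x P where x: "z = (x, P)" "x \<in> cls 3" "P \<in> \<Omega>" by blast
    have "P \<noteq> cj x ` cj x ` P" using cube[OF x(2,3)] move[OF x(2,3)] by metis
    moreover have "P \<noteq> cj x ` P" "cj x ` P \<noteq> cj x ` cj x ` P"
      using move[OF x(2,3)] move[OF x(2) cl[OF x(2,3)]] by metis+
    ultimately show "?f z \<in> ?T"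
      using x(3) cl[OF x(2,3)] cl[OF x(2) cl[OF x(2,3)]] unfolding x(1) by simp
  qed
  moreover have "finite ?T"
    by (rule finite_subset[of _ "\<Omega> \<times> \<Omega> \<times> \<Omega>"]) (auto simp: finite_\<Omega>)
  ultimately have "card (cls 3 \<times> \<Omega>) \<le> card ?T" by (rule card_inj_on_le)
  then have "card (cls 3) * (q + 2) \<le> (q + 1) * q * (q + 2)"
    using card_distinct_triples[OF finite_\<Omega> card_\<Omega>] card_\<Omega> by (simp add: card_cartesian_product mult_ac)
  then have le: "card (cls 3) \<le> (q + 1) * q" by (subst (asm) mult_le_cancel2) auto
  have "sp 3 - 1 = q + 1" using three by simp
  then have "card (cls 3) * 2 * (q + 2) = (q + 1) * q * (q + 1) * (q + 2)"
    using card_cls[OF three(1)] unfolding three(2,3) order_eq by (simp only: mult_ac)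
  then have "card (cls 3) * 2 = (q + 1) * q * (q + 1)" by (subst (asm) mult_cancel2) auto
  then have "(q + 1) * q * (q + 1) \<le> (q + 1) * q * 2" using le by linarith
  then show False using q3 by (subst (asm) mult_le_cancel1) auto
qed

text \<open>The action on the five Sylow 2-subgroups is faithful. Elements other than involutions
  are squares, hence even permutations; they are 45 out of 60, more than a proper subgroup can
  contain. So the image lies in the alternating group, which has the same order.\<close>

lemma iso_alt_group_5:
  assumes q: "q = 3"
  shows "G \<cong> alt_group 5"
proof -
  have og: "order G = 60" using order_eq q by simp
  have "card \<Omega> = card {1..5::nat}" using card_\<Omega> q by simp
  then obtain \<beta> where \<beta>: "bij_betw \<beta> {1..5::nat} \<Omega>"
    using finite_\<Omega> by (metis bij_betw_iff_card finite_atLeastAtMost)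
  define \<gamma> where "\<gamma> = inv_into {1..5::nat} \<beta>"
  have \<gamma>: "\<gamma> P \<in> {1..5}" "\<beta> (\<gamma> P) = P" if "P \<in> \<Omega>" for P
    using that \<beta> inv_into_into[of P \<beta> "{1..5}"] unfolding \<gamma>_def bij_betw_def by (simp_all add: f_inv_into_f)
  have \<beta>\<Omega>: "\<beta> i \<in> \<Omega>" "\<gamma> (\<beta> i) = i" if "i \<in> {1..5}" for i
    using that \<beta> unfolding \<gamma>_def by (auto simp: bij_betw_def)
  define f where "f g = (\<lambda>i. if i \<in> {1..5} then \<gamma> (cj g ` \<beta> i) else i)" for g
  have comp: "f (g \<otimes> h) = f g \<circ> f h" if "g \<in> carrier G" "h \<in> carrier G" for g h
  proof
    fix i
    show "f (g \<otimes> h) i = (f g \<circ> f h) i"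
    proof (cases "i \<in> {1..5}")
      case True
      then show ?thesis
        using \<gamma>[OF \<Omega>_cj[OF that(2) \<beta>\<Omega>(1)[OF True]]] cj_image_cj[OF that(2,1) \<Omega>_subset[OF \<beta>\<Omega>(1)[OF True]]]
        by (simp add: f_def)
    qed (auto simp: f_def)
  qed
  have one: "f \<one> = id"
    using \<beta>\<Omega> \<Omega>_subset by (auto simp: f_def cj_image_one)
  have perm: "f g permutes {1..5}" if g: "g \<in> carrier G" for g
  proof (rule bij_imp_permutes)
    show "bij_betw (f g) {1..5} {1..5}"
    proof (rule bij_betw_byWitness[where f' = "f (inv g)"])
      show "\<forall>a\<in>{1..5}. f (inv g) (f g a) = a" "\<forall>a\<in>{1..5}. f g (f (inv g) a) = a"
        using comp[of "inv g" g] comp[of g "inv g"] one g by (simp_all add: fun_eq_iff)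
      show "f g ` {1..5} \<subseteq> {1..5}" "f (inv g) ` {1..5} \<subseteq> {1..5}"
        using \<gamma>(1)[OF \<Omega>_cj] \<beta>\<Omega>(1) g by (auto simp: f_def)
    qed
  qed (simp only: f_def if_False)
  have hom: "f \<in> hom G (sym_group 5)"
    using perm comp by (auto simp: hom_def sym_group_carrier sym_group_mult)
  interpret \<phi>: group_hom G "sym_group 5" f
    using hom sym_group_is_group by (simp add: group_hom_def group_hom_axioms_def is_group)
  have trivial: "g = \<one>" if g: "g \<in> carrier G" "f g = id" for g
  proof (rule ccontr)
    assume "g \<noteq> \<one>"
    have "P \<in> fixed g" if "P \<in> \<Omega>" for P
    proof -
      have "f g (\<gamma> P) = \<gamma> P" using g by simp
      then have "\<gamma> (cj g ` P) = \<gamma> P" using \<gamma>[OF that] by (simp add: f_def)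
      then have "cj g ` P = P" using \<gamma>(2) \<Omega>_cj[OF g(1) that] that by metis
      then show ?thesis using that g by (simp add: fixed_def normalizer_def)
    qed
    then have "card \<Omega> \<le> card (fixed g)" using finite_\<Omega> by (intro card_mono) (auto simp: fixed_def)
    then show False using card_fixed_le[OF g(1) \<open>g \<noteq> \<one>\<close>] card_\<Omega> q by simp
  qed
  have inj: "inj_on f (carrier G)"
    using \<phi>.inj_on_one_iff trivial by (simp add: sym_group_one)
  interpret sg: group_hom G sign_img "sign \<circ> f"
    using Group.hom_compose[OF hom sign_is_hom] sign_img_is_group
    by (simp add: group_hom_def group_hom_axioms_def is_group)
  let ?K = "kernel G sign_img (sign \<circ> f)"
  have evenK: "x \<in> ?K" if x: "x \<in> carrier G" "x \<notin> cls 2" for x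
  proof -
    obtain p :: nat where p: "prime p" "x [^] p = \<one>" using prime_exp x by blast
    have sq: "y \<otimes> y \<in> ?K" if y: "y \<in> carrier G" for y
    proof -
      have "sign (f y) = 1 \<or> sign (f y) = - 1" by (simp add: sign_def)
      then have "sign (f y \<circ> f y) = 1"
        using sg.hom_mult[OF y y] comp[OF y y] by (auto simp: sign_img_def)
      then show ?thesis using y comp by (simp add: kernel_def sign_img_def)
    qed
    show ?thesis
    proof (cases "p = 2")
      case True
      then have "x = \<one>" using x p by (auto simp: cls_def)
      then show ?thesis using sq[of \<one>] by simp
    next
      case False
      then have "odd p" using p(1) prime_odd_nat prime_ge_2_nat[OF p(1)] by auto
      then obtain k where "p = 2 * k + 1" by (elim oddE)
      then have "(k + 1) + (k + 1) = p + 1" by simp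
      then have "x [^] (k + 1) \<otimes> x [^] (k + 1) = x [^] (p + 1)" using nat_pow_mult x(1) by metis
      also have "\<dots> = x" using x p by simp
      finally show ?thesis using sq[of "x [^] (k + 1)"] x by simp
    qed
  qed
  have K: "subgroup ?K G" by (rule sg.subgroup_kernel)
  have "card (cls 2) * 12 = 60 * 3" using card_cls[OF two] sp2 q og by simp
  then have "card (cls 2) = 15" by simp
  then have "card (carrier G - cls 2) = 45"
    using og by (subst card_Diff_subset) (auto simp: order_def cls_def)
  moreover have "card (carrier G - cls 2) \<le> card ?K"
    using evenK fin_subgroup[OF K] by (intro card_mono) auto
  ultimately have "45 \<le> card ?K" by simp
  moreover obtain m where "60 = card ?K * m" using subgroup_order_dvd[OF K] og by (elim dvdE) simp
  moreover have "m = 1"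
  proof (rule ccontr)
    assume "m \<noteq> 1"
    moreover have "m \<noteq> 0" using \<open>60 = card ?K * m\<close> by (cases m) auto
    ultimately have "45 * 2 \<le> card ?K * m" using \<open>45 \<le> card ?K\<close> by (intro mult_le_mono) auto
    then show False using \<open>60 = card ?K * m\<close> by linarith
  qed
  ultimately have "card ?K = 60" by simp
  then have "?K = carrier G"
    using og subgroup.subset[OF K] by (intro card_subset_eq) (auto simp: order_def)
  then have alt: "f g \<in> carrier (alt_group 5)" if "g \<in> carrier G" for g
    using that perm by (auto simp: alt_group_carrier kernel_def sign_img_def sign_def split: if_splits)
  have "card (carrier (alt_group 5)) = 60"
    using alt_group_card_carrier[of 5] by (simp add: fact_numeral)
  moreover have "finite (carrier (alt_group 5))"
    using calculation card.infinite by fastforce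
  ultimately have "f ` carrier G = carrier (alt_group 5)"
    using alt card_image[OF inj] og by (intro card_subset_eq) (auto simp: order_def)
  then have "f \<in> iso G (alt_group 5)"
    using inj alt comp by (auto simp: iso_def hom_def bij_betw_def alt_group_mult)
  then show ?thesis by (rule is_isoI)
qed

end

text \<open>One of \<open>q\<close>, \<open>q + 1\<close>, \<open>q + 2\<close> is divisible by 3,
  and \<open>q + 1\<close> is a power of 2. If 3 divides \<open>q\<close>, the group is identified;
  if 3 divides \<open>sp r = q + 2\<close>, then \<open>r = 3\<close>, which the triples of points
  exclude.\<close>

theorem (in epo) even_classification:
  assumes two: "2 \<in> primes"
  shows "(\<exists>p\<in>primes. order G = sp p * np p) \<or> G \<cong> alt_group 5"
proof (rule disjCI, rule ccontr)
  assume no: "\<not> G \<cong> alt_group 5" and nn: "\<not> (\<exists>p\<in>primes. order G = sp p * np p)"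
  have nn': "order G \<noteq> sp p * np p" if "p \<in> primes" for p using nn that by blast
  obtain q r where qr: "q \<in> primes" "r \<in> primes" "odd q" "odd r" "q \<noteq> r" "sp 2 = q + 1" "np 2 = q" "sp q = q" "np q = 2"
    "sp r = q + 2" "np r = 2" "order G = (q + 1) * q * (q + 2)"
    by (rule even_structure[OF two nn'])
  interpret epo_even G q
    using epo_axioms two qr by (simp add: epo_even_def epo_even_axioms_def)
  have "\<not> 3 dvd q + 1"
  proof
    assume "3 dvd q + 1"
    then have "3 dvd (2::nat) ^ multiplicity 2 (order G)" using qr(6) sp_eq[of 2] by simp
    then have "3 dvd (2::nat)" by (rule prime_dvd_power[rotated]) simp
    then show False by simp
  qed
  then have "3 dvd q \<or> 3 dvd q + 2" by presburger
  then show False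
  proof
    assume "3 dvd q"
    then have "q = 3" using q3(1) primes_dvd_imp_eq[of 3 q] by simp
    then show False using iso_alt_group_5 no by blast
  next
    assume "3 dvd q + 2"
    then have "3 dvd r ^ multiplicity r (order G)" using qr(2,10) sp_eq[of r] by (simp add: primes_iff)
    then have "3 dvd r" by (rule prime_dvd_power[rotated]) simp
    then have "r = 3" using qr(2) primes_dvd_imp_eq[of 3 r] by (simp add: primes_iff)
    then show False using three_not_dvd qr by metis
  qed
qed

section \<open>Characters via the group algebra\<close>

text \<open>Subtract the projection onto a nonzero column; the trace drops by one.\<close>

lemma hermitian_idempotent_trace:
  fixes M :: "'b \<Rightarrow> 'b \<Rightarrow> complex"
  assumes A: "finite A"
    and herm: "\<And>x y. x \<in> A \<Longrightarrow> y \<in> A \<Longrightarrow> M y x = cnj (M x y)"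
    and idem: "\<And>x y. x \<in> A \<Longrightarrow> y \<in> A \<Longrightarrow> (\<Sum>z\<in>A. M x z * M z y) = M x y"
  shows "\<exists>n::nat. (\<Sum>x\<in>A. M x x) = of_nat n"
  using herm idem
proof (induction "nat \<lfloor>Re (\<Sum>x\<in>A. M x x)\<rfloor>" arbitrary: M rule: less_induct)
  case (less M)
  have diag: "M x x = of_real (\<Sum>z\<in>A. (cmod (M x z))\<^sup>2)" if "x \<in> A" for x
  proof -
    have "M x x = (\<Sum>z\<in>A. M x z * cnj (M x z))"
      using less.prems(1)[OF that] less.prems(2)[OF that that] by simp
    then show ?thesis by (simp add: complex_norm_square[symmetric])
  qed
  show ?case
  proof (cases "\<forall>a\<in>A. M a a = 0")
    case True
    then show ?thesis by (intro exI[of _ 0]) simp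
  next
    case False
    then obtain a where a: "a \<in> A" "M a a \<noteq> 0" by blast
    define N where "N x y = M x y - M x a * M a y / M a a" for x y
    have raa: "cnj (M a a) = M a a" using less.prems(1)[OF a(1) a(1)] by simp
    have herm: "N y x = cnj (N x y)" if "x \<in> A" "y \<in> A" for x y
      using less.prems(1)[OF that] less.prems(1)[OF that(1) a(1)] less.prems(1)[OF a(1) that(2)] raa
      by (simp add: N_def)
    have idem: "(\<Sum>z\<in>A. N x z * N z y) = N x y" if "x \<in> A" "y \<in> A" for x y
    proof -
      have "(\<Sum>z\<in>A. N x z * N z y) = (\<Sum>z\<in>A. M x z * M z y) - (\<Sum>z\<in>A. M x z * M z a) * M a y / M a a
          - M x a * (\<Sum>z\<in>A. M a z * M z y) / M a a
          + M x a * (\<Sum>z\<in>A. M a z * M z a) * M a y / (M a a * M a a)"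
        by (simp add: N_def algebra_simps sum.distrib sum_subtractf sum_distrib_left sum_distrib_right
            sum_divide_distrib)
      also have "\<dots> = N x y"
        using that a by (simp add: less.prems(2) N_def)
      finally show ?thesis .
    qed
    have "(\<Sum>x\<in>A. M x a * M a x) = (\<Sum>x\<in>A. M a x * M x a)" by (simp add: mult.commute)
    then have tr: "(\<Sum>x\<in>A. M x x) = (\<Sum>x\<in>A. N x x) + 1"
      using a less.prems(2)[OF a(1) a(1)] by (simp add: N_def sum_subtractf flip: sum_divide_distrib)
    have "N x x = of_real (\<Sum>z\<in>A. (cmod (N x z))\<^sup>2)" if "x \<in> A" for x
    proof -
      have "N x x = (\<Sum>z\<in>A. N x z * cnj (N x z))"
        using herm[OF that] idem[OF that that] by simp
      then show ?thesis by (simp add: complex_norm_square[symmetric])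
    qed
    then have "0 \<le> Re (\<Sum>x\<in>A. N x x)" by (simp add: sum_nonneg)
    then have "nat \<lfloor>Re (\<Sum>x\<in>A. N x x)\<rfloor> < nat \<lfloor>Re (\<Sum>x\<in>A. M x x)\<rfloor>" unfolding tr by simp
    then obtain n :: nat where "(\<Sum>x\<in>A. N x x) = of_nat n" using less.hyps[of N] herm idem by blast
    then show ?thesis unfolding tr by (intro exI[of _ "Suc n"]) simp
  qed
qed

lemma mult_if_delta: "(if P then 1 else 0) * (c::complex) = (if P then c else 0)"
  "(c::complex) * (if P then 1 else 0) = (if P then c else 0)"
  by simp_all

text \<open>Elimination of one coordinate at a time. It later yields an annihilating polynomial for
  an element of the group algebra.\<close>

lemma linear_dependence:
  fixes v :: "'i \<Rightarrow> 'b \<Rightarrow> complex"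
  assumes "finite A" "finite I" "card A < card I"
  shows "\<exists>c. (\<exists>i\<in>I. c i \<noteq> 0) \<and> (\<forall>x\<in>A. (\<Sum>i\<in>I. c i * v i x) = 0)"
  using assms
proof (induction A arbitrary: I v)
  case empty
  then have "I \<noteq> {}" by auto
  then show ?case by (intro exI[of _ "\<lambda>_. 1"]) auto
next
  case (insert a A)
  show ?case
  proof (cases "\<forall>i\<in>I. v i a = 0")
    case True
    obtain c where "\<exists>i\<in>I. c i \<noteq> 0" "\<forall>x\<in>A. (\<Sum>i\<in>I. c i * v i x) = 0"
      using insert.IH[of I v] insert.prems insert.hyps by auto
    with True show ?thesis by (intro exI[of _ c]) auto
  next
    case False
    then obtain j where j: "j \<in> I" "v j a \<noteq> 0" by blast
    define w where "w i x = v i x - v i a / v j a * v j x" for i x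
    have "card A < card (I - {j})" using insert j by (simp add: card_Diff_singleton)
    then obtain c where c: "\<exists>i\<in>I - {j}. c i \<noteq> 0" "\<forall>x\<in>A. (\<Sum>i\<in>I - {j}. c i * w i x) = 0"
      using insert.IH[of "I - {j}" w] insert.prems by auto
    define d where "d i = (if i = j then - (\<Sum>i\<in>I - {j}. c i * v i a / v j a) else c i)" for i
    have "(\<Sum>i\<in>I. d i * v i x) = (\<Sum>i\<in>I - {j}. c i * w i x)" for x
    proof -
      have "(\<Sum>i\<in>I. d i * v i x) = d j * v j x + (\<Sum>i\<in>I - {j}. c i * v i x)"
        using j insert.prems by (simp add: sum.remove[of I j] d_def)
      also have "\<dots> = (\<Sum>i\<in>I - {j}. c i * w i x)"
        by (simp add: d_def w_def algebra_simps sum_subtractf sum_distrib_left)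
      finally show ?thesis .
    qed
    moreover have "(\<Sum>i\<in>I - {j}. c i * w i a) = 0" using j by (simp add: w_def)
    moreover have "\<exists>i\<in>I. d i \<noteq> 0" using c(1) by (auto simp: d_def)
    ultimately show ?thesis using c(2) by (intro exI[of _ d]) auto
  qed
qed

section \<open>The group algebra with convolution and adjoint\<close>

context fin_group
begin

lemma sum_lmult: "y \<in> carrier G \<Longrightarrow> (\<Sum>x\<in>carrier G. f (y \<otimes> x)) = (\<Sum>x\<in>carrier G. f x)"
  by (rule sum.reindex_bij_betw, rule bij_betw_byWitness[where f' = "\<lambda>x. inv y \<otimes> x"]) auto

lemma sum_inv: "(\<Sum>x\<in>carrier G. f (inv x)) = (\<Sum>x\<in>carrier G. f x)"
  by (rule sum.reindex_bij_betw, rule bij_betw_byWitness[where f' = "m_inv G"]) auto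

lemma sum_rmult: "y \<in> carrier G \<Longrightarrow> (\<Sum>x\<in>carrier G. f (x \<otimes> y)) = (\<Sum>x\<in>carrier G. f x)"
  by (rule sum.reindex_bij_betw, rule bij_betw_byWitness[where f' = "\<lambda>x. x \<otimes> inv y"]) (auto simp: m_assoc)

lemma sum_cj: "y \<in> carrier G \<Longrightarrow> (\<Sum>x\<in>carrier G. f (cj y x)) = (\<Sum>x\<in>carrier G. f x)"
  by (rule sum.reindex_bij_betw[OF cj_bij])

definition conv :: "('a \<Rightarrow> complex) \<Rightarrow> ('a \<Rightarrow> complex) \<Rightarrow> 'a \<Rightarrow> complex" (infixl \<open>\<star>\<close> 70) where
  "(a \<star> b) z = (if z \<in> carrier G then \<Sum>u\<in>carrier G. a u * b (inv u \<otimes> z) else 0)"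

definition star :: "('a \<Rightarrow> complex) \<Rightarrow> 'a \<Rightarrow> complex" where
  "star a z = (if z \<in> carrier G then cnj (a (inv z)) else 0)"

definition delta :: "'a \<Rightarrow> 'a \<Rightarrow> complex" where
  "delta v z = (if z = v then 1 else 0)"

definition el :: "('a \<Rightarrow> complex) \<Rightarrow> bool" where
  "el a \<longleftrightarrow> (\<forall>x. x \<notin> carrier G \<longrightarrow> a x = 0)"

definition class_fun :: "('a \<Rightarrow> complex) \<Rightarrow> bool" where
  "class_fun a \<longleftrightarrow> el a \<and> (\<forall>y\<in>carrier G. \<forall>x\<in>carrier G. a (cj y x) = a x)"

definition ip :: "('a \<Rightarrow> complex) \<Rightarrow> ('a \<Rightarrow> complex) \<Rightarrow> complex" where
  "ip a b = (\<Sum>x\<in>carrier G. a x * cnj (b x)) / of_nat (order G)"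

text \<open>For a projection \<open>e\<close> this is, up to complex conjugation, the character of
  the left ideal generated by \<open>e\<close>: the trace of left translation by \<open>x\<close> on
  that ideal is \<open>ch e (inv x)\<close>.\<close>

definition ch :: "('a \<Rightarrow> complex) \<Rightarrow> 'a \<Rightarrow> complex" where
  "ch a x = (if x \<in> carrier G then \<Sum>y\<in>carrier G. a (cj y x) else 0)"

definition proj :: "('a \<Rightarrow> complex) \<Rightarrow> bool" where
  "proj e \<longleftrightarrow> e \<star> e = e \<and> star e = e"

text \<open>Primitivity is encoded by a corner algebra that consists of scalars only. This makes the
  operator \<open>e \<star> b \<star> e\<close> on the group algebra have rank one, and its failure
  supplies an element from which a smaller projection can be made.\<close>

definition prim :: "('a \<Rightarrow> complex) \<Rightarrow> bool" where
  "prim e \<longleftrightarrow> proj e \<and> e \<noteq> (\<lambda>_. 0) \<and> (\<forall>a. \<exists>c. e \<star> a \<star> e = (\<lambda>x. c * e x))"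

lemma el_conv [simp]: "el (a \<star> b)"
  by (simp add: el_def conv_def)

lemma el_star [simp]: "el (star a)"
  by (simp add: el_def star_def)

lemma el_eqI: "el a \<Longrightarrow> el b \<Longrightarrow> (\<And>x. x \<in> carrier G \<Longrightarrow> a x = b x) \<Longrightarrow> a = b"
  by (rule ext) (metis el_def)

lemma el_proj: "proj e \<Longrightarrow> el e"
  by (metis el_conv proj_def)

lemma conv_assoc: "a \<star> b \<star> c = a \<star> (b \<star> c)"
proof (rule el_eqI)
  fix z assume z: "z \<in> carrier G"
  have "(a \<star> b \<star> c) z = (\<Sum>u\<in>carrier G. \<Sum>v\<in>carrier G. a v * b (inv v \<otimes> u) * c (inv u \<otimes> z))"
    using z by (simp add: conv_def sum_distrib_right)
  also have "\<dots> = (\<Sum>v\<in>carrier G. \<Sum>u\<in>carrier G. a v * b (inv v \<otimes> u) * c (inv u \<otimes> z))"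
    by (rule sum.swap)
  also have "\<dots> = (\<Sum>v\<in>carrier G. \<Sum>w\<in>carrier G. a v * b w * c (inv w \<otimes> (inv v \<otimes> z)))"
  proof (rule sum.cong[OF refl])
    fix v assume v: "v \<in> carrier G"
    show "(\<Sum>u\<in>carrier G. a v * b (inv v \<otimes> u) * c (inv u \<otimes> z))
        = (\<Sum>w\<in>carrier G. a v * b w * c (inv w \<otimes> (inv v \<otimes> z)))"
      by (subst sum_lmult[OF v, symmetric], rule sum.cong) (use v z in \<open>auto simp: inv_mult_group m_assoc\<close>)
  qed
  also have "\<dots> = (a \<star> (b \<star> c)) z"
    using z by (simp add: conv_def sum_distrib_left mult.assoc)
  finally show "(a \<star> b \<star> c) z = (a \<star> (b \<star> c)) z" .
qed simp_all

lemma conv_add: "(\<lambda>x. a x + b x) \<star> c = (\<lambda>x. (a \<star> c) x + (b \<star> c) x)"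
  "c \<star> (\<lambda>x. a x + b x) = (\<lambda>x. (c \<star> a) x + (c \<star> b) x)"
  by (rule ext, simp add: conv_def algebra_simps sum.distrib)+

lemma conv_diff: "(\<lambda>x. a x - b x) \<star> c = (\<lambda>x. (a \<star> c) x - (b \<star> c) x)"
  "c \<star> (\<lambda>x. a x - b x) = (\<lambda>x. (c \<star> a) x - (c \<star> b) x)"
  by (rule ext, simp add: conv_def algebra_simps sum_subtractf)+

lemma conv_scale: "(\<lambda>x. k * a x) \<star> c = (\<lambda>x. k * (a \<star> c) x)"
  "c \<star> (\<lambda>x. k * a x) = (\<lambda>x. k * (c \<star> a) x)"
  by (rule ext, simp add: conv_def algebra_simps sum_distrib_left)+

lemma conv_zero [simp]: "(\<lambda>_. 0) \<star> c = (\<lambda>_. 0)" "c \<star> (\<lambda>_. 0) = (\<lambda>_. 0)"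
  by (rule ext, simp add: conv_def)+

lemma star_conv: "star (a \<star> b) = star b \<star> star a"
proof (rule el_eqI)
  fix z assume z: "z \<in> carrier G"
  have "star (a \<star> b) z = (\<Sum>u\<in>carrier G. cnj (a u) * cnj (b (inv u \<otimes> inv z)))"
    using z by (simp add: star_def conv_def)
  also have "\<dots> = (\<Sum>w\<in>carrier G. cnj (a (inv z \<otimes> w)) * cnj (b (inv w)))"
    by (subst sum_lmult[of "inv z", symmetric], use z in simp, rule sum.cong)
      (use z in \<open>auto simp: inv_mult_group m_assoc\<close>)
  also have "\<dots> = (star b \<star> star a) z"
    using z by (auto simp: star_def conv_def inv_mult_group intro!: sum.cong)
  finally show "star (a \<star> b) z = (star b \<star> star a) z" .
qed simp_all

lemma star_star: "el a \<Longrightarrow> star (star a) = a"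
  by (rule el_eqI) (simp_all add: star_def)

lemma star_add: "star (\<lambda>x. a x + b x) = (\<lambda>x. star a x + star b x)"
  by (rule ext) (simp add: star_def)

lemma star_diff: "star (\<lambda>x. a x - b x) = (\<lambda>x. star a x - star b x)"
  by (rule ext) (simp add: star_def)

lemma star_scale: "star (\<lambda>x. k * a x) = (\<lambda>x. cnj k * star a x)"
  by (rule ext) (simp add: star_def)

lemma delta_conv: "el a \<Longrightarrow> delta \<one> \<star> a = a" "el a \<Longrightarrow> a \<star> delta \<one> = a"
proof -
  assume a: "el a"
  show "delta \<one> \<star> a = a"
  proof (rule el_eqI)
    fix z assume z: "z \<in> carrier G"
    have "(delta \<one> \<star> a) z = (\<Sum>u\<in>carrier G. if u = \<one> then a (inv u \<otimes> z) else 0)"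
      using z by (simp add: conv_def delta_def mult_if_delta)
    then show "(delta \<one> \<star> a) z = a z" using z by simp
  qed (simp_all add: a)
  show "a \<star> delta \<one> = a"
  proof (rule el_eqI)
    fix z assume z: "z \<in> carrier G"
    have "(a \<star> delta \<one>) z = (\<Sum>u\<in>carrier G. if z = u then a u else 0)"
      using z by (auto simp: conv_def delta_def inv_solve_left' mult_if_delta intro!: sum.cong)
    then show "(a \<star> delta \<one>) z = a z" using z by simp
  qed (simp_all add: a)
qed

lemma proj_delta: "proj (delta \<one>)"
proof -
  have "el (delta \<one>)" by (auto simp: el_def delta_def)
  then show ?thesis
    by (auto simp: proj_def delta_conv star_def delta_def intro!: ext)
qed

lemma star_self_one: "(star a \<star> a) \<one> = of_real (\<Sum>u\<in>carrier G. (cmod (a u))\<^sup>2)"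
proof -
  have "(star a \<star> a) \<one> = (\<Sum>u\<in>carrier G. cnj (a (inv u)) * a (inv u))"
    by (auto simp: conv_def star_def intro!: sum.cong)
  also have "\<dots> = (\<Sum>u\<in>carrier G. a u * cnj (a u))" by (subst sum_inv) (simp add: mult.commute)
  finally show ?thesis by (simp add: complex_norm_square[symmetric])
qed

lemma star_self_pos:
  assumes "el a" "a \<noteq> (\<lambda>_. 0)"
  shows "0 < (\<Sum>u\<in>carrier G. (cmod (a u))\<^sup>2)"
proof -
  obtain u where "a u \<noteq> 0" using assms(2) by auto
  moreover from this have "u \<in> carrier G" using assms(1) by (auto simp: el_def)
  ultimately show ?thesis by (intro sum_pos2[of _ u]) auto
qed

lemma proj_one: "proj e \<Longrightarrow> e \<one> = of_real (\<Sum>u\<in>carrier G. (cmod (e u))\<^sup>2)"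
  using star_self_one[of e] by (simp add: proj_def)

lemma class_fun_ch: "class_fun (ch a)"
proof -
  have "(\<Sum>y\<in>carrier G. a (cj y (cj z x))) = (\<Sum>y\<in>carrier G. a (cj y x))"
    if "z \<in> carrier G" "x \<in> carrier G" for z x
    using that sum_rmult[of z "\<lambda>y. a (cj y x)"] by (simp add: cj_cj)
  then show ?thesis by (simp add: class_fun_def ch_def el_def)
qed

lemma ip_ch:
  assumes "class_fun b"
  shows "ip (ch a) b = (\<Sum>x\<in>carrier G. a x * cnj (b x))"
proof -
  have "(\<Sum>x\<in>carrier G. ch a x * cnj (b x)) = (\<Sum>x\<in>carrier G. \<Sum>y\<in>carrier G. a (cj y x) * cnj (b (cj y x)))"
    using assms by (auto simp: ch_def class_fun_def sum_distrib_right intro!: sum.cong)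
  also have "\<dots> = (\<Sum>y\<in>carrier G. \<Sum>x\<in>carrier G. a (cj y x) * cnj (b (cj y x)))" by (rule sum.swap)
  also have "\<dots> = of_nat (order G) * (\<Sum>x\<in>carrier G. a x * cnj (b x))"
    by (simp add: sum_cj[where f = "\<lambda>x. a x * cnj (b x)"] order_def)
  finally show ?thesis using order_pos by (simp add: ip_def)
qed

lemma sandwich_delta:
  assumes "y \<in> carrier G" "z \<in> carrier G"
  shows "(e \<star> delta z \<star> f) y = (\<Sum>u\<in>carrier G. e u * f (inv z \<otimes> (inv u \<otimes> y)))"
proof -
  have "(delta z \<star> f) w = f (inv z \<otimes> w)" if w: "w \<in> carrier G" for w
  proof -
    have "(delta z \<star> f) w = (\<Sum>u\<in>carrier G. if u = z then f (inv u \<otimes> w) else 0)"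
      using w by (simp add: conv_def delta_def mult_if_delta)
    then show ?thesis using assms by simp
  qed
  then show ?thesis using assms unfolding conv_assoc by (subst conv_def) auto
qed

text \<open>In other words, \<open>(e \<star> delta z \<star> f) y\<close> is the matrix, with rows
  \<open>y\<close> and columns \<open>z\<close>, of the operator that sends \<open>b\<close> to
  \<open>e \<star> b \<star> f\<close>.\<close>

lemma sandwich:
  assumes "y \<in> carrier G"
  shows "(\<Sum>z\<in>carrier G. (e \<star> delta z \<star> f) y * b z) = (e \<star> b \<star> f) y"
proof -
  have "(\<Sum>z\<in>carrier G. (e \<star> delta z \<star> f) y * b z)
      = (\<Sum>z\<in>carrier G. \<Sum>u\<in>carrier G. e u * (b z * f (inv z \<otimes> (inv u \<otimes> y))))"
    using assms by (simp add: sandwich_delta sum_distrib_left mult_ac)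
  also have "\<dots> = (\<Sum>u\<in>carrier G. \<Sum>z\<in>carrier G. e u * (b z * f (inv z \<otimes> (inv u \<otimes> y))))" by (rule sum.swap)
  also have "\<dots> = (e \<star> b \<star> f) y"
    unfolding conv_assoc using assms by (simp add: conv_def sum_distrib_left)
  finally show ?thesis .
qed

lemma ip_ch_trace:
  assumes "star f = f"
  shows "ip (ch e) (ch f) = (\<Sum>y\<in>carrier G. (e \<star> delta y \<star> f) y)"
proof -
  have f: "cnj (f x) = f (inv x)" if "x \<in> carrier G" for x
    using fun_cong[OF assms, of "inv x"] that by (simp add: star_def)
  have "ip (ch e) (ch f) = (\<Sum>u\<in>carrier G. e u * (\<Sum>y\<in>carrier G. cnj (f (cj y u))))"
    by (simp add: ip_ch class_fun_ch ch_def)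
  also have "\<dots> = (\<Sum>u\<in>carrier G. e u * (\<Sum>y\<in>carrier G. f (inv y \<otimes> (inv u \<otimes> y))))"
  proof (rule sum.cong[OF refl])
    fix u assume u: "u \<in> carrier G"
    have "(\<Sum>y\<in>carrier G. cnj (f (cj y u))) = (\<Sum>y\<in>carrier G. cnj (f (cj (inv y) u)))"
      by (rule sum_inv[symmetric])
    also have "\<dots> = (\<Sum>y\<in>carrier G. f (inv y \<otimes> (inv u \<otimes> y)))"
      using u by (auto simp: f cj_def inv_mult_group m_assoc intro!: sum.cong)
    finally show "e u * (\<Sum>y\<in>carrier G. cnj (f (cj y u))) = e u * (\<Sum>y\<in>carrier G. f (inv y \<otimes> (inv u \<otimes> y)))"
      by simp
  qed
  also have "\<dots> = (\<Sum>y\<in>carrier G. \<Sum>u\<in>carrier G. e u * f (inv y \<otimes> (inv u \<otimes> y)))"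
    unfolding sum_distrib_left by (rule sum.swap)
  also have "\<dots> = (\<Sum>y\<in>carrier G. (e \<star> delta y \<star> f) y)" by (simp add: sandwich_delta)
  finally show ?thesis .
qed

text \<open>For projections \<open>e\<close> and \<open>f\<close> the operator that sends
  \<open>b\<close> to \<open>e \<star> b \<star> f\<close> is a Hermitian idempotent, and the inner
  product is its trace. This takes the place of the dimension of a space of homomorphisms.\<close>

lemma ip_ch_nat:
  assumes "proj e" "proj f"
  shows "\<exists>n::nat. ip (ch e) (ch f) = of_nat n"
proof -
  have ef: "star e = e" "star f = f" "e \<star> e = e" "f \<star> f = f" using assms by (simp_all add: proj_def)
  have cnj: "cnj (h x) = h (inv x)" if "star h = h" "x \<in> carrier G" for h x
    using fun_cong[OF that(1), of "inv x"] that(2) by (simp add: star_def)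
  define M where "M y z = (e \<star> delta z \<star> f) y" for y z
  have "\<exists>n::nat. (\<Sum>x\<in>carrier G. M x x) = of_nat n"
  proof (rule hermitian_idempotent_trace[where M = M])
    fix y z assume yz: "y \<in> carrier G" "z \<in> carrier G"
    have "cnj (M y z) = (\<Sum>u\<in>carrier G. e (inv u) * f (inv y \<otimes> (u \<otimes> z)))"
      using yz by (auto simp: M_def sandwich_delta cnj ef inv_mult_group m_assoc intro!: sum.cong)
    also have "\<dots> = (\<Sum>u\<in>carrier G. e (inv (inv u)) * f (inv y \<otimes> (inv u \<otimes> z)))" by (rule sum_inv[symmetric])
    finally show "M z y = cnj (M y z)" using yz by (simp add: M_def sandwich_delta)
    have "(\<Sum>x\<in>carrier G. M y x * M x z) = (e \<star> (e \<star> delta z \<star> f) \<star> f) y"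
      unfolding M_def by (rule sandwich[OF yz(1)])
    also have "e \<star> (e \<star> delta z \<star> f) \<star> f = (e \<star> e) \<star> delta z \<star> (f \<star> f)" by (simp only: conv_assoc)
    finally show "(\<Sum>x\<in>carrier G. M y x * M x z) = M y z" by (simp add: M_def ef)
  qed simp
  then show ?thesis using ip_ch_trace[OF ef(2)] by (simp add: M_def)
qed

text \<open>With \<open>delta \<one>\<close> as second projection the trace is the dimension of the
  ideal of \<open>e\<close>; it serves as the measure for splitting projections.\<close>

lemma rank_nat:
  assumes "proj e"
  shows "\<exists>n::nat. of_nat (order G) * e \<one> = of_nat n \<and> (0 < n \<longleftrightarrow> e \<noteq> (\<lambda>_. 0))"
proof -
  have "ip (ch e) (ch (delta \<one>)) = (\<Sum>x\<in>carrier G. if x = \<one> then e x * of_nat (order G) else 0)"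
    by (subst ip_ch[OF class_fun_ch], rule sum.cong) (auto simp: ch_def delta_def order_def)
  then have eq: "ip (ch e) (ch (delta \<one>)) = of_nat (order G) * e \<one>" by (simp add: mult.commute)
  then obtain n :: nat where n: "of_nat (order G) * e \<one> = of_nat n"
    using ip_ch_nat[OF assms proj_delta] by auto
  have "0 < n" if "e \<noteq> (\<lambda>_. 0)"
  proof -
    have "e \<one> \<noteq> 0" using star_self_pos[OF el_proj[OF assms] that] by (subst proj_one[OF assms]) (simp only: of_real_eq_0_iff)
    then show ?thesis using n order_pos by (cases n) auto
  qed
  moreover have "n = 0" if "e = (\<lambda>_. 0)" using n that by simp
  ultimately show ?thesis using n by blast
qed

end

text \<open>Polynomials in an element \<open>b\<close> of the corner algebra of a projection \<open>e\<close>, which serves as unit.\<close>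

context fin_group
begin

definition ev :: "('a \<Rightarrow> complex) \<Rightarrow> ('a \<Rightarrow> complex) \<Rightarrow> complex poly \<Rightarrow> 'a \<Rightarrow> complex" where
  "ev e b p = fold_coeffs (\<lambda>c v x. c * e x + (b \<star> v) x) p (\<lambda>_. 0)"

lemma ev_0 [simp]: "ev e b 0 = (\<lambda>_. 0)"
  by (simp add: ev_def)

lemma ev_pCons: "ev e b (pCons c p) = (\<lambda>x. c * e x + (b \<star> ev e b p) x)"
  by (cases "c = 0 \<and> p = 0") (auto simp: ev_def)

end

locale corner = fin_group +
  fixes e b
  assumes e: "proj e" and b: "star b = b" "e \<star> b = b" "b \<star> e = b"
begin

abbreviation evb where "evb \<equiv> ev e b"

lemma ee: "e \<star> e = e" "star e = e"
  using e by (simp_all add: proj_def)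

lemma ev_e: "e \<star> evb p = evb p" "evb p \<star> e = evb p"
proof -
  show "e \<star> evb p = evb p"
    by (induction p) (simp_all add: ev_pCons conv_add conv_scale ee b flip: conv_assoc)
  show "evb p \<star> e = evb p"
    by (induction p) (simp_all add: ev_pCons conv_add conv_scale ee b conv_assoc)
qed

lemma el_ev: "el (evb p)"
  using ev_e(1)[of p] el_conv by metis

lemma ev_add: "evb (p + q) = (\<lambda>x. evb p x + evb q x)"
proof (induction p arbitrary: q)
  case (pCons c p)
  obtain a r where q: "q = pCons a r" by (cases q)
  have "evb (pCons c p + q) = (\<lambda>x. (c + a) * e x + (b \<star> (\<lambda>x. evb p x + evb r x)) x)"
    by (simp add: q ev_pCons pCons.IH)
  then show ?case by (simp add: q ev_pCons conv_add algebra_simps)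
qed simp

lemma ev_smult: "evb (smult c p) = (\<lambda>x. c * evb p x)"
  by (induction p) (simp_all add: ev_pCons conv_scale algebra_simps)

lemma ev_mult: "evb (p * q) = evb p \<star> evb q"
proof (induction p)
  case (pCons c p)
  have "evb (pCons c p * q) = (\<lambda>x. c * evb q x + (b \<star> (evb p \<star> evb q)) x)"
    by (simp add: ev_add ev_smult ev_pCons pCons.IH)
  also have "\<dots> = evb (pCons c p) \<star> evb q"
    by (simp add: ev_pCons conv_add conv_scale ev_e conv_assoc)
  finally show ?case .
qed simp

lemma ev_commute: "evb p \<star> evb q = evb q \<star> evb p"
  by (metis ev_mult mult.commute)

lemma ev_b: "evb [:0, 1:] = b"
  by (rule ext) (simp add: ev_pCons conv_scale conv_add b el_def)

lemma b_ev: "b \<star> evb p = evb p \<star> b"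
  using ev_commute[of "[:0, 1:]" p] by (simp add: ev_b)

lemma star_ev: "star (evb p) = evb (map_poly cnj p)"
proof (induction p)
  case (pCons c p)
  have "star (evb (pCons c p)) = (\<lambda>x. cnj c * e x + (star (evb p) \<star> b) x)"
    by (simp add: ev_pCons star_add star_scale ee star_conv b)
  then show ?case
    by (simp add: ev_pCons pCons.IH b_ev map_poly_pCons)
qed (simp add: star_def fun_eq_iff)

lemma annihilating_poly: "\<exists>p. p \<noteq> 0 \<and> evb p = (\<lambda>_. 0)"
proof -
  define v where "v i = evb (monom 1 i)" for i
  obtain c where c: "\<exists>i\<in>{..card (carrier G)}. c i \<noteq> 0"
    "\<forall>x\<in>carrier G. (\<Sum>i\<in>{..card (carrier G)}. c i * v i x) = 0"
    using linear_dependence[of "carrier G" "{..card (carrier G)}" v] by auto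
  define p where "p = (\<Sum>i\<in>{..card (carrier G)}. smult (c i) (monom 1 i))"
  have "evb (\<Sum>i\<in>A. smult (c i) (monom 1 i)) x = (\<Sum>i\<in>A. c i * v i x)" if "finite A" for A x
    using that by (induction A) (simp_all add: ev_add ev_smult v_def)
  then have "evb p x = 0" if "x \<in> carrier G" for x using c(2) that by (simp add: p_def)
  then have "evb p = (\<lambda>_. 0)" using el_ev[of p] by (auto simp: el_def fun_eq_iff)
  moreover have "p \<noteq> 0"
  proof
    assume "p = 0"
    obtain i where i: "i \<le> card (carrier G)" "c i \<noteq> 0" using c(1) by auto
    have "Polynomial.coeff p i = (\<Sum>j\<in>{..card (carrier G)}. if j = i then c j else 0)"
      by (simp add: p_def Polynomial.coeff_sum Polynomial.coeff_monom mult_if_delta)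
    then show False using \<open>p = 0\<close> i by simp
  qed
  ultimately show ?thesis by blast
qed

text \<open>Divide a minimal annihilating polynomial of \<open>b\<close> by \<open>X - l\<close> for
  a root \<open>l\<close>, giving \<open>r\<close>. Then \<open>c = evb r\<close> is a nonzero
  eigenvector, on which every polynomial in \<open>b\<close> acts by its value at \<open>l\<close>.
  As \<open>b\<close> is self-adjoint, \<open>star c\<close> is such a polynomial, so
  \<open>star c \<star> c\<close> is a multiple of \<open>c\<close>, nonzero by positivity; scaling
  makes \<open>c\<close> a projection. It is not \<open>e\<close>, since otherwise \<open>b\<close>
  would be the scalar \<open>l\<close>.\<close>

lemma proper_projection:
  assumes nonscalar: "\<And>c. b \<noteq> (\<lambda>x. c * e x)" and e0: "e \<noteq> (\<lambda>_. 0)"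
  obtains f where "proj f" "f \<noteq> (\<lambda>_. 0)" "f \<noteq> e" "e \<star> f = f" "f \<star> e = f"
proof -
  define p where "p = arg_min degree (\<lambda>p. p \<noteq> 0 \<and> evb p = (\<lambda>_. 0))"
  have p: "p \<noteq> 0" "evb p = (\<lambda>_. 0)"
    and pmin: "\<And>r. r \<noteq> 0 \<Longrightarrow> evb r = (\<lambda>_. 0) \<Longrightarrow> degree p \<le> degree r"
    using arg_min_natI[of "\<lambda>p. p \<noteq> 0 \<and> evb p = (\<lambda>_. 0)" _ degree]
      arg_min_nat_le[of "\<lambda>p. p \<noteq> 0 \<and> evb p = (\<lambda>_. 0)" _ degree] annihilating_poly
    unfolding p_def by blast+
  have "degree p \<noteq> 0"
  proof
    assume "degree p = 0"
    then obtain a where "p = [:a:]" by (rule degree_eq_zeroE)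
    then have "(\<lambda>x. a * e x) = (\<lambda>_. 0)" "a \<noteq> 0" using p by (auto simp: ev_pCons)
    then show False using e0 by (auto simp: fun_eq_iff)
  qed
  then have "\<not> constant (poly p)" by (simp add: constant_degree)
  then obtain l where "poly p l = 0" using fundamental_theorem_of_algebra by blast
  then obtain r where r: "p = [:- l, 1:] * r" by (metis dvdE poly_eq_0_iff_dvd)
  have r0: "r \<noteq> 0" using r p by auto
  have "degree p = Suc (degree r)" unfolding r using r0 by (subst degree_mult_eq) auto
  define c where "c = evb r"
  have c0: "c \<noteq> (\<lambda>_. 0)" using pmin[OF r0] \<open>degree p = Suc (degree r)\<close> by (auto simp: c_def)
  have scal: "evb s \<star> c = (\<lambda>x. poly s l * c x)" for s
  proof -
    have "[:- l, 1:] dvd s - [:poly s l:]" by (simp flip: poly_eq_0_iff_dvd)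
    then obtain t where "s - [:poly s l:] = [:- l, 1:] * t" by (elim dvdE)
    then have s: "s = [:poly s l:] + t * [:- l, 1:]" by (metis add.commute diff_add_cancel mult.commute)
    have "evb s \<star> c = evb (s * r)" by (simp add: ev_mult c_def)
    also have "s * r = smult (poly s l) r + t * p" by (subst s) (simp add: r algebra_simps)
    also have "evb \<dots> = (\<lambda>x. poly s l * c x)" by (simp add: ev_add ev_smult ev_mult p c_def)
    finally show ?thesis .
  qed
  define n where "n = poly (map_poly cnj r) l"
  have sc: "star c \<star> c = (\<lambda>x. n * c x)" using scal[of "map_poly cnj r"] by (simp add: c_def star_ev n_def)
  have elc: "el c" by (simp add: c_def el_ev)
  have n0: "n \<noteq> 0"
  proof
    assume "n = 0"
    then have "(star c \<star> c) \<one> = 0" using sc by simp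
    then show False using star_self_pos[OF elc c0] by (simp add: star_self_one del: of_real_sum)
  qed
  have "star (star c \<star> c) = star c \<star> c" by (simp add: star_conv star_star elc)
  then have "(\<lambda>x. cnj n * star c x) = (\<lambda>x. n * c x)" by (simp add: sc star_scale)
  then have st: "star c = (\<lambda>x. n / cnj n * c x)" using n0 by (auto simp: fun_eq_iff field_simps)
  have "(\<lambda>x. n / cnj n * (c \<star> c) x) = (\<lambda>x. n * c x)"
    using sc unfolding st conv_scale(1)[of "n / cnj n"] .
  then have cc: "c \<star> c = (\<lambda>x. cnj n * c x)" using n0 by (auto simp: fun_eq_iff field_simps)
  define f where "f = (\<lambda>x. (1 / cnj n) * c x)"
  have "f \<star> f = f" unfolding f_def conv_scale cc using n0 by (auto simp: fun_eq_iff)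
  moreover have "star f = f" unfolding f_def star_scale st using n0 by (auto simp: fun_eq_iff)
  moreover have "f \<noteq> (\<lambda>_. 0)" using c0 n0 by (auto simp: f_def fun_eq_iff)
  moreover have "e \<star> f = f" "f \<star> e = f" unfolding f_def conv_scale c_def ev_e by (rule refl)+
  moreover have "f \<noteq> e"
  proof
    assume "f = e"
    then have ce: "c = (\<lambda>x. cnj n * e x)" using n0 by (auto simp: f_def fun_eq_iff field_simps)
    have "evb [:0, 1:] \<star> c = (\<lambda>x. l * c x)" using scal[of "[:0, 1:]"] by simp
    then have "(\<lambda>x. cnj n * b x) = (\<lambda>x. l * (cnj n * e x))" by (simp add: ev_b ce conv_scale b)
    then have "b = (\<lambda>x. l * e x)" using n0 by (auto simp: fun_eq_iff field_simps)
    then show False using nonscalar by blast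
  qed
  ultimately show ?thesis using that by (simp add: proj_def)
qed

end

section \<open>Primitive projections and irreducible characters\<close>

context fin_group
begin

text \<open>A non-scalar corner element \<open>d\<close> is a combination of the self-adjoint
  elements \<open>b1\<close> and \<open>b2\<close>, its doubled real part and a multiple of its
  imaginary part; they cannot both be scalar.\<close>

lemma nonprim_split:
  assumes e: "proj e" "e \<noteq> (\<lambda>_. 0)" "\<not> prim e"
  obtains f where "proj f" "f \<noteq> (\<lambda>_. 0)" "f \<noteq> e" "e \<star> f = f" "f \<star> e = f"
proof -
  have ee: "e \<star> e = e" "star e = e" using e by (simp_all add: proj_def)
  obtain a where a: "\<And>c. e \<star> a \<star> e \<noteq> (\<lambda>x. c * e x)" using e unfolding prim_def by blast
  define d where "d = e \<star> a \<star> e"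
  have d: "e \<star> d = d" "d \<star> e = d" "el d" by (simp_all add: d_def conv_assoc ee flip: conv_assoc[of e e])
  have ds: "e \<star> star d = star d" "star d \<star> e = star d"
    using d ee star_conv[of d e] star_conv[of e d] by simp_all
  define b1 where "b1 = (\<lambda>x. 1 * d x + 1 * star d x)"
  define b2 where "b2 = (\<lambda>x. \<i> * d x + (- \<i>) * star d x)"
  have b: "star b1 = b1" "e \<star> b1 = b1" "b1 \<star> e = b1" "star b2 = b2" "e \<star> b2 = b2" "b2 \<star> e = b2"
    unfolding b1_def b2_def star_add star_scale conv_add conv_scale star_star[OF d(3)] d ds by auto
  have "(\<forall>c. b1 \<noteq> (\<lambda>x. c * e x)) \<or> (\<forall>c. b2 \<noteq> (\<lambda>x. c * e x))"
  proof (rule ccontr)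
    assume "\<not> ?thesis"
    then obtain c1 c2 where c: "b1 = (\<lambda>x. c1 * e x)" "b2 = (\<lambda>x. c2 * e x)" by blast
    have "d = (\<lambda>x. (1/2) * (b1 x + (- \<i>) * b2 x))"
      by (auto simp: b1_def b2_def algebra_simps)
    also have "\<dots> = (\<lambda>x. ((c1 - \<i> * c2) / 2) * e x)" by (auto simp: c algebra_simps)
    finally show False using a[of "(c1 - \<i> * c2) / 2"] by (simp add: d_def)
  qed
  then consider "corner G e b1" "\<forall>c. b1 \<noteq> (\<lambda>x. c * e x)" | "corner G e b2" "\<forall>c. b2 \<noteq> (\<lambda>x. c * e x)"
    using b e fin_group_axioms by (auto simp: corner_def corner_axioms_def)
  then show ?thesis
  proof cases
    case 1
    then show ?thesis using corner.proper_projection[OF 1(1) _ e(2)] that by blast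
  next
    case 2
    then show ?thesis using corner.proper_projection[OF 2(1) _ e(2)] that by blast
  qed
qed

lemma prim_decomposition:
  assumes "proj e"
  shows "\<exists>es. (\<forall>f\<in>set es. prim f) \<and> e = (\<lambda>x. \<Sum>f\<leftarrow>es. f x)"
proof -
  obtain n :: nat where "of_nat (order G) * e \<one> = of_nat n" using rank_nat[OF assms] by blast
  then show ?thesis using assms
  proof (induction n arbitrary: e rule: less_induct)
    case (less n)
    show ?case
    proof (cases "e = (\<lambda>_. 0) \<or> prim e")
      case True
      then show ?thesis by (auto intro: exI[of _ "[]"] exI[of _ "[e]"])
    next
      case False
      then obtain f where f: "proj f" "f \<noteq> (\<lambda>_. 0)" "f \<noteq> e" "e \<star> f = f" "f \<star> e = f"
        using nonprim_split[of e] less.prems(2) by blast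
      define h where "h = (\<lambda>x. e x - f x)"
      have h: "proj h"
        using less.prems(2) f by (simp add: h_def proj_def conv_diff star_diff)
      have "f = e" if "h = (\<lambda>_. 0)" using that by (simp add: h_def fun_eq_iff)
      then have h0: "h \<noteq> (\<lambda>_. 0)" using f(3) by blast
      obtain k where k: "of_nat (order G) * f \<one> = of_nat k" "0 < k" using rank_nat[OF f(1)] f(2) by blast
      obtain m where m: "of_nat (order G) * h \<one> = of_nat m" "0 < m" using rank_nat[OF h] h0 by blast
      have "of_nat n = (of_nat (k + m) :: complex)"
        using less.prems(1) k(1) m(1) by (simp add: h_def algebra_simps)
      then have "n = k + m" by (simp only: of_nat_eq_iff)
      then obtain es es' where "\<forall>g\<in>set es. prim g" "f = (\<lambda>x. \<Sum>g\<leftarrow>es. g x)"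
        "\<forall>g\<in>set es'. prim g" "h = (\<lambda>x. \<Sum>g\<leftarrow>es'. g x)"
        using less.IH[OF _ k(1) f(1)] less.IH[OF _ m(1) h] k m by auto
      then have "\<forall>g\<in>set (es @ es'). prim g" "e = (\<lambda>x. \<Sum>g\<leftarrow>es @ es'. g x)"
        by (auto simp: h_def fun_eq_iff algebra_simps)
      then show ?thesis by blast
    qed
  qed
qed

text \<open>The inner product is the trace of the operator that sends \<open>b\<close> to
  \<open>e \<star> b \<star> e\<close>, an idempotent whose image is the line through
  \<open>e\<close>.\<close>

lemma ip_prim:
  assumes e: "prim e"
  shows "ip (ch e) (ch e) = 1"
proof -
  have pe: "e \<star> e = e" "star e = e" "e \<noteq> (\<lambda>_. 0)" using e by (simp_all add: prim_def proj_def)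
  have "\<forall>y. \<exists>c. e \<star> delta y \<star> e = (\<lambda>x. c * e x)" using e by (simp add: prim_def)
  then obtain t where t: "\<forall>y. e \<star> delta y \<star> e = (\<lambda>x. t y * e x)" by (rule choice[THEN exE])
  have eq: "(\<Sum>z\<in>carrier G. t z * e y * e z) = e y" if "y \<in> carrier G" for y
    using sandwich[OF that, of e e e] by (simp add: t pe)
  obtain y where y: "e y \<noteq> 0" using pe(3) by auto
  then have "y \<in> carrier G" using el_proj[of e] e by (auto simp: el_def prim_def)
  moreover have "e y * (\<Sum>z\<in>carrier G. t z * e z) = (\<Sum>z\<in>carrier G. t z * e y * e z)"
    by (simp add: sum_distrib_left mult_ac)
  ultimately have "e y * (\<Sum>z\<in>carrier G. t z * e z) = e y * 1" using eq by simp
  then have "(\<Sum>z\<in>carrier G. t z * e z) = 1" using y by (subst (asm) mult_cancel_left) simp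
  then show ?thesis using ip_ch_trace[OF pe(2), of e] by (simp add: t)
qed

definition Irr :: "('a \<Rightarrow> complex) set" where
  "Irr = ch ` {e. prim e}"

lemma Irr_class_fun: "\<chi> \<in> Irr \<Longrightarrow> class_fun \<chi>"
  by (auto simp: Irr_def class_fun_ch)

lemma Irr_el: "\<chi> \<in> Irr \<Longrightarrow> x \<notin> carrier G \<Longrightarrow> \<chi> x = 0"
  using Irr_class_fun by (simp add: class_fun_def el_def)

lemma prim_proj: "prim e \<Longrightarrow> proj e"
  by (simp add: prim_def)

lemma ip_self: "ip a a = of_real ((\<Sum>x\<in>carrier G. (cmod (a x))\<^sup>2) / order G)"
  by (simp add: ip_def complex_norm_square[symmetric])

lemma ip_diff: "ip (\<lambda>x. a x - b x) c = ip a c - ip b c" "ip c (\<lambda>x. a x - b x) = ip c a - ip c b"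
  by (simp_all add: ip_def algebra_simps sum_subtractf diff_divide_distrib)

lemma ip_scale: "ip (\<lambda>x. k * a x) c = k * ip a c" "ip c (\<lambda>x. k * a x) = cnj k * ip c a"
  by (simp_all add: ip_def sum_distrib_left mult_ac)

lemma ip_sum: "ip (\<lambda>x. \<Sum>i\<in>I. f i x) c = (\<Sum>i\<in>I. ip (f i) c)" "ip c (\<lambda>x. \<Sum>i\<in>I. f i x) = (\<Sum>i\<in>I. ip c (f i))"
  by (simp_all add: ip_def sum_distrib_left sum_distrib_right sum.swap[of _ _ I] sum_divide_distrib)

lemma ip_cnj: "cnj (ip a b) = ip b a"
  by (simp add: ip_def mult.commute)

text \<open>The inner product is a natural number \<open>n\<close>, and the squared norm of the
  difference of two distinct unit vectors, \<open>2 - 2 * n\<close>, is positive; so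
  \<open>n = 0\<close>.\<close>

lemma Irr_orthonormal:
  assumes "\<chi> \<in> Irr" "\<psi> \<in> Irr"
  shows "ip \<chi> \<psi> = (if \<chi> = \<psi> then 1 else 0)"
proof (cases "\<chi> = \<psi>")
  case True
  then show ?thesis using assms ip_prim by (auto simp: Irr_def)
next
  case False
  have 1: "ip \<chi> \<chi> = 1" "ip \<psi> \<psi> = 1" using assms ip_prim by (auto simp: Irr_def)
  obtain e f where ef: "\<chi> = ch e" "\<psi> = ch f" "prim e" "prim f" using assms by (auto simp: Irr_def)
  obtain n :: nat where n: "ip \<chi> \<psi> = of_nat n"
    using ip_ch_nat[of e f] prim_proj ef by auto
  have n': "ip \<psi> \<chi> = of_nat n" using ip_cnj[of \<chi> \<psi>] n by simp
  define d where "d = (\<lambda>x. \<chi> x - \<psi> x)"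
  define r where "r = (\<Sum>x\<in>carrier G. (cmod (d x))\<^sup>2)"
  have "complex_of_real (r / order G) = ip d d" by (simp only: ip_self r_def)
  also have "\<dots> = complex_of_real (2 - 2 * real n)" by (simp add: d_def ip_diff 1 n n')
  finally have eq: "r / order G = 2 - 2 * real n" by (simp only: of_real_eq_iff)
  have eld: "el d" using assms by (simp add: d_def el_def Irr_el)
  have "d \<noteq> (\<lambda>_. 0)" using False by (auto simp: d_def fun_eq_iff)
  then have "0 < r" using star_self_pos[OF eld] by (simp add: r_def)
  then have "0 < 2 - 2 * real n" using eq order_pos by (metis divide_pos_pos of_nat_0_less_iff)
  then have "n = 0" by simp
  with n False show ?thesis by simp
qed

text \<open>Write the unit as a sum of primitive projections. The inner products of their characters
  with \<open>\<chi>\<close> add up to the degree of \<open>\<chi>\<close>, which is not zero, so by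
  orthogonality \<open>\<chi>\<close> is one of these characters.\<close>

lemma finite_Irr: "finite Irr"
proof -
  obtain es where es: "\<forall>f\<in>set es. prim f" "delta \<one> = (\<lambda>x. \<Sum>f\<leftarrow>es. f x)"
    using prim_decomposition[OF proj_delta] by blast
  have "Irr \<subseteq> ch ` set es"
  proof
    fix \<chi> assume \<chi>: "\<chi> \<in> Irr"
    then obtain f where f: "prim f" "\<chi> = ch f" by (auto simp: Irr_def)
    have sum: "(\<Sum>g\<leftarrow>gs. ip (ch g) \<chi>) = (\<Sum>x\<in>carrier G. (\<Sum>g\<leftarrow>gs. g x) * cnj (\<chi> x))" for gs
      using ip_ch[OF Irr_class_fun[OF \<chi>]]
      by (induction gs) (simp_all add: sum.distrib algebra_simps)
    have "(\<Sum>g\<leftarrow>es. ip (ch g) \<chi>) = cnj (\<chi> \<one>)"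
      unfolding sum using fun_cong[OF es(2), symmetric] by (simp add: delta_def mult_if_delta)
    also have "\<chi> \<one> = of_nat (order G) * f \<one>" by (simp add: f ch_def order_def)
    also have "cnj \<dots> \<noteq> 0"
      using rank_nat[OF prim_proj[OF f(1)]] f(1) unfolding prim_def by auto
    finally have ne: "(\<Sum>g\<leftarrow>es. ip (ch g) \<chi>) \<noteq> 0" .
    have "\<exists>g\<in>set es. ip (ch g) \<chi> \<noteq> 0"
    proof (rule ccontr)
      assume "\<not> ?thesis"
      then have "map (\<lambda>g. ip (ch g) \<chi>) es = map (\<lambda>_. 0) es" by simp
      then have "(\<Sum>g\<leftarrow>es. ip (ch g) \<chi>) = (\<Sum>g\<leftarrow>es. 0)" by (rule arg_cong)
      then show False using ne by simp
    qed
    then obtain g where g: "g \<in> set es" "ip (ch g) \<chi> \<noteq> 0" by blast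
    have "ch g \<in> Irr" using g es by (auto simp: Irr_def)
    then show "\<chi> \<in> ch ` set es" using Irr_orthonormal[OF _ \<chi>] g by (auto split: if_splits)
  qed
  then show ?thesis by (rule finite_subset) simp
qed

lemma class_fun_central:
  assumes "class_fun z"
  shows "z \<star> a = a \<star> z"
proof (rule el_eqI)
  fix x assume x: "x \<in> carrier G"
  have "(z \<star> a) x = (\<Sum>u\<in>carrier G. z (inv u) * a (u \<otimes> x))"
    using x sum_inv[of "\<lambda>u. z u * a (inv u \<otimes> x)"] by (simp add: conv_def)
  also have "\<dots> = (\<Sum>u\<in>carrier G. z (x \<otimes> inv u) * a u)"
    using x sum_rmult[of "inv x" "\<lambda>u. z (inv u) * a (u \<otimes> x)"]
    by (simp add: inv_mult_group m_assoc)
  also have "\<dots> = (\<Sum>u\<in>carrier G. a u * z (inv u \<otimes> x))"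
  proof (rule sum.cong[OF refl])
    fix u assume u: "u \<in> carrier G"
    have "z (cj (inv u) (x \<otimes> inv u)) = z (x \<otimes> inv u)"
      using assms x u unfolding class_fun_def by blast
    moreover have "cj (inv u) (x \<otimes> inv u) = inv u \<otimes> x" using x u by (simp add: cj_def m_assoc)
    ultimately show "z (x \<otimes> inv u) * a u = a u * z (inv u \<otimes> x)" by simp
  qed
  finally show "(z \<star> a) x = (a \<star> z) x" using x by (simp add: conv_def)
qed simp_all

text \<open>A class function is central, so it multiplies each primitive projection by a scalar.
  Applied to a decomposition of the unit, this writes \<open>z\<close> as a combination of primitive
  projections, and averaging over conjugates turns these into irreducible characters.\<close>

lemma class_fun_expansion:
  assumes z: "class_fun z"
  shows "z x = (\<Sum>\<chi>\<in>Irr. ip z \<chi> * \<chi> x)"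
proof -
  obtain es where es: "\<forall>f\<in>set es. prim f" "delta \<one> = (\<lambda>x. \<Sum>f\<leftarrow>es. f x)"
    using prim_decomposition[OF proj_delta] by blast
  have elz: "el z" using z by (simp add: class_fun_def)
  have "\<exists>c. z \<star> f = (\<lambda>x. c * f x)" if "prim f" for f
  proof -
    have "z \<star> f = z \<star> (f \<star> f)" using that by (simp add: prim_def proj_def)
    also have "\<dots> = f \<star> z \<star> f" by (simp add: class_fun_central[OF z] flip: conv_assoc)
    finally show ?thesis using that unfolding prim_def by metis
  qed
  then have "\<forall>f. \<exists>c. prim f \<longrightarrow> z \<star> f = (\<lambda>x. c * f x)" by blast
  then have "\<exists>c. \<forall>f. prim f \<longrightarrow> z \<star> f = (\<lambda>x. c f * f x)" by (rule choice)
  then obtain c where c: "\<And>f. prim f \<Longrightarrow> z \<star> f = (\<lambda>x. c f * f x)" by blast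
  have conv_list: "z \<star> (\<lambda>x. \<Sum>f\<leftarrow>gs. f x) = (\<lambda>x. \<Sum>f\<leftarrow>gs. (z \<star> f) x)" for gs
    by (induction gs) (simp_all add: conv_add)
  have zsum: "z x = (\<Sum>f\<leftarrow>es. c f * f x)" for x
  proof -
    have "z = z \<star> (\<lambda>x. \<Sum>f\<leftarrow>es. f x)" using delta_conv(2)[OF elz] es(2) by simp
    also have "\<dots> = (\<lambda>x. \<Sum>f\<leftarrow>es. (z \<star> f) x)" by (rule conv_list)
    also have "\<dots> = (\<lambda>x. \<Sum>f\<leftarrow>es. c f * f x)" using es(1) c by (auto intro!: ext arg_cong[where f = sum_list] map_cong)
    finally show ?thesis by metis
  qed
  have avg: "of_nat (order G) * z x = (\<Sum>f\<leftarrow>es. c f * ch f x)" if x: "x \<in> carrier G" for x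
  proof -
    have "of_nat (order G) * z x = (\<Sum>y\<in>carrier G. z (cj y x))"
      using z x by (simp add: class_fun_def order_def)
    also have "\<dots> = (\<Sum>y\<in>carrier G. \<Sum>f\<leftarrow>es. c f * f (cj y x))" by (simp only: zsum)
    also have "\<dots> = (\<Sum>f\<leftarrow>es. \<Sum>y\<in>carrier G. c f * f (cj y x))"
      by (induction es) (simp_all add: sum.distrib)
    finally show ?thesis using x by (simp add: ch_def sum_distrib_left)
  qed
  have "\<exists>d. \<forall>x\<in>carrier G. (\<Sum>f\<leftarrow>gs. c f * ch f x) = (\<Sum>\<chi>\<in>Irr. d \<chi> * \<chi> x)" if "\<forall>f\<in>set gs. prim f" for gs
    using that
  proof (induction gs)
    case Nil
    then show ?case by (intro exI[of _ "\<lambda>_. 0"]) simp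
  next
    case (Cons g gs)
    then obtain d where d: "\<forall>x\<in>carrier G. (\<Sum>f\<leftarrow>gs. c f * ch f x) = (\<Sum>\<chi>\<in>Irr. d \<chi> * \<chi> x)" by auto
    have "ch g \<in> Irr" using Cons by (simp add: Irr_def)
    then have "(\<Sum>\<chi>\<in>Irr. (if \<chi> = ch g then c g else 0) * \<chi> x) = c g * ch g x" for x
      using finite_Irr by (simp add: if_distrib[where f = "\<lambda>a. a * _"] cong: if_cong)
    then show ?case
      using d by (intro exI[of _ "\<lambda>\<chi>. (if \<chi> = ch g then c g else 0) + d \<chi>"]) (simp add: distrib_right sum.distrib)
  qed
  from this[OF es(1)] obtain d where d: "\<forall>x\<in>carrier G. (\<Sum>f\<leftarrow>es. c f * ch f x) = (\<Sum>\<chi>\<in>Irr. d \<chi> * \<chi> x)"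
    by blast
  define d' where "d' \<chi> = d \<chi> / of_nat (order G)" for \<chi>
  have zd: "z = (\<lambda>x. \<Sum>\<chi>\<in>Irr. d' \<chi> * \<chi> x)"
  proof (rule el_eqI[OF elz])
    show "el (\<lambda>x. \<Sum>\<chi>\<in>Irr. d' \<chi> * \<chi> x)"
      by (simp add: el_def Irr_el)
    show "z x = (\<Sum>\<chi>\<in>Irr. d' \<chi> * \<chi> x)" if "x \<in> carrier G" for x
    proof -
      have "of_nat (order G) * z x = (\<Sum>\<chi>\<in>Irr. d \<chi> * \<chi> x)" using avg[OF that] d that by simp
      then have "z x = (\<Sum>\<chi>\<in>Irr. d \<chi> * \<chi> x) / of_nat (order G)" using order_pos by (simp add: field_simps)
      then show ?thesis by (simp add: d'_def sum_divide_distrib)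
    qed
  qed
  have "ip z \<psi> = d' \<psi>" if "\<psi> \<in> Irr" for \<psi>
  proof -
    have "ip z \<psi> = (\<Sum>\<chi>\<in>Irr. d' \<chi> * ip \<chi> \<psi>)" by (subst zd) (simp only: ip_sum ip_scale)
    also have "\<dots> = (\<Sum>\<chi>\<in>Irr. if \<chi> = \<psi> then d' \<chi> else 0)"
      using that by (intro sum.cong) (auto simp: Irr_orthonormal)
    finally show ?thesis using that finite_Irr by simp
  qed
  then show ?thesis by (subst zd) simp
qed

lemma parseval:
  assumes "class_fun z" "class_fun w"
  shows "ip z w = (\<Sum>\<chi>\<in>Irr. ip z \<chi> * cnj (ip w \<chi>))"
proof -
  have "w = (\<lambda>x. \<Sum>\<chi>\<in>Irr. ip w \<chi> * \<chi> x)" using class_fun_expansion[OF assms(2)] by blast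
  then have "ip z w = ip z (\<lambda>x. \<Sum>\<chi>\<in>Irr. ip w \<chi> * \<chi> x)" by (rule arg_cong)
  also have "\<dots> = (\<Sum>\<chi>\<in>Irr. cnj (ip w \<chi>) * ip z \<chi>)" by (simp only: ip_sum ip_scale)
  finally show ?thesis by (simp add: mult.commute)
qed

end

section \<open>Trivial, conjugate, real and linear characters\<close>

context fin_group
begin

lemma IrrI: "prim e \<Longrightarrow> ch e = \<chi> \<Longrightarrow> \<chi> \<in> Irr"
  by (auto simp: Irr_def)

definition one_fun :: "'a \<Rightarrow> complex" where "one_fun x = (if x \<in> carrier G then 1 else 0)"

lemma one_fun_Irr: "one_fun \<in> Irr"
proof -
  define e where "e = (\<lambda>x. one_fun x / of_nat (order G))"
  have n: "of_nat (order G) \<noteq> (0 :: complex)" using order_pos by simp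
  have ce: "(e \<star> a) x = (\<Sum>u\<in>carrier G. a u) / of_nat (order G)" if x: "x \<in> carrier G" for a x
  proof -
    have "(e \<star> a) x = (\<Sum>u\<in>carrier G. a (inv u \<otimes> x)) / of_nat (order G)"
      using x by (simp add: conv_def e_def one_fun_def sum_divide_distrib)
    also have "(\<Sum>u\<in>carrier G. a (inv u \<otimes> x)) = (\<Sum>u\<in>carrier G. a (u \<otimes> x))"
      by (rule sum_inv[of "\<lambda>u. a (u \<otimes> x)"])
    also have "\<dots> = (\<Sum>u\<in>carrier G. a u)" by (rule sum_rmult[OF x])
    finally show ?thesis .
  qed
  have scal: "e \<star> a = (\<lambda>x. (\<Sum>u\<in>carrier G. a u) * e x)" for a
    by (rule el_eqI) (simp_all add: ce, simp_all add: e_def one_fun_def el_def)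
  have sum: "(\<Sum>u\<in>carrier G. e u) = 1" using n by (simp add: e_def one_fun_def order_def)
  have ee: "e \<star> e = e" by (simp add: scal sum)
  have se: "star e = e" by (rule ext) (simp add: star_def e_def one_fun_def)
  have "e \<star> a \<star> e = (\<lambda>x. (\<Sum>u\<in>carrier G. a u) * e x)" for a
    by (simp add: scal[of a] conv_scale ee)
  moreover have "e \<noteq> (\<lambda>_. 0)" using sum by (metis sum.neutral_const zero_neq_one)
  ultimately have "prim e" using ee se by (auto simp: prim_def proj_def)
  moreover have "ch e = one_fun"
    using n by (intro ext) (simp add: ch_def e_def one_fun_def order_def)
  ultimately show ?thesis by (rule IrrI)
qed

lemma cnj_Irr: "\<chi> \<in> Irr \<Longrightarrow> (\<lambda>x. cnj (\<chi> x)) \<in> Irr"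
proof -
  assume "\<chi> \<in> Irr"
  then obtain e where e: "prim e" "\<chi> = ch e" by (auto simp: Irr_def)
  define c where "c a = (\<lambda>x::'a. cnj (a x))" for a
  have cc: "c (c a) = a" for a by (simp add: c_def)
  have conv: "c a \<star> c b = c (a \<star> b)" for a b by (rule ext) (simp add: conv_def c_def)
  have star: "star (c a) = c (star a)" for a by (rule ext) (simp add: star_def c_def)
  have scal: "\<exists>k. c e \<star> a \<star> c e = (\<lambda>x. k * c e x)" for a
  proof -
    obtain k where "e \<star> c a \<star> e = (\<lambda>x. k * e x)" using e(1) unfolding prim_def by blast
    moreover have "c e \<star> a \<star> c e = c (e \<star> c a \<star> e)" using conv[of e "c a"] conv[of "e \<star> c a" e] by (simp add: cc)
    ultimately show ?thesis by (auto simp: c_def)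
  qed
  have "e \<star> e = e" "star e = e" "e \<noteq> (\<lambda>_. 0)" using e(1) by (auto simp: prim_def proj_def)
  moreover from this(3) have "c e \<noteq> (\<lambda>_. 0)" by (auto simp: c_def fun_eq_iff)
  ultimately have "prim (c e)" using scal by (simp add: prim_def proj_def conv star)
  moreover have "ch (c e) = (\<lambda>x. cnj (\<chi> x))" by (rule ext) (simp add: ch_def c_def e(2))
  ultimately show ?thesis by (rule IrrI)
qed

lemma Irr_degree:
  assumes "\<chi> \<in> Irr"
  shows "\<exists>n::nat. \<chi> \<one> = of_nat n \<and> 0 < n"
proof -
  obtain e where e: "prim e" "\<chi> = ch e" using assms by (auto simp: Irr_def)
  obtain n :: nat where n: "of_nat (order G) * e \<one> = of_nat n" "0 < n"
    using rank_nat[OF prim_proj[OF e(1)]] e(1) by (auto simp: prim_def)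
  have "\<chi> \<one> = of_nat (order G) * e \<one>" by (simp add: e(2) ch_def order_def)
  with n show ?thesis by auto
qed

lemma Irr_inv: "\<chi> \<in> Irr \<Longrightarrow> x \<in> carrier G \<Longrightarrow> \<chi> (inv x) = cnj (\<chi> x)"
proof -
  assume "\<chi> \<in> Irr" and x: "x \<in> carrier G"
  then obtain e where e: "prim e" "\<chi> = ch e" by (auto simp: Irr_def)
  have "e (inv y) = cnj (e y)" if "y \<in> carrier G" for y
  proof -
    have "star e = e" using e(1) by (simp add: prim_def proj_def)
    from fun_cong[OF this, of "inv y"] show ?thesis using that by (simp add: star_def)
  qed
  then show ?thesis using x by (simp add: e(2) ch_def cj_inv)
qed

text \<open>Column orthogonality for \<open>x\<close> and \<open>inv x\<close>, which are not conjugate if the order is odd,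
  shows that exactly one irreducible character is real.\<close>

lemma real_Irr_odd:
  assumes odd: "odd (order G)" and \<chi>: "\<chi> \<in> Irr" and real: "(\<lambda>x. cnj (\<chi> x)) = \<chi>"
  shows "\<chi> = one_fun"
proof (rule ccontr)
  assume ne: "\<chi> \<noteq> one_fun"
  have col: "(\<Sum>\<psi>\<in>Irr. \<psi> x * \<psi> x) = (if x = \<one> then of_nat (order G) else 0)" if x: "x \<in> carrier G" for x
  proof -
    define C where "C = (\<lambda>y. cj y x) ` carrier G"
    define z where "z = (\<lambda>u. if u \<in> C then 1 else 0 :: complex)"
    have CG: "C \<subseteq> carrier G" using x by (auto simp: C_def)
    have cjC: "cj w u \<in> C" if "w \<in> carrier G" "u \<in> C" for w u
      using that x by (auto simp: C_def cj_cj)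
    have "cj w u \<in> C \<longleftrightarrow> u \<in> C" if "w \<in> carrier G" "u \<in> carrier G" for w u
      using cjC[of w u] cjC[of "inv w" "cj w u"] that by auto
    then have z: "class_fun z" using CG by (auto simp: class_fun_def el_def z_def)
    have "ip z \<psi> = of_nat (card C) * cnj (\<psi> x) / of_nat (order G)" if \<psi>: "\<psi> \<in> Irr" for \<psi>
    proof -
      have "(\<Sum>u\<in>carrier G. z u * cnj (\<psi> u)) = (\<Sum>u\<in>C. cnj (\<psi> u))"
        using CG by (intro sum.mono_neutral_cong_right) (auto simp: z_def)
      also have "\<dots> = (\<Sum>u\<in>C. cnj (\<psi> x))"
        using Irr_class_fun[OF \<psi>] x by (intro sum.cong) (auto simp: C_def class_fun_def)
      finally show ?thesis by (simp add: ip_def)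
    qed
    then have "z (inv x) = (\<Sum>\<psi>\<in>Irr. of_nat (card C) * cnj (\<psi> x) / of_nat (order G) * \<psi> (inv x))"
      by (subst class_fun_expansion[OF z]) simp
    also have "\<dots> = of_nat (card C) / of_nat (order G) * (\<Sum>\<psi>\<in>Irr. cnj (\<psi> x * \<psi> x))"
      using x by (simp add: Irr_inv sum_distrib_left mult_ac)
    finally have eq: "z (inv x) = of_nat (card C) / of_nat (order G) * cnj (\<Sum>\<psi>\<in>Irr. \<psi> x * \<psi> x)" by simp
    have C0: "card C \<noteq> 0" using CG fin_subset[OF CG] by (auto simp: C_def)
    show ?thesis
    proof (cases "x = \<one>")
      case True
      then have "C = {\<one>}" by (auto simp: C_def)
      then have "1 = 1 / of_nat (order G) * cnj (\<Sum>\<psi>\<in>Irr. \<psi> x * \<psi> x)" using eq True by (simp add: z_def)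
      then have "cnj (\<Sum>\<psi>\<in>Irr. \<psi> x * \<psi> x) = of_nat (order G)" using order_pos by (simp add: field_simps)
      then have "cnj (cnj (\<Sum>\<psi>\<in>Irr. \<psi> x * \<psi> x)) = of_nat (order G)" by (simp only: complex_cnj_of_nat)
      then show ?thesis using True by simp
    next
      case False
      have "inv x \<notin> C"
      proof
        assume "inv x \<in> C"
        then obtain y where y: "y \<in> carrier G" "inv x = cj y x" by (auto simp: C_def)
        \<comment> \<open>If \<open>y\<close> conjugates \<open>x\<close> to its inverse, then
          powers of \<open>y\<close> do so alternately; the odd power \<open>y [^] order G\<close>
          is trivial, so \<open>x\<close> equals its inverse, which odd order excludes.\<close>
        have pw: "cj (y [^] (n::nat)) x = (if even n then x else inv x)" for n
        proof (induction n)
          case (Suc n)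
          have "cj (y [^] Suc n) x = cj (y [^] n) (cj y x)" using x y by (simp add: cj_cj)
          also have "\<dots> = inv (cj (y [^] n) x)" using y x by (simp add: cj_inv flip: y(2))
          finally show ?case using Suc x by simp
        qed (use x in simp)
        have "y [^] order G = \<one>" by (rule pow_order_eq_1[OF y(1)])
        then have xi: "inv x = x" using pw[of "order G"] odd x by simp
        then have "x [^] (2::nat) = \<one>" using x by (metis l_inv numeral_2_eq_2 nat_pow_Suc nat_pow_0 l_one)
        then show False
          using pow_coprime_one[OF x _ pow_order_eq_1[OF x], of 2] odd False by simp
      qed
      then have "of_nat (card C) / of_nat (order G) * cnj (\<Sum>\<psi>\<in>Irr. \<psi> x * \<psi> x) = 0"
        using eq by (simp add: z_def)
      then have "cnj (\<Sum>\<psi>\<in>Irr. \<psi> x * \<psi> x) = 0" using C0 order_pos by (simp del: cnj_sum)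
      then have "(\<Sum>\<psi>\<in>Irr. \<psi> x * \<psi> x) = 0" by (simp only: complex_cnj_zero_iff)
      then show ?thesis using False by simp
    qed
  qed
  \<comment> \<open>Both sides count the real irreducible characters: by orthonormality on the left,
    and by the column relation \<open>col\<close>, where only \<open>x = \<one>\<close> contributes,
    on the right.\<close>
  have "(\<Sum>\<psi>\<in>Irr. ip \<psi> (\<lambda>x. cnj (\<psi> x))) = (\<Sum>x\<in>carrier G. \<Sum>\<psi>\<in>Irr. \<psi> x * \<psi> x) / of_nat (order G)"
    by (simp add: ip_def sum.swap[of _ Irr] flip: sum_divide_distrib)
  also have "\<dots> = 1" using order_pos by (simp add: col)
  finally have tot: "(\<Sum>\<psi>\<in>Irr. ip \<psi> (\<lambda>x. cnj (\<psi> x))) = 1" .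
  define r where "r \<psi> = (if (\<lambda>x. cnj (\<psi> x)) = \<psi> then 1 else 0 :: real)" for \<psi> :: "'a \<Rightarrow> complex"
  have "ip \<psi> (\<lambda>x. cnj (\<psi> x)) = of_real (r \<psi>)" if "\<psi> \<in> Irr" for \<psi>
    using Irr_orthonormal[OF that cnj_Irr[OF that]] by (auto simp: r_def)
  then have "complex_of_real (\<Sum>\<psi>\<in>Irr. r \<psi>) = 1" using tot by simp
  then have "(\<Sum>\<psi>\<in>Irr. r \<psi>) = 1" using of_real_eq_1_iff by blast
  moreover have "(\<Sum>\<psi>\<in>{\<chi>, one_fun}. r \<psi>) \<le> (\<Sum>\<psi>\<in>Irr. r \<psi>)"
    using \<chi> one_fun_Irr finite_Irr by (intro sum_mono2) (auto simp: r_def)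
  moreover have "(\<lambda>x. cnj (one_fun x)) = one_fun" by (auto simp: one_fun_def)
  then have "(\<Sum>\<psi>\<in>{\<chi>, one_fun}. r \<psi>) = 2" using ne real by (simp add: r_def)
  ultimately show False by simp
qed

text \<open>For a projection \<open>e\<close> of rank one, equality holds in the triangle and Cauchy--Schwarz
  inequalities for \<open>e \<star> e = e\<close>.\<close>

lemma linear_Irr_mult:
  assumes \<chi>: "\<chi> \<in> Irr" and one: "\<chi> \<one> = 1" and xy: "x \<in> carrier G" "y \<in> carrier G"
  shows "\<chi> (x \<otimes> y) = \<chi> x * \<chi> y"
proof -
  obtain e where e: "prim e" "\<chi> = ch e" using \<chi> by (auto simp: Irr_def)
  have pe: "proj e" "e \<star> e = e" "star e = e" using e(1) by (simp_all add: prim_def proj_def)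
  define g where "g = real (order G)"
  have g: "0 < g" using order_pos by (simp add: g_def)
  have "of_real g * e \<one> = 1" using one by (simp add: e(2) ch_def order_def g_def)
  then have e1: "e \<one> = 1 / of_real g" using g by (simp add: nonzero_eq_divide_eq mult.commute)
  have sq: "(\<Sum>u\<in>carrier G. (cmod (e u))\<^sup>2) = 1 / g"
    using proj_one[OF pe(1)] e1 by (metis of_real_1 of_real_divide of_real_eq_iff)
  have sq2: "(\<Sum>u\<in>carrier G. (cmod (e (inv u \<otimes> z)))\<^sup>2) = 1 / g" if z: "z \<in> carrier G" for z
    using sum_inv[of "\<lambda>u. (cmod (e (u \<otimes> z)))\<^sup>2"] sum_rmult[OF z, of "\<lambda>u. (cmod (e u))\<^sup>2"] sq by simp
  have le: "cmod (e z) \<le> 1 / g" if z: "z \<in> carrier G" for z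
  proof -
    have "e z = (\<Sum>u\<in>carrier G. e u * e (inv u \<otimes> z))" using fun_cong[OF pe(2), of z] z by (simp add: conv_def)
    then have "cmod (e z) \<le> (\<Sum>u\<in>carrier G. cmod (e u) * cmod (e (inv u \<otimes> z)))"
      by (metis (no_types, lifting) norm_mult norm_sum sum.cong)
    also have "\<dots> \<le> (\<Sum>u\<in>carrier G. ((cmod (e u))\<^sup>2 + (cmod (e (inv u \<otimes> z)))\<^sup>2) / 2)"
    proof (rule sum_mono)
      fix u
      show "cmod (e u) * cmod (e (inv u \<otimes> z)) \<le> ((cmod (e u))\<^sup>2 + (cmod (e (inv u \<otimes> z)))\<^sup>2) / 2"
        using sum_squares_bound[of "cmod (e u)" "cmod (e (inv u \<otimes> z))"] by simp
    qed
    also have "\<dots> = 1 / g" using sq sq2[OF z] by (simp add: sum.distrib flip: sum_divide_distrib)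
    finally show ?thesis .
  qed
  have eq: "cmod (e z) = 1 / g" if z: "z \<in> carrier G" for z
  proof (rule ccontr)
    assume "cmod (e z) \<noteq> 1 / g"
    then have "cmod (e z) < 1 / g" using le[OF z] by simp
    then have "(\<Sum>u\<in>carrier G. (cmod (e u))\<^sup>2) < (\<Sum>u\<in>carrier G. (1 / g)\<^sup>2)"
      using z le by (intro sum_strict_mono_ex1) (auto intro!: power_mono power_strict_mono bexI[of _ z])
    also have "\<dots> = 1 / g" using g by (simp add: g_def order_def power2_eq_square)
    finally show False using sq by simp
  qed
  have sqz: "e z * cnj (e z) = 1 / (of_real g)\<^sup>2" if z: "z \<in> carrier G" for z
    using eq[OF z] by (simp add: complex_norm_square[symmetric] power_divide)
  have mult: "e (u \<otimes> v) = of_real g * (e u * e v)" if uv: "u \<in> carrier G" "v \<in> carrier G" for u v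
  proof -
    define z where "z = u \<otimes> v"
    have z: "z \<in> carrier G" using uv by (simp add: z_def)
    define a where "a u = of_real g * (e u * e (inv u \<otimes> z))" for u
    have "(\<Sum>u\<in>carrier G. e u * e (inv u \<otimes> z)) = e z"
      using fun_cong[OF pe(2), of z] z by (simp add: conv_def)
    then have sa: "(\<Sum>u\<in>carrier G. a u) = of_real g * e z" by (simp add: a_def flip: sum_distrib_left)
    then have "cnj (\<Sum>u\<in>carrier G. a u) = of_real g * cnj (e z)" by simp
    then have sca: "(\<Sum>u\<in>carrier G. cnj (a u)) = of_real g * cnj (e z)" by simp
    have aa: "a u * cnj (a u) = 1 / (of_real g)\<^sup>2" if u: "u \<in> carrier G" for u
    proof -
      have "a u * cnj (a u) = (of_real g)\<^sup>2 * ((e u * cnj (e u)) * (e (inv u \<otimes> z) * cnj (e (inv u \<otimes> z))))"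
        by (simp add: a_def power2_eq_square mult_ac)
      then show ?thesis using u z g by (simp add: sqz power2_eq_square)
    qed
    \<comment> \<open>The numbers \<open>a u\<close> have modulus \<open>1 / g\<close> and so has
      their mean \<open>e z\<close>. Thus their variance, computed here, is 0, and every
      \<open>a u\<close> equals \<open>e z\<close>.\<close>
    have "(\<Sum>u\<in>carrier G. (a u - e z) * cnj (a u - e z))
        = (\<Sum>u\<in>carrier G. a u * cnj (a u)) - cnj (e z) * (\<Sum>u\<in>carrier G. a u)
          - e z * (\<Sum>u\<in>carrier G. cnj (a u)) + of_real g * (e z * cnj (e z))"
      by (simp add: algebra_simps sum.distrib sum_subtractf sum_distrib_left g_def order_def)
    also have "\<dots> = (\<Sum>u\<in>carrier G. 1 / (of_real g)\<^sup>2) - of_real g * (e z * cnj (e z))"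
      unfolding sa sca by (simp add: aa algebra_simps)
    also have "\<dots> = 0" using g by (simp add: sqz[OF z] g_def order_def)
    finally have "complex_of_real (\<Sum>u\<in>carrier G. (cmod (a u - e z))\<^sup>2) = 0"
      by (simp only: of_real_sum complex_norm_square)
    then have "(\<Sum>u\<in>carrier G. (cmod (a u - e z))\<^sup>2) = 0" by (simp only: of_real_eq_0_iff)
    then have "a u = e z" using uv(1) by (simp add: sum_nonneg_eq_0_iff)
    then show ?thesis using uv by (simp add: a_def z_def)
  qed
  have \<chi>e: "\<chi> z = of_real g * e z" if z: "z \<in> carrier G" for z
  proof -
    have "e (cj y z) = e z" if y: "y \<in> carrier G" for y
    proof -
      have "of_real g * (e y * e (inv y)) = e \<one>" using mult[of y "inv y"] y by simp
      then have yi: "of_real g * (of_real g * (e y * e (inv y))) = 1" using e1 g by simp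
      have "e (cj y z) = of_real g * (of_real g * (e y * e (inv y))) * e z"
        using y z by (simp add: cj_def mult mult_ac)
      then show ?thesis by (simp add: yi)
    qed
    then show ?thesis using z by (simp add: e(2) ch_def g_def order_def)
  qed
  show ?thesis using xy by (simp add: \<chi>e mult)
qed

end

section \<open>Linear characters of trivially intersecting Sylow subgroups\<close>

context fin_group
begin

text \<open>Homomorphisms into the multiplicative group of complex numbers, extended by 0 so that
  they are elements of the group algebra; the value at \<open>\<one>\<close> excludes the zero
  function.\<close>

definition lin :: "'a set \<Rightarrow> ('a \<Rightarrow> complex) set" where
  "lin P = {l. (\<forall>x. x \<notin> P \<longrightarrow> l x = 0) \<and> (\<forall>x\<in>P. \<forall>y\<in>P. l (x \<otimes> y) = l x * l y) \<and> l \<one> = 1}"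

definition triv :: "'a set \<Rightarrow> 'a \<Rightarrow> complex" where "triv P x = (if x \<in> P then 1 else 0)"

text \<open>Frobenius' formula for the induced character. Written as \<open>ch\<close> of a
  projection (see \<open>proj_lin\<close>), its inner products with irreducible characters are
  natural numbers at once.\<close>

definition ind :: "'a set \<Rightarrow> ('a \<Rightarrow> complex) \<Rightarrow> 'a \<Rightarrow> complex" where
  "ind P l = ch (\<lambda>x. l x / of_nat (card P))"

end

locale lin_subgroup = fin_group + P: subgroup P G for P
begin

lemma finP [simp]: "finite P"
  using fin_subgroup P.subgroup_axioms by blast

lemma P_nonempty [simp]: "P \<noteq> {}"
  using P.one_closed by blast

lemma cardP [simp]: "0 < card P"
  by (rule subgroup_card_pos[OF P.subgroup_axioms])

lemma triv_lin: "triv P \<in> lin P"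
  by (auto simp: lin_def triv_def)

lemma lin_mult: "l \<in> lin P \<Longrightarrow> x \<in> P \<Longrightarrow> y \<in> P \<Longrightarrow> l (x \<otimes> y) = l x * l y"
  by (simp add: lin_def)

lemma lin_out: "l \<in> lin P \<Longrightarrow> x \<notin> P \<Longrightarrow> l x = 0"
  by (simp add: lin_def)

lemma lin_one: "l \<in> lin P \<Longrightarrow> l \<one> = 1"
  by (simp add: lin_def)

lemma lin_pow: "l \<in> lin P \<Longrightarrow> x \<in> P \<Longrightarrow> l (x [^] (n::nat)) = l x ^ n"
  by (induction n) (simp_all add: lin_one lin_mult subgroup_pow P.subgroup_axioms)

lemma lin_root: "l \<in> lin P \<Longrightarrow> x \<in> P \<Longrightarrow> l x ^ order G = 1"
  using lin_pow[of l x "order G"] pow_order_eq_1[of x] lin_one[of l] by simp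

lemma lin_norm: "l \<in> lin P \<Longrightarrow> x \<in> P \<Longrightarrow> cmod (l x) = 1"
  using lin_root[of l x] order_pos by (metis norm_ge_zero norm_one norm_power power_eq_1_iff not_gr_zero)

lemma lin_cnj: "l \<in> lin P \<Longrightarrow> x \<in> P \<Longrightarrow> l x * cnj (l x) = 1"
  using lin_norm[of l x] by (simp add: complex_norm_square[symmetric])

lemma lin_inv: "l \<in> lin P \<Longrightarrow> x \<in> P \<Longrightarrow> l (inv x) = cnj (l x)"
proof -
  assume l: "l \<in> lin P" and x: "x \<in> P"
  have "l x * l (inv x) = l x * cnj (l x)"
    using lin_mult[OF l x, of "inv x"] x lin_one[OF l] lin_cnj[OF l x] by simp
  moreover have "l x \<noteq> 0" using lin_norm[OF l x] by auto
  ultimately show ?thesis by simp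
qed

lemma finite_lin: "finite (lin P)"
proof (rule finite_subset)
  let ?Z = "{z::complex. z ^ order G = 1}"
  show "lin P \<subseteq> {f. \<forall>x. (x \<in> P \<longrightarrow> f x \<in> ?Z) \<and> (x \<notin> P \<longrightarrow> f x = 0)}"
    using lin_root lin_out by auto
  have "finite ?Z" using order_pos by (intro finite_roots_unity) simp
  then show "finite {f. \<forall>x. (x \<in> P \<longrightarrow> f x \<in> ?Z) \<and> (x \<notin> P \<longrightarrow> f x = 0)}"
    by (intro finite_set_of_finite_funs) auto
qed

lemma lin_times: "l \<in> lin P \<Longrightarrow> m \<in> lin P \<Longrightarrow> (\<lambda>x. l x * m x) \<in> lin P"
  by (auto simp: lin_def)

lemma lin_conj: "l \<in> lin P \<Longrightarrow> (\<lambda>x. cnj (l x)) \<in> lin P"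
  by (auto simp: lin_def)

lemma sum_P_mult: "y \<in> P \<Longrightarrow> (\<Sum>x\<in>P. f (y \<otimes> x)) = (\<Sum>x\<in>P. f x)"
  by (rule sum.reindex_bij_betw, rule bij_betw_byWitness[where f' = "\<lambda>x. inv y \<otimes> x"]) auto

lemma sum_lin: "l \<in> lin P \<Longrightarrow> (\<Sum>x\<in>P. l x) = (if l = triv P then of_nat (card P) else 0)"
proof (cases "l = triv P")
  case False
  assume l: "l \<in> lin P"
  have "\<exists>y\<in>P. l y \<noteq> 1" using False l by (force simp: triv_def lin_def)
  then obtain y where y: "y \<in> P" "l y \<noteq> 1" by blast
  have "(\<Sum>x\<in>P. l x) = (\<Sum>x\<in>P. l (y \<otimes> x))" by (rule sum_P_mult[OF y(1), symmetric])
  also have "\<dots> = l y * (\<Sum>x\<in>P. l x)" using l y by (simp add: lin_mult sum_distrib_left)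
  finally have "(l y - 1) * (\<Sum>x\<in>P. l x) = 0" by (simp add: algebra_simps)
  then show ?thesis using y False by simp
qed (simp add: triv_def)

lemma lin_orthogonal:
  assumes "l \<in> lin P" "m \<in> lin P"
  shows "(\<Sum>x\<in>P. l x * cnj (m x)) = (if l = m then of_nat (card P) else 0)"
proof -
  have "(\<lambda>x. l x * cnj (m x)) = triv P \<longleftrightarrow> l = m"
  proof
    assume eq: "(\<lambda>x. l x * cnj (m x)) = triv P"
    have "l x = m x" for x
    proof (cases "x \<in> P")
      case True
      have "l x * cnj (m x) = 1" using fun_cong[OF eq, of x] True by (simp add: triv_def)
      then have "l x * (cnj (m x) * m x) = m x" by (simp add: mult.assoc[symmetric])
      then show ?thesis using lin_cnj[OF assms(2) True] by (simp add: mult.commute)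
    qed (simp add: assms lin_out)
    then show "l = m" by blast
  next
    assume "l = m"
    then show "(\<lambda>x. l x * cnj (m x)) = triv P"
      using lin_cnj[OF assms(2)] lin_out[OF assms(2)] by (auto simp: triv_def)
  qed
  then show ?thesis using sum_lin[OF lin_times[OF assms(1) lin_conj[OF assms(2)]]] by simp
qed

text \<open>Let \<open>K\<close> be the common kernel of all linear characters. Summing all values
  \<open>l x\<close> once over the characters first and once over \<open>P\<close> first gives
  \<open>card P = card K * card (lin P)\<close>.\<close>

lemma card_lin_dvd: "card (lin P) dvd card P"
proof -
  define K where "K = {x \<in> P. \<forall>l\<in>lin P. l x = 1}"
  have sum: "(\<Sum>l\<in>lin P. l x) = (if x \<in> K then of_nat (card (lin P)) else 0)" if x: "x \<in> P" for x
  proof (cases "x \<in> K")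
    case True
    then have "(\<Sum>l\<in>lin P. l x) = (\<Sum>l\<in>lin P. 1)" by (intro sum.cong) (auto simp: K_def)
    then show ?thesis using True by simp
  next
    case False
    then obtain m where m: "m \<in> lin P" "m x \<noteq> 1" using x by (auto simp: K_def)
    have "(\<Sum>l\<in>lin P. l x) = (\<Sum>l\<in>lin P. m x * l x)"
    proof (rule sum.reindex_bij_witness[where i = "\<lambda>l y. m y * l y" and j = "\<lambda>l y. cnj (m y) * l y"])
      fix l assume l: "l \<in> lin P"
      have mm: "m y * cnj (m y) * l y = l y" for y
        by (cases "y \<in> P") (simp_all add: lin_cnj[OF m(1)] lin_out[OF l])
      have c: "m y * (cnj (m y) * l y) = l y" "cnj (m y) * (m y * l y) = l y" for y
        using mm[of y] by (simp_all only: mult.assoc mult.left_commute[of "cnj (m y)"])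
      show "(\<lambda>y. m y * (cnj (m y) * l y)) = l" "(\<lambda>y. cnj (m y) * (m y * l y)) = l" "m x * (cnj (m x) * l x) = l x"
        using c by auto
      show "(\<lambda>y. cnj (m y) * l y) \<in> lin P" "(\<lambda>y. m y * l y) \<in> lin P"
        using lin_times[OF lin_conj[OF m(1)] l] lin_times[OF m(1) l] by auto
    qed
    then have eq: "m x * (\<Sum>l\<in>lin P. l x) = (\<Sum>l\<in>lin P. l x)"
      by (subst sum_distrib_left) simp
    have "(1 - m x) * (\<Sum>l\<in>lin P. l x) = 0" by (simp only: left_diff_distrib eq) simp
    then show ?thesis using m False by simp
  qed
  have "(\<Sum>x\<in>P. \<Sum>l\<in>lin P. l x) = (\<Sum>x\<in>P. if x \<in> K then of_nat (card (lin P)) else 0)"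
    by (rule sum.cong) (simp_all add: sum)
  also have "\<dots> = of_nat (card K * card (lin P))"
    by (simp add: sum.If_cases K_def Int_def conj_commute)
  also have "(\<Sum>x\<in>P. \<Sum>l\<in>lin P. l x) = (\<Sum>l\<in>lin P. \<Sum>x\<in>P. l x)" by (rule sum.swap)
  also have "\<dots> = of_nat (card P)" using finite_lin triv_lin by (simp add: sum_lin)
  finally have "card P = card K * card (lin P)" by (simp only: of_nat_eq_iff)
  then show ?thesis by simp
qed

lemma proj_lin: "l \<in> lin P \<Longrightarrow> proj (\<lambda>x. l x / of_nat (card P))"
proof -
  assume l: "l \<in> lin P"
  let ?e = "\<lambda>x. l x / of_nat (card P) :: complex"
  have "?e \<star> ?e = ?e"
  proof (rule el_eqI)
    show "el ?e" using lin_out[OF l] P.subset by (auto simp: el_def)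
    fix z assume z: "z \<in> carrier G"
    have "(?e \<star> ?e) z = (\<Sum>u\<in>P. l u * l (inv u \<otimes> z)) / (of_nat (card P) * of_nat (card P))"
      using z lin_out[OF l] P.subset unfolding conv_def
      by (simp add: sum_divide_distrib) (intro sum.mono_neutral_cong_right; auto)
    also have "(\<Sum>u\<in>P. l u * l (inv u \<otimes> z)) = (\<Sum>u\<in>P. l z)"
    proof (rule sum.cong[OF refl])
      fix u assume u: "u \<in> P"
      show "l u * l (inv u \<otimes> z) = l z"
      proof (cases "z \<in> P")
        case True
        then show ?thesis using lin_mult[OF l u, of "inv u \<otimes> z"] u by simp
      next
        case False
        then have "inv u \<otimes> z \<notin> P" using u z P.m_closed[OF u, of "inv u \<otimes> z"] by auto
        then show ?thesis using False lin_out[OF l] by simp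
      qed
    qed
    finally show "(?e \<star> ?e) z = ?e z" by simp
  qed simp
  moreover have "star ?e = ?e"
  proof (rule el_eqI)
    show "el ?e" using lin_out[OF l] P.subset by (auto simp: el_def)
    fix z assume z: "z \<in> carrier G"
    show "star ?e z = ?e z"
    proof (cases "z \<in> P")
      case True
      then show ?thesis using z lin_inv[OF l] by (simp add: star_def)
    next
      case False
      then have "inv z \<notin> P" using z P.m_inv_closed[of "inv z"] by auto
      then show ?thesis using False z lin_out[OF l] by (simp add: star_def)
    qed
  qed simp
  ultimately show "proj ?e" by (simp add: proj_def)
qed

lemma ip_ind: "class_fun b \<Longrightarrow> l \<in> lin P \<Longrightarrow> ip (ind P l) b = (\<Sum>x\<in>P. l x * cnj (b x)) / of_nat (card P)"
  unfolding ind_def using lin_out P.subset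
  by (subst ip_ch) (auto simp: sum_divide_distrib intro!: sum.mono_neutral_cong_right)

lemma ind_Irr_nat: "l \<in> lin P \<Longrightarrow> \<chi> \<in> Irr \<Longrightarrow> \<exists>n::nat. ip (ind P l) \<chi> = of_nat n"
  using ip_ch_nat[OF proj_lin] prim_proj by (auto simp: ind_def Irr_def)

lemma class_fun_ind: "class_fun (ind P l)"
  by (simp add: ind_def class_fun_ch)

end

text \<open>A \<open>p\<close>-group has a nontrivial linear character: a maximal subgroup is normal of index \<open>p\<close>.\<close>

lemma (in epo) nontrivial_lin:
  assumes p: "prime p" and P: "psub G p P" "P \<noteq> {\<one>}"
  shows "\<exists>l\<in>lin P. l \<noteq> triv P"
proof -
  have sP: "subgroup P G" using P by (simp add: psub_def)
  interpret P: subgroup P G by fact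
  have finP: "finite P" using fin_subgroup[OF sP] .
  let ?Q = "\<lambda>M. subgroup M G \<and> M \<subset> P"
  have "?Q {\<one>}" using triv_subgroup P(2) P.one_closed by auto
  then obtain M where M: "?Q M" and Mmax: "\<And>K. ?Q K \<Longrightarrow> card K \<le> card M"
    using ex_has_greatest_nat[of ?Q "{\<one>}" card "card P"] psubset_card_mono[OF finP] by blast
  interpret M: subgroup M G using M by simp
  obtain x where x: "x \<in> P" "x \<notin> M" "x \<in> normalizer G M"
    using psub_normalizer_grows[OF p P(1) M.subgroup_axioms] M by blast
  have xp: "x [^] p = \<one>" using psub_exp[OF p P(1) x(1)] .
  have xG: "x \<in> carrier G" using x by simp
  have xN: "cj (x [^] (i::nat)) m \<in> M" if "m \<in> M" for i m
    using that subgroup_pow[OF normalizer_subgroup[OF M.subset] x(3)] normalizer_cj by blast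
  define K where "K = {x [^] (i::nat) \<otimes> m | i m. m \<in> M}"
  \<comment> \<open>The natural number \<open>p * i - i\<close> stands for \<open>- i\<close> modulo
    \<open>p\<close>, so that inverses of powers of \<open>x\<close> stay within natural
    exponents.\<close>
  have comm: "m \<otimes> x [^] i = x [^] i \<otimes> cj (x [^] (p * i - i)) m" if m: "m \<in> M" for m and i :: nat
  proof -
    have "p * i - i + i = p * i" using prime_gt_0_nat[OF p] by (cases p) auto
    then have "x [^] (p * i - i) \<otimes> x [^] i = \<one>" using xG xp by (simp add: nat_pow_mult flip: nat_pow_pow)
    then have e: "x [^] (p * i - i) = inv (x [^] i)" using xG inv_equality[of "x [^] (p * i - i)" "x [^] i"] by simp
    show ?thesis unfolding e using xG m by (simp add: cj_def m_assoc)
  qed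
  have "subgroup K G"
  proof (rule subgroupI)
    show "K \<subseteq> carrier G" using xG by (auto simp: K_def)
    show "K \<noteq> {}" using M.one_closed unfolding K_def by blast
    show "a \<otimes> b \<in> K" if abK: "a \<in> K" "b \<in> K" for a b
    proof -
      obtain i m j n where ab: "a = x [^] (i::nat) \<otimes> m" "b = x [^] (j::nat) \<otimes> n" "m \<in> M" "n \<in> M"
        using abK unfolding K_def by blast
      have "a \<otimes> b = x [^] i \<otimes> (m \<otimes> x [^] j) \<otimes> n" using ab xG by (simp add: m_assoc)
      also have "\<dots> = x [^] (i + j) \<otimes> (cj (x [^] (p * j - j)) m \<otimes> n)"
        unfolding comm[OF ab(3)] using ab xG by (simp add: m_assoc flip: nat_pow_mult)
      finally show ?thesis using xN[OF ab(3)] ab(4) M.m_closed by (auto simp: K_def)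
    qed
    show "inv a \<in> K" if aK: "a \<in> K" for a
    proof -
      obtain i m where a: "a = x [^] (i::nat) \<otimes> m" "m \<in> M" using aK unfolding K_def by blast
      have "p * i - i + i = p * i" using prime_gt_0_nat[OF p] by (cases p) auto
      then have "x [^] (p * i - i) \<otimes> x [^] i = \<one>" using xG xp by (simp add: nat_pow_mult flip: nat_pow_pow)
      then have e: "inv (x [^] i) = x [^] (p * i - i)" using xG inv_equality[of "x [^] (p * i - i)" "x [^] i"] by simp
      have "inv a = inv m \<otimes> x [^] (p * i - i)" using a xG e by (simp add: inv_mult_group)
      also have "\<dots> = x [^] (p * i - i) \<otimes> cj (x [^] (p * (p * i - i) - (p * i - i))) (inv m)"
        using comm[of "inv m"] a by simp
      finally show ?thesis using xN[of "inv m"] a(2) by (auto simp: K_def)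
    qed
  qed
  moreover have MK: "M \<subset> K"
  proof -
    have "y = x [^] (0::nat) \<otimes> y" if "y \<in> M" for y using that by simp
    then have "M \<subseteq> K" unfolding K_def by blast
    moreover have "x = x [^] (1::nat) \<otimes> \<one>" using xG by simp
    then have "x \<in> K" unfolding K_def using M.one_closed by blast
    ultimately show ?thesis using x(2) by blast
  qed
  moreover have "K \<subseteq> P" using x(1) M subgroup_pow[OF sP] by (auto simp: K_def)
  ultimately have KP: "K = P"
    using Mmax[of K] psubset_card_mono[OF finite_subset[OF _ finP], of K M] by (metis leD psubsetI)
  have rep: "\<exists>i m. y = x [^] (i::nat) \<otimes> m \<and> m \<in> M" if "y \<in> P" for y using that KP by (auto simp: K_def)
  have uniq: "[i = j] (mod p)" if e: "x [^] (i::nat) \<otimes> m = x [^] (j::nat) \<otimes> n" "m \<in> M" "n \<in> M" for i j m n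
  proof -
    have wlog: "[i = j] (mod p)" if le: "i \<le> j" and e: "x [^] (i::nat) \<otimes> m = x [^] (j::nat) \<otimes> n" "m \<in> M" "n \<in> M" for i j m n
    proof (rule ccontr)
      assume ne: "\<not> [i = j] (mod p)"
      have "x [^] i \<otimes> m = x [^] i \<otimes> (x [^] (j - i) \<otimes> n)"
        using e le xG by (simp add: nat_pow_mult flip: m_assoc)
      then have "m = x [^] (j - i) \<otimes> n" using e(2,3) xG by simp
      then have "x [^] (j - i) = m \<otimes> inv n" using e(2,3) xG by (simp add: m_assoc)
      then have mem: "x [^] (j - i) \<in> M" using e(2,3) by simp
      have "\<not> p dvd j - i" using ne le by (metis cong_altdef_nat cong_sym)
      then have "coprime (j - i) p" using p by (metis coprime_commute prime_imp_coprime)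
      then obtain k where k: "[(j - i) * k = Suc 0] (mod p)" using cong_solve_coprime_nat by blast
      have "(x [^] (j - i)) [^] k = x [^] Suc 0"
        unfolding nat_pow_pow[OF xG] using k by (intro pow_cong[OF xG xp]) (simp add: cong_def)
      then have "x \<in> M" using subgroup_pow[OF M.subgroup_axioms mem, of k] xG by simp
      then show False using x(2) by blast
    qed
    show ?thesis using wlog[OF _ e] wlog[OF _ e(1)[symmetric] e(3,2)] by (metis cong_sym nat_le_linear)
  qed
  define \<zeta> where "\<zeta> = cis (2 * pi / real p)"
  have \<zeta>p: "\<zeta> ^ p = 1" using prime_gt_0_nat[OF p] by (simp add: \<zeta>_def DeMoivre)
  have \<zeta>cong: "\<zeta> ^ i = \<zeta> ^ j" if "[i = j] (mod p)" for i j
  proof -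
    have "\<zeta> ^ k = \<zeta> ^ (k mod p)" for k
      using \<zeta>p by (metis div_mult_mod_eq mult.commute mult.left_neutral power_add power_mult power_one)
    then show ?thesis using that by (metis cong_def)
  qed
  \<comment> \<open>The exponent of \<open>x\<close> in \<open>y\<close> is unique modulo
    \<open>p\<close> by \<open>uniq\<close>, and \<open>\<zeta>\<close> is a \<open>p\<close>-th
    root of unity, so the choice of the exponent does not affect the value.\<close>
  define l where "l y = (if y \<in> P then \<zeta> ^ (SOME i::nat. \<exists>m\<in>M. y = x [^] i \<otimes> m) else 0)" for y
  have l: "l y = \<zeta> ^ i" if y: "y = x [^] i \<otimes> m" "m \<in> M" for y i m
  proof -
    have "y \<in> P" using y x(1) M subgroup_pow[OF sP] by auto
    have "\<exists>m'\<in>M. y = x [^] (SOME i::nat. \<exists>m\<in>M. y = x [^] i \<otimes> m) \<otimes> m'" using y by (intro someI_ex[of "\<lambda>i::nat. \<exists>m\<in>M. y = x [^] i \<otimes> m"]) blast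
    then have "[(SOME i::nat. \<exists>m\<in>M. y = x [^] i \<otimes> m) = i] (mod p)" using uniq y by metis
    then show ?thesis using \<open>y \<in> P\<close> \<zeta>cong by (simp add: l_def)
  qed
  have "l (a \<otimes> b) = l a * l b" if ab: "a \<in> P" "b \<in> P" for a b
  proof -
    obtain i m j n where r: "a = x [^] (i::nat) \<otimes> m" "m \<in> M" "b = x [^] (j::nat) \<otimes> n" "n \<in> M"
      using rep ab by metis
    have "a \<otimes> b = x [^] i \<otimes> (m \<otimes> x [^] j) \<otimes> n" using r xG by (simp add: m_assoc)
    also have "\<dots> = x [^] (i + j) \<otimes> (cj (x [^] (p * j - j)) m \<otimes> n)"
      unfolding comm[OF r(2)] using r xG by (simp add: m_assoc flip: nat_pow_mult)
    finally have "l (a \<otimes> b) = \<zeta> ^ (i + j)" using l xN[OF r(2)] r(4) M.m_closed by blast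
    then show ?thesis using l[OF r(1,2)] l[OF r(3,4)] by (simp add: power_add)
  qed
  moreover have "l \<one> = 1" using l[of \<one> 0 \<one>] by simp
  ultimately have "l \<in> lin P" by (simp add: lin_def l_def)
  moreover have "l x = \<zeta>" using l[of x 1 \<one>] xG by simp
  then have "l \<noteq> triv P"
  proof -
    have "\<zeta> \<noteq> 1"
    proof
      assume "\<zeta> = 1"
      then have "cos (2 * pi / real p) = 1" by (metis \<zeta>_def cis.sel(1) one_complex.sel(1))
      then obtain k :: int where "2 * pi / real p = k * 2 * pi" using cos_one_2pi_int by auto
      then have "1 = real_of_int k * real p" using prime_gt_0_nat[OF p] by (simp add: field_simps)
      then have "1 = k * int p" by (metis of_int_1 of_int_eq_iff of_int_mult of_int_of_nat_eq)
      then show False using p by (metis dvd_triv_right int_dvd_int_iff nat_dvd_1_iff_1 not_prime_1 of_nat_1)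
    qed
    then show ?thesis using \<open>l x = \<zeta>\<close> x(1) by (auto simp: triv_def)
  qed
  ultimately show ?thesis by blast
qed

section \<open>Class functions induced from one Sylow subgroup\<close>

locale epo_prime = epo +
  fixes p
  assumes p: "p \<in> primes"
begin

abbreviation "P \<equiv> sylp p"
abbreviation "N \<equiv> normalizer G P"

lemma prime_p: "prime p"
  using p by (simp add: primes_iff)

lemma P_syl: "syl G p P"
  by (rule sylp[OF prime_p])

sublocale lin_subgroup G P
  using P_syl by (auto simp: lin_subgroup_def fin_group_axioms syl_def)

sublocale N: subgroup N G
  by (rule normalizer_subgroup) (rule P.subset)

lemma finN [simp]: "finite N"
  using fin_subgroup N.subgroup_axioms by blast

lemma card_N: "card N = card P * np p"
  using card_normalizer_syl[OF p P_syl] by (simp add: sp_def)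

lemma N_iff: "x \<in> P \<Longrightarrow> x \<noteq> \<one> \<Longrightarrow> y \<in> carrier G \<Longrightarrow> cj y x \<in> P \<longleftrightarrow> y \<in> N"
  using syl_ti_normalizer[OF prime_p P_syl] normalizer_cj by blast

lemma cj_N: "y \<in> N \<Longrightarrow> x \<in> carrier G \<Longrightarrow> cj y x \<in> P \<longleftrightarrow> x \<in> P"
  using normalizer_cj[of y P x] normalizer_cj[of "inv y" P "cj y x"] by auto

lemma P_N: "x \<in> P \<Longrightarrow> x \<in> N"
  using subgroup_in_normalizer[OF P.subgroup_axioms] by blast

definition act :: "'a \<Rightarrow> ('a \<Rightarrow> complex) \<Rightarrow> 'a \<Rightarrow> complex" where
  "act y l x = (if x \<in> P then l (cj y x) else 0)"

lemma act_lin: "y \<in> N \<Longrightarrow> l \<in> lin P \<Longrightarrow> act y l \<in> lin P"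
  by (auto simp: lin_def act_def cj_mult cj_N)

lemma act_act: "y \<in> N \<Longrightarrow> z \<in> N \<Longrightarrow> act y (act z l) = act (z \<otimes> y) l"
  by (rule ext) (simp add: act_def cj_cj cj_N)

lemma act_one: "l \<in> lin P \<Longrightarrow> act \<one> l = l"
  by (rule ext) (simp add: act_def lin_out)

lemma act_triv: "y \<in> N \<Longrightarrow> act y (triv P) = triv P"
  by (rule ext) (simp add: act_def triv_def cj_N)

text \<open>An element \<open>y\<close> outside \<open>P\<close> fixes only the identity of
  \<open>P\<close>, so \<open>inv x \<otimes> cj y x\<close> runs through all of \<open>P\<close> as
  \<open>x\<close> does. A linear character fixed by \<open>y\<close> has the value 1 there, hence
  is trivial.\<close>

lemma act_id_iff:
  assumes y: "y \<in> N" and l: "l \<in> lin P" "l \<noteq> triv P"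
  shows "act y l = l \<longleftrightarrow> y \<in> P"
proof
  assume yP: "y \<in> P"
  have "l (cj y x) = l x" if x: "x \<in> P" for x
  proof -
    have "l (cj y x) = l y * l x * cnj (l y)"
      using yP x l(1) by (simp add: cj_def lin_mult lin_inv)
    also have "\<dots> = l x" using lin_cnj[OF l(1) yP] by (simp add: mult_ac)
    finally show ?thesis .
  qed
  then show "act y l = l" using l(1) lin_out by (auto simp: act_def)
next
  assume eq: "act y l = l"
  show "y \<in> P"
  proof (rule ccontr)
    assume yP: "y \<notin> P"
    let ?f = "\<lambda>x. inv x \<otimes> cj y x"
    have inj: "inj_on ?f P"
    proof (rule inj_onI)
      fix a b assume ab: "a \<in> P" "b \<in> P" "?f a = ?f b"
      have abG: "a \<in> carrier G" "b \<in> carrier G" "y \<in> carrier G" using ab(1,2) y by simp_all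
      have "b \<otimes> inv a = b \<otimes> (inv a \<otimes> cj y a) \<otimes> inv (cj y a)" using abG by (simp add: m_assoc)
      also have "\<dots> = b \<otimes> (inv b \<otimes> cj y b) \<otimes> inv (cj y a)" unfolding ab(3) ..
      also have "\<dots> = cj y (b \<otimes> inv a)" using abG by (simp add: cj_mult cj_inv)
      finally have "b \<otimes> inv a = cj y (b \<otimes> inv a)" .
      then have "b \<otimes> inv a = \<one>" using no_fixed_points[OF p P_syl y yP, of "b \<otimes> inv a"] ab by simp
      then show "a = b" using ab by (metis P.mem_carrier inv_closed inv_equality inv_inv)
    qed
    have "?f ` P = P" using inj cj_N[OF y] by (intro endo_inj_surj) auto
    have "l z = 1" if z: "z \<in> P" for z
    proof -
      obtain x where x: "x \<in> P" "z = ?f x" using z \<open>?f ` P = P\<close> by blast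
      have cP: "cj y x \<in> P" using x y cj_N by simp
      have "l (cj y x) = l x" using fun_cong[OF eq, of x] x by (simp add: act_def)
      then have "l z = cnj (l x) * l x" using x cP l(1) by (simp add: lin_mult lin_inv)
      then show ?thesis using lin_cnj[OF l(1) x(1)] by (simp add: mult.commute)
    qed
    then have "l = triv P" using l(1) lin_out by (auto simp: triv_def)
    then show False using l(2) by blast
  qed
qed

text \<open>Induced from \<open>triv P - l\<close>. As this vanishes at the identity, so does
  \<open>beta l\<close>, which confines its support to the \<open>p\<close>-elements.\<close>

definition beta :: "('a \<Rightarrow> complex) \<Rightarrow> 'a \<Rightarrow> complex" where
  "beta l = (\<lambda>x. ind P (triv P) x - ind P l x)"

lemma class_fun_beta: "class_fun (beta l)"
  using class_fun_ind[of l] class_fun_ind[of "triv P"] by (auto simp: beta_def class_fun_def el_def)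

lemma ind_eq: "x \<in> carrier G \<Longrightarrow> ind P l x = (\<Sum>y\<in>carrier G. l (cj y x)) / of_nat (card P)"
  by (simp add: ind_def ch_def sum_divide_distrib)

lemma beta_eq:
  "x \<in> carrier G \<Longrightarrow> beta l x = (\<Sum>y\<in>carrier G. triv P (cj y x) - l (cj y x)) / of_nat (card P)"
  by (simp add: beta_def ind_eq sum_subtractf diff_divide_distrib)

lemma cls_eq: "cls p = conjs P"
  by (rule cls_eq_conjs[OF p P_syl])

lemma beta_support:
  assumes l: "l \<in> lin P" and x: "x \<notin> cls p"
  shows "beta l x = 0"
proof (cases "x \<in> carrier G")
  case True
  have "triv P (cj y x) - l (cj y x) = 0" if y: "y \<in> carrier G" for y
  proof (cases "cj y x \<in> P")
    case inP: True
    have "x = \<one>"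
    proof (rule ccontr)
      assume "x \<noteq> \<one>"
      then have "x \<in> conjs P"
        unfolding conjs_def
        by (intro CollectI exI[of _ "inv y"] exI[of _ "cj y x"]) (use inP y True in simp)
      then show False using x cls_eq by simp
    qed
    then show ?thesis using y lin_one[OF l] by (simp add: triv_def)
  next
    case False
    then show ?thesis using lin_out[OF l] by (simp add: triv_def)
  qed
  then show ?thesis using True by (simp add: beta_eq)
qed (use class_fun_beta[of l] in \<open>simp add: class_fun_def el_def\<close>)

lemma beta_P:
  assumes l: "l \<in> lin P" and x: "x \<in> P"
  shows "beta l x = (\<Sum>y\<in>N. 1 - l (cj y x)) / of_nat (card P)"
proof (cases "x = \<one>")
  case True
  then show ?thesis using beta_support[OF l, of x] lin_one[OF l] by (simp add: cls_def)
next
  case False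
  have "(\<Sum>y\<in>carrier G. triv P (cj y x) - l (cj y x)) = (\<Sum>y\<in>N. 1 - l (cj y x))"
  proof (rule sum.mono_neutral_cong_right)
    show "\<forall>y\<in>carrier G - N. triv P (cj y x) - l (cj y x) = 0"
      using N_iff[OF x False] lin_out[OF l] by (auto simp: triv_def)
    show "triv P (cj y x) - l (cj y x) = 1 - l (cj y x)" if "y \<in> N" for y
      using that x cj_N by (simp add: triv_def)
  qed (use N.subset in auto)
  then show ?thesis using x by (simp add: beta_eq)
qed

lemma ip_beta:
  assumes l: "l \<in> lin P" and b: "class_fun b"
  shows "ip (beta l) b = (\<Sum>x\<in>P. (1 - l x) * cnj (b x)) / of_nat (card P)"
proof -
  have "ip (beta l) b = ip (ind P (triv P)) b - ip (ind P l) b" by (simp add: beta_def ip_diff)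
  also have "\<dots> = ((\<Sum>x\<in>P. triv P x * cnj (b x)) - (\<Sum>x\<in>P. l x * cnj (b x))) / of_nat (card P)"
    by (simp add: ip_ind[OF b] l triv_lin diff_divide_distrib)
  also have "(\<Sum>x\<in>P. triv P x * cnj (b x)) - (\<Sum>x\<in>P. l x * cnj (b x)) = (\<Sum>x\<in>P. (1 - l x) * cnj (b x))"
    by (simp add: triv_def sum_subtractf left_diff_distrib)
  finally show ?thesis .
qed

lemma act_fiber_card:
  assumes l: "l \<in> lin P" "l \<noteq> triv P" and z: "z \<in> N"
  shows "card {y \<in> N. act y l = act z l} = card P"
proof -
  have "bij_betw (\<lambda>x. x \<otimes> z) P {y \<in> N. act y l = act z l}"
  proof (rule bij_betw_byWitness[where f' = "\<lambda>y. y \<otimes> inv z"])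
    show "(\<lambda>x. x \<otimes> z) ` P \<subseteq> {y \<in> N. act y l = act z l}"
    proof (rule image_subsetI)
      fix x assume x: "x \<in> P"
      have "act x l = l" using act_id_iff[OF P_N[OF x] l] x by blast
      then have "act z (act x l) = act z l" by simp
      then show "x \<otimes> z \<in> {y \<in> N. act y l = act z l}"
        using act_act[OF z P_N[OF x]] P_N[OF x] z by simp
    qed
    show "(\<lambda>y. y \<otimes> inv z) ` {y \<in> N. act y l = act z l} \<subseteq> P"
    proof (rule image_subsetI)
      fix y assume y: "y \<in> {y \<in> N. act y l = act z l}"
      have "act (y \<otimes> inv z) l = act (inv z) (act y l)"
        by (rule act_act[symmetric]) (use y z in auto)
      also have "\<dots> = act (inv z) (act z l)" using y by simp
      also have "\<dots> = l" using z l(1) by (simp add: act_act act_one)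
      finally show "y \<otimes> inv z \<in> P" using act_id_iff[OF _ l, of "y \<otimes> inv z"] y z by simp
    qed
  qed (use z in \<open>auto simp: m_assoc\<close>)
  then show ?thesis by (simp add: bij_betw_same_card)
qed

lemma beta_act:
  assumes l: "l \<in> lin P" and y: "y \<in> N"
  shows "beta (act y l) = beta l"
proof (rule el_eqI)
  fix x assume x: "x \<in> carrier G"
  have a: "act y l (cj w x) = l (cj (y \<otimes> w) x)" if "w \<in> carrier G" for w
    using that x y lin_out[OF l] by (simp add: act_def cj_cj[symmetric] cj_N)
  have "(\<Sum>w\<in>carrier G. act y l (cj w x)) = (\<Sum>w\<in>carrier G. l (cj w x))"
    using sum_lmult[of y "\<lambda>w. l (cj w x)"] y by (simp add: a)
  then show "beta (act y l) x = beta l x" using x by (simp add: beta_def ind_eq)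
qed (use class_fun_beta in \<open>auto simp: class_fun_def\<close>)

text \<open>By trivial intersection only conjugation by \<open>y\<close> in \<open>N\<close>
  contributes. The inner product of \<open>triv P - l\<close> and \<open>triv P - act y m\<close> on
  \<open>P\<close> is 1, plus 1 if the two nontrivial characters agree; summing over
  \<open>N\<close> and dividing by \<open>card P\<close> gives both terms.\<close>

lemma ip_beta_count:
  assumes l: "l \<in> lin P" "l \<noteq> triv P" and m: "m \<in> lin P" "m \<noteq> triv P"
  shows "ip (beta l) (beta m) = of_nat (np p) + of_nat (card {y \<in> N. act y m = l}) / of_nat (card P)"
proof -
  let ?c = "of_nat (card P) :: complex"
  have c0: "?c \<noteq> 0" using cardP by (metis less_numeral_extra(3) of_nat_eq_0_iff)
  have inner: "(\<Sum>x\<in>P. (1 - l x) * cnj (1 - m (cj y x))) = ?c + (if act y m = l then ?c else 0)" if y: "y \<in> N" for y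
  proof -
    have "(\<Sum>x\<in>P. (1 - l x) * cnj (1 - m (cj y x))) = (\<Sum>x\<in>P. (triv P x - l x) * cnj (triv P x - act y m x))"
      by (rule sum.cong) (simp_all add: triv_def act_def)
    also have "\<dots> = (\<Sum>x\<in>P. triv P x * cnj (triv P x)) - (\<Sum>x\<in>P. l x * cnj (triv P x))
        - (\<Sum>x\<in>P. triv P x * cnj (act y m x)) + (\<Sum>x\<in>P. l x * cnj (act y m x))"
      by (simp add: algebra_simps sum.distrib sum_subtractf)
    also have "\<dots> = ?c + (if act y m = l then ?c else 0)"
    proof -
      have "act y m \<noteq> triv P"
      proof
        assume "act y m = triv P"
        then have "act (inv y) (act y m) = triv P" using y by (simp add: act_triv)
        then show False using y m by (simp add: act_act act_one)
      qed
      then show ?thesis using l triv_lin act_lin[OF y m(1)] by (auto simp: lin_orthogonal)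
    qed
    finally show ?thesis .
  qed
  have "ip (beta l) (beta m) = (\<Sum>x\<in>P. \<Sum>y\<in>N. (1 - l x) * cnj (1 - m (cj y x))) / (?c * ?c)"
    by (simp add: ip_beta[OF l(1) class_fun_beta] beta_P[OF m(1)] sum_distrib_left sum_divide_distrib)
  also have "\<dots> = (\<Sum>y\<in>N. ?c + (if act y m = l then ?c else 0)) / (?c * ?c)"
    by (subst sum.swap) (simp only: inner cong: sum.cong)
  also have "\<dots> = (of_nat (card N) * ?c + of_nat (card {y \<in> N. act y m = l}) * ?c) / (?c * ?c)"
    by (simp add: sum.distrib sum.If_cases Int_def)
  also have "\<dots> = of_nat (np p) + of_nat (card {y \<in> N. act y m = l}) / ?c"
    using c0 by (simp add: card_N field_simps)
  finally show ?thesis .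
qed

lemma beta_eq_iff:
  assumes l: "l \<in> lin P" "l \<noteq> triv P" and m: "m \<in> lin P" "m \<noteq> triv P"
  shows "beta l = beta m \<longleftrightarrow> (\<exists>y\<in>N. act y m = l)"
proof
  assume eq: "beta l = beta m"
  have "{y \<in> N. act y m = l} \<noteq> {}"
  proof
    assume "{y \<in> N. act y m = l} = {}"
    then have "ip (beta l) (beta m) = of_nat (np p)" using ip_beta_count[OF l m] by simp
    moreover have "ip (beta l) (beta l) = of_nat (np p) + 1"
      using ip_beta_count[OF l l] act_fiber_card[OF l N.one_closed] l cardP by (simp add: act_one)
    ultimately show False using eq by simp
  qed
  then show "\<exists>y\<in>N. act y m = l" by blast
qed (use beta_act m in blast)

lemma ip_beta_beta:
  assumes l: "l \<in> lin P" "l \<noteq> triv P" and m: "m \<in> lin P" "m \<noteq> triv P"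
  shows "ip (beta l) (beta m) = of_nat (np p) + (if beta l = beta m then 1 else 0)"
proof (cases "\<exists>y\<in>N. act y m = l")
  case True
  then obtain z where z: "z \<in> N" "l = act z m" by blast
  have "card {y \<in> N. act y m = l} = card P" unfolding z(2) by (rule act_fiber_card[OF m z(1)])
  then show ?thesis using ip_beta_count[OF l m] beta_eq_iff[OF l m] True cardP by simp
next
  case False
  then have "{y \<in> N. act y m = l} = {}" by blast
  then show ?thesis using ip_beta_count[OF l m] beta_eq_iff[OF l m] False by simp
qed

definition betas where "betas = beta ` (lin P - {triv P})"

lemma finite_betas [simp]: "finite betas"
  using finite_lin by (simp add: betas_def)

text \<open>The map \<open>beta\<close> identifies exactly the orbits of \<open>N\<close> on
  nontrivial linear characters, and each orbit has length \<open>np p\<close> because the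
  stabilizers are \<open>P\<close>.\<close>

lemma card_betas: "card betas * np p = card (lin P) - 1"
proof -
  have "card (lin P - {triv P}) = np p * card betas"
  proof (rule card_const_fibers)
    show "finite (lin P - {triv P})" using finite_lin by simp
    show "beta ` (lin P - {triv P}) = betas" by (simp add: betas_def)
    fix b assume "b \<in> betas"
    then obtain l where l: "l \<in> lin P" "l \<noteq> triv P" "b = beta l" by (auto simp: betas_def)
    let ?F = "{m \<in> lin P - {triv P}. beta m = b}"
    have "card N = card P * card ?F"
    proof (rule card_const_fibers)
      show "(\<lambda>y. act y l) ` N = ?F"
      proof
        show "(\<lambda>y. act y l) ` N \<subseteq> ?F"
        proof (rule image_subsetI)
          fix y assume y: "y \<in> N"
          have "act y l \<noteq> triv P"
          proof
            assume "act y l = triv P"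
            then have "act (inv y) (act y l) = triv P" using y by (simp add: act_triv)
            then show False using y l by (simp add: act_act act_one)
          qed
          then show "act y l \<in> ?F" using y l beta_act act_lin by simp
        qed
        show "?F \<subseteq> (\<lambda>y. act y l) ` N" using beta_eq_iff[OF _ _ l(1,2)] l(3) by blast
      qed
      fix m assume "m \<in> ?F"
      then obtain z where z: "z \<in> N" "m = act z l" using beta_eq_iff[OF _ _ l(1,2)] l(3) by blast
      show "card {y \<in> N. act y l = m} = card P" unfolding z(2) by (rule act_fiber_card[OF l(1,2) z(1)])
    qed simp
    then show "card ?F = np p" using card_N cardP by simp
  qed
  then show ?thesis using triv_lin finite_lin by (simp add: mult.commute)
qed

lemma betas_nonempty: "betas \<noteq> {}"
  using nontrivial_lin[OF prime_p syl_psub[OF P_syl] sylp_nontrivial[OF p P_syl]] by (auto simp: betas_def)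

lemma betas_ip: "b \<in> betas \<Longrightarrow> c \<in> betas \<Longrightarrow> ip b c = of_nat (np p) + (if b = c then 1 else 0)"
  using ip_beta_beta by (auto simp: betas_def)

lemma betas_class_fun: "b \<in> betas \<Longrightarrow> class_fun b"
  using class_fun_beta by (auto simp: betas_def)

lemma betas_support: "b \<in> betas \<Longrightarrow> x \<notin> cls p \<Longrightarrow> b x = 0"
  using beta_support by (auto simp: betas_def)

lemma betas_one: "b \<in> betas \<Longrightarrow> ip b one_fun = 1"
proof -
  assume "b \<in> betas"
  then obtain l where l: "l \<in> lin P" "l \<noteq> triv P" "b = beta l" by (auto simp: betas_def)
  have "class_fun one_fun" by (rule Irr_class_fun[OF one_fun_Irr])
  then have "ip b one_fun = (\<Sum>x\<in>P. 1 - l x) / of_nat (card P)"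
    using l by (simp add: ip_beta one_fun_def)
  also have "(\<Sum>x\<in>P. 1 - l x) = of_nat (card P)" using l by (simp add: sum_subtractf sum_lin)
  finally show ?thesis using cardP by simp
qed

lemma betas_int: "b \<in> betas \<Longrightarrow> \<chi> \<in> Irr \<Longrightarrow> \<exists>i::int. ip b \<chi> = of_int i"
proof -
  assume "b \<in> betas" and \<chi>: "\<chi> \<in> Irr"
  then obtain l where l: "l \<in> lin P" "b = beta l" by (auto simp: betas_def)
  obtain m n :: nat where "ip (ind P (triv P)) \<chi> = of_nat m" "ip (ind P l) \<chi> = of_nat n"
    using ind_Irr_nat[OF triv_lin \<chi>] ind_Irr_nat[OF l(1) \<chi>] by blast
  then have "ip b \<chi> = of_int (int m - int n)" by (simp add: l beta_def ip_diff)
  then show ?thesis by blast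
qed

lemma betas_cnj: "b \<in> betas \<Longrightarrow> (\<lambda>x. cnj (b x)) \<in> betas"
proof -
  assume "b \<in> betas"
  then obtain l where l: "l \<in> lin P" "l \<noteq> triv P" "b = beta l" by (auto simp: betas_def)
  have "(\<lambda>x. cnj (l x)) \<noteq> triv P"
  proof
    assume eq: "(\<lambda>x. cnj (l x)) = triv P"
    have "l x = triv P x" for x
      using arg_cong[OF fun_cong[OF eq, of x], of cnj] by (auto simp: triv_def)
    then show False using l(2) by blast
  qed
  moreover have "(\<lambda>x. cnj (b x)) = beta (\<lambda>x. cnj (l x))"
    by (rule ext) (simp add: l(3) beta_def ind_def ch_def triv_def if_distrib[of cnj] cong: if_cong)
  ultimately show ?thesis using lin_conj[OF l(1)] by (auto simp: betas_def)
qed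

lemma card_lin: "card (lin P) dvd sp p" "2 \<le> card (lin P)"
proof -
  show "card (lin P) dvd sp p" using card_lin_dvd by (simp add: sp_def)
  have "card betas \<noteq> 0" "np p \<noteq> 0" using betas_nonempty np_pos[OF p] by auto
  then have "card (lin P) - 1 \<noteq> 0" using card_betas by (metis mult_eq_0_iff)
  then show "2 \<le> card (lin P)" by simp
qed

text \<open>If \<open>P\<close> is self-normalizing, then some \<open>b\<close> has norm 2, so it is the difference of the
  trivial character and a nontrivial linear character of \<open>G\<close>, whose kernel is wanted.\<close>

lemma self_normalizing_kernel:
  assumes np: "np p = 1"
  shows "\<exists>K. subgroup K G \<and> normalizer G K = carrier G \<and> K \<noteq> carrier G \<and> carrier G - cls p \<subseteq> K"
proof -
  obtain b where b: "b \<in> betas" using betas_nonempty by blast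
  have "\<forall>\<chi>. \<exists>i::int. \<chi> \<in> Irr \<longrightarrow> ip b \<chi> = of_int i" using betas_int[OF b] by blast
  then have "\<exists>u. \<forall>\<chi>. \<chi> \<in> Irr \<longrightarrow> ip b \<chi> = of_int (u \<chi> :: int)" by (rule choice)
  then obtain u :: "('a \<Rightarrow> complex) \<Rightarrow> int" where u: "\<And>\<chi>. \<chi> \<in> Irr \<Longrightarrow> ip b \<chi> = of_int (u \<chi>)" by blast
  have u1: "u one_fun = 1" using u[OF one_fun_Irr] betas_one[OF b] by (metis of_int_1 of_int_eq_iff)
  have "of_int (\<Sum>\<chi>\<in>Irr. u \<chi> * u \<chi>) = ip b b"
    using parseval[OF betas_class_fun[OF b] betas_class_fun[OF b]] u by simp
  also have "\<dots> = of_int 2" using betas_ip[OF b b] np by simp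
  finally have "(\<Sum>\<chi>\<in>Irr. u \<chi> * u \<chi>) = 2" by (simp only: of_int_eq_iff)
  then have s1: "(\<Sum>\<chi>\<in>Irr - {one_fun}. u \<chi> * u \<chi>) = 1"
    using finite_Irr one_fun_Irr u1 by (simp add: sum.remove[of Irr one_fun])
  then obtain \<chi> where \<chi>: "\<chi> \<in> Irr" "\<chi> \<noteq> one_fun" "u \<chi> \<noteq> 0"
    by (metis (no_types, lifting) DiffE mult_zero_left singletonI sum.neutral zero_neq_one)
  have "(\<Sum>\<psi>\<in>Irr - {one_fun} - {\<chi>}. u \<psi> * u \<psi>) = 1 - u \<chi> * u \<chi>"
    using s1 \<chi> finite_Irr by (simp add: sum.remove[of "Irr - {one_fun}" \<chi>])
  moreover have "0 < u \<chi> * u \<chi>" using \<chi>(3) by (metis not_real_square_gt_zero zero_less_mult_iff linorder_neqE_linordered_idom)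
  moreover have "0 \<le> (\<Sum>\<psi>\<in>Irr - {one_fun} - {\<chi>}. u \<psi> * u \<psi>)" by (intro sum_nonneg) simp
  ultimately have uu: "u \<chi> * u \<chi> = 1" "(\<Sum>\<psi>\<in>Irr - {one_fun} - {\<chi>}. u \<psi> * u \<psi>) = 0" by linarith+
  then have u0: "u \<psi> = 0" if "\<psi> \<in> Irr - {one_fun} - {\<chi>}" for \<psi>
    using that finite_Irr by (simp add: sum_nonneg_eq_0_iff)
  have bx: "b x = one_fun x + of_int (u \<chi>) * \<chi> x" for x
  proof -
    have "b x = (\<Sum>\<psi>\<in>Irr. of_int (u \<psi>) * \<psi> x)"
      using class_fun_expansion[OF betas_class_fun[OF b], of x] u by simp
    also have "\<dots> = (\<Sum>\<psi>\<in>{one_fun, \<chi>}. of_int (u \<psi>) * \<psi> x)"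
      using finite_Irr u0 \<chi> one_fun_Irr by (intro sum.mono_neutral_right) auto
    finally show ?thesis using \<chi>(2) u1 by simp
  qed
  obtain n :: nat where n: "\<chi> \<one> = of_nat n" "0 < n" using Irr_degree[OF \<chi>(1)] by blast
  \<comment> \<open>Evaluating at the identity gives \<open>1 + u \<chi> * n = 0\<close>, which
    fixes both the sign and the degree: \<open>u \<chi> = -1\<close> and
    \<open>n = 1\<close>.\<close>
  have "b \<one> = 0" using betas_support[OF b] by (simp add: cls_def)
  then have "of_int (1 + u \<chi> * int n) = (0 :: complex)" using bx[of \<one>] n by (simp add: one_fun_def)
  then have un: "1 + u \<chi> * int n = 0" by (simp only: of_int_eq_0_iff)
  have um: "u \<chi> = -1"
  proof -
    have "u \<chi> = 1 \<or> u \<chi> = -1" using uu(1) by (metis zmult_eq_1_iff)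
    then show ?thesis using un n(2) by auto
  qed
  then have "n = 1" using un by simp
  then have lin: "\<chi> (x \<otimes> y) = \<chi> x * \<chi> y" if "x \<in> carrier G" "y \<in> carrier G" for x y
    using linear_Irr_mult[OF \<chi>(1)] n that by simp
  have \<chi>b: "\<chi> x = one_fun x - b x" for x using bx[of x] um by simp
  define K where "K = {x \<in> carrier G. \<chi> x = 1}"
  have c: "\<chi> (cj y x) = \<chi> x" if "x \<in> carrier G" "y \<in> carrier G" for x y
    using Irr_class_fun[OF \<chi>(1)] that by (simp add: class_fun_def)
  have "subgroup K G"
  proof (rule subgroupI)
    show "K \<noteq> {}" using n \<open>n = 1\<close> by (auto simp: K_def)
  qed (auto simp: K_def lin Irr_inv[OF \<chi>(1)])
  moreover have "normalizer G K = carrier G"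
    using normalizer_subset by (auto intro!: normalizerI simp: K_def c)
  moreover have "K \<noteq> carrier G"
  proof
    assume "K = carrier G"
    then have "\<chi> x = 1" if "x \<in> carrier G" for x using that by (auto simp: K_def)
    then have "b x = 0" if "x \<in> carrier G" for x using \<chi>b[of x] that by (simp add: one_fun_def)
    then have "ip b b = 0" by (simp add: ip_def)
    then show False using betas_ip[OF b b] np by simp
  qed
  moreover have "carrier G - cls p \<subseteq> K" using \<chi>b betas_support[OF b] by (auto simp: K_def one_fun_def)
  ultimately show ?thesis by blast
qed

end

section \<open>Coherent families of integral vectors\<close>

lemma even_sum_involution:
  fixes f :: "'x \<Rightarrow> int"
  assumes "finite R" and "\<And>x. x \<in> R \<Longrightarrow> s x \<in> R" and "\<And>x. x \<in> R \<Longrightarrow> s x \<noteq> x"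
    and "\<And>x. x \<in> R \<Longrightarrow> s (s x) = x" and "\<And>x. x \<in> R \<Longrightarrow> f (s x) = f x"
  shows "even (sum f R)"
  using assms
proof (induction R rule: finite_psubset_induct)
  case (psubset R)
  note p = psubset.prems
  show ?case
  proof (cases "R = {}")
    case False
    then obtain x where x: "x \<in> R" by blast
    have "even (sum f (R - {x, s x}))"
    proof (rule psubset.IH)
      show "R - {x, s x} \<subset> R" using x by blast
      fix y assume y: "y \<in> R - {x, s x}"
      then have yR: "y \<in> R" by blast
      have "s y \<noteq> x" "s y \<noteq> s x"
        using p(3)[OF yR] p(3)[OF x] y by (metis DiffE insertI1 insertI2)+
      then show "s y \<in> R - {x, s x}" using p(1)[OF yR] by blast
      show "s y \<noteq> y" by (rule p(2)[OF yR])
      show "s (s y) = y" by (rule p(3)[OF yR])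
      show "f (s y) = f y" by (rule p(4)[OF yR])
    qed
    moreover have "sum f R = sum f (R - {x, s x}) + sum f {x, s x}"
      using p(1)[OF x] x psubset.hyps by (intro sum.subset_diff) auto
    moreover have "sum f {x, s x} = 2 * f x"
      using p(2)[OF x] p(4)[OF x] by (simp add: eq_commute[of x])
    ultimately show ?thesis by simp
  qed simp
qed

text \<open>Orthogonality to the positive vector \<open>d\<close> forces coordinates of both signs,
  and squared norm 2 leaves room for one 1 and one -1 only.\<close>

lemma norm_two_vector:
  fixes f d :: "'x \<Rightarrow> int"
  assumes Y: "finite Y" and d: "\<And>x. x \<in> Y \<Longrightarrow> 0 < d x"
    and n: "(\<Sum>x\<in>Y. (f x)\<^sup>2) = 2" and z: "(\<Sum>x\<in>Y. f x * d x) = 0"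
  shows "\<exists>a m. a \<in> Y \<and> m \<in> Y \<and> a \<noteq> m \<and>
    (\<forall>x\<in>Y. f x = (if x = a then 1 else 0) - (if x = m then 1 else 0))"
proof -
  have nz: "\<exists>x\<in>Y. f x \<noteq> 0"
  proof (rule ccontr)
    assume "\<not> ?thesis"
    then have "(\<Sum>x\<in>Y. (f x)\<^sup>2) = 0" by (intro sum.neutral) auto
    then show False using n by simp
  qed
  have pos: "\<exists>x\<in>Y. 0 < g x" if g: "(\<Sum>x\<in>Y. g x * d x) = 0" "\<exists>x\<in>Y. g x \<noteq> 0" for g :: "'x \<Rightarrow> int"
  proof (rule ccontr)
    assume "\<not> ?thesis"
    then have neg: "g x \<le> 0" if "x \<in> Y" for x using that by force
    have le: "0 \<le> - (g x * d x)" if x: "x \<in> Y" for x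
      using mult_nonpos_nonneg[OF neg[OF x] less_imp_le[OF d[OF x]]] by linarith
    have "(\<Sum>x\<in>Y. - (g x * d x)) = 0" using g(1) by (simp add: sum_negf)
    then have "\<forall>x\<in>Y. - (g x * d x) = 0" by (subst (asm) sum_nonneg_eq_0_iff) (use Y le in simp_all)
    moreover obtain x where x: "x \<in> Y" "g x \<noteq> 0" using g(2) by blast
    ultimately have "g x * d x = 0" by (metis neg_equal_0_iff_equal)
    then show False using x(2) d[OF x(1)] by simp
  qed
  obtain a where a: "a \<in> Y" "0 < f a" using pos[OF z nz] by blast
  have "\<exists>x\<in>Y. 0 < - f x" by (rule pos) (use z nz in \<open>auto simp: sum_negf\<close>)
  then obtain m where m: "m \<in> Y" "f m < 0" by auto
  have am: "a \<noteq> m" using a m by auto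
  have "(\<Sum>x\<in>Y. (f x)\<^sup>2) = (\<Sum>x\<in>Y - {a, m}. (f x)\<^sup>2) + (\<Sum>x\<in>{a, m}. (f x)\<^sup>2)"
    using a m Y by (intro sum.subset_diff) auto
  then have s: "(\<Sum>x\<in>Y - {a, m}. (f x)\<^sup>2) + (f a)\<^sup>2 + (f m)\<^sup>2 = 2" using n am by simp
  have nn: "0 \<le> (\<Sum>x\<in>Y - {a, m}. (f x)\<^sup>2)" by (intro sum_nonneg) simp
  have sq: "1 \<le> (f a)\<^sup>2" "1 \<le> (f m)\<^sup>2" using a(2) m(2) by (simp_all add: int_one_le_iff_zero_less)
  have sq2: "1 < t\<^sup>2" if "1 < \<bar>t\<bar>" for t :: int
    using one_less_power[OF that, of 2] by simp
  have "\<bar>f a\<bar> \<le> 1" "\<bar>f m\<bar> \<le> 1" using sq2[of "f a"] sq2[of "f m"] s nn sq by linarith+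
  then have fa: "f a = 1" "f m = -1" using a(2) m(2) by linarith+
  have "(\<Sum>x\<in>Y - {a, m}. (f x)\<^sup>2) = 0" using s fa by simp
  then have "\<forall>x\<in>Y - {a, m}. (f x)\<^sup>2 = 0" using Y by (subst (asm) sum_nonneg_eq_0_iff) auto
  then show ?thesis using a m fa am by (intro exI[of _ a] exI[of _ m]) auto
qed

text \<open>If neither index is shared, \<open>a\<close> and \<open>m'\<close> both carry a positive
  coefficient, so both equal \<open>s\<close>; but then the coefficient there would be 2. If both
  are shared, the difference vanishes.\<close>

lemma unit_difference:
  fixes a m a' m' s t :: 'x
  assumes "\<And>x. x \<in> Y \<Longrightarrow> (if x = a then 1 else 0) - (if x = m then 1 else 0)
      - ((if x = a' then 1 else 0) - (if x = m' then 1 else 0)) =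
      (if x = s then 1 else 0) - (if x = t then 1 else (0::int))"
    and "a \<in> Y" "m' \<in> Y" "s \<in> Y" "a \<noteq> m" "a' \<noteq> m'" "s \<noteq> t"
  shows "(a = a') \<noteq> (m = m')"
proof (cases "a = a'")
  case True
  show ?thesis
  proof
    assume "(a = a') = (m = m')"
    then show False using assms(1)[OF assms(4)] True assms(7) by simp
  qed
next
  case False
  have "m = m'"
  proof (rule ccontr)
    assume m: "m \<noteq> m'"
    have "1 + (if a = m' then 1 else (0::int)) = (if a = s then 1 else 0) - (if a = t then 1 else 0)"
      using assms(1)[OF assms(2)] assms(5) False by simp
    then have "a = s" "a \<noteq> m'" by (auto split: if_splits)
    moreover have "(if m' = a then 1 else (0::int)) + 1 = (if m' = s then 1 else 0) - (if m' = t then 1 else 0)"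
      using assms(1)[OF assms(3)] assms(6) m by auto
    then have "m' = s" by (auto split: if_splits)
    ultimately show False by simp
  qed
  then show ?thesis using False by simp
qed

text \<open>Relative to a fixed member \<open>u\<close>, every other vector \<open>b\<close> is
  shifted by a unit vector at \<open>a b\<close> minus one at \<open>m b\<close>, and any two shifts
  share exactly one of the indices. If \<open>b1\<close> departed from \<open>b\<close> in
  \<open>m\<close> and \<open>b2\<close> departed from it in \<open>a\<close>, then
  \<open>b1\<close> and \<open>b2\<close> would share neither; so one index is common to all. A
  common \<open>m\<close> gives the sign 1, a common \<open>a\<close> the sign -1.\<close>

lemma coherent_family:
  fixes c :: "'b \<Rightarrow> 'x \<Rightarrow> int" and d :: "'x \<Rightarrow> int"
  assumes Y: "finite Y" and d: "\<And>x. x \<in> Y \<Longrightarrow> 0 < d x" and B: "2 \<le> card B"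
    and n: "\<And>b b'. b \<in> B \<Longrightarrow> b' \<in> B \<Longrightarrow> b \<noteq> b' \<Longrightarrow> (\<Sum>x\<in>Y. (c b x - c b' x)\<^sup>2) = 2"
    and z: "\<And>b b'. b \<in> B \<Longrightarrow> b' \<in> B \<Longrightarrow> (\<Sum>x\<in>Y. (c b x - c b' x) * d x) = 0"
  shows "\<exists>e C j. (e = 1 \<or> e = - 1) \<and> inj_on j B \<and> j ` B \<subseteq> Y \<and>
    (\<forall>b\<in>B. \<forall>x\<in>Y. c b x = C x + (if x = j b then e else 0))"
proof -
  have diff: "\<exists>a m. a \<in> Y \<and> m \<in> Y \<and> a \<noteq> m \<and>
      (\<forall>x\<in>Y. c b x - c b' x = (if x = a then 1 else 0) - (if x = m then 1 else 0))"
    if "b \<in> B" "b' \<in> B" "b \<noteq> b'" for b b'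
    using norm_two_vector[OF Y d n[OF that] z[OF that(1,2)]] .
  have "B \<noteq> {}" using B by auto
  then obtain u where u: "u \<in> B" by blast
  define B' where "B' = B - {u}"
  have "B' \<noteq> {}"
  proof
    assume "B' = {}"
    then have "B = {u}" using u by (auto simp: B'_def)
    then show False using B by simp
  qed
  have "\<forall>b\<in>B'. \<exists>y. fst y \<in> Y \<and> snd y \<in> Y \<and> fst y \<noteq> snd y \<and>
      (\<forall>x\<in>Y. c b x - c u x = (if x = fst y then 1 else 0) - (if x = snd y then 1 else 0))"
  proof
    fix b assume "b \<in> B'"
    then have "b \<in> B" "b \<noteq> u" by (auto simp: B'_def)
    from diff[OF this(1) u this(2)] obtain a m where "a \<in> Y" "m \<in> Y" "a \<noteq> m"
      "\<forall>x\<in>Y. c b x - c u x = (if x = a then 1 else 0) - (if x = m then 1 else 0)" by blast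
    then show "\<exists>y. fst y \<in> Y \<and> snd y \<in> Y \<and> fst y \<noteq> snd y \<and>
      (\<forall>x\<in>Y. c b x - c u x = (if x = fst y then 1 else 0) - (if x = snd y then 1 else 0))"
      by (intro exI[of _ "(a, m)"]) simp
  qed
  from bchoice[OF this] obtain y where y: "\<forall>b\<in>B'. fst (y b) \<in> Y \<and> snd (y b) \<in> Y \<and> fst (y b) \<noteq> snd (y b) \<and>
      (\<forall>x\<in>Y. c b x - c u x = (if x = fst (y b) then 1 else 0) - (if x = snd (y b) then 1 else 0))" by blast
  define a where "a b = fst (y b)" for b
  define m where "m b = snd (y b)" for b
  have am: "a b \<in> Y" "m b \<in> Y" "a b \<noteq> m b" if "b \<in> B'" for b using y that by (auto simp: a_def m_def)
  have c: "c b x = c u x + (if x = a b then 1 else 0) - (if x = m b then 1 else 0)" if "b \<in> B'" "x \<in> Y" for b x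
    using y[rule_format, OF that(1), THEN conjunct2, THEN conjunct2, THEN conjunct2, rule_format, OF that(2)]
    unfolding a_def m_def by linarith
  have xor: "(a b = a b') \<noteq> (m b = m b')" if b: "b \<in> B'" "b' \<in> B'" "b \<noteq> b'" for b b'
  proof -
    obtain s t where st: "s \<in> Y" "s \<noteq> t"
      "\<forall>x\<in>Y. c b x - c b' x = (if x = s then 1 else 0) - (if x = t then 1 else 0)"
      using diff[of b b'] b by (auto simp: B'_def)
    show ?thesis
    proof (rule unit_difference[of Y])
      show "(if x = a b then 1 else 0) - (if x = m b then 1 else 0)
        - ((if x = a b' then 1 else 0) - (if x = m b' then 1 else 0)) =
        (if x = s then 1 else 0) - (if x = t then 1 else (0::int))" if "x \<in> Y" for x
        using st(3)[rule_format, OF that] c[OF b(1) that] c[OF b(2) that] by linarith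
    qed (use am b st in auto)
  qed
  have "(\<exists>\<mu>. \<forall>b\<in>B'. m b = \<mu>) \<or> (\<exists>\<alpha>. \<forall>b\<in>B'. a b = \<alpha>)"
  proof (rule ccontr)
    assume no: "\<not> ?thesis"
    then obtain b where b: "b \<in> B'" by blast
    obtain b1 where b1: "b1 \<in> B'" "m b1 \<noteq> m b" using no by blast
    then have eq: "a b1 = a b" using xor[of b1 b] b by auto
    obtain b2 where b2: "b2 \<in> B'" "a b2 \<noteq> a b" using no by blast
    have "m b2 = m b" using xor[of b2 b] b b2 by auto
    moreover have "m b2 = m b1" using xor[of b2 b1] b1 b2 eq by auto
    ultimately show False using b1(2) by simp
  qed
  then show ?thesis
  proof
    assume "\<exists>\<mu>. \<forall>b\<in>B'. m b = \<mu>"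
    then obtain \<mu>0 where \<mu>0: "\<forall>b\<in>B'. m b = \<mu>0" by blast
    then have \<mu>Y: "\<mu>0 \<in> Y" using \<open>B' \<noteq> {}\<close> am by auto
    show ?thesis
    proof (intro exI conjI ballI)
      show "(1::int) = 1 \<or> (1::int) = - 1"
        by simp
      show "inj_on (\<lambda>b. if b = u then \<mu>0 else a b) B"
      proof (rule inj_onI)
        fix b b' assume bb: "b \<in> B" "b' \<in> B" "(if b = u then \<mu>0 else a b) = (if b' = u then \<mu>0 else a b')"
        show "b = b'"
        proof (rule ccontr)
          assume ne: "b \<noteq> b'"
          show False
          proof (cases "b = u \<or> b' = u")
            case True
            then show False using bb ne am(3)[of b] am(3)[of b'] \<mu>0 unfolding B'_def by (auto split: if_splits)
          next
            case False
            then have "b \<in> B'" "b' \<in> B'" using bb by (auto simp: B'_def)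
            then show False using xor[OF _ _ ne] \<mu>0 bb(3) False by simp
          qed
        qed
      qed
      show "(\<lambda>b. if b = u then \<mu>0 else a b) ` B \<subseteq> Y" using \<mu>Y am(1) by (auto simp: B'_def)
      show "c b x = (c u x - (if x = \<mu>0 then 1 else 0)) + (if x = (if b = u then \<mu>0 else a b) then 1 else 0)"
        if "b \<in> B" "x \<in> Y" for b x
        using c[of b x] \<mu>0 that by (auto simp: B'_def)
    qed
  next
    assume "\<exists>\<alpha>. \<forall>b\<in>B'. a b = \<alpha>"
    then obtain \<alpha>0 where \<alpha>0: "\<forall>b\<in>B'. a b = \<alpha>0" by blast
    then have \<alpha>Y: "\<alpha>0 \<in> Y" using \<open>B' \<noteq> {}\<close> am by auto
    show ?thesis
    proof (intro exI conjI ballI)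
      show "(- 1::int) = 1 \<or> (- 1::int) = - 1"
        by simp
      show "inj_on (\<lambda>b. if b = u then \<alpha>0 else m b) B"
      proof (rule inj_onI)
        fix b b' assume bb: "b \<in> B" "b' \<in> B" "(if b = u then \<alpha>0 else m b) = (if b' = u then \<alpha>0 else m b')"
        show "b = b'"
        proof (rule ccontr)
          assume ne: "b \<noteq> b'"
          show False
          proof (cases "b = u \<or> b' = u")
            case True
            then show False using bb ne am(3)[of b] am(3)[of b'] \<alpha>0 unfolding B'_def by (auto split: if_splits)
          next
            case False
            then have "b \<in> B'" "b' \<in> B'" using bb by (auto simp: B'_def)
            then show False using xor[OF _ _ ne] \<alpha>0 bb(3) False by simp
          qed
        qed
      qed
      show "(\<lambda>b. if b = u then \<alpha>0 else m b) ` B \<subseteq> Y" using \<alpha>Y am(2) by (auto simp: B'_def)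
      show "c b x = (c u x + (if x = \<alpha>0 then 1 else 0)) + (if x = (if b = u then \<alpha>0 else m b) then - 1 else 0)"
        if "b \<in> B" "x \<in> Y" for b x
        using c[of b x] \<alpha>0 that by (auto simp: B'_def)
    qed
  qed
qed

text \<open>The integral data extracted from the characters: \<open>Y\<close> are the irreducible
  characters, \<open>u\<close> the trivial one, \<open>bar\<close> is complex conjugation,
  \<open>d\<close> the degree, \<open>I\<close> the set of primes, \<open>c b\<close> the
  coordinates of an induced function and \<open>q\<close> the index of a Sylow subgroup in its
  normalizer.\<close>

locale coherent =
  fixes Y :: "'x set" and u :: 'x and bar :: "'x \<Rightarrow> 'x" and d :: "'x \<Rightarrow> int"
    and I :: "'i set" and B :: "'i \<Rightarrow> 'b set" and c :: "'b \<Rightarrow> 'x \<Rightarrow> int" and q :: "'i \<Rightarrow> int"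
  assumes Y: "finite Y" "u \<in> Y" and I: "finite I"
    and d: "x \<in> Y \<Longrightarrow> 0 < d x"
    and bar: "x \<in> Y \<Longrightarrow> bar x \<in> Y" "x \<in> Y \<Longrightarrow> bar (bar x) = x" "x \<in> Y \<Longrightarrow> bar x = x \<Longrightarrow> x = u" "bar u = u"
    and B: "i \<in> I \<Longrightarrow> finite (B i)" "i \<in> I \<Longrightarrow> even (card (B i))" "i \<in> I \<Longrightarrow> 2 \<le> card (B i)"
    and cu: "i \<in> I \<Longrightarrow> b \<in> B i \<Longrightarrow> c b u = 1"
    and cd: "i \<in> I \<Longrightarrow> b \<in> B i \<Longrightarrow> (\<Sum>x\<in>Y. c b x * d x) = 0"
    and cbar: "i \<in> I \<Longrightarrow> b \<in> B i \<Longrightarrow> \<exists>b'\<in>B i. \<forall>x\<in>Y. c b' x = c b (bar x)"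
    and gram: "i \<in> I \<Longrightarrow> b \<in> B i \<Longrightarrow> b' \<in> B i \<Longrightarrow> (\<Sum>x\<in>Y. c b x * c b' x) = q i + (if b = b' then 1 else 0)"
    and orth: "i \<in> I \<Longrightarrow> k \<in> I \<Longrightarrow> i \<noteq> k \<Longrightarrow> b \<in> B i \<Longrightarrow> b' \<in> B k \<Longrightarrow> (\<Sum>x\<in>Y. c b x * c b' x) = 0"
begin

definition coh :: "'i \<Rightarrow> int \<Rightarrow> ('x \<Rightarrow> int) \<Rightarrow> ('b \<Rightarrow> 'x) \<Rightarrow> bool" where
  "coh i e C j \<longleftrightarrow> (e = 1 \<or> e = - 1) \<and> inj_on j (B i) \<and> j ` B i \<subseteq> Y \<and>
    (\<forall>b\<in>B i. \<forall>x\<in>Y. c b x = C x + (if x = j b then e else 0))"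

lemma coh_ex:
  assumes i: "i \<in> I"
  shows "\<exists>e C j. coh i e C j"
  unfolding coh_def
proof (rule coherent_family[OF Y(1)])
  show "2 \<le> card (B i)" by (rule B(3)[OF i])
  fix b b' assume b: "b \<in> B i" "b' \<in> B i"
  show "(\<Sum>x\<in>Y. (c b x - c b' x) * d x) = 0"
    using cd[OF i b(1)] cd[OF i b(2)] by (simp add: left_diff_distrib sum_subtractf)
  assume ne: "b \<noteq> b'"
  have "(\<Sum>x\<in>Y. (c b x - c b' x)\<^sup>2) =
      (\<Sum>x\<in>Y. c b x * c b x - c b x * c b' x - c b' x * c b x + c b' x * c b' x)"
    by (rule sum.cong) (simp_all add: power2_eq_square algebra_simps)
  also have "\<dots> = (\<Sum>x\<in>Y. c b x * c b x) - (\<Sum>x\<in>Y. c b x * c b' x) - (\<Sum>x\<in>Y. c b' x * c b x) + (\<Sum>x\<in>Y. c b' x * c b' x)"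
    by (simp only: sum.distrib sum_subtractf)
  finally show "(\<Sum>x\<in>Y. (c b x - c b' x)\<^sup>2) = 2"
    using gram[OF i b(1) b(1)] gram[OF i b(1) b(2)] gram[OF i b(2) b(1)] gram[OF i b(2) b(2)] ne by simp
qed (use d in auto)

context
  fixes e C j
  assumes coh: "\<And>i. i \<in> I \<Longrightarrow> coh i (e i) (C i) (j i)"
begin

lemma ei: "i \<in> I \<Longrightarrow> e i = 1 \<or> e i = - 1" and inj: "i \<in> I \<Longrightarrow> inj_on (j i) (B i)"
  and jY: "i \<in> I \<Longrightarrow> b \<in> B i \<Longrightarrow> j i b \<in> Y"
  and cC: "i \<in> I \<Longrightarrow> b \<in> B i \<Longrightarrow> x \<in> Y \<Longrightarrow> c b x = C i x + (if x = j i b then e i else 0)"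
  using coh unfolding coh_def by blast+

text \<open>The exceptional characters of \<open>i\<close>: those at which some vector of
  \<open>B i\<close> departs from the common part \<open>C i\<close>.\<close>

definition S :: "'i \<Rightarrow> 'x set" where "S i = j i ` B i"

lemma S_Y: "i \<in> I \<Longrightarrow> S i \<subseteq> Y" using jY by (auto simp: S_def)

lemma finS: "i \<in> I \<Longrightarrow> finite (S i)" using B(1) by (simp add: S_def)

lemma card_S: "i \<in> I \<Longrightarrow> card (S i) = card (B i)" using inj by (simp add: S_def card_image)

lemma jeq: "i \<in> I \<Longrightarrow> b \<in> B i \<Longrightarrow> b' \<in> B i \<Longrightarrow> j i b = j i b' \<longleftrightarrow> b = b'"
  using inj_on_eq_iff[OF inj] by blast

lemma other: "i \<in> I \<Longrightarrow> b \<in> B i \<Longrightarrow> \<exists>b'\<in>B i. b' \<noteq> b"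
proof (rule ccontr)
  assume i: "i \<in> I" and b: "b \<in> B i" and "\<not> (\<exists>b'\<in>B i. b' \<noteq> b)"
  then have "B i = {b}" by blast
  then show False using B(3)[OF i] by simp
qed

text \<open>The vectors \<open>b1\<close> and \<open>b2\<close> differ only at their own exceptional
  positions and have the same inner product, 0, with \<open>b'\<close>.\<close>

lemma const_S:
  assumes ik: "i \<in> I" "k \<in> I" "i \<noteq> k" and b: "b1 \<in> B i" "b2 \<in> B i" and b': "b' \<in> B k"
  shows "c b' (j i b1) = c b' (j i b2)"
proof -
  have e0: "e i \<noteq> 0" using ei[OF ik(1)] by auto
  have sb: "(\<Sum>x\<in>Y. c b x * c b' x) = (\<Sum>x\<in>Y. C i x * c b' x) + e i * c b' (j i b)" if b: "b \<in> B i" for b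
  proof -
    have "(\<Sum>x\<in>Y. c b x * c b' x) = (\<Sum>x\<in>Y. C i x * c b' x + (if x = j i b then e i * c b' x else 0))"
      by (rule sum.cong) (auto simp: cC[OF ik(1) b] distrib_right)
    then show ?thesis using Y(1) jY[OF ik(1) b] by (simp add: sum.distrib)
  qed
  have "e i * c b' (j i b1) = e i * c b' (j i b2)"
    using sb[OF b(1)] sb[OF b(2)] orth[OF ik b(1) b'] orth[OF ik b(2) b'] by linarith
  then show ?thesis using e0 by simp
qed

text \<open>By \<open>const_S\<close> every vector of \<open>B k\<close> is constant on
  \<open>S i\<close>. At a common point of \<open>S i\<close> and \<open>S k\<close> exactly one
  vector of \<open>B k\<close> carries the extra \<open>e k\<close>; comparing it with another
  vector, \<open>C k\<close> would have to change from this point to a second one of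
  \<open>S i\<close> by \<open>e k\<close> and also by 0 or \<open>- e k\<close>.\<close>

lemma S_disj: assumes ik: "i \<in> I" "k \<in> I" "i \<noteq> k" shows "S i \<inter> S k = {}"
proof (rule ccontr)
  assume "S i \<inter> S k \<noteq> {}"
  then obtain b b' where b: "b \<in> B i" "b' \<in> B k" "j i b = j k b'" unfolding S_def by auto
  obtain b1 where b1: "b1 \<in> B i" "b1 \<noteq> b" using other[OF ik(1) b(1)] by blast
  obtain b2 where b2: "b2 \<in> B k" "b2 \<noteq> b'" using other[OF ik(2) b(2)] by blast
  have n: "j i b1 \<noteq> j k b'" using jeq[OF ik(1) b1(1) b(1)] b1(2) b(3) by simp
  have n': "j i b \<noteq> j k b2" using jeq[OF ik(2) b2(1) b(2)] b2(2) b(3) by auto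
  have 1: "C k (j i b) + e k = C k (j i b1)"
    using const_S[OF ik b(1) b1(1) b(2)] cC[OF ik(2) b(2) jY[OF ik(1) b(1)]] cC[OF ik(2) b(2) jY[OF ik(1) b1(1)]] b(3) n by simp
  have 2: "C k (j i b) = C k (j i b1) + (if j i b1 = j k b2 then e k else 0)"
    using const_S[OF ik b(1) b1(1) b2(1)] cC[OF ik(2) b2(1) jY[OF ik(1) b(1)]] cC[OF ik(2) b2(1) jY[OF ik(1) b1(1)]] n' by simp
  show False using 1 2 ei[OF ik(2)] by (auto split: if_splits)
qed

lemma C_S: assumes ik: "i \<in> I" "k \<in> I" "i \<noteq> k" and b: "b \<in> B i" and b': "b' \<in> B k"
  shows "c b' (j i b) = C k (j i b)"
proof -
  have "j i b \<noteq> j k b'" using S_disj[OF ik] b b' by (auto simp: S_def)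
  then show ?thesis using cC[OF ik(2) b' jY[OF ik(1) b]] by simp
qed

lemma u_S: assumes i: "i \<in> I" shows "u \<notin> S i"
proof
  assume "u \<in> S i"
  then obtain b where b: "b \<in> B i" "u = j i b" by (auto simp: S_def)
  obtain b1 where b1: "b1 \<in> B i" "b1 \<noteq> b" using other[OF i b(1)] by blast
  have "u \<noteq> j i b1" using jeq[OF i b1(1) b(1)] b1(2) b(2) by auto
  then show False
    using cC[OF i b(1) Y(2)] cC[OF i b1(1) Y(2)] cu[OF i b(1)] cu[OF i b1(1)] b(2) ei[OF i] by auto
qed

lemma C_const: assumes i: "i \<in> I" and b: "b \<in> B i" "b' \<in> B i" shows "C i (j i b) = C i (j i b')"
proof -
  have sb: "(\<Sum>x\<in>Y. c b x * c b x) = (\<Sum>x\<in>Y. C i x * C i x) + (2 * e i * C i (j i b) + e i * e i)" if b: "b \<in> B i" for b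
  proof -
    have "(\<Sum>x\<in>Y. c b x * c b x) = (\<Sum>x\<in>Y. C i x * C i x + (if x = j i b then 2 * e i * C i x + e i * e i else 0))"
      by (rule sum.cong) (auto simp: cC[OF i b] algebra_simps)
    then show ?thesis using Y(1) jY[OF i b] by (simp add: sum.distrib)
  qed
  have "e i * C i (j i b) = e i * C i (j i b')"
    using sb[OF b(1)] sb[OF b(2)] gram[OF i b(1) b(1)] gram[OF i b(2) b(2)] by simp
  then show ?thesis using ei[OF i] by auto
qed

text \<open>A description of \<open>S i\<close> that does not mention the choice of
  \<open>j\<close>, so that invariance under \<open>bar\<close> can be read off
  \<open>cbar\<close>.\<close>

lemma S_iff: assumes i: "i \<in> I" and x: "x \<in> Y"
  shows "x \<in> S i \<longleftrightarrow> (\<exists>b\<in>B i. \<exists>b'\<in>B i. c b x \<noteq> c b' x)"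
proof
  assume "x \<in> S i"
  then obtain b where b: "b \<in> B i" "x = j i b" by (auto simp: S_def)
  obtain b1 where b1: "b1 \<in> B i" "b1 \<noteq> b" using other[OF i b(1)] by blast
  have "c b x \<noteq> c b1 x"
    using cC[OF i b(1) x] cC[OF i b1(1) x] b(2) ei[OF i] jeq[OF i b1(1) b(1)] b1(2) by auto
  then show "\<exists>b\<in>B i. \<exists>b'\<in>B i. c b x \<noteq> c b' x" using b(1) b1(1) by blast
next
  assume "\<exists>b\<in>B i. \<exists>b'\<in>B i. c b x \<noteq> c b' x"
  then obtain b b' where b: "b \<in> B i" "b' \<in> B i" "c b x \<noteq> c b' x" by blast
  then have "x = j i b \<or> x = j i b'" using cC[OF i b(1) x] cC[OF i b(2) x] by (auto split: if_splits)
  then show "x \<in> S i" using b by (auto simp: S_def)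
qed

lemma S_bar1: assumes i: "i \<in> I" and x: "x \<in> Y" "x \<in> S i" shows "bar x \<in> S i"
proof -
  obtain b b' where b: "b \<in> B i" "b' \<in> B i" "c b x \<noteq> c b' x" using S_iff[OF i x(1)] x(2) by blast
  obtain b1 where b1: "b1 \<in> B i" "\<forall>x\<in>Y. c b1 x = c b (bar x)" using cbar[OF i b(1)] by blast
  obtain b2 where b2: "b2 \<in> B i" "\<forall>x\<in>Y. c b2 x = c b' (bar x)" using cbar[OF i b(2)] by blast
  have "c b1 (bar x) = c b x" "c b2 (bar x) = c b' x"
    using b1(2)[rule_format, OF bar(1)[OF x(1)]] b2(2)[rule_format, OF bar(1)[OF x(1)]] bar(2)[OF x(1)] by simp_all
  then have "c b1 (bar x) \<noteq> c b2 (bar x)" using b(3) by simp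
  then show ?thesis by (intro S_iff[THEN iffD2, OF i bar(1)[OF x(1)]] bexI[OF _ b1(1)] bexI[OF _ b2(1)])
qed

lemma S_bar: assumes i: "i \<in> I" and x: "x \<in> Y" shows "bar x \<in> S i \<longleftrightarrow> x \<in> S i"
  using S_bar1[OF i x] S_bar1[OF i bar(1)[OF x]] bar(2)[OF x] by auto

lemma C_bar: assumes i: "i \<in> I" and x: "x \<in> Y" "x \<notin> S i" shows "C i (bar x) = C i x"
proof -
  have "B i \<noteq> {}" using B(3)[OF i] by auto
  then obtain b where b: "b \<in> B i" by blast
  obtain b1 where b1: "b1 \<in> B i" "\<forall>x\<in>Y. c b1 x = c b (bar x)" using cbar[OF i b] by blast
  have n: "x \<noteq> j i b1" "bar x \<noteq> j i b" using x(2) S_bar[OF i x(1)] b b1(1) by (auto simp: S_def)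
  have "C i (bar x) = c b (bar x)" using cC[OF i b bar(1)[OF x(1)]] n(2) by simp
  also have "\<dots> = c b1 x" using b1(2) x(1) by simp
  also have "\<dots> = C i x" using cC[OF i b1(1) x(1)] n(1) by simp
  finally show ?thesis .
qed

lemma sum_S: assumes i: "i \<in> I" and b: "b \<in> B i" "b0 \<in> B i"
  shows "(\<Sum>x\<in>S i. c b x) = int (card (B i)) * C i (j i b0) + e i"
proof -
  have "(\<Sum>x\<in>S i. c b x) = (\<Sum>b'\<in>B i. c b (j i b'))" using inj[OF i] by (simp add: S_def sum.reindex)
  also have "\<dots> = (\<Sum>b'\<in>B i. C i (j i b0) + (if b' = b then e i else 0))"
  proof (rule sum.cong)
    fix b' assume b': "b' \<in> B i"
    show "c b (j i b') = C i (j i b0) + (if b' = b then e i else 0)"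
      using cC[OF i b(1) jY[OF i b']] C_const[OF i b' b(2)] jeq[OF i b' b(1)] by simp
  qed simp
  also have "\<dots> = int (card (B i)) * C i (j i b0) + e i" using B(1)[OF i] b(1) by (simp add: sum.distrib)
  finally show ?thesis .
qed

text \<open>As \<open>u\<close> is the only fixed point of \<open>bar\<close>, evaluate the inner product 0 of \<open>b\<close> and \<open>b'\<close> modulo 2.\<close>

lemma parity: assumes ik: "i \<in> I" "k \<in> I" "i \<noteq> k" and b: "b \<in> B i" "b' \<in> B k"
  shows "odd (C k (j i b) + C i (j k b'))"
proof -
  have ki: "k \<noteq> i" using ik(3) by simp
  define R where "R = Y - ({u} \<union> S i \<union> S k)"
  have dj: "S i \<inter> S k = {}" by (rule S_disj[OF ik])
  have fin: "finite (S i)" "finite (S k)" using finS ik by auto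
  let ?f = "\<lambda>x. c b x * c b' x"
  have on_R: "?f x = C i x * C k x" if "x \<in> R" for x
  proof -
    have "x \<in> Y" "x \<noteq> j i b" "x \<noteq> j k b'" using that b by (auto simp: R_def S_def)
    then show ?thesis using cC[OF ik(1) b(1)] cC[OF ik(2) b(2)] by simp
  qed
  have "even (sum ?f R)"
  proof (rule even_sum_involution[where s = bar])
    show "finite R" using Y(1) by (simp add: R_def)
    fix x assume x: "x \<in> R"
    then have xY: "x \<in> Y" "x \<noteq> u" "x \<notin> S i" "x \<notin> S k" by (auto simp: R_def)
    show "bar x \<noteq> x" "bar (bar x) = x" using bar xY by auto
    have "bar x \<noteq> u" using bar(2)[OF xY(1)] bar(4) xY(2) by auto
    then show bR: "bar x \<in> R" using S_bar[OF ik(1) xY(1)] S_bar[OF ik(2) xY(1)] xY bar(1) by (auto simp: R_def)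
    show "?f (bar x) = ?f x" unfolding on_R[OF bR] on_R[OF x] using C_bar ik xY by simp
  qed
  moreover have "sum ?f Y = sum ?f R + sum ?f ({u} \<union> S i \<union> S k)"
    unfolding R_def using Y S_Y[OF ik(1)] S_Y[OF ik(2)] by (intro sum.subset_diff) auto
  moreover have "sum ?f ({u} \<union> S i \<union> S k) = ?f u + sum ?f (S i) + sum ?f (S k)"
    using u_S[OF ik(1)] u_S[OF ik(2)] dj fin by (subst sum.union_disjoint; (subst sum.union_disjoint)?) auto
  moreover have "?f u = 1" using cu[OF ik(1) b(1)] cu[OF ik(2) b(2)] by simp
  moreover have "sum ?f (S i) = (int (card (B i)) * C i (j i b) + e i) * C k (j i b)"
  proof -
    have "sum ?f (S i) = (\<Sum>x\<in>S i. c b x * C k (j i b))"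
      by (rule sum.cong) (auto simp: S_def const_S[OF ik _ b(1) b(2)] C_S[OF ik b])
    then show ?thesis by (simp add: sum_S[OF ik(1) b(1) b(1)] flip: sum_distrib_right)
  qed
  moreover have "sum ?f (S k) = (int (card (B k)) * C k (j k b') + e k) * C i (j k b')"
  proof -
    have "sum ?f (S k) = (\<Sum>x\<in>S k. c b' x * C i (j k b'))"
      by (rule sum.cong) (auto simp: S_def const_S[OF ik(2,1) ki _ b(2) b(1)] C_S[OF ik(2,1) ki b(2) b(1)])
    then show ?thesis by (simp add: sum_S[OF ik(2) b(2) b(2)] flip: sum_distrib_right)
  qed
  moreover have "sum ?f Y = 0" by (rule orth[OF ik b])
  \<comment> \<open>The cardinalities are even and the signs odd, so modulo 2 the blocks
    \<open>{u}\<close>, \<open>S i\<close> and \<open>S k\<close> contribute 1,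
    \<open>C k (j i b)\<close> and \<open>C i (j k b')\<close>.\<close>
  ultimately have "even (1 + (int (card (B i)) * C i (j i b) + e i) * C k (j i b) +
      (int (card (B k)) * C k (j k b') + e k) * C i (j k b'))"
    by (metis add.assoc even_add even_zero)
  moreover have "odd (e i)" "odd (e k)" using ei[OF ik(1)] ei[OF ik(2)] by auto
  ultimately show ?thesis using B(2)[OF ik(1)] B(2)[OF ik(2)] by (simp, blast)
qed

text \<open>From the squared norm \<open>q i + 1\<close> the trivial character takes 1, and
  \<open>S i\<close> takes at least 1, because the values \<open>C i\<close> and \<open>C i\<close>
  plus a sign cannot both be 0. What is left bounds the contribution of the other exceptional
  sets.\<close>

lemma norm_bound: assumes i: "i \<in> I" and b: "\<And>k. k \<in> I \<Longrightarrow> b k \<in> B k"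
  shows "(\<Sum>k\<in>I - {i}. int (card (B k)) * (C i (j k (b k)))\<^sup>2) \<le> q i - 1"
proof -
  let ?f = "\<lambda>x. (c (b i) x)\<^sup>2"
  note bi = b[OF i]
  have "sum ?f (insert u (\<Union>k\<in>I. S k)) \<le> sum ?f Y" using Y S_Y by (intro sum_mono2) auto
  moreover have "sum ?f Y = q i + 1" using gram[OF i bi bi] by (simp add: power2_eq_square)
  moreover have "sum ?f (insert u (\<Union>k\<in>I. S k)) = 1 + (\<Sum>k\<in>I. sum ?f (S k))"
  proof -
    have "sum ?f (insert u (\<Union>k\<in>I. S k)) = ?f u + sum ?f (\<Union>k\<in>I. S k)"
      using u_S finS I by (intro sum.insert) auto
    moreover have "sum ?f (\<Union>k\<in>I. S k) = (\<Sum>k\<in>I. sum ?f (S k))"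
      using finS I S_disj by (intro sum.UNION_disjoint) auto
    ultimately show ?thesis using cu[OF i bi] by simp
  qed
  moreover have "(\<Sum>k\<in>I. sum ?f (S k)) = sum ?f (S i) + (\<Sum>k\<in>I - {i}. sum ?f (S k))" by (rule sum.remove[OF I i])
  moreover have "(\<Sum>k\<in>I - {i}. sum ?f (S k)) = (\<Sum>k\<in>I - {i}. int (card (B k)) * (C i (j k (b k)))\<^sup>2)"
  proof (rule sum.cong)
    fix k assume "k \<in> I - {i}"
    then have k: "k \<in> I" "i \<in> I" "k \<noteq> i" using i by auto
    have "sum ?f (S k) = (\<Sum>x\<in>S k. (C i (j k (b k)))\<^sup>2)"
      by (rule sum.cong) (auto simp: S_def const_S[OF k _ b[OF k(1)] bi] C_S[OF k b[OF k(1)] bi])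
    then show "sum ?f (S k) = int (card (B k)) * (C i (j k (b k)))\<^sup>2" by (simp add: card_S[OF k(1)])
  qed simp
  moreover have "1 \<le> sum ?f (S i)"
  proof -
    obtain b1 where b1: "b1 \<in> B i" "b1 \<noteq> b i" using other[OF i bi] by blast
    have "c (b i) (j i (b i)) \<noteq> 0 \<or> c (b i) (j i b1) \<noteq> 0"
      using cC[OF i bi jY[OF i bi]] cC[OF i bi jY[OF i b1(1)]] C_const[OF i bi b1(1)] jeq[OF i b1(1) bi] b1(2) ei[OF i] by auto
    then obtain x where x: "x \<in> S i" "c (b i) x \<noteq> 0" using bi b1(1) unfolding S_def by blast
    have "?f x \<le> sum ?f (S i)" using finS[OF i] x(1) by (intro member_le_sum) auto
    moreover have "0 < ?f x" using x(2) by simp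
    ultimately show ?thesis by linarith
  qed
  ultimately show ?thesis by linarith
qed

end

text \<open>One exceptional character \<open>x i\<close> is kept for each \<open>i\<close>:
  \<open>\<gamma> i\<close> is its common coefficient in its own family, and \<open>a i k\<close>
  its coefficient in the family of \<open>k\<close>.\<close>

theorem exceptional_vectors:
  "\<exists>x b e \<gamma> a. \<forall>i\<in>I. x i \<in> Y \<and> b i \<in> B i \<and> (e i = 1 \<or> e i = - 1) \<and>
    (\<forall>b'\<in>B i. c b' (x i) = \<gamma> i + (if b' = b i then e i else (0::int))) \<and>
    (\<forall>k\<in>I - {i}. (\<forall>b'\<in>B k. c b' (x i) = a i k) \<and> odd (a i k + a k i)) \<and>
    (\<Sum>k\<in>I - {i}. int (card (B k)) * (a k i)\<^sup>2) \<le> q i - 1"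
proof -
  have "\<forall>i\<in>I. \<exists>y. coh i (fst y) (fst (snd y)) (snd (snd y))" using coh_ex by force
  from bchoice[OF this] obtain y where "\<forall>i\<in>I. coh i (fst (y i)) (fst (snd (y i))) (snd (snd (y i)))" by blast
  then have coh: "\<And>i. i \<in> I \<Longrightarrow> coh i (fst (y i)) (fst (snd (y i))) (snd (snd (y i)))" by blast
  define e where "e i = fst (y i)" for i
  define C where "C i = fst (snd (y i))" for i
  define j where "j i = snd (snd (y i))" for i
  have coh: "\<And>i. i \<in> I \<Longrightarrow> coh i (e i) (C i) (j i)" using coh by (simp add: e_def C_def j_def)
  have "\<forall>i\<in>I. \<exists>b. b \<in> B i"
  proof
    fix i assume i: "i \<in> I"
    have "B i \<noteq> {}" using B(3)[OF i] by auto
    then show "\<exists>b. b \<in> B i" by blast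
  qed
  from bchoice[OF this] obtain b where b: "\<forall>i\<in>I. b i \<in> B i" by blast
  have *: "j i (b i) \<in> Y \<and> b i \<in> B i \<and> (e i = 1 \<or> e i = - 1) \<and>
    (\<forall>b'\<in>B i. c b' (j i (b i)) = C i (j i (b i)) + (if b' = b i then e i else 0)) \<and>
    (\<forall>k\<in>I - {i}. (\<forall>b'\<in>B k. c b' (j i (b i)) = C k (j i (b i))) \<and> odd (C k (j i (b i)) + C i (j k (b k)))) \<and>
    (\<Sum>k\<in>I - {i}. int (card (B k)) * (C i (j k (b k)))\<^sup>2) \<le> q i - 1" if i: "i \<in> I" for i
  proof (intro conjI ballI)
    have bi: "b i \<in> B i" using b i by blast
    then show "b i \<in> B i" .
    show "j i (b i) \<in> Y" by (rule jY[OF coh i bi])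
    show "e i = 1 \<or> e i = - 1" by (rule ei[OF coh i])
    show "c b' (j i (b i)) = C i (j i (b i)) + (if b' = b i then e i else 0)" if b': "b' \<in> B i" for b'
      using cC[OF coh i b' jY[OF coh i bi]] jeq[OF coh i bi b'] by auto
    show "(\<Sum>k\<in>I - {i}. int (card (B k)) * (C i (j k (b k)))\<^sup>2) \<le> q i - 1"
      by (rule norm_bound[OF coh i]) (use b in auto)
    fix k assume "k \<in> I - {i}"
    then have k: "k \<in> I" "i \<noteq> k" using i by auto
    have bk: "b k \<in> B k" using b k by blast
    show "odd (C k (j i (b i)) + C i (j k (b k)))" by (rule parity[OF coh i k bi bk])
    show "c b' (j i (b i)) = C k (j i (b i))" if b': "b' \<in> B k" for b'
      by (rule C_S[OF coh i k bi b'])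
  qed
  show ?thesis
    by (rule exI[of _ "\<lambda>i. j i (b i)"], rule exI[of _ b], rule exI[of _ e],
        rule exI[of _ "\<lambda>i. C i (j i (b i))"], rule exI[of _ "\<lambda>i k. C k (j i (b i))"], rule ballI, rule *)
qed

end

section \<open>Odd order\<close>

text \<open>The contradiction for groups of odd order without self-normalizing Sylow subgroups: \<open>q i\<close> is the index of a Sylow
  subgroup in its normalizer, \<open>w i\<close> and \<open>h i\<close> count its induced functions and its linear characters,
  \<open>A\<close> and \<open>L\<close> consist of the \<open>k\<close> whose induced functions contain, or do not contain, the exceptional
  character of \<open>i\<close>.  Choose \<open>i\<close> with \<open>h i\<close> minimal, or with \<open>q i = 3\<close>.\<close>

lemma odd_numeric:
  fixes q w h :: "'i \<Rightarrow> nat" and g :: nat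
  assumes I: "finite I" "I \<noteq> {}" and g: "0 < g"
    and q: "\<And>i. i \<in> I \<Longrightarrow> 3 \<le> q i" "\<And>i. i \<in> I \<Longrightarrow> odd (q i)"
    and w: "\<And>i. i \<in> I \<Longrightarrow> 2 \<le> w i" "\<And>i. i \<in> I \<Longrightarrow> even (w i)"
    and h: "\<And>i. i \<in> I \<Longrightarrow> h i = w i * q i + 1" "inj_on h I"
    and split: "\<And>i. i \<in> I \<Longrightarrow> \<exists>A L. I - {i} = A \<union> L \<and>
      (\<Sum>k\<in>A. real (w k) / h k) \<le> real (q i) / h i - 1 / g \<and> (\<Sum>k\<in>L. w k) \<le> q i - 1"
    and mass: "1 - 1 / g \<le> (\<Sum>i\<in>I. 1 / real (q i))"
  shows False
proof -
  \<comment> \<open>Since \<open>h k = w k * q k + 1\<close>, the mass \<open>1 / q k\<close> is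
    \<open>w k / h k\<close> times the factor \<open>h k / (h k - 1)\<close>. With a bound
    \<open>R\<close> for these factors outside \<open>L\<close>, the estimate for \<open>A\<close>
    turns the mass equation into an inequality in which the terms \<open>1 / g\<close>
    cancel.\<close>
  have step: "\<exists>L. L \<subseteq> I - {i} \<and> (\<Sum>k\<in>L. w k) \<le> q i - 1 \<and>
      (\<forall>R\<ge>1. (\<forall>k\<in>I - {i} - L. real (h k) / (real (h k) - 1) \<le> R) \<longrightarrow>
        1 \<le> 1 / real (q i) + R * (real (q i) / h i) + (\<Sum>k\<in>L. 1 / real (q k)))"
    if i: "i \<in> I" for i
  proof -
    obtain A L where AL: "I - {i} = A \<union> L" "(\<Sum>k\<in>A. real (w k) / h k) \<le> real (q i) / h i - 1 / g"
      "(\<Sum>k\<in>L. w k) \<le> q i - 1" using split[OF i] by blast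
    have fin: "finite A" "finite L" using AL(1) I(1) by (metis finite_Diff finite_Un)+
    have "1 \<le> 1 / real (q i) + R * (real (q i) / h i) + (\<Sum>k\<in>L. 1 / real (q k))"
      if R: "1 \<le> R" "\<forall>k\<in>I - {i} - L. real (h k) / (real (h k) - 1) \<le> R" for R
    proof -
      have "1 - 1 / g \<le> 1 / real (q i) + (\<Sum>k\<in>I - {i}. 1 / real (q k))"
        using mass I(1) i by (simp add: sum.remove)
      also have "I - {i} = (A - L) \<union> L" using AL(1) by blast
      also have "(\<Sum>k\<in>(A - L) \<union> L. 1 / real (q k)) = (\<Sum>k\<in>A - L. 1 / real (q k)) + (\<Sum>k\<in>L. 1 / real (q k))"
        using fin by (intro sum.union_disjoint) auto
      also have "(\<Sum>k\<in>A - L. 1 / real (q k)) \<le> (\<Sum>k\<in>A - L. R * (real (w k) / h k))"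
      proof (rule sum_mono)
        fix k assume k: "k \<in> A - L"
        then have kI: "k \<in> I" "k \<in> I - {i} - L" using AL(1) by blast+
        have pos: "0 < real (w k)" "0 < real (q k)" using q(1)[OF kI(1)] w(1)[OF kI(1)] by auto
        have hk: "real (h k) = real (w k) * q k + 1" using h(1)[OF kI(1)] by simp
        have "real (h k) / (real (h k) - 1) \<le> R" using R(2) kI(2) by blast
        then have le: "real (h k) \<le> R * (real (w k) * q k)" using pos unfolding hk by (simp add: field_simps)
        have hp: "0 < real (h k)" unfolding hk using pos by (simp add: add_pos_pos)
        have "1 / real (q k) \<le> R * real (w k) / real (h k)"
          using le pos hp by (simp add: divide_le_eq le_divide_eq mult_ac)
        then show "1 / real (q k) \<le> R * (real (w k) / h k)" by simp
      qed
      also have "\<dots> \<le> (\<Sum>k\<in>A. R * (real (w k) / h k))"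
        using fin R(1) by (intro sum_mono2) auto
      also have "\<dots> \<le> R * (real (q i) / h i - 1 / g)"
        unfolding sum_distrib_left[symmetric] using AL(2) R(1) by (intro mult_left_mono) auto
      also have "\<dots> \<le> R * (real (q i) / h i) - 1 / g"
        using R(1) g by (simp add: right_diff_distrib mult_right_mono divide_right_mono)
      finally show ?thesis by simp
    qed
    then show ?thesis using AL by (intro exI[of _ L]) auto
  qed
  have h7: "7 \<le> h k" "odd (h k)" if "k \<in> I" for k
  proof -
    have "2 * 3 \<le> w k * q k" using q(1)[OF that] w(1)[OF that] by (intro mult_le_mono)
    then show "7 \<le> h k" "odd (h k)" using h(1)[OF that] w(2)[OF that] by auto
  qed
  have ratio: "real (h k) / (real (h k) - 1) \<le> (real c + 1) / c" if "k \<in> I" "c + 1 \<le> h k" "0 < c" for k c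
  proof -
    have "real c \<le> real (h k) - 1" using that(2) by linarith
    then show ?thesis using that(3) by (simp add: field_simps)
  qed
  have Lcard: "2 * card L \<le> (\<Sum>k\<in>L. w k)" if "L \<subseteq> I" for L
    using sum_mono[of L "\<lambda>_. 2" w] w(1) that by (auto simp: subset_iff)
  show False
  proof (cases "\<exists>i\<in>I. q i = 3")
    case q3: True
    show False
    proof (cases "\<exists>i\<in>I. q i = 3 \<and> w i \<noteq> 2")
      case True
      then obtain i where i: "i \<in> I" "q i = 3" "w i \<noteq> 2" by blast
      \<comment> \<open>Here \<open>h i\<close> is at least 13 and \<open>L\<close> has at most one
        element; \<open>1/3 + 7/6 * 3/13 + 1/3\<close> is below 1. The factor 7/6 comes from the
        general bound \<open>h k \<ge> 7\<close>.\<close>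
      have "4 \<le> w i" using w[OF i(1)] i(3) by (auto elim!: evenE)
      then have hi: "13 \<le> h i" using h(1)[OF i(1)] i(2) by simp
      obtain L where L: "L \<subseteq> I - {i}" "(\<Sum>k\<in>L. w k) \<le> q i - 1"
        "\<forall>R\<ge>1. (\<forall>k\<in>I - {i} - L. real (h k) / (real (h k) - 1) \<le> R) \<longrightarrow>
        1 \<le> 1 / real (q i) + R * (real (q i) / h i) + (\<Sum>k\<in>L. 1 / real (q k))" using step[OF i(1)] by blast
      have "L \<subseteq> I" using L(1) by blast
      from Lcard[OF this] have "card L \<le> 1" using L(2) i(2) by linarith
      then have "(\<Sum>k\<in>L. 1 / real (q k)) \<le> 1 / 3"
      proof -
        have "(\<Sum>k\<in>L. 1 / real (q k)) \<le> (\<Sum>k\<in>L. 1 / 3)"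
        proof (rule sum_mono)
          fix k assume "k \<in> L"
          then have "3 \<le> q k" using L(1) q(1)[of k] by blast
          then show "1 / real (q k) \<le> 1 / 3" by (intro divide_left_mono) auto
        qed
        then show ?thesis using \<open>card L \<le> 1\<close> by simp
      qed
      moreover have "1 \<le> 1 / 3 + 7 / 6 * (real (q i) / h i) + (\<Sum>k\<in>L. 1 / real (q k))"
        using L(3)[rule_format, of "7 / 6"] ratio[of _ 6] h7(1) i(2) by simp
      moreover have "real (q i) / h i \<le> 3 / 13" using hi i(2) by (simp add: field_simps)
      ultimately show False by simp
    next
      case False
      then obtain i where i: "i \<in> I" "q i = 3" "w i = 2" using q3 by blast
      have hi: "h i = 7" using h(1)[OF i(1)] i by simp
      have other: "5 \<le> q k" "11 \<le> h k" if k: "k \<in> I - {i}" for k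
      proof -
        have "q k \<noteq> 3"
        proof
          assume "q k = 3"
          then have "h k = h i" using False k h(1)[of k] hi by auto
          then show False using h(2) k i(1) by (auto dest: inj_onD)
        qed
        then show q5: "5 \<le> q k" using q[of k] k by (auto elim!: oddE)
        have "2 * 5 \<le> w k * q k" using q5 w(1)[of k] k by (intro mult_le_mono) auto
        then show "11 \<le> h k" using h(1)[of k] k by simp
      qed
      obtain L where L: "L \<subseteq> I - {i}" "(\<Sum>k\<in>L. w k) \<le> q i - 1"
        "\<forall>R\<ge>1. (\<forall>k\<in>I - {i} - L. real (h k) / (real (h k) - 1) \<le> R) \<longrightarrow>
        1 \<le> 1 / real (q i) + R * (real (q i) / h i) + (\<Sum>k\<in>L. 1 / real (q k))" using step[OF i(1)] by blast
      have finL: "finite L" using L(1) I(1) finite_subset by blast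
      have "L \<subseteq> I" using L(1) by blast
      from Lcard[OF this] have "card L \<le> 1" using L(2) i(2) by linarith
      then consider "L = {}" | k where "L = {k}"
        using finL by (metis One_nat_def card_0_eq card_1_singletonE le_SucE le_zero_eq)
      then show False
      proof cases
        case 1
        then show False
          using L(3)[rule_format, of "11 / 10"] ratio[of _ 10] other(2) i(2) hi by simp
      next
        case (2 k)
        have kI: "k \<in> I - {i}" using 2 L(1) by blast
        have wk: "w k = 2" using 2 L(2) i(2) w(1)[of k] kI by simp
        show False
        proof (cases "q k = 5")
          case True
          \<comment> \<open>The factor 11/10 is not enough here, as
            \<open>1/3 + 11/10 * 3/7 + 1/5\<close> is slightly above 1. Injectivity and oddness
            raise the remaining values of \<open>h\<close> to 13, and 13/12 brings the sum just
            below 1.\<close>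
          have hk: "h k = 11" using h(1)[of k] wk True kI by simp
          have "13 \<le> h m" if m: "m \<in> I - {i} - L" for m
          proof -
            have "h m \<noteq> 11" using inj_on_eq_iff[OF h(2), of m k] m kI hk 2 by simp
            then have "h m \<noteq> 11 \<and> h m \<noteq> 12 \<and> 11 \<le> h m" using h7(2)[of m] m other(2)[of m] by auto
            then show ?thesis by linarith
          qed
          then show False
            using L(3)[rule_format, of "13 / 12"] ratio[of _ 12] i(2) hi 2 True by simp
        next
          case False
          then have "7 \<le> q k" using other(1)[OF kI] q(2)[of k] kI by (auto elim!: oddE)
          then have "1 / real (q k) \<le> 1 / 7" by (simp add: field_simps)
          moreover have "1 \<le> 1 / 3 + 11 / 10 * (3 / 7) + 1 / real (q k)"
            using L(3)[rule_format, of "11 / 10"] ratio[of _ 10] other(2) i(2) hi 2 by simp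
          ultimately show False by simp
        qed
      qed
    qed
  next
    case False
    have q5: "5 \<le> q k" if "k \<in> I" for k
    proof -
      have "q k \<noteq> 3" "q k \<noteq> 4" using False that q(2)[OF that] by auto
      then show ?thesis using q(1)[OF that] by linarith
    qed
    obtain i where i: "i \<in> I" "\<And>k. k \<in> I \<Longrightarrow> h i \<le> h k"
      using ex_min_if_finite[of "h ` I"] I by (metis (no_types, lifting) arg_min_if_finite(1) arg_min_least)
    define c where "c = q i"
    have c5: "5 \<le> c" using q5[OF i(1)] by (simp add: c_def)
    have above: "h i + 2 \<le> h k" if k: "k \<in> I - {i}" for k
    proof -
      have "h k \<noteq> h i" using inj_on_eq_iff[OF h(2), of k i] k i(1) by simp
      moreover have "h k \<noteq> h i + 1" using h7(2)[of k] h7(2)[OF i(1)] k by auto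
      ultimately show ?thesis using i(2)[of k] k by auto
    qed
    obtain L where L: "L \<subseteq> I - {i}" "(\<Sum>k\<in>L. w k) \<le> c - 1"
      "\<forall>R\<ge>1. (\<forall>k\<in>I - {i} - L. real (h k) / (real (h k) - 1) \<le> R) \<longrightarrow>
      1 \<le> 1 / real c + R * (real c / h i) + (\<Sum>k\<in>L. 1 / real (q k))" using step[OF i(1)] by (auto simp: c_def)
    have finL: "finite L" using L(1) I(1) finite_subset by blast
    have qk: "1 / real (q k) = real (w k) / (real (h k) - 1)" if "k \<in> L" for k
      using h(1)[of k] w(1)[of k] that L(1) by auto
    have c15: "1 / real c \<le> 1 / 5" using c5 by (simp add: field_simps)
    show False
    proof (cases "w i = 2")
      case w2: False
      have "4 \<le> w i" using w[OF i(1)] w2 by (auto elim!: evenE)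
      then have "4 * c \<le> w i * c" by simp
      then have hi: "4 * c + 1 \<le> h i" using h(1)[OF i(1)] by (simp add: c_def)
      have "(\<Sum>k\<in>L. 1 / real (q k)) \<le> (\<Sum>k\<in>L. real (w k) / (4 * c))"
      proof (rule sum_mono)
        fix k assume k: "k \<in> L"
        have "4 * real c \<le> real (h k) - 1" using above[of k] hi k L(1) by force
        then show "1 / real (q k) \<le> real (w k) / (4 * c)"
          unfolding qk[OF k] using c5 by (intro divide_left_mono) auto
      qed
      also have "\<dots> = real (\<Sum>k\<in>L. w k) / (4 * c)" by (simp flip: sum_divide_distrib)
      also have "\<dots> \<le> real c / (4 * c)" using L(2) by (intro divide_right_mono) (linarith, simp)
      also have "\<dots> = 1 / 4" using c5 by simp
      finally have "(\<Sum>k\<in>L. 1 / real (q k)) \<le> 1 / 4" .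
      moreover have "real c / h i \<le> 1 / 4" using hi c5 by (simp add: divide_le_eq)
      moreover have "1 \<le> 1 / real c + 7 / 6 * (real c / h i) + (\<Sum>k\<in>L. 1 / real (q k))"
        using L(3)[rule_format, of "7 / 6"] ratio[of _ 6] h7(1) by simp
      ultimately show False using c15 by simp
    next
      case True
      then have hi: "h i = 2 * c + 1" using h(1)[OF i(1)] by (simp add: c_def)
      \<comment> \<open>By minimality, oddness and injectivity every other \<open>h k\<close> is at
        least \<open>2 * c + 3\<close>. The resulting factor times \<open>c / h i\<close> stays
        below 1/2, by the amount computed in \<open>Rq\<close>.\<close>
      have r: "real (h k) / (real (h k) - 1) \<le> (2 * real c + 3) / (2 * real c + 2)" if "k \<in> I - {i} - L" for k
        using ratio[of k "2 * c + 2"] above[of k] that hi by (simp add: add.commute)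
      have main: "1 \<le> 1 / real c + (2 * real c + 3) / (2 * real c + 2) * (real c / (2 * real c + 1)) + (\<Sum>k\<in>L. 1 / real (q k))"
        using L(3)[rule_format, of "(2 * real c + 3) / (2 * real c + 2)"] r hi by (simp add: add.commute)
      define a where "a = real c"
      have a5: "5 \<le> a" using c5 by (simp add: a_def)
      have Rq: "(2 * a + 3) / (2 * a + 2) * (a / (2 * a + 1)) = 1 / 2 - 1 / ((2 * a + 1) * (2 * a + 2))"
      proof -
        define D where "D = (2 * a + 1) * (2 * a + 2)"
        have D: "D \<noteq> 0" using a5 by (simp add: D_def)
        have "(2 * a + 3) / (2 * a + 2) * (a / (2 * a + 1)) = ((2 * a + 3) * a) / D"
          by (simp add: D_def mult.commute)
        also have "(2 * a + 3) * a = D / 2 - 1" by (simp add: D_def algebra_simps)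
        also have "(D / 2 - 1) / D = 1 / 2 - 1 / D" using D by (simp add: diff_divide_distrib)
        finally show ?thesis by (simp add: D_def)
      qed
      have B: "(\<Sum>k\<in>L. 1 / real (q k)) \<le> card L * (1 / 5)"
        proof (rule sum_bounded_above)
        fix k assume "k \<in> L"
        then have "5 \<le> q k" using L(1) q5[of k] by blast
        then show "1 / real (q k) \<le> 1 / 5" by (intro divide_left_mono) auto
      qed
      have pos: "0 < 1 / ((2 * a + 1) * (2 * a + 2))" using a5 by simp
      have main': "1 / 2 + 1 / ((2 * a + 1) * (2 * a + 2)) \<le> 1 / a + (\<Sum>k\<in>L. 1 / real (q k))"
        using main unfolding Rq[unfolded a_def] a_def by linarith
      show False
      proof (cases "card L \<le> 1")
        case True
        then have "(\<Sum>k\<in>L. 1 / real (q k)) \<le> 1 / 5" using B by (simp add: order.trans)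
        then show False using main' pos c15 unfolding a_def by linarith
      next
        case L2: False
        show False
        \<comment> \<open>The value 5 is separate because the inequality refuted in the general
          case, \<open>a * (a + 2) \<le> 4 * (2 * a + 1)\<close>, holds for it and fails only from 7
          on. Here \<open>L\<close> has two elements with \<open>w = 2\<close> and \<open>q\<close>
          at least 7, and \<open>1/5 + 2/7\<close> is below 1/2.\<close>
        proof (cases "c = 5")
          case c: True
          have "L \<subseteq> I" using L(1) by blast
          from Lcard[OF this] have "2 * card L \<le> 4" using L(2) c by linarith
          then have cL: "card L = 2" using L2 by simp
          have "w k = 2" if k: "k \<in> L" for k
          proof -
            have "(\<Sum>m\<in>L - {k}. w m) + w k \<le> 4" using L(2) c k finL by (simp add: sum.remove)
            moreover have "2 * card (L - {k}) \<le> (\<Sum>m\<in>L - {k}. w m)" by (rule Lcard) (use L(1) in blast)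
            ultimately have "w k \<le> 2" using cL k finL by (simp add: card_Diff_singleton)
            then show ?thesis using w(1)[of k] k L(1) by auto
          qed
          then have "7 \<le> q k" if k: "k \<in> L" for k
          proof -
            have kI: "k \<in> I" "k \<in> I - {i}" using k L(1) by auto
            have "13 \<le> 2 * q k + 1" using above[OF kI(2)] hi c h(1)[OF kI(1)] \<open>\<And>k. k \<in> L \<Longrightarrow> w k = 2\<close>[OF k] by simp
            then show ?thesis using q(2)[OF kI(1)] by (auto elim!: oddE)
          qed
          then have "(\<Sum>k\<in>L. 1 / real (q k)) \<le> card L * (1 / 7)"
            proof (intro sum_bounded_above)
            fix k assume k: "k \<in> L"
            show "1 / real (q k) \<le> 1 / 7" using \<open>\<And>k. k \<in> L \<Longrightarrow> 7 \<le> q k\<close>[OF k] by (intro divide_left_mono) auto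
          qed
          then have "(\<Sum>k\<in>L. 1 / real (q k)) \<le> 2 / 7" using cL by simp
          then show False using main' pos c by (simp add: a_def)
        next
          case False
          have a7: "7 \<le> a"
          proof -
            have "c \<noteq> 6" using q(2)[OF i(1)] by (auto simp: c_def)
            then show ?thesis using c5 False by (simp add: a_def)
          qed
          have "L \<noteq> {}" using L2 by auto
          \<comment> \<open>Bounding all of \<open>L\<close> by the first possible value
            \<open>2 * c + 3\<close> of \<open>h\<close> would be too weak. Only the minimal
            \<open>m\<close> can attain it; the others have \<open>h\<close> at least
            \<open>2 * c + 5\<close>, and their total weight is at least 2.\<close>
          then obtain m where m: "m \<in> L" "\<And>k. k \<in> L \<Longrightarrow> h m \<le> h k"
            using finL by (metis (no_types, lifting) arg_min_if_finite(1) arg_min_least)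
          have Lm: "card (L - {m}) \<noteq> 0" using L2 m(1) finL by (simp add: card_Diff_singleton)
          have "2 * card (L - {m}) \<le> (\<Sum>k\<in>L - {m}. w k)" by (rule Lcard) (use L(1) in blast)
          then have s2: "2 \<le> (\<Sum>k\<in>L - {m}. w k)" using Lm by linarith
          have sm: "w m + (\<Sum>k\<in>L - {m}. w k) \<le> c - 1" using L(2) m(1) finL by (simp add: sum.remove)
          define s where "s = real (\<Sum>k\<in>L - {m}. w k)"
          have s: "2 \<le> s" "real (w m) + s \<le> a - 1" using s2 sm c5 unfolding s_def a_def by linarith+
          have hm: "2 * a + 2 \<le> real (h m) - 1" using above[of m] m(1) L(1) hi by (force simp: a_def)
          have "(\<Sum>k\<in>L - {m}. 1 / real (q k)) \<le> (\<Sum>k\<in>L - {m}. real (w k) / (2 * a + 4))"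
          proof (rule sum_mono)
            fix k assume k: "k \<in> L - {m}"
            have kI: "k \<in> I" "m \<in> I" using k m(1) L(1) by auto
            have "h k \<noteq> h m" using inj_on_eq_iff[OF h(2), of k m] k kI by simp
            moreover have "h k \<noteq> h m + 1" using h7(2)[OF kI(1)] h7(2)[OF kI(2)] by auto
            ultimately have "h m + 2 \<le> h k" using m(2)[of k] k by auto
            then have "2 * a + 4 \<le> real (h k) - 1" using hm by linarith
            then show "1 / real (q k) \<le> real (w k) / (2 * a + 4)"
              using qk[of k] k a5 by (simp add: divide_left_mono)
          qed
          also have "\<dots> = s / (2 * a + 4)" by (simp add: s_def flip: sum_divide_distrib)
          finally have B2: "(\<Sum>k\<in>L - {m}. 1 / real (q k)) \<le> s / (2 * a + 4)" .
          have B1: "1 / real (q m) \<le> real (w m) / (2 * a + 2)"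
            unfolding qk[OF m(1)] using hm a5 by (intro divide_left_mono) auto
          have "real (w m) / (2 * a + 2) + s / (2 * a + 4) \<le> (a - 1 - s) / (2 * a + 2) + s / (2 * a + 4)"
            using s a5 by (intro add_right_mono divide_right_mono) auto
          also have "\<dots> = (a - 1) / (2 * a + 2) - s * (1 / (2 * a + 2) - 1 / (2 * a + 4))"
            by (simp add: diff_divide_distrib right_diff_distrib)
          also have "\<dots> \<le> (a - 1) / (2 * a + 2) - 2 * (1 / (2 * a + 2) - 1 / (2 * a + 4))"
          proof -
            have "0 \<le> 1 / (2 * a + 2) - 1 / (2 * a + 4)" using a5 by (simp add: field_simps)
            then show ?thesis using s(1) by (intro diff_left_mono mult_right_mono) auto
          qed
          finally have "(\<Sum>k\<in>L. 1 / real (q k)) \<le> (a - 1) / (2 * a + 2) - 2 * (1 / (2 * a + 2) - 1 / (2 * a + 4))"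
            using B1 B2 m(1) finL by (simp add: sum.remove)
          then have "1 / 2 + 1 / ((2 * a + 1) * (2 * a + 2)) \<le> 1 / a + ((a - 1) / (2 * a + 2) - 2 * (1 / (2 * a + 2) - 1 / (2 * a + 4)))"
            using main' by linarith
          also have "\<dots> = 1 / 2 + 2 / (a * ((a + 1) * (a + 2)))"
            using a5 by (simp add: divide_simps) (simp add: algebra_simps)
          finally have "1 / ((2 * a + 1) * (2 * a + 2)) \<le> 2 / (a * ((a + 1) * (a + 2)))" by simp
          then have "a * ((a + 1) * (a + 2)) \<le> 2 * ((2 * a + 1) * (2 * a + 2))"
            using a5 by (simp add: divide_simps)
          then have "(a + 1) * (a * (a + 2)) \<le> (a + 1) * (4 * (2 * a + 1))" by (simp add: algebra_simps)
          then have "a * (a + 2) \<le> 4 * (2 * a + 1)" using a5 by simp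
          moreover have "7 * a \<le> a * a" using a7 by (intro mult_right_mono) auto
          ultimately show False using a7 by (simp add: algebra_simps)
        qed
      qed
    qed
  qed
qed

section \<open>Bessel's inequality on the \<open>p\<close>-elements\<close>

context epo_prime
begin

text \<open>The weights \<open>s\<close> are those of the projection of \<open>z\<close> to the span of \<open>betas\<close>, obtained by inverting the Gram matrix.\<close>

lemma bessel:
  assumes r: "\<And>b. b \<in> betas \<Longrightarrow> ip z b = of_real (r b)"
  shows "(\<Sum>b\<in>betas. (r b)\<^sup>2) - real (np p) / (real (card betas) * np p + 1) * (\<Sum>b\<in>betas. r b)\<^sup>2
    \<le> (\<Sum>x\<in>cls p. (cmod (z x))\<^sup>2) / order G"
proof -
  define q w h R where "q = real (np p)" and "w = real (card betas)" and "h = w * q + 1" and "R = (\<Sum>b\<in>betas. r b)"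
  have h: "0 < h" by (simp add: h_def w_def q_def add_nonneg_pos)
  \<comment> \<open>The inverse of the Gram matrix \<open>q * J + I\<close> of size \<open>w\<close>
    is \<open>I - (q / h) * J\<close> with \<open>h = w * q + 1\<close>.\<close>
  define s where "s b = r b - q / h * R" for b
  \<comment> \<open>Truncation to \<open>cls p\<close> does not change the inner products with
    \<open>betas\<close>, which are supported there, and it is what leaves only \<open>cls p\<close>
    on the right-hand side.\<close>
  define y where "y x = (if x \<in> cls p then z x else 0)" for x
  define v where "v x = (\<Sum>b\<in>betas. of_real (s b) * b x)" for x :: 'a
  have yb: "ip y b = of_real (r b)" if b: "b \<in> betas" for b
  proof -
    have "ip y b = ip z b"
      unfolding ip_def by (intro arg_cong2[where f = "(/)"] sum.cong refl) (auto simp: y_def betas_support[OF b])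
    then show ?thesis using r[OF b] by simp
  qed
  have yv: "ip y v = of_real (\<Sum>b\<in>betas. s b * r b)"
    unfolding v_def ip_sum(2) ip_scale(2) by (simp add: yb cong: sum.cong)
  have vy: "ip v y = of_real (\<Sum>b\<in>betas. s b * r b)" using ip_cnj[of y v] yv by simp
  have vv: "ip v v = of_real (q * (\<Sum>b\<in>betas. s b)\<^sup>2 + (\<Sum>b\<in>betas. (s b)\<^sup>2))"
  proof -
    have "ip v v = (\<Sum>b\<in>betas. \<Sum>c\<in>betas. of_real (s b) * of_real (s c) * ip b c)"
    proof -
      have "ip v v = (\<Sum>b\<in>betas. of_real (s b) * ip b v)" unfolding v_def by (subst ip_sum(1)) (simp add: ip_scale(1))
      also have "\<dots> = (\<Sum>b\<in>betas. of_real (s b) * (\<Sum>c\<in>betas. of_real (s c) * ip b c))"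
        unfolding v_def by (subst ip_sum(2)) (simp add: ip_scale(2))
      finally show ?thesis by (simp add: sum_distrib_left mult.assoc)
    qed
    also have "\<dots> = (\<Sum>b\<in>betas. \<Sum>c\<in>betas. of_real (q * (s b * s c)) + (if c = b then of_real ((s b)\<^sup>2) else 0))"
      by (intro sum.cong refl) (auto simp: betas_ip q_def power2_eq_square algebra_simps)
    also have "\<dots> = of_real (q * (\<Sum>b\<in>betas. \<Sum>c\<in>betas. s b * s c) + (\<Sum>b\<in>betas. (s b)\<^sup>2))"
      by (simp add: sum.distrib sum_distrib_left)
    also have "(\<Sum>b\<in>betas. \<Sum>c\<in>betas. s b * s c) = (\<Sum>b\<in>betas. s b)\<^sup>2"
      by (simp add: power2_eq_square sum_product)
    finally show ?thesis .
  qed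
  have "ip (\<lambda>x. y x - v x) (\<lambda>x. y x - v x) = ip y y - ip v y - (ip y v - ip v v)"
    by (simp add: ip_diff algebra_simps)
  then have E1: "ip (\<lambda>x. y x - v x) (\<lambda>x. y x - v x) =
      of_real ((\<Sum>x\<in>carrier G. (cmod (y x))\<^sup>2) / order G - 2 * (\<Sum>b\<in>betas. s b * r b) +
      (q * (\<Sum>b\<in>betas. s b)\<^sup>2 + (\<Sum>b\<in>betas. (s b)\<^sup>2)))"
    unfolding yv vy vv by (simp add: ip_self)
  have E2: "ip (\<lambda>x. y x - v x) (\<lambda>x. y x - v x) = of_real ((\<Sum>x\<in>carrier G. (cmod (y x - v x))\<^sup>2) / order G)"
    by (rule ip_self)
  have "0 \<le> (\<Sum>x\<in>carrier G. (cmod (y x - v x))\<^sup>2) / order G" by (simp add: sum_nonneg)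
  then have pos: "0 \<le> (\<Sum>x\<in>carrier G. (cmod (y x))\<^sup>2) / order G - 2 * (\<Sum>b\<in>betas. s b * r b) +
      (q * (\<Sum>b\<in>betas. s b)\<^sup>2 + (\<Sum>b\<in>betas. (s b)\<^sup>2))"
    using trans[OF sym[OF E2] E1] by (simp only: of_real_eq_iff)
  have "(\<Sum>x\<in>carrier G. (cmod (y x))\<^sup>2) = (\<Sum>x\<in>cls p. (cmod (z x))\<^sup>2)"
    using fin by (intro sum.mono_neutral_cong_right) (auto simp: y_def cls_def)
  moreover have "(\<Sum>b\<in>betas. s b * r b) = (\<Sum>b\<in>betas. (r b)\<^sup>2) - q / h * R * R"
  proof -
    have "(\<Sum>b\<in>betas. s b * r b) = (\<Sum>b\<in>betas. (r b)\<^sup>2 - q / h * R * r b)"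
      by (rule sum.cong) (simp_all add: s_def left_diff_distrib power2_eq_square)
    then show ?thesis by (simp only: sum_subtractf sum_distrib_left[symmetric] R_def)
  qed
  moreover have "(\<Sum>b\<in>betas. s b) = R / h"
  proof -
    have "(\<Sum>b\<in>betas. s b) = R - w * (q / h * R)" by (simp add: s_def sum_subtractf R_def w_def)
    also have "\<dots> = R / h" using h by (simp add: h_def field_simps)
    finally show ?thesis .
  qed
  moreover have "(\<Sum>b\<in>betas. (s b)\<^sup>2) = (\<Sum>b\<in>betas. (r b)\<^sup>2) - 2 * (q / h * R) * R + w * (q / h * R)\<^sup>2"
  proof -
    have "(\<Sum>b\<in>betas. (s b)\<^sup>2) = (\<Sum>b\<in>betas. (r b)\<^sup>2 - 2 * (q / h * R) * r b + (q / h * R)\<^sup>2)"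
      unfolding s_def by (rule sum.cong) (simp_all add: power2_diff)
    also have "\<dots> = (\<Sum>b\<in>betas. (r b)\<^sup>2) - 2 * (q / h * R) * (\<Sum>b\<in>betas. r b) + w * (q / h * R)\<^sup>2"
      by (simp only: sum.distrib sum_subtractf sum_distrib_left[symmetric] sum_constant w_def)
    finally show ?thesis by (simp add: R_def)
  qed
  moreover have "q * (R / h)\<^sup>2 + w * (q / h * R)\<^sup>2 = q / h * R * R"
  proof -
    have "q * (R / h)\<^sup>2 + w * (q / h * R)\<^sup>2 = (q * R\<^sup>2 * h) / h\<^sup>2"
      by (simp add: h_def power_divide power_mult_distrib distrib_left flip: add_divide_distrib) (simp add: power2_eq_square algebra_simps)
    also have "\<dots> = q / h * R * R" using h by (simp add: power2_eq_square)
    finally show ?thesis .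
  qed
  ultimately have "(\<Sum>b\<in>betas. (r b)\<^sup>2) - q / h * R * R \<le> (\<Sum>x\<in>cls p. (cmod (z x))\<^sup>2) / order G"
    using pos by (simp add: mult.assoc)
  then show ?thesis by (simp add: q_def w_def h_def R_def power2_eq_square mult.assoc)
qed

end

section \<open>The contradiction in odd order\<close>

context epo
begin

definition bt :: "nat \<Rightarrow> ('a \<Rightarrow> complex) set" where "bt p = epo_prime.betas G p"

text \<open>The inner product is an integer by \<open>betas_int\<close>; taking the floor of the
  real part only converts it to type \<open>int\<close>.\<close>

definition crd :: "('a \<Rightarrow> complex) \<Rightarrow> ('a \<Rightarrow> complex) \<Rightarrow> int" where "crd b \<chi> = \<lfloor>Re (ip b \<chi>)\<rfloor>"

lemma epo_primeI: "p \<in> primes \<Longrightarrow> epo_prime G p"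
  by (intro epo_prime.intro epo_axioms epo_prime_axioms.intro)

lemma ip_crd:
  assumes "p \<in> primes" "b \<in> bt p" "\<chi> \<in> Irr"
  shows "ip b \<chi> = of_int (crd b \<chi>)" "ip \<chi> b = of_int (crd b \<chi>)"
proof -
  obtain i :: int where "ip b \<chi> = of_int i"
    using epo_prime.betas_int[OF epo_primeI[OF assms(1)]] assms by (auto simp: bt_def)
  then show 1: "ip b \<chi> = of_int (crd b \<chi>)" by (simp add: crd_def)
  show "ip \<chi> b = of_int (crd b \<chi>)" using ip_cnj[of b \<chi>] 1 by simp
qed

lemma odd_np:
  assumes "odd (order G)" "p \<in> primes"
  shows "odd (np p)"
proof -
  have "np p dvd order G"
    using card_normalizer_syl[OF assms(2) sylp] assms(2)
    by (metis dvd_trans dvd_triv_right primes_iff normalizer_subgroup subgroup_order_dvd sylp syl_def subgroup.subset)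
  then show ?thesis using assms(1) by (meson dvd_trans)
qed

lemma card_bt:
  assumes p: "p \<in> primes"
  shows "card (bt p) * np p + 1 = card (lin (sylp p))"
  using epo_prime.card_betas[OF epo_primeI[OF p]] epo_prime.card_lin(2)[OF epo_primeI[OF p]] by (simp add: bt_def)

text \<open>Odd order enters twice: only the trivial character is real, and the number of linear
  characters of a Sylow subgroup, a divisor of the group order, is odd, which makes
  \<open>card (bt p)\<close> even. Functions of distinct primes are orthogonal because their
  supports are disjoint.\<close>

lemma coherent_bt:
  assumes odd: "odd (order G)"
  shows "coherent Irr one_fun (\<lambda>\<chi> x. cnj (\<chi> x)) (\<lambda>\<chi>. \<lfloor>Re (\<chi> \<one>)\<rfloor>) primes bt crd (\<lambda>p. int (np p))"
proof
  show "finite Irr" "one_fun \<in> Irr" "finite primes" using finite_Irr one_fun_Irr by auto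
  have deg: "\<chi> \<one> = of_int \<lfloor>Re (\<chi> \<one>)\<rfloor> \<and> 0 < \<lfloor>Re (\<chi> \<one>)\<rfloor>" if "\<chi> \<in> Irr" for \<chi>
    using Irr_degree[OF that] by auto
  then show "0 < \<lfloor>Re (\<chi> \<one>)\<rfloor>" if "\<chi> \<in> Irr" for \<chi> using that by blast
  show "(\<lambda>x. cnj (\<chi> x)) \<in> Irr" if "\<chi> \<in> Irr" for \<chi> by (rule cnj_Irr[OF that])
  show "(\<lambda>x. cnj (cnj (\<chi> x))) = \<chi>" for \<chi> :: "'a \<Rightarrow> complex" by simp
  show "\<chi> = one_fun" if "\<chi> \<in> Irr" "(\<lambda>x. cnj (\<chi> x)) = \<chi>" for \<chi> by (rule real_Irr_odd[OF odd that])
  show "(\<lambda>x. cnj (one_fun x)) = one_fun" by (auto simp: one_fun_def fun_eq_iff)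
  fix p assume p: "p \<in> primes"
  note ep = epo_primeI[OF p]
  show fb: "finite (bt p)" using epo_prime.finite_betas[OF ep] by (simp add: bt_def)
  have "odd (card (lin (sylp p)))"
    using epo_prime.card_lin(1)[OF ep] sp_dvd[of p] p odd by (meson dvd_trans primes_iff)
  then show ev: "even (card (bt p))" using card_bt[OF p] odd_np[OF odd p] by (metis even_mult_iff odd_add odd_one)
  have "bt p \<noteq> {}" using epo_prime.betas_nonempty[OF ep] by (simp add: bt_def)
  then have "card (bt p) \<noteq> 0" using fb by simp
  then show "2 \<le> card (bt p)" using ev by (auto elim!: evenE)
  fix b assume b: "b \<in> bt p"
  then have bb: "b \<in> epo_prime.betas G p" by (simp add: bt_def)
  have cb: "class_fun b" by (rule epo_prime.betas_class_fun[OF ep bb])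
  show "crd b one_fun = 1" using epo_prime.betas_one[OF ep bb] by (simp add: crd_def)
  have "b \<one> = 0" by (rule epo_prime.betas_support[OF ep bb]) (simp add: cls_def)
  then have "(\<Sum>\<chi>\<in>Irr. ip b \<chi> * \<chi> \<one>) = 0" using class_fun_expansion[OF cb, of \<one>] by simp
  also have "(\<Sum>\<chi>\<in>Irr. ip b \<chi> * \<chi> \<one>) = (\<Sum>\<chi>\<in>Irr. of_int (crd b \<chi> * \<lfloor>Re (\<chi> \<one>)\<rfloor>))"
  proof (rule sum.cong)
    fix \<chi> assume \<chi>: "\<chi> \<in> Irr"
    show "ip b \<chi> * \<chi> \<one> = of_int (crd b \<chi> * \<lfloor>Re (\<chi> \<one>)\<rfloor>)"
      unfolding of_int_mult ip_crd(1)[OF p b \<chi>, symmetric] deg[OF \<chi>, THEN conjunct1, symmetric] by (rule refl)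
  qed simp
  finally show "(\<Sum>\<chi>\<in>Irr. crd b \<chi> * \<lfloor>Re (\<chi> \<one>)\<rfloor>) = 0" by (simp only: of_int_sum[symmetric] of_int_eq_0_iff)
  have "crd (\<lambda>x. cnj (b x)) \<chi> = crd b (\<lambda>x. cnj (\<chi> x))" for \<chi>
  proof -
    have "ip (\<lambda>x. cnj (b x)) \<chi> = cnj (ip b (\<lambda>x. cnj (\<chi> x)))" by (simp add: ip_def)
    then show ?thesis by (simp add: crd_def)
  qed
  moreover have "(\<lambda>x. cnj (b x)) \<in> bt p" using epo_prime.betas_cnj[OF ep bb] by (simp add: bt_def)
  ultimately show "\<exists>b'\<in>bt p. \<forall>\<chi>\<in>Irr. crd b' \<chi> = crd b (\<lambda>x. cnj (\<chi> x))" by blast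
  have pars: "of_int (\<Sum>\<chi>\<in>Irr. crd b \<chi> * crd b' \<chi>) = ip b b'" if k: "k \<in> primes" "b' \<in> bt k" for k b'
  proof -
    have "class_fun b'" using epo_prime.betas_class_fun[OF epo_primeI[OF k(1)]] k(2) by (simp add: bt_def)
    then have "ip b b' = (\<Sum>\<chi>\<in>Irr. ip b \<chi> * cnj (ip b' \<chi>))" by (rule parseval[OF cb])
    also have "\<dots> = (\<Sum>\<chi>\<in>Irr. of_int (crd b \<chi> * crd b' \<chi>))"
      by (rule sum.cong) (simp_all add: ip_crd(1)[OF p b] ip_crd(1)[OF k])
    finally show ?thesis by simp
  qed
  show "(\<Sum>\<chi>\<in>Irr. crd b \<chi> * crd b' \<chi>) = int (np p) + (if b = b' then 1 else 0)" if b': "b' \<in> bt p" for b'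
  proof -
    have "of_int (\<Sum>\<chi>\<in>Irr. crd b \<chi> * crd b' \<chi>) = (of_int (int (np p) + (if b = b' then 1 else 0)) :: complex)"
      using pars[OF p b'] epo_prime.betas_ip[OF ep bb, of b'] b' by (simp add: bt_def)
    then show ?thesis by (simp only: of_int_eq_iff)
  qed
  fix k b' assume k: "k \<in> primes" "p \<noteq> k" "b' \<in> bt k"
  have "b x * cnj (b' x) = 0" for x
  proof (cases "x \<in> cls p")
    case True
    then have "x \<notin> cls k" using cls_disjoint[OF p k(1,2)] by blast
    then show ?thesis using epo_prime.betas_support[OF epo_primeI[OF k(1)]] k(3) by (simp add: bt_def)
  next
    case False
    then show ?thesis using epo_prime.betas_support[OF ep bb] by simp
  qed
  then have "ip b b' = 0" unfolding ip_def by (simp only: sum.neutral_const div_0)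
  then show "(\<Sum>\<chi>\<in>Irr. crd b \<chi> * crd b' \<chi>) = 0" using pars[OF k(1,3)] by (metis of_int_eq_0_iff)
qed

lemma character_mass:
  assumes \<chi>: "\<chi> \<in> Irr"
  shows "1 / order G + (\<Sum>k\<in>primes. (\<Sum>x\<in>cls k. (cmod (\<chi> x))\<^sup>2) / order G) \<le> 1"
proof -
  have "of_real ((\<Sum>x\<in>carrier G. (cmod (\<chi> x))\<^sup>2) / order G) = (1::complex)"
    using ip_self[of \<chi>] Irr_orthonormal[OF \<chi> \<chi>] by simp
  then have tot: "(\<Sum>x\<in>carrier G. (cmod (\<chi> x))\<^sup>2) / order G = 1" by (simp only: of_real_eq_1_iff)
  have "(\<Sum>x\<in>carrier G. (cmod (\<chi> x))\<^sup>2) = (cmod (\<chi> \<one>))\<^sup>2 + (\<Sum>x\<in>carrier G - {\<one>}. (cmod (\<chi> x))\<^sup>2)"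
    using fin by (intro sum.remove) auto
  also have "(\<Sum>x\<in>carrier G - {\<one>}. (cmod (\<chi> x))\<^sup>2) = (\<Sum>k\<in>primes. \<Sum>x\<in>cls k. (cmod (\<chi> x))\<^sup>2)"
    unfolding cls_cover using cls_disjoint by (intro sum.UNION_disjoint) auto
  finally have "1 = (cmod (\<chi> \<one>))\<^sup>2 / order G + (\<Sum>k\<in>primes. (\<Sum>x\<in>cls k. (cmod (\<chi> x))\<^sup>2) / order G)"
    using tot by (simp add: add_divide_distrib sum_divide_distrib)
  moreover obtain n :: nat where "\<chi> \<one> = of_nat n" "0 < n" using Irr_degree[OF \<chi>] by blast
  then have "1 \<le> (cmod (\<chi> \<one>))\<^sup>2" by simp
  then have "1 / order G \<le> (cmod (\<chi> \<one>))\<^sup>2 / order G" by (intro divide_right_mono) auto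
  ultimately show ?thesis by linarith
qed

text \<open>Bessel's inequality for the exceptional character \<open>x i\<close> gives at least
  \<open>1 - np i / h i\<close> on \<open>cls i\<close>, and at least \<open>w k / h k\<close> on
  \<open>cls k\<close> whenever \<open>a i k\<close> is nonzero; with the identity these add up to
  at most 1. If \<open>a i k = 0\<close>, then \<open>a k i\<close> is odd and
  \<open>norm_bound\<close> limits the total weight of such \<open>k\<close>. The numerical
  contradiction is \<open>odd_numeric\<close>.\<close>

theorem odd_self_normalizing:
  assumes odd: "odd (order G)" and nt: "primes \<noteq> {}"
  shows "\<exists>p\<in>primes. np p = 1"
proof (rule ccontr)
  assume no: "\<not> ?thesis"
  define w where "w k = card (bt k)" for k
  define h where "h k = w k * np k + 1" for k
  have q3: "3 \<le> np k" if k: "k \<in> primes" for k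
  proof -
    have "prime (np k)" using np_cases[OF k] no k by blast
    then have "2 \<le> np k" by (rule prime_ge_2_nat)
    moreover have "np k \<noteq> 2" using odd_np[OF odd k] by auto
    ultimately show ?thesis by linarith
  qed
  interpret coh: coherent Irr one_fun "\<lambda>\<chi> x. cnj (\<chi> x)" "\<lambda>\<chi>. \<lfloor>Re (\<chi> \<one>)\<rfloor>" primes bt crd "\<lambda>p. int (np p)"
    by (rule coherent_bt[OF odd])
  obtain x b e \<gamma> a where ex: "\<forall>i\<in>primes. x i \<in> Irr \<and> b i \<in> bt i \<and> (e i = 1 \<or> e i = - 1) \<and>
    (\<forall>b'\<in>bt i. crd b' (x i) = \<gamma> i + (if b' = b i then e i else (0::int))) \<and>
    (\<forall>k\<in>primes - {i}. (\<forall>b'\<in>bt k. crd b' (x i) = a i k) \<and> odd (a i k + a k i)) \<and>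
    (\<Sum>k\<in>primes - {i}. int (card (bt k)) * (a k i)\<^sup>2) \<le> int (np i) - 1"
    using coh.exceptional_vectors by blast
  have x: "x i \<in> Irr" and bi: "b i \<in> bt i" and ei: "e i = 1 \<or> e i = - 1" if "i \<in> primes" for i using ex that by blast+
  have xi: "crd b' (x i) = \<gamma> i + (if b' = b i then e i else (0::int))" if "i \<in> primes" "b' \<in> bt i" for i b' using ex that by blast
  have xk: "crd b' (x i) = a i k" if "i \<in> primes" "k \<in> primes - {i}" "b' \<in> bt k" for i k b' using ex that by blast
  have par: "odd (a i k + a k i)" if "i \<in> primes" "k \<in> primes - {i}" for i k using ex that by blast
  have nb: "(\<Sum>k\<in>primes - {i}. int (w k) * (a k i)\<^sup>2) \<le> int (np i) - 1" if "i \<in> primes" for i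
    using ex that unfolding w_def by blast
  have hr: "real (h k) = real (w k) * np k + 1" "0 < real (h k)" for k
    by (simp add: h_def) (unfold of_nat_0_less_iff, simp add: h_def)
  have w2: "2 \<le> w k" "even (w k)" if "k \<in> primes" for k using coh.B(2,3) that by (auto simp: w_def)
  have bes: "(\<Sum>b'\<in>bt k. (real_of_int (crd b' (x i)))\<^sup>2) - real (np k) / h k * (\<Sum>b'\<in>bt k. real_of_int (crd b' (x i)))\<^sup>2
      \<le> (\<Sum>y\<in>cls k. (cmod (x i y))\<^sup>2) / order G" if ik: "i \<in> primes" "k \<in> primes" for i k
  proof -
    have "ip (x i) b' = of_real (real_of_int (crd b' (x i)))" if "b' \<in> epo_prime.betas G k" for b'
      using ip_crd(2)[OF ik(2) _ x[OF ik(1)]] that by (simp add: bt_def)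
    from epo_prime.bessel[OF epo_primeI[OF ik(2)] this] show ?thesis by (simp add: hr w_def flip: bt_def)
  qed
  have off: "real (w k) / h k * (real_of_int (a i k))\<^sup>2 \<le> (\<Sum>y\<in>cls k. (cmod (x i y))\<^sup>2) / order G"
    if ik: "i \<in> primes" "k \<in> primes - {i}" for i k
  proof -
    define t where "t = real_of_int (a i k)"
    have k: "k \<in> primes" using ik(2) by blast
    have "real (w k) * t\<^sup>2 - real (np k) / h k * (real (w k) * t)\<^sup>2 = real (w k) / h k * t\<^sup>2"
    proof -
      have "real (w k) * t\<^sup>2 = real (w k) * t\<^sup>2 * h k / h k" using hr(2)[of k] by simp
      then have "real (w k) * t\<^sup>2 - real (np k) / h k * (real (w k) * t)\<^sup>2 = (real (w k) * t\<^sup>2 * h k - real (np k) * (real (w k) * t)\<^sup>2) / h k"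
        by (simp add: diff_divide_distrib)
      also have "real (w k) * t\<^sup>2 * h k - real (np k) * (real (w k) * t)\<^sup>2 = real (w k) * t\<^sup>2"
        unfolding hr(1) by (simp add: power2_eq_square algebra_simps)
      finally show ?thesis by simp
    qed
    moreover have "(\<Sum>b'\<in>bt k. (real_of_int (crd b' (x i)))\<^sup>2) = real (w k) * t\<^sup>2"
      "(\<Sum>b'\<in>bt k. real_of_int (crd b' (x i))) = real (w k) * t"
      using xk[OF ik] by (simp_all add: w_def t_def)
    ultimately show ?thesis using bes[OF ik(1) k] by (simp add: t_def)
  qed
  have dia: "1 - real (np i) / h i \<le> (\<Sum>y\<in>cls i. (cmod (x i y))\<^sup>2) / order G" if i: "i \<in> primes" for i
  proof -
    define g where "g = real_of_int (\<gamma> i)"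
    define s where "s = real_of_int (e i)"
    have ss: "s * s = 1" using ei[OF i] by (auto simp: s_def)
    have finb: "finite (bt i)" using coh.B(1)[OF i] .
    have val: "real_of_int (crd b' (x i)) = g + (if b' = b i then s else 0)" if "b' \<in> bt i" for b'
      using xi[OF i that] by (simp add: g_def s_def)
    have S1: "(\<Sum>b'\<in>bt i. real_of_int (crd b' (x i))) = real (w i) * g + s"
      using finb bi[OF i] by (simp add: val sum.distrib w_def cong: sum.cong)
    have "(\<Sum>b'\<in>bt i. (real_of_int (crd b' (x i)))\<^sup>2) = (\<Sum>b'\<in>bt i. g\<^sup>2 + (if b' = b i then 2 * s * g + s * s else 0))"
      by (rule sum.cong) (auto simp: val power2_eq_square algebra_simps)
    then have S2: "(\<Sum>b'\<in>bt i. (real_of_int (crd b' (x i)))\<^sup>2) = real (w i) * g\<^sup>2 + (2 * s * g + 1)"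
      using finb bi[OF i] by (simp add: sum.distrib w_def ss)
    \<comment> \<open>Bessel's bound simplifies to \<open>1 - np i / h i\<close> plus this quantity
      over \<open>h i\<close>. It is nonnegative because the integer \<open>\<gamma> i\<close> has
      modulus at most its square, and \<open>w i\<close> is at least 2.\<close>
    have "0 \<le> real (w i) * g\<^sup>2 + 2 * s * g"
    proof -
      have "\<bar>\<gamma> i\<bar> * 1 \<le> \<bar>\<gamma> i\<bar> * \<bar>\<gamma> i\<bar>"
      proof (cases "\<gamma> i = 0")
        case False
        then have "1 \<le> \<bar>\<gamma> i\<bar>" by linarith
        then show ?thesis by (intro mult_left_mono) auto
      qed simp
      also have "\<dots> = (\<gamma> i)\<^sup>2" by (simp add: power2_eq_square)
      finally have "\<bar>\<gamma> i\<bar> \<le> (\<gamma> i)\<^sup>2" by simp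
      then have "\<bar>g\<bar> \<le> g\<^sup>2" unfolding g_def by (metis of_int_abs of_int_le_iff of_int_power)
      moreover have "2 * g\<^sup>2 \<le> real (w i) * g\<^sup>2" using w2(1)[OF i] by (intro mult_right_mono) auto
      moreover have "- \<bar>g\<bar> \<le> s * g" using ei[OF i] by (auto simp: s_def)
      ultimately show ?thesis by linarith
    qed
    moreover have "real (w i) * g\<^sup>2 + (2 * s * g + 1) - real (np i) / h i * (real (w i) * g + s)\<^sup>2
        = 1 - real (np i) / h i + (real (w i) * g\<^sup>2 + 2 * s * g) / h i"
    proof -
      have sq: "(real (w i) * g + s)\<^sup>2 = real (w i) * (real (w i) * g\<^sup>2 + 2 * s * g) + 1"
        using ss by (simp add: power2_eq_square algebra_simps)
      define Z where "Z = real (w i) * g\<^sup>2 + 2 * s * g"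
      have "Z = Z * h i / h i" using hr(2)[of i] by simp
      also have "Z * h i = Z * real (w i) * np i + Z" unfolding hr(1) by (simp add: algebra_simps)
      finally have "Z = Z * real (w i) * np i / h i + Z / h i" by (simp add: add_divide_distrib)
      moreover have "real (np i) / h i * (real (w i) * Z + 1) = Z * real (w i) * np i / h i + real (np i) / h i"
        by (simp add: distrib_left mult_ac add_divide_distrib)
      moreover have "real (w i) * g\<^sup>2 + (2 * s * g + 1) = Z + 1" by (simp add: Z_def)
      ultimately show ?thesis unfolding sq Z_def[symmetric] by linarith
    qed
    moreover have "0 \<le> (real (w i) * g\<^sup>2 + 2 * s * g) / h i" by (rule divide_nonneg_nonneg) (use calculation in simp_all)
    ultimately show ?thesis using bes[OF i i] unfolding S1 S2 by linarith
  qed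
  show False
  proof (rule odd_numeric[of primes "order G" np w h])
    show "finite primes" "primes \<noteq> {}" "0 < order G" using nt order_pos by auto
    show "3 \<le> np i" "odd (np i)" "2 \<le> w i" "even (w i)" "h i = w i * np i + 1" if "i \<in> primes" for i
      using q3 odd_np[OF odd] w2 that by (auto simp: h_def)
    \<comment> \<open>\<open>h k\<close> is the number of linear characters of a Sylow
      \<open>k\<close>-subgroup and divides its order, so distinct primes give coprime values above
      1.\<close>
    show "inj_on h primes"
    proof (rule inj_onI, rule ccontr)
      fix k l assume kl: "k \<in> primes" "l \<in> primes" "h k = h l" "k \<noteq> l"
      have hl: "h m dvd sp m" if "m \<in> primes" for m
        using epo_prime.card_lin(1)[OF epo_primeI[OF that]] card_bt[OF that] by (simp add: h_def w_def)
      have "is_unit (h k)" using coprime_sp[OF kl(1,2,4)] hl[OF kl(1)] hl[OF kl(2)] kl(3)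
        by (metis coprime_common_divisor)
      then show False using q3[OF kl(1)] w2(1)[OF kl(1)] by (simp add: h_def)
    qed
    show "1 - 1 / order G \<le> (\<Sum>i\<in>primes. 1 / real (np i))"
      unfolding mass[symmetric] by (intro sum_mono divide_right_mono) auto
    fix i assume i: "i \<in> primes"
    let ?A = "{k \<in> primes - {i}. a i k \<noteq> 0}" and ?L = "{k \<in> primes - {i}. a i k = 0}"
    show "\<exists>A L. primes - {i} = A \<union> L \<and>
      (\<Sum>k\<in>A. real (w k) / h k) \<le> real (np i) / h i - 1 / order G \<and> (\<Sum>k\<in>L. w k) \<le> np i - 1"
    proof (rule exI[of _ ?A], rule exI[of _ ?L], intro conjI)
      show "primes - {i} = ?A \<union> ?L" by blast
      have "(\<Sum>k\<in>?A. real (w k) / h k) \<le> (\<Sum>k\<in>?A. real (w k) / h k * (real_of_int (a i k))\<^sup>2)"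
      proof (rule sum_mono)
        fix k assume "k \<in> ?A"
        then have "0 < (a i k)\<^sup>2" by simp
        then have "1 \<le> (a i k)\<^sup>2" by linarith
        then have "1 \<le> (real_of_int (a i k))\<^sup>2" by (metis of_int_1_le_iff of_int_power)
        then have "real (w k) / h k * 1 \<le> real (w k) / h k * (real_of_int (a i k))\<^sup>2" by (intro mult_left_mono) auto
        then show "real (w k) / h k \<le> real (w k) / h k * (real_of_int (a i k))\<^sup>2" by simp
      qed
      also have "\<dots> \<le> (\<Sum>k\<in>primes - {i}. real (w k) / h k * (real_of_int (a i k))\<^sup>2)"
        by (intro sum_mono2) auto
      also have "\<dots> \<le> (\<Sum>k\<in>primes - {i}. (\<Sum>y\<in>cls k. (cmod (x i y))\<^sup>2) / order G)"
        by (intro sum_mono off[OF i])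
      finally have A: "(\<Sum>k\<in>?A. real (w k) / h k) \<le> (\<Sum>k\<in>primes - {i}. (\<Sum>y\<in>cls k. (cmod (x i y))\<^sup>2) / order G)" .
      have "(\<Sum>k\<in>primes. (\<Sum>y\<in>cls k. (cmod (x i y))\<^sup>2) / order G) =
          (\<Sum>y\<in>cls i. (cmod (x i y))\<^sup>2) / order G + (\<Sum>k\<in>primes - {i}. (\<Sum>y\<in>cls k. (cmod (x i y))\<^sup>2) / order G)"
        by (rule sum.remove) (use i in auto)
      with A dia[OF i] character_mass[OF x[OF i]]
      show "(\<Sum>k\<in>?A. real (w k) / h k) \<le> real (np i) / h i - 1 / order G" by linarith
      have "int (\<Sum>k\<in>?L. w k) \<le> (\<Sum>k\<in>?L. int (w k) * (a k i)\<^sup>2)"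
        unfolding of_nat_sum
      proof (rule sum_mono)
        fix k assume k: "k \<in> ?L"
        then have "odd (a i k + a k i)" "a i k = 0" using par[OF i] by blast+
        then have "odd (a k i)" by simp
        then have "a k i \<noteq> 0" by auto
        then have "0 < (a k i)\<^sup>2" by simp
        then have "1 \<le> (a k i)\<^sup>2" by linarith
        then have "int (w k) * 1 \<le> int (w k) * (a k i)\<^sup>2" by (intro mult_left_mono) auto
        then show "int (w k) \<le> int (w k) * (a k i)\<^sup>2" by simp
      qed
      also have "\<dots> \<le> (\<Sum>k\<in>primes - {i}. int (w k) * (a k i)\<^sup>2)" by (intro sum_mono2) auto
      also have "\<dots> \<le> int (np i) - 1" by (rule nb[OF i])
      finally have "int (\<Sum>k\<in>?L. w k) \<le> int (np i) - 1" by simp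
      then show "(\<Sum>k\<in>?L. w k) \<le> np i - 1" by linarith
    qed
  qed
qed

end

section \<open>Descent to normal subgroups and the classification\<close>

context epo
begin

text \<open>A self-normalizing Sylow \<open>p\<close>-subgroup yields a proper normal subgroup
  \<open>M\<close> of \<open>K\<close> that contains all elements outside \<open>cls p\<close>. If
  \<open>M\<close> is trivial, \<open>K\<close> itself has exponent \<open>p\<close>; otherwise
  induction applies to \<open>M\<close>.\<close>

lemma odd_normal_psub:
  "subgroup K G \<Longrightarrow> K \<noteq> {\<one>} \<Longrightarrow> odd (card K) \<Longrightarrow>
    \<exists>p V. prime p \<and> psub (G\<lparr>carrier := K\<rparr>) p V \<and> V \<noteq> {\<one>} \<and> normalizer (G\<lparr>carrier := K\<rparr>) V = K"
proof (induction "card K" arbitrary: K rule: less_induct)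
  case less
  note K = less.prems(1)
  interpret H: epo "G\<lparr>carrier := K\<rparr>" by (rule epo_subgroup[OF K])
  have oH: "order (G\<lparr>carrier := K\<rparr>) = card K" by (simp add: order_def)
  have oneK: "\<one> \<in> K" by (rule subgroup.one_closed[OF K])
  have "card K \<noteq> 1" using less.prems(2) oneK by (auto simp: card_1_singleton_iff)
  then obtain r where "prime r" "r dvd card K" using prime_factor_nat by blast
  then have "H.primes \<noteq> {}" using H.primes_iff oH by auto
  then obtain p where p: "p \<in> H.primes" "H.np p = 1" using H.odd_self_normalizing less.prems(3) oH by auto
  have pp: "prime p" using p(1) H.primes_iff by blast
  interpret Hp: epo_prime "G\<lparr>carrier := K\<rparr>" p by (rule H.epo_primeI[OF p(1)])
  obtain M where M: "subgroup M (G\<lparr>carrier := K\<rparr>)" "normalizer (G\<lparr>carrier := K\<rparr>) M = K" "M \<noteq> K" "K - H.cls p \<subseteq> M"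
    using Hp.self_normalizing_kernel[OF p(2)] by auto
  show ?case
  proof (cases "M = {\<one>}")
    case True
    have sK: "subgroup K (G\<lparr>carrier := K\<rparr>)" using H.subgroup_self by simp
    have "x [^] p = \<one>" if "x \<in> K" for x
    proof (cases "x \<in> H.cls p")
      case False
      then have "x = \<one>" using True M(4) that by blast
      then show ?thesis by simp
    qed (simp add: H.cls_def)
    then have "psub (G\<lparr>carrier := K\<rparr>) p K" using H.exp_psub[OF sK pp] by simp
    moreover have "normalizer (G\<lparr>carrier := K\<rparr>) K = K"
      using H.subgroup_in_normalizer[OF sK] H.normalizer_subset[of K] by auto
    ultimately show ?thesis using pp less.prems(2) by blast
  next
    case False
    have MK: "M \<subseteq> K" using subgroup.subset[OF M(1)] by simp
    have sM: "subgroup M G" by (rule incl_subgroup[OF K M(1)])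
    have "card M < card K" using MK M(3) fin_subgroup[OF K] by (intro psubset_card_mono) auto
    moreover have "odd (card M)" using subgroup_card_dvd[OF sM K MK] less.prems(3) by (meson dvd_trans)
    ultimately obtain q V where V: "prime q" "psub (G\<lparr>carrier := M\<rparr>) q V" "V \<noteq> {\<one>}" "normalizer (G\<lparr>carrier := M\<rparr>) V = M"
      using less.hyps[OF _ sM False] by blast
    interpret L: epo "G\<lparr>carrier := M\<rparr>" by (rule epo_subgroup[OF sM])
    \<comment> \<open>\<open>V\<close> is known to be normal in \<open>M\<close> only. The set of
      all solutions of \<open>x [^] q = \<one>\<close> in \<open>M\<close> is invariant under
      conjugation by \<open>K\<close>, because \<open>K\<close> normalizes \<open>M\<close>.\<close>
    obtain P where P: "syl (G\<lparr>carrier := M\<rparr>) q P" "P = {x \<in> M. x [^] q = \<one>}"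
      using L.normal_psub_structure[OF V(1,2)] V(3,4) by auto
    have sP: "subgroup P G" using incl_subgroup[OF sM, of P] P(1) by (simp add: syl_def)
    have PM: "P \<subseteq> M" unfolding P(2) by blast
    have sPK: "subgroup P (G\<lparr>carrier := K\<rparr>)" using subgroup_incl[OF sP K] PM MK by blast
    have "psub (G\<lparr>carrier := K\<rparr>) q P" using sPK syl_psub[OF P(1)] by (simp add: psub_def)
    moreover have "P \<noteq> {\<one>}"
    proof -
      have "V \<subseteq> M" using V(2) subgroup.subset by (force simp: psub_def)
      then have "V \<subseteq> P" using L.psub_exp[OF V(1,2)] by (auto simp: P(2))
      moreover have "\<one> \<in> V" using V(2) subgroup.one_closed by (force simp: psub_def)
      ultimately show ?thesis using V(3) by blast
    qed
    moreover have "normalizer (G\<lparr>carrier := K\<rparr>) P = K"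
    proof
      show "normalizer (G\<lparr>carrier := K\<rparr>) P \<subseteq> K" using H.normalizer_subset[of P] by simp
      show "K \<subseteq> normalizer (G\<lparr>carrier := K\<rparr>) P"
      proof
        fix y assume y: "y \<in> K"
        show "y \<in> normalizer (G\<lparr>carrier := K\<rparr>) P"
        proof (rule H.normalizerI)
          fix a assume a: "a \<in> P"
          let ?c = "cj\<^bsub>G\<lparr>carrier := K\<rparr>\<^esub> y a"
          have "?c \<in> M" using H.normalizer_cj[of y M a] y M(2) a PM by blast
          moreover have "?c [^]\<^bsub>G\<lparr>carrier := K\<rparr>\<^esub> q = \<one>\<^bsub>G\<lparr>carrier := K\<rparr>\<^esub>"
          proof -
            have aK: "a \<in> carrier (G\<lparr>carrier := K\<rparr>)" using a PM MK by auto
            have "a [^]\<^bsub>G\<lparr>carrier := K\<rparr>\<^esub> q = \<one>\<^bsub>G\<lparr>carrier := K\<rparr>\<^esub>" using a P(2) by simp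
            then show ?thesis using H.cj_pow[of y a q] H.cj_one(1)[of y] aK y by simp
          qed
          ultimately show "?c \<in> P" unfolding P(2) by simp
        qed (use y PM MK in auto)
      qed
    qed
    ultimately show ?thesis using V(1) by blast
  qed
qed

theorem classification:
  assumes "order G \<noteq> 1" and no: "\<not> G \<cong> alt_group 5"
  shows "\<exists>p P. prime p \<and> psub G p P \<and> P \<noteq> {\<one>} \<and> normalizer G P = carrier G \<and> P = {x \<in> carrier G. x [^] p = \<one>} \<and>
    (order G = card P \<or> (\<exists>q. prime q \<and> q \<noteq> p \<and> order G = card P * q))"
proof -
  have "\<exists>p V. prime p \<and> psub G p V \<and> V \<noteq> {\<one>} \<and> normalizer G V = carrier G"
  proof (cases "2 dvd order G")
    case True
    then have "2 \<in> primes" using primes_iff by simp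
    then obtain p where p: "p \<in> primes" "order G = sp p * np p" using even_classification no by blast
    have pp: "prime p" using p primes_iff by blast
    have s: "syl G p (sylp p)" by (rule sylp[OF pp])
    have "card (normalizer G (sylp p)) = card (carrier G)"
      using card_normalizer_syl[OF p(1) s] p(2) by (simp add: order_def)
    then have "normalizer G (sylp p) = carrier G" by (intro card_subset_eq normalizer_subset) simp_all
    then show ?thesis using pp syl_psub[OF s] sylp_nontrivial[OF p(1) s] by blast
  next
    case False
    have "carrier G \<noteq> {\<one>}" using assms(1) by (auto simp: order_def)
    then show ?thesis using odd_normal_psub[OF subgroup_self] False by (simp add: order_def)
  qed
  then obtain p V where V: "prime p" "psub G p V" "V \<noteq> {\<one>}" "normalizer G V = carrier G" by blast
  obtain P where P: "syl G p P" "normalizer G P = carrier G" "P = {x \<in> carrier G. x [^] p = \<one>}"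
    "order G = card P \<or> (\<exists>q. prime q \<and> q \<noteq> p \<and> order G = card P * q)"
    using normal_psub_structure[OF V] by blast
  have "V \<subseteq> carrier G" "\<one> \<in> V" using V(2) by (auto simp: psub_def dest: subgroup.subset subgroup.one_closed)
  then have "V \<subseteq> P" using psub_exp[OF V(1,2)] unfolding P(3) by blast
  then have "P \<noteq> {\<one>}" using V(3) \<open>\<one> \<in> V\<close> by blast
  then show ?thesis using V(1) syl_psub[OF P(1)] P(2,3,4) by blast
qed

end

section \<open>The Frobenius case\<close>

lemma (in group) conj_subgroup_eq: "g \<in> carrier G \<Longrightarrow> conj_subgroup G g H = cj g ` H"
  by (auto simp: conj_subgroup_def cj_def l_coset_def r_coset_def)

locale epo_frobenius = epo +
  fixes P p q
  assumes p: "prime (p::nat)" and P: "psub G p P" "P \<noteq> {\<one>}" "normalizer G P = carrier G"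
    and P_eq: "P = {x \<in> carrier G. x [^] p = \<one>}"
    and q: "prime q" "q \<noteq> p" and order: "order G = card P * q"
begin

lemma sP: "subgroup P G" using P(1) by (simp add: psub_def)

lemma prime_dvd_order:
  assumes r: "prime r" "r \<noteq> p" "r dvd card P * q"
  shows "r = q"
proof -
  obtain n where n: "card P = p ^ n" using P(1) by (auto simp: psub_def)
  have "\<not> r dvd card P"
  proof
    assume "r dvd card P"
    then have "r dvd p" unfolding n by (rule prime_dvd_power[OF r(1)])
    then show False using primes_dvd_imp_eq[OF r(1) p] r(2) by simp
  qed
  then have "r dvd q" using prime_dvd_mult_iff[OF r(1)] r(3) by blast
  then show ?thesis by (rule primes_dvd_imp_eq[OF r(1) q(1)])
qed

lemma card_trivial_int:
  assumes H: "subgroup H G" "H \<inter> P = {\<one>}"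
  shows "card H \<le> q"
proof -
  interpret H: subgroup H G by (rule H(1))
  interpret P: subgroup P G by (rule sP)
  have "inj_on (\<lambda>(h, u). h \<otimes> u) (H \<times> P)"
  proof (rule inj_onI, clarsimp)
    fix h u h' u' assume a: "h \<in> H" "u \<in> P" "h' \<in> H" "u' \<in> P" "h \<otimes> u = h' \<otimes> u'"
    have "inv h' \<otimes> h = u' \<otimes> inv u"
    proof -
      have c: "h \<in> carrier G" "u \<in> carrier G" "h' \<in> carrier G" "u' \<in> carrier G" using a(1-4) by simp_all
      have "inv h' \<otimes> h = inv h' \<otimes> (h \<otimes> u) \<otimes> inv u" using c by (simp add: m_assoc)
      also have "\<dots> = inv h' \<otimes> (h' \<otimes> u') \<otimes> inv u" by (simp only: a(5))
      also have "\<dots> = u' \<otimes> inv u" using c by (simp add: m_assoc)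
      finally show ?thesis .
    qed
    moreover have "inv h' \<otimes> h \<in> H" "u' \<otimes> inv u \<in> P" using a by auto
    ultimately have "inv h' \<otimes> h \<in> H \<inter> P" by simp
    then have "inv h' \<otimes> h = \<one>" using H(2) by blast
    then have "h = h'" using a by (metis H.mem_carrier inv_cancel(2) inv_closed r_one)
    then show "h = h' \<and> u = u'" using a by simp
  qed
  then have "card (H \<times> P) \<le> card (carrier G)" by (rule card_inj_on_le) auto
  then have "card H * card P \<le> card P * q" using order by (simp add: order_def card_cartesian_product)
  then show ?thesis using P.subset subgroup_card_pos[OF sP] by simp
qed

lemma malnormal:
  assumes H: "frobenius_complement G H" and g: "g \<in> carrier G" "h \<in> H" "h \<noteq> \<one>" "cj g h \<in> H"
  shows "g \<in> H"
proof (rule ccontr)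
  assume "g \<notin> H"
  then have "H \<inter> cj g ` H = {\<one>}"
    using H g(1) unfolding frobenius_complement_def conj_subgroup_eq[OF g(1), symmetric] by blast
  then have "cj g h = \<one>" using g by blast
  moreover have "h \<in> carrier G" using H g(2) subgroup.mem_carrier by (force simp: frobenius_complement_def)
  ultimately show False using g(1,3) by simp
qed

text \<open>The theorem speaks of every complement, so an arbitrary one is analysed. If it contained
  a nontrivial \<open>x\<close> of \<open>P\<close>, malnormality would pass from \<open>x\<close>
  to a central element \<open>z\<close> of \<open>P\<close>, from \<open>z\<close> to all of
  \<open>P\<close>, and from the normal subgroup \<open>P\<close> to the whole group. So
  \<open>H\<close> meets \<open>P\<close> trivially, which leaves \<open>q\<close> as only prime
  divisor and as upper bound of its order.\<close>

lemma complement_card: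
  assumes H: "frobenius_complement G H"
  shows "H \<inter> P = {\<one>}" "card H = q"
proof -
  have sH: "subgroup H G" "H \<noteq> {\<one>}" "H \<noteq> carrier G" using H by (auto simp: frobenius_complement_def)
  interpret H: subgroup H G by (rule sH(1))
  interpret P: subgroup P G by (rule sP)
  show HP: "H \<inter> P = {\<one>}"
  proof (rule ccontr)
    assume "H \<inter> P \<noteq> {\<one>}"
    then obtain x where x: "x \<in> H" "x \<in> P" "x \<noteq> \<one>" using H.one_closed P.one_closed by blast
    obtain z where z: "z \<in> P" "z \<noteq> \<one>" "\<forall>v\<in>P. cj v z = z" using psub_center[OF p P(1,2)] by blast
    have "cj z x = x" using z(3) x(2) z(1) by (metis P.mem_carrier cj_id_iff)
    then have "cj z x \<in> H" using x(1) by (simp only:)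
    then have zH: "z \<in> H" by (rule malnormal[OF H P.mem_carrier[OF z(1)] x(1,3)])
    have "v \<in> H" if v: "v \<in> P" for v
    proof -
      have "cj v z \<in> H" unfolding z(3)[rule_format, OF v] by (rule zH)
      then show ?thesis by (rule malnormal[OF H P.mem_carrier[OF v] zH z(2)])
    qed
    then have "P \<subseteq> H" by blast
    then have "g \<in> H" if "g \<in> carrier G" for g
      by (intro malnormal[OF H that x(1,3)]) (use normalizer_cj[of g P x] P(3) that x(2) in blast)
    then show False using sH(3) H.subset by blast
  qed
  have le: "card H \<le> q" by (rule card_trivial_int[OF sH(1) HP])
  have "card H \<noteq> 1"
  proof
    assume "card H = 1"
    then obtain y where "H = {y}" by (rule card_1_singletonE)
    then show False using sH(2) H.one_closed by blast
  qed
  then obtain r where r: "prime r" "r dvd card H" using prime_factor_nat by blast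
  have "r \<noteq> p"
  proof
    assume "r = p"
    then obtain x where x: "x \<in> H" "x \<noteq> \<one>" "x [^] p = \<one>" using cauchy_subgroup[OF p sH(1)] r(2) by blast
    have "x \<in> P" unfolding P_eq using H.mem_carrier[OF x(1)] x(3) by blast
    then show False using HP x(1,2) by blast
  qed
  moreover have "r dvd card P * q" using dvd_trans[OF r(2) subgroup_order_dvd[OF sH(1)]] unfolding order .
  ultimately have rq: "r = q" by (rule prime_dvd_order[OF r(1)])
  have "q \<le> card H" using dvd_imp_le[OF r(2) subgroup_card_pos[OF sH(1)]] unfolding rq .
  then show "card H = q" using le by (rule antisym[rotated])
qed

lemma mult_q: "multiplicity q (order G) = 1"
proof -
  have "\<not> q dvd card P"
    using P(1) q p unfolding psub_def by (metis prime_dvd_power primes_dvd_imp_eq)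
  then have "multiplicity q (card P) = 0" by (rule not_dvd_imp_multiplicity_0)
  moreover have "multiplicity q (order G) = multiplicity q (card P) + multiplicity q q"
    unfolding order using q subgroup_card_pos[OF sP] by (intro prime_elem_multiplicity_mult_distrib) auto
  ultimately show ?thesis using q by simp
qed

text \<open>Every complement has order \<open>q\<close>, so it is a Sylow \<open>q\<close>-subgroup,
  and its conjugates contain all elements of order \<open>q\<close>. The nontrivial elements left
  over have order \<open>p\<close>, that is, lie in \<open>P\<close>.\<close>

lemma kernel_eq:
  assumes H: "frobenius_complement G H"
  shows "frobenius_kernel G H = P"
proof -
  have sH: "subgroup H G" using H by (simp add: frobenius_complement_def)
  interpret H: subgroup H G by (rule sH)
  interpret P: subgroup P G by (rule sP)
  have sylH: "syl G q H" using complement_card(2)[OF H] mult_q sH by (simp add: syl_def)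
  have k: "frobenius_kernel G H = (carrier G - (\<Union>g\<in>carrier G. cj g ` H)) \<union> {\<one>}"
    by (simp add: frobenius_kernel_def conj_subgroup_eq)
  have "x \<in> P \<longleftrightarrow> x \<notin> (\<Union>g\<in>carrier G. cj g ` H)" if x: "x \<in> carrier G" "x \<noteq> \<one>" for x
  proof
    assume xP: "x \<in> P"
    show "x \<notin> (\<Union>g\<in>carrier G. cj g ` H)"
    proof
      assume "x \<in> (\<Union>g\<in>carrier G. cj g ` H)"
      then obtain g h where g: "g \<in> carrier G" "h \<in> H" "x = cj g h" by blast
      have "h = cj (inv g) x" using g H.mem_carrier by simp
      then have "h \<in> P" using normalizer_cj[of "inv g" P x] P(3) g(1) xP by simp
      then have "h = \<one>" using g(2) complement_card(1)[OF H] by blast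
      then show False using g x(2) by simp
    qed
  next
    assume nx: "x \<notin> (\<Union>g\<in>carrier G. cj g ` H)"
    obtain r :: nat where r: "prime r" "x [^] r = \<one>" using prime_exp[OF x(1)] by blast
    show "x \<in> P"
    proof (rule ccontr)
      assume "x \<notin> P"
      then have "r \<noteq> p" using P_eq r x(1) by blast
      have "r dvd order G"
      proof (rule ccontr)
        assume "\<not> r dvd order G"
        then have "coprime r (order G)" using r(1) by (simp add: prime_imp_coprime)
        then show False using pow_coprime_one[OF x(1) r(2) pow_order_eq_1[OF x(1)]] x(2) by simp
      qed
      then have rq: "r = q"
        using r(1) p q P(1) \<open>r \<noteq> p\<close> unfolding psub_def order
        by (metis prime_dvd_mult_iff prime_dvd_power primes_dvd_imp_eq)
      let ?C = "(\<lambda>i::nat. x [^] i) ` {..<q}"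
      note C = cyclic_prime[OF q(1) x(1) r(2)[unfolded rq] x(2)]
      have "card ?C = q ^ 1" using C(2) by (simp add: card_image)
      then have "psub G q ?C" using C(1) unfolding psub_def by blast
      then obtain g where g: "g \<in> carrier G" "?C \<subseteq> cj g ` H" using psub_conj_syl[OF q(1) _ sylH] by blast
      have "x \<in> ?C" using x(1) prime_gt_1_nat[OF q(1)] by (intro image_eqI[of _ _ 1]) auto
      then show False using nx g by blast
    qed
  qed
  then show ?thesis unfolding k using P.subset P.one_closed by blast
qed

text \<open>Let \<open>C\<close> have order \<open>q\<close>. For \<open>u\<close> in
  \<open>P\<close> that normalizes \<open>C\<close>, the commutator of \<open>u\<close> and a
  generator \<open>x\<close> lies in both \<open>C\<close> and the normal subgroup \<open>P\<close>,
  hence is trivial; commuting elements of orders \<open>p\<close> and \<open>q\<close> do not exist,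
  so \<open>u = \<one>\<close>. Thus \<open>C\<close> is self-normalizing, and as its order is
  prime, distinct conjugates meet trivially.\<close>

lemma complement_ex: "\<exists>H. frobenius_complement G H"
proof -
  have "q dvd order G" using order by simp
  then obtain x where x: "x \<in> carrier G" "x \<noteq> \<one>" "x [^] q = \<one>" using cauchy[OF q(1)] by blast
  define C where "C = (\<lambda>i::nat. x [^] i) ` {..<q}"
  have sC: "subgroup C G" and cC: "card C = q"
    using cyclic_prime[OF q(1) x(1,3,2)] by (simp_all add: C_def card_image)
  interpret C: subgroup C G by (rule sC)
  interpret P: subgroup P G by (rule sP)
  let ?N = "normalizer G C"
  have sN: "subgroup ?N G" by (rule normalizer_subgroup[OF C.subset])
  have NP: "?N \<inter> P = {\<one>}"
  proof -
    have "u = \<one>" if u: "u \<in> ?N" "u \<in> P" for u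
    proof -
      have uG: "u \<in> carrier G" using u(2) by simp
      have xC: "x \<in> C" using x(1) prime_gt_1_nat[OF q(1)] unfolding C_def by (intro image_eqI[of _ _ 1]) auto
      have inC: "cj u x \<otimes> inv x \<in> C" using normalizer_cj[OF u(1) xC] xC by simp
      have inP: "cj u x \<otimes> inv x \<in> P"
      proof -
        have "cj x (inv u) \<in> P" using normalizer_cj[of x P "inv u"] P(3) x(1) u(2) by simp
        then have "u \<otimes> cj x (inv u) \<in> P" using u(2) by simp
        then show ?thesis using uG x(1) by (simp add: cj_def m_assoc)
      qed
      have w: "(cj u x \<otimes> inv x) [^] q = \<one>" "(cj u x \<otimes> inv x) [^] p = \<one>"
        using pow_subgroup_card[OF sC inC] inP unfolding cC P_eq by blast+
      have "cj u x \<otimes> inv x = \<one>"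
        using pow_coprime_one[OF _ w] uG x(1) primes_coprime[OF q(1) p q(2)] by simp
      then have "cj u x = x" using uG x(1) by (metis cj_closed inv_closed inv_inv inv_unique' r_inv inv_equality)
      then have "u \<otimes> x = x \<otimes> u" using cj_id_iff[OF uG x(1)] by simp
      moreover have "u [^] p = \<one>" using u(2) P_eq by blast
      ultimately show ?thesis using commute_coprime_one[OF p q(1) q(2)[symmetric] uG x(1)] x(2,3) by blast
    qed
    then show ?thesis using subgroup.one_closed[OF sN] P.one_closed by blast
  qed
  have NC: "?N = C"
    using card_trivial_int[OF sN NP] subgroup_in_normalizer[OF sC] cC fin_subgroup[OF sN]
    by (metis card_seteq)
  have "C \<inter> cj g ` C = {\<one>}" if g: "g \<in> carrier G" "g \<notin> C" for g
  proof (rule ccontr)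
    assume ne: "C \<inter> cj g ` C \<noteq> {\<one>}"
    have sg: "subgroup (cj g ` C) G" by (rule cj_subgroup[OF g(1) sC])
    obtain y where y: "y \<in> C" "y \<in> cj g ` C" "y \<noteq> \<one>" using ne C.one_closed subgroup.one_closed[OF sg] by blast
    have cg: "card (cj g ` C) = q" using cj_image_card[OF g(1) C.subset] cC by simp
    have "cj g ` C = C"
      by (rule trans[OF prime_card_pow(1)[OF q(1) sg cg y(2,3)] sym[OF prime_card_pow(1)[OF q(1) sC cC y(1,3)]]])
    then have "g \<in> ?N" using g(1) by (simp add: normalizer_def)
    then show False using g(2) NC by simp
  qed
  moreover have "C \<noteq> {\<one>}"
  proof
    assume "C = {\<one>}"
    then have "card C = 1" by simp
    then show False using cC prime_gt_1_nat[OF q(1)] by simp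
  qed
  moreover have "C \<noteq> carrier G"
  proof
    assume "C = carrier G"
    then have "P = {\<one>}" using complement_card NP NC P.subset by blast
    then show False using P(2) by simp
  qed
  ultimately have "frobenius_complement G C" using sC by (simp add: frobenius_complement_def conj_subgroup_eq)
  then show ?thesis by blast
qed

lemma kernel_exp: "p_group_exp_p G P p"
  unfolding p_group_exp_p_def
proof (intro conjI ballI)
  show "\<exists>n. card P = p ^ n" using P(1) by (simp add: psub_def)
  show "x [^] p = \<one>" if "x \<in> P" for x using that P_eq by blast
qed (use p P(2) sP in auto)

end

section \<open>The quotient by the non-maximal elements\<close>

lemma (in group) cj_hom: "g \<in> carrier G \<Longrightarrow> group_hom G G (cj g)"
  by (intro group_hom.intro group_hom_axioms.intro) (auto simp: hom_def cj_mult)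

context fin_group
begin

lemma non_max_iff:
  "x \<in> non_max_cyclic_elems G \<longleftrightarrow> x \<in> carrier G \<and> (\<exists>y\<in>carrier G. generate G {x} \<subset> generate G {y})"
  unfolding non_max_cyclic_elems_def maximal_cyclic_def cyclic_subgroups_def by blast

lemma non_max_cj:
  assumes x: "x \<in> non_max_cyclic_elems G" and g: "g \<in> carrier G"
  shows "cj g x \<in> non_max_cyclic_elems G"
proof -
  obtain y where y: "x \<in> carrier G" "y \<in> carrier G" "generate G {x} \<subset> generate G {y}" using x non_max_iff by blast
  have gen: "generate G {cj g z} = cj g ` generate G {z}" if "z \<in> carrier G" for z
    using group_hom.generate_img[OF cj_hom[OF g], of "{z}"] that by simp
  have "inj_on (cj g) (generate G {y})" using cj_inj[OF g] generate_incl[of "{y}"] y(2) by simp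
  then have "cj g ` generate G {x} \<subset> cj g ` generate G {y}" using y(3) by (metis image_strict_mono)
  then show ?thesis using non_max_iff gen y g by (metis cj_closed)
qed

lemma normal_gen: "generate G (non_max_cyclic_elems G) \<lhd> G"
  by (rule normal_generateI) (use non_max_cj non_max_iff in \<open>auto simp: cj_def\<close>)

lemma prime_pow_non_max:
  assumes g: "g \<in> carrier G" "g \<noteq> \<one>"
  shows "\<exists>p::nat. prime p \<and> g [^] p \<in> non_max_cyclic_elems G"
proof -
  have "ord g \<noteq> 1" using g ord_eq_1 by simp
  then obtain p where p: "prime p" "p dvd ord g" using prime_factor_nat by blast
  then obtain m where m: "ord g = p * m" by blast
  have pos: "0 < ord g" using ord_ge_1[OF _ g(1)] by simp
  have "(g [^] p) [^] m = \<one>" using m pow_ord_eq_1[OF g(1)] nat_pow_pow[OF g(1)] by simp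
  then have "ord (g [^] p) dvd m" using pow_eq_id g(1) by simp
  then have "ord (g [^] p) \<le> m" using m pos by (intro dvd_imp_le) auto
  moreover have "m < ord g" using m pos prime_gt_1_nat[OF p(1)] by simp
  ultimately have "card (generate G {g [^] p}) < card (generate G {g})"
    using generate_pow_card g(1) by (metis le_less_trans nat_pow_closed)
  moreover have "generate G {g [^] p} \<subseteq> generate G {g}"
  proof (rule generate_subgroup_incl)
    show sg: "subgroup (generate G {g}) G" using g(1) by (simp add: generate_is_subgroup)
    show "{g [^] p} \<subseteq> generate G {g}" using subgroup_pow[OF sg] generate.incl[of g "{g}" G] by blast
  qed
  ultimately have "generate G {g [^] p} \<subset> generate G {g}" by auto
  then show ?thesis using p(1) g(1) non_max_iff by blast
qed

lemma epo_quotient: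
  assumes N: "N \<lhd> G" and sub: "non_max_cyclic_elems G \<subseteq> N"
  shows "epo (G Mod N)"
proof -
  interpret N: normal N G by (rule N)
  interpret Q: group "G Mod N" by (rule N.factorgroup_is_group)
  show ?thesis
  proof
    show "finite (carrier (G Mod N))" by (simp add: carrier_FactGroup)
    fix Z assume "Z \<in> carrier (G Mod N)"
    then obtain g where g: "g \<in> carrier G" "Z = N #> g" by (auto simp: carrier_FactGroup)
    obtain p :: nat where p: "prime p" "g [^] p \<in> N"
    proof (cases "g = \<one>")
      case True
      then show ?thesis using that[OF two_is_prime_nat] by simp
    next
      case False
      then show ?thesis using prime_pow_non_max[OF g(1)] sub that by blast
    qed
    have "Z [^]\<^bsub>G Mod N\<^esub> p = N" using N.FactGroup_pow[OF g(1)] g p(2) N.subset by (simp add: coset_join2 N.subgroup_axioms)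
    then show "\<exists>p::nat. prime p \<and> Z [^]\<^bsub>G Mod N\<^esub> p = \<one>\<^bsub>G Mod N\<^esub>" using p(1) by auto
  qed
qed

end

theorem theorem1p1:
  fixes G (structure)
  assumes "group G" and "finite (carrier G)"
    and "generate G (non_max_cyclic_elems G) \<noteq> carrier G"
  shows "(\<exists>p. p_group_exp_p (G Mod generate G (non_max_cyclic_elems G))
                 (carrier (G Mod generate G (non_max_cyclic_elems G))) p)
       \<or> (\<exists>p q. Factorial_Ring.prime p \<and> Factorial_Ring.prime q \<and> q \<noteq> p \<and>
            frobenius_group (G Mod generate G (non_max_cyclic_elems G)) \<and>
            (\<forall>H. frobenius_complement (G Mod generate G (non_max_cyclic_elems G)) H \<longrightarrow>
                 card H = q \<and>
                 p_group_exp_p (G Mod generate G (non_max_cyclic_elems G))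
                   (frobenius_kernel (G Mod generate G (non_max_cyclic_elems G)) H) p))
       \<or> (G Mod generate G (non_max_cyclic_elems G)) \<cong> alt_group 5"
proof -
  interpret fin_group G by (intro fin_group.intro fin_group_axioms.intro assms)
  define N where "N = generate G (non_max_cyclic_elems G)"
  have N: "N \<lhd> G" unfolding N_def by (rule normal_gen)
  interpret N: normal N G by (rule N)
  have "non_max_cyclic_elems G \<subseteq> N" by (auto simp: N_def intro: generate.incl)
  then interpret Q: epo "G Mod N" by (rule epo_quotient[OF N])
  \<comment> \<open>Properness of the generated subgroup enters here: it provides the nontrivial
    \<open>P\<close> on which the first two cases of the conclusion rest.\<close>
  have nt: "order (G Mod N) \<noteq> 1"
  proof
    assume "order (G Mod N) = 1"
    then obtain Z where Z: "carrier (G Mod N) = {Z}" by (auto simp: order_def card_1_singleton_iff)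
    have "g \<in> N" if g: "g \<in> carrier G" for g
    proof -
      have "N #> g \<in> {Z}" "N #> \<one> \<in> {Z}" using g unfolding Z[symmetric] carrier_FactGroup by blast+
      then have "N #> g = N" using N.subset by simp
      then show ?thesis using g coset_join1[OF _ g N.subgroup_axioms] N.subset by simp
    qed
    then show False using assms(3) N.subset unfolding N_def by blast
  qed
  show ?thesis
    unfolding N_def[symmetric]
  proof (cases "(G Mod N) \<cong> alt_group 5")
    case False
    obtain p P where P: "prime p" "psub (G Mod N) p P" "P \<noteq> {\<one>\<^bsub>G Mod N\<^esub>}" "normalizer (G Mod N) P = carrier (G Mod N)"
      "P = {x \<in> carrier (G Mod N). x [^]\<^bsub>G Mod N\<^esub> p = \<one>\<^bsub>G Mod N\<^esub>}"
      "order (G Mod N) = card P \<or> (\<exists>q. prime q \<and> q \<noteq> p \<and> order (G Mod N) = card P * q)"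
      using Q.classification[OF nt False] by blast
    show "(\<exists>p. p_group_exp_p (G Mod N) (carrier (G Mod N)) p) \<or>
      (\<exists>p q. prime p \<and> prime q \<and> q \<noteq> p \<and> frobenius_group (G Mod N) \<and>
        (\<forall>H. frobenius_complement (G Mod N) H \<longrightarrow> card H = q \<and> p_group_exp_p (G Mod N) (frobenius_kernel (G Mod N) H) p)) \<or>
      (G Mod N) \<cong> alt_group 5"
    proof (cases "order (G Mod N) = card P")
      case True
      have "P \<subseteq> carrier (G Mod N)" by (subst P(5)) blast
      then have eq: "P = carrier (G Mod N)" using True Q.fin by (intro card_subset_eq) (auto simp: order_def)
      have "p_group_exp_p (G Mod N) P p" using P(1,2,3,5) unfolding p_group_exp_p_def psub_def by blast
      then show ?thesis unfolding eq by blast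
    next
      case False
      then obtain q where q: "prime q" "q \<noteq> p" "order (G Mod N) = card P * q" using P(6) by blast
      interpret F: epo_frobenius "G Mod N" P p q
        by (intro epo_frobenius.intro Q.epo_axioms epo_frobenius_axioms.intro P(1-5) q)
      have "frobenius_group (G Mod N)"
        unfolding frobenius_group_def using Q.is_group Q.fin F.complement_ex by blast
      then show ?thesis using P(1) q(1,2) F.complement_card(2) F.kernel_eq F.kernel_exp by auto
    qed
  qed blast
qed

end
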